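(* Let $p$ be a prime, let $R$ be a ring in which $p$ is nilpotent, let $\mathcal{P}$, $\mathcal{P}'$ be displays over $R$ and assume that $\mathcal{P}$ is nilpotent. Then the abelian group $\mathrm{Hom}_R(\mathcal{P}, \mathcal{P}')$ of morphisms of displays is $p$-torsionfree.
   Context: For a ring $R$ in which $p$ is nilpotent let $W(R)$ be the ring of $p$-typical Witt vectors with Frobenius $F$ and Verschiebung $V$, let $I_R = \ker(W(R) \to R) = V(W(R))$, and let $F^{\mathrm{div}} \colon I_R \to W(R)$ be the inverse of $V$ (an $F$-linear map). For a $W(R)$-module $M$ write $M^F = W(R) \otimes_{F, W(R)} M$. Displays. A finite projective $(W(R), I_R)$-module is a pair $\mathcal{P} = (T, L)$ of finite projective $W(R)$-modules; a morphism $(T,L) \to (T',L')$ is a matrix $\begin{bmatrix} a & b \\ c & d \end{bmatrix}$ of $W(R)$-linear maps $a \colon T \to T'$, $b \colon L \to I_R \otimes_{W(R)} T'$, $c \colon T \to L'$, $d \colon L \to L'$ (composition is matrix multiplication, using $I_R \to W(R)$); it induces a $W(R)$-linear map $T \oplus L \to T' \oplus L'$. Put $\mathcal{P}^F = T^F \oplus L^F$; this is functorial by sending the matrix above to $\begin{bmatrix} a^F & b^{F,\mathrm{div}} \\ p\, c^F & d^F \end{bmatrix}$, where $b^{F,\mathrm{div}} \colon L^F \to (I_R)^F \otimes T'^F \to T'^F$ uses the linearization of $F^{\mathrm{div}}$. A display over $R$ is such a pair $\mathcal{P}$ together with an isomorphism of $W(R)$-modules $\Psi \colon \mathcal{P}^F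 \to T \oplus L$; a morphism of displays is a morphism of pairs whose induced maps commute with $\Psi, \Psi'$. Nilpotence. Let $\breve{z} \colon L \to L^F$ be the lower right component of $\Psi^{-1} \colon T \oplus L \to T^F \oplus L^F$. Then $\mathcal{P}$ is nilpotent of nilpotence order $\le e$ if the composition $\breve{z}^{(p^{e-1})} \circ \dotsb \circ \breve{z} \colon (R/pR) \otimes_{W(R)} L \to ((R/pR) \otimes_{W(R)} L)^{(p^e)}$ vanishes, where $(-)^{(p^i)}$ is the twist by the $i$-th power of the Frobenius of $R/pR$; $\mathcal{P}$ is nilpotent if this holds for some $e$. *)

theory Defs
  imports
    "HOL-Library.Poly_Mapping"
    "HOL-Library.FuncSet"
    "HOL-Computational_Algebra.Primes"
    "HOL-Algebra.Module"
    "HOL-Algebra.Ideal"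
    "HOL-Algebra.QuotRing"
    "HOL-Algebra.Free_Abelian_Groups"
begin

section \<open>Witt vectors\<close>

type_synonym 'v int_mpoly = "('v \<Rightarrow>\<^sub>0 nat) \<Rightarrow>\<^sub>0 int"

definition mpoly_var :: "'v \<Rightarrow> 'v int_mpoly" where
  "mpoly_var v = Poly_Mapping.single (Poly_Mapping.single v 1) 1"

definition mpoly_eval :: "('a, 'm) ring_scheme \<Rightarrow> ('v \<Rightarrow> 'a) \<Rightarrow> 'v int_mpoly \<Rightarrow> 'a" where
  "mpoly_eval R x P =
     (\<Oplus>\<^bsub>R\<^esub>m\<in>Poly_Mapping.keys P. [Poly_Mapping.lookup P m] \<cdot>\<^bsub>R\<^esub>
        (\<Otimes>\<^bsub>R\<^esub>v\<in>Poly_Mapping.keys m. x v [^]\<^bsub>R\<^esub> Poly_Mapping.lookup m v))"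

definition ghost :: "nat \<Rightarrow> (nat \<Rightarrow> 'r::comm_semiring_1) \<Rightarrow> nat \<Rightarrow> 'r" where
  "ghost p x n = (\<Sum>i\<le>n. of_nat (p ^ i) * x i ^ (p ^ (n - i)))"

text \<open>For the right-hand sides \<open>\<Phi>\<close> used below, existence of the integral polynomials with
  ghost components \<open>\<Phi>\<close> is Witt's theorem; they are unique because the polynomial ring has no
  additive torsion.\<close>

definition witt_poly :: "nat \<Rightarrow> (nat \<Rightarrow> 'v int_mpoly) \<Rightarrow> nat \<Rightarrow> 'v int_mpoly" where
  "witt_poly p \<Phi> = (THE S. \<forall>n. ghost p S n = \<Phi> n)"

definition witt_add_poly :: "nat \<Rightarrow> nat \<Rightarrow> (nat + nat) int_mpoly" where
  "witt_add_poly p = witt_poly p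
     (\<lambda>n. ghost p (\<lambda>i. mpoly_var (Inl i)) n + ghost p (\<lambda>i. mpoly_var (Inr i)) n)"

definition witt_mult_poly :: "nat \<Rightarrow> nat \<Rightarrow> (nat + nat) int_mpoly" where
  "witt_mult_poly p = witt_poly p
     (\<lambda>n. ghost p (\<lambda>i. mpoly_var (Inl i)) n * ghost p (\<lambda>i. mpoly_var (Inr i)) n)"

definition witt_frob_poly :: "nat \<Rightarrow> nat \<Rightarrow> nat int_mpoly" where
  "witt_frob_poly p = witt_poly p (\<lambda>n. ghost p mpoly_var (Suc n))"

definition witt :: "nat \<Rightarrow> ('a, 'm) ring_scheme \<Rightarrow> (nat \<Rightarrow> 'a) ring" where
  "witt p R =
    \<lparr>carrier = {x. \<forall>n. x n \<in> carrier R},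
     monoid.mult = (\<lambda>x y n. mpoly_eval R (case_sum x y) (witt_mult_poly p n)),
     one = (\<lambda>n. if n = 0 then \<one>\<^bsub>R\<^esub> else \<zero>\<^bsub>R\<^esub>),
     ring.zero = (\<lambda>n. \<zero>\<^bsub>R\<^esub>),
     ring.add = (\<lambda>x y n. mpoly_eval R (case_sum x y) (witt_add_poly p n))\<rparr>"

definition witt_F :: "nat \<Rightarrow> ('a, 'm) ring_scheme \<Rightarrow> (nat \<Rightarrow> 'a) \<Rightarrow> (nat \<Rightarrow> 'a)" where
  "witt_F p R x = (\<lambda>n. mpoly_eval R x (witt_frob_poly p n))"

definition witt_V :: "('a, 'm) ring_scheme \<Rightarrow> (nat \<Rightarrow> 'a) \<Rightarrow> (nat \<Rightarrow> 'a)" where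
  "witt_V R x = (\<lambda>n. case n of 0 \<Rightarrow> \<zero>\<^bsub>R\<^esub> | Suc k \<Rightarrow> x k)"

definition witt_Fdiv :: "nat \<Rightarrow> ('a, 'm) ring_scheme \<Rightarrow> (nat \<Rightarrow> 'a) \<Rightarrow> (nat \<Rightarrow> 'a)" where
  "witt_Fdiv p R = the_inv_into (carrier (witt p R)) (witt_V R)"


section \<open>Modules and tensor products\<close>

text \<open>A \<open>module\<close> record extends a \<open>ring\<close> record; its fields \<open>mult\<close> and \<open>one\<close> play no
  role for modules and are mostly left \<open>undefined\<close>.\<close>

text \<open>Linear maps are extensional functions, so that equality in Hom-sets is equality of maps.\<close>

definition lin_maps ::
  "('a, 'm) ring_scheme \<Rightarrow> ('a, 'b, 'x) module_scheme \<Rightarrow> ('a, 'c, 'y) module_scheme \<Rightarrow> ('b \<Rightarrow> 'c) set"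
  where "lin_maps A M N =
    {f \<in> carrier M \<rightarrow>\<^sub>E carrier N.
       (\<forall>x\<in>carrier M. \<forall>y\<in>carrier M. f (x \<oplus>\<^bsub>M\<^esub> y) = f x \<oplus>\<^bsub>N\<^esub> f y) \<and>
       (\<forall>a\<in>carrier A. \<forall>x\<in>carrier M. f (a \<odot>\<^bsub>M\<^esub> x) = a \<odot>\<^bsub>N\<^esub> f x)}"

definition module_isos ::
  "('a, 'm) ring_scheme \<Rightarrow> ('a, 'b, 'x) module_scheme \<Rightarrow> ('a, 'c, 'y) module_scheme \<Rightarrow> ('b \<Rightarrow> 'c) set"
  where "module_isos A M N = {f \<in> lin_maps A M N. bij_betw f (carrier M) (carrier N)}"

definition free_module :: "('a, 'm) ring_scheme \<Rightarrow> nat \<Rightarrow> ('a, nat \<Rightarrow> 'a) module" where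
  "free_module A n =
    \<lparr>carrier = {..<n} \<rightarrow>\<^sub>E carrier A, monoid.mult = undefined, one = undefined,
     ring.zero = (\<lambda>i\<in>{..<n}. \<zero>\<^bsub>A\<^esub>),
     ring.add = (\<lambda>x y. \<lambda>i\<in>{..<n}. x i \<oplus>\<^bsub>A\<^esub> y i),
     smult = (\<lambda>a x. \<lambda>i\<in>{..<n}. a \<otimes>\<^bsub>A\<^esub> x i)\<rparr>"

text \<open>Finite projective: a direct summand of a free module of finite rank.\<close>

definition finite_projective :: "('a, 'm) ring_scheme \<Rightarrow> ('a, 'b, 'x) module_scheme \<Rightarrow> bool" where
  "finite_projective A M \<longleftrightarrow> module A M \<and>
    (\<exists>n. \<exists>i \<in> lin_maps A M (free_module A n). \<exists>q \<in> lin_maps A (free_module A n) M.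
       \<forall>x\<in>carrier M. q (i x) = x)"

definition direct_sum ::
  "('a, 'b, 'x) module_scheme \<Rightarrow> ('a, 'c, 'y) module_scheme \<Rightarrow> ('a, 'b \<times> 'c) module" where
  "direct_sum M N =
    \<lparr>carrier = carrier M \<times> carrier N, monoid.mult = undefined, one = undefined,
     ring.zero = (\<zero>\<^bsub>M\<^esub>, \<zero>\<^bsub>N\<^esub>),
     ring.add = (\<lambda>(x, y) (x', y'). (x \<oplus>\<^bsub>M\<^esub> x', y \<oplus>\<^bsub>N\<^esub> y')),
     smult = (\<lambda>a (x, y). (a \<odot>\<^bsub>M\<^esub> x, a \<odot>\<^bsub>N\<^esub> y))\<rparr>"

type_synonym ('m, 'n) tensor = "('m \<times> 'n \<Rightarrow>\<^sub>0 int) set"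

definition tensor_relations ::
  "('a, 'k) ring_scheme \<Rightarrow> ('a, 'm, 'x) module_scheme \<Rightarrow> ('a, 'n, 'y) module_scheme
    \<Rightarrow> ('m \<times> 'n \<Rightarrow>\<^sub>0 int) set" where
  "tensor_relations A M N =
     {frag_of (x \<oplus>\<^bsub>M\<^esub> x', y) - frag_of (x, y) - frag_of (x', y) | x x' y.
        x \<in> carrier M \<and> x' \<in> carrier M \<and> y \<in> carrier N} \<union>
     {frag_of (x, y \<oplus>\<^bsub>N\<^esub> y') - frag_of (x, y) - frag_of (x, y') | x y y'.
        x \<in> carrier M \<and> y \<in> carrier N \<and> y' \<in> carrier N} \<union>
     {frag_of (a \<odot>\<^bsub>M\<^esub> x, y) - frag_of (x, a \<odot>\<^bsub>N\<^esub> y) | a x y.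
        a \<in> carrier A \<and> x \<in> carrier M \<and> y \<in> carrier N}"

definition tensor_kernel ::
  "('a, 'k) ring_scheme \<Rightarrow> ('a, 'm, 'x) module_scheme \<Rightarrow> ('a, 'n, 'y) module_scheme
    \<Rightarrow> ('m \<times> 'n \<Rightarrow>\<^sub>0 int) set" where
  "tensor_kernel A M N =
     generate (free_Abelian_group (carrier M \<times> carrier N)) (tensor_relations A M N)"

definition tensor_group ::
  "('a, 'k) ring_scheme \<Rightarrow> ('a, 'm, 'x) module_scheme \<Rightarrow> ('a, 'n, 'y) module_scheme
    \<Rightarrow> ('m, 'n) tensor monoid" where
  "tensor_group A M N =
     free_Abelian_group (carrier M \<times> carrier N) Mod tensor_kernel A M N"

definition pure_tensor ::
  "('a, 'k) ring_scheme \<Rightarrow> ('a, 'm, 'x) module_scheme \<Rightarrow> ('a, 'n, 'y) module_scheme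
    \<Rightarrow> 'm \<Rightarrow> 'n \<Rightarrow> ('m, 'n) tensor" where
  "pure_tensor A M N x y =
     tensor_kernel A M N #>\<^bsub>free_Abelian_group (carrier M \<times> carrier N)\<^esub> frag_of (x, y)"

text \<open>The additive map sending \<open>x \<otimes> y\<close> to \<open>f (x, y)\<close>, for balanced biadditive \<open>f\<close>; it is
  evaluated on an arbitrary representative, the choice being irrelevant for such \<open>f\<close>.\<close>

definition tensor_lift ::
  "('c, 'k) ring_scheme \<Rightarrow> ('m \<times> 'n \<Rightarrow> 'c) \<Rightarrow> ('m, 'n) tensor \<Rightarrow> 'c" where
  "tensor_lift Q f X =
     (let c = (SOME c. c \<in> X)
      in \<Oplus>\<^bsub>Q\<^esub>z\<in>Poly_Mapping.keys c. [Poly_Mapping.lookup c z] \<cdot>\<^bsub>Q\<^esub> f z)"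

text \<open>The tensor product over \<open>A\<close>, with a further ring acting on the left factor through \<open>s\<close>.\<close>

definition tensor_with_action ::
  "('a, 'k) ring_scheme \<Rightarrow> ('a, 'm, 'x) module_scheme \<Rightarrow> ('a, 'n, 'y) module_scheme
    \<Rightarrow> ('b \<Rightarrow> 'm \<Rightarrow> 'm) \<Rightarrow> ('b, ('m, 'n) tensor) module" where
  "tensor_with_action A M N s =
     (let G = tensor_group A M N;
          Q = \<lparr>carrier = carrier G, monoid.mult = undefined, one = undefined,
               ring.zero = \<one>\<^bsub>G\<^esub>, ring.add = monoid.mult G\<rparr> :: ('m, 'n) tensor ring
      in ring.extend Q (module.fields
           (\<lambda>b. tensor_lift Q (\<lambda>(x, y). pure_tensor A M N (s b x) y))))"

definition tensor_product ::
  "('a, 'k) ring_scheme \<Rightarrow> ('a, 'm, 'x) module_scheme \<Rightarrow> ('a, 'n, 'y) module_scheme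
    \<Rightarrow> ('a, ('m, 'n) tensor) module" where
  "tensor_product A M N = tensor_with_action A M N (smult M)"

text \<open>The ring \<open>B\<close> as an \<open>A\<close>-module via \<open>\<phi> : A \<rightarrow> B\<close>.\<close>

definition ring_as_module :: "('b, 'm) ring_scheme \<Rightarrow> ('a \<Rightarrow> 'b) \<Rightarrow> ('a, 'b) module" where
  "ring_as_module B \<phi> =
    \<lparr>carrier = carrier B, monoid.mult = monoid.mult B, one = \<one>\<^bsub>B\<^esub>,
     ring.zero = \<zero>\<^bsub>B\<^esub>, ring.add = ring.add B,
     smult = (\<lambda>a b. \<phi> a \<otimes>\<^bsub>B\<^esub> b)\<rparr>"

text \<open>The \<open>B\<close>-module \<open>B \<otimes>\<^bsub>\<phi>,A\<^esub> M\<close>.\<close>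

definition base_change ::
  "('a, 'k) ring_scheme \<Rightarrow> ('b, 'l) ring_scheme \<Rightarrow> ('a \<Rightarrow> 'b) \<Rightarrow> ('a, 'm, 'x) module_scheme
    \<Rightarrow> ('b, ('b, 'm) tensor) module" where
  "base_change A B \<phi> M = tensor_with_action A (ring_as_module B \<phi>) M (monoid.mult B)"

definition base_change_unit ::
  "('a, 'k) ring_scheme \<Rightarrow> ('b, 'l) ring_scheme \<Rightarrow> ('a \<Rightarrow> 'b) \<Rightarrow> ('a, 'm, 'x) module_scheme
    \<Rightarrow> 'm \<Rightarrow> ('b, 'm) tensor" where
  "base_change_unit A B \<phi> M x = pure_tensor A (ring_as_module B \<phi>) M \<one>\<^bsub>B\<^esub> x"

text \<open>The additive map \<open>B \<otimes>\<^bsub>\<phi>,A\<^esub> M \<rightarrow> N\<close>, \<open>b \<otimes> x \<mapsto> \<psi> b \<odot> h x\<close>, for \<open>\<psi> : B \<rightarrow> C\<close>, a \<open>C\<close>-module \<open>N\<close>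
  and a \<open>\<psi> \<circ> \<phi>\<close>-linear map \<open>h : M \<rightarrow> N\<close>. For \<open>\<psi> = id\<close> this is the linearization of \<open>h\<close>.\<close>

definition semilinearization ::
  "('c, 'n, 'y) module_scheme \<Rightarrow> ('b \<Rightarrow> 'c) \<Rightarrow> ('m \<Rightarrow> 'n) \<Rightarrow> ('b, 'm) tensor \<Rightarrow> 'n" where
  "semilinearization N \<psi> h = tensor_lift N (\<lambda>(b, x). \<psi> b \<odot>\<^bsub>N\<^esub> h x)"

abbreviation linearization ::
  "('b, 'n, 'y) module_scheme \<Rightarrow> ('m \<Rightarrow> 'n) \<Rightarrow> ('b, 'm) tensor \<Rightarrow> 'n" where
  "linearization N \<equiv> semilinearization N (\<lambda>b. b)"

text \<open>The base change \<open>B \<otimes>\<^bsub>\<phi>,A\<^esub> M \<rightarrow> B \<otimes>\<^bsub>\<phi>,A\<^esub> M'\<close> of a map \<open>f : M \<rightarrow> M'\<close>.\<close>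

definition base_change_map ::
  "('a, 'k) ring_scheme \<Rightarrow> ('b, 'l) ring_scheme \<Rightarrow> ('a \<Rightarrow> 'b) \<Rightarrow> ('a, 'm', 'y) module_scheme
    \<Rightarrow> ('m \<Rightarrow> 'm') \<Rightarrow> ('b, 'm) tensor \<Rightarrow> ('b, 'm') tensor" where
  "base_change_map A B \<phi> M' f =
     linearization (base_change A B \<phi> M') (\<lambda>x. base_change_unit A B \<phi> M' (f x))"

text \<open>The canonical isomorphism
  \<open>B \<otimes>\<^bsub>\<phi>,A\<^esub> (M \<otimes>\<^bsub>A\<^esub> N) \<rightarrow> (B \<otimes>\<^bsub>\<phi>,A\<^esub> M) \<otimes>\<^bsub>B\<^esub> (B \<otimes>\<^bsub>\<phi>,A\<^esub> N)\<close>.\<close>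

definition base_change_tensor ::
  "('a, 'k) ring_scheme \<Rightarrow> ('b, 'l) ring_scheme \<Rightarrow> ('a \<Rightarrow> 'b) \<Rightarrow> ('a, 'm, 'x) module_scheme
    \<Rightarrow> ('a, 'n, 'y) module_scheme
    \<Rightarrow> ('b, ('m, 'n) tensor) tensor \<Rightarrow> (('b, 'm) tensor, ('b, 'n) tensor) tensor" where
  "base_change_tensor A B \<phi> M N =
     (let MB = base_change A B \<phi> M; NB = base_change A B \<phi> N; Q = tensor_product B MB NB
      in linearization Q (tensor_lift Q (\<lambda>(x, y).
           pure_tensor B MB NB (base_change_unit A B \<phi> M x) (base_change_unit A B \<phi> N y))))"


section \<open>Pairs, displays and their morphisms\<close>

definition witt_I :: "nat \<Rightarrow> ('a, 'm) ring_scheme \<Rightarrow> (nat \<Rightarrow> 'a, nat \<Rightarrow> 'a) module" where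
  "witt_I p R =
     (ring_as_module (witt p R) (\<lambda>x. x))\<lparr>carrier := {x \<in> carrier (witt p R). x 0 = \<zero>\<^bsub>R\<^esub>}\<rparr>"

definition I_tensor ::
  "nat \<Rightarrow> ('a, 'm) ring_scheme \<Rightarrow> (nat \<Rightarrow> 'a, 't, 'x) module_scheme
    \<Rightarrow> (nat \<Rightarrow> 'a, (nat \<Rightarrow> 'a, 't) tensor) module" where
  "I_tensor p R M = tensor_product (witt p R) (witt_I p R) M"

definition I_incl :: "(nat \<Rightarrow> 'a, 't, 'x) module_scheme \<Rightarrow> (nat \<Rightarrow> 'a, 't) tensor \<Rightarrow> 't" where
  "I_incl M = linearization M (\<lambda>x. x)"

definition F_twist ::
  "nat \<Rightarrow> ('a, 'm) ring_scheme \<Rightarrow> (nat \<Rightarrow> 'a, 't, 'x) module_scheme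
    \<Rightarrow> (nat \<Rightarrow> 'a, (nat \<Rightarrow> 'a, 't) tensor) module" where
  "F_twist p R M = base_change (witt p R) (witt p R) (witt_F p R) M"

definition F_twist_map ::
  "nat \<Rightarrow> ('a, 'm) ring_scheme \<Rightarrow> (nat \<Rightarrow> 'a, 't', 'x) module_scheme
    \<Rightarrow> ('t \<Rightarrow> 't') \<Rightarrow> (nat \<Rightarrow> 'a, 't) tensor \<Rightarrow> (nat \<Rightarrow> 'a, 't') tensor" where
  "F_twist_map p R M' f = base_change_map (witt p R) (witt p R) (witt_F p R) M' f"

definition Fdiv_lin ::
  "nat \<Rightarrow> ('a, 'm) ring_scheme \<Rightarrow> (nat \<Rightarrow> 'a, nat \<Rightarrow> 'a) tensor \<Rightarrow> (nat \<Rightarrow> 'a)" where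
  "Fdiv_lin p R = linearization (ring_as_module (witt p R) (\<lambda>x. x)) (witt_Fdiv p R)"

text \<open>The composition \<open>L\<^sup>F \<rightarrow> (I \<otimes> T')\<^sup>F \<cong> I\<^sup>F \<otimes> T'\<^sup>F \<rightarrow> T'\<^sup>F\<close> attached to \<open>b : L \<rightarrow> I \<otimes> T'\<close>, the last
  map being \<open>u \<otimes> y \<mapsto> Fdiv_lin u \<odot> y\<close>.\<close>

definition Fdiv_map ::
  "nat \<Rightarrow> ('a, 'm) ring_scheme \<Rightarrow> (nat \<Rightarrow> 'a, 't', 'x) module_scheme
    \<Rightarrow> ('l \<Rightarrow> (nat \<Rightarrow> 'a, 't') tensor) \<Rightarrow> (nat \<Rightarrow> 'a, 'l) tensor \<Rightarrow> (nat \<Rightarrow> 'a, 't') tensor" where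
  "Fdiv_map p R T' b =
     tensor_lift (F_twist p R T') (\<lambda>(u, y). Fdiv_lin p R u \<odot>\<^bsub>F_twist p R T'\<^esub> y)
     \<circ> base_change_tensor (witt p R) (witt p R) (witt_F p R) (witt_I p R) T'
     \<circ> F_twist_map p R (I_tensor p R T') b"

record ('w, 't, 'l) display =
  disp_T :: "('w, 't) module"
  disp_L :: "('w, 'l) module"
  disp_Psi :: "('w, 't) tensor \<times> ('w, 'l) tensor \<Rightarrow> 't \<times> 'l"

definition disp_sum :: "('w, 't, 'l) display \<Rightarrow> ('w, 't \<times> 'l) module" where
  "disp_sum P = direct_sum (disp_T P) (disp_L P)"

definition disp_F ::
  "nat \<Rightarrow> ('a, 'm) ring_scheme \<Rightarrow> (nat \<Rightarrow> 'a, 't, 'l) display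
    \<Rightarrow> (nat \<Rightarrow> 'a, (nat \<Rightarrow> 'a, 't) tensor \<times> (nat \<Rightarrow> 'a, 'l) tensor) module" where
  "disp_F p R P = direct_sum (F_twist p R (disp_T P)) (F_twist p R (disp_L P))"

definition is_display ::
  "nat \<Rightarrow> ('a, 'm) ring_scheme \<Rightarrow> (nat \<Rightarrow> 'a, 't, 'l) display \<Rightarrow> bool" where
  "is_display p R P \<longleftrightarrow>
     finite_projective (witt p R) (disp_T P) \<and> finite_projective (witt p R) (disp_L P) \<and>
     disp_Psi P \<in> module_isos (witt p R) (disp_F p R P) (disp_sum P)"

text \<open>The quadruple \<open>(a, b, c, d)\<close> stands for the matrix with rows \<open>a b\<close> and \<open>c d\<close>.\<close>

type_synonym ('w, 't, 'l, 't1, 'l1) pair_map =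
  "('t \<Rightarrow> 't1) \<times> ('l \<Rightarrow> ('w, 't1) tensor) \<times> ('t \<Rightarrow> 'l1) \<times> ('l \<Rightarrow> 'l1)"

definition pair_homs ::
  "nat \<Rightarrow> ('a, 'm) ring_scheme \<Rightarrow> (nat \<Rightarrow> 'a, 't, 'l) display \<Rightarrow> (nat \<Rightarrow> 'a, 't1, 'l1) display
    \<Rightarrow> (nat \<Rightarrow> 'a, 't, 'l, 't1, 'l1) pair_map set" where
  "pair_homs p R P P' =
     lin_maps (witt p R) (disp_T P) (disp_T P') \<times>
     lin_maps (witt p R) (disp_L P) (I_tensor p R (disp_T P')) \<times>
     lin_maps (witt p R) (disp_T P) (disp_L P') \<times>
     lin_maps (witt p R) (disp_L P) (disp_L P')"

fun induced_map ::
  "(nat \<Rightarrow> 'a, 't1, 'l1) display \<Rightarrow> (nat \<Rightarrow> 'a, 't, 'l, 't1, 'l1) pair_map \<Rightarrow> 't \<times> 'l \<Rightarrow> 't1 \<times> 'l1" where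
  "induced_map P' (a, b, c, d) (x, y) =
     (a x \<oplus>\<^bsub>disp_T P'\<^esub> I_incl (disp_T P') (b y), c x \<oplus>\<^bsub>disp_L P'\<^esub> d y)"

fun F_map ::
  "nat \<Rightarrow> ('a, 'm) ring_scheme \<Rightarrow> (nat \<Rightarrow> 'a, 't1, 'l1) display
    \<Rightarrow> (nat \<Rightarrow> 'a, 't, 'l, 't1, 'l1) pair_map
    \<Rightarrow> (nat \<Rightarrow> 'a, 't) tensor \<times> (nat \<Rightarrow> 'a, 'l) tensor
    \<Rightarrow> (nat \<Rightarrow> 'a, 't1) tensor \<times> (nat \<Rightarrow> 'a, 'l1) tensor" where
  "F_map p R P' (a, b, c, d) (u, v) =
     (F_twist_map p R (disp_T P') a u \<oplus>\<^bsub>F_twist p R (disp_T P')\<^esub> Fdiv_map p R (disp_T P') b v,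
      ([p] \<cdot>\<^bsub>F_twist p R (disp_L P')\<^esub> F_twist_map p R (disp_L P') c u)
        \<oplus>\<^bsub>F_twist p R (disp_L P')\<^esub> F_twist_map p R (disp_L P') d v)"

definition display_homs ::
  "nat \<Rightarrow> ('a, 'm) ring_scheme \<Rightarrow> (nat \<Rightarrow> 'a, 't, 'l) display \<Rightarrow> (nat \<Rightarrow> 'a, 't1, 'l1) display
    \<Rightarrow> (nat \<Rightarrow> 'a, 't, 'l, 't1, 'l1) pair_map set" where
  "display_homs p R P P' =
     {f \<in> pair_homs p R P P'. \<forall>u \<in> carrier (disp_F p R P).
        induced_map P' f (disp_Psi P u) = disp_Psi P' (F_map p R P' f u)}"

definition map_add ::
  "('a, 'b, 'x) module_scheme \<Rightarrow> ('a, 'c, 'y) module_scheme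
    \<Rightarrow> ('b \<Rightarrow> 'c) \<Rightarrow> ('b \<Rightarrow> 'c) \<Rightarrow> ('b \<Rightarrow> 'c)" where
  "map_add M N f g = (\<lambda>x\<in>carrier M. f x \<oplus>\<^bsub>N\<^esub> g x)"

definition map_zero ::
  "('a, 'b, 'x) module_scheme \<Rightarrow> ('a, 'c, 'y) module_scheme \<Rightarrow> ('b \<Rightarrow> 'c)" where
  "map_zero M N = (\<lambda>x\<in>carrier M. \<zero>\<^bsub>N\<^esub>)"

text \<open>The group operation is written multiplicatively, as the \<open>mult\<close> field of a \<open>monoid\<close> record;
  it is the entrywise addition of matrices.\<close>

definition Hom_display ::
  "nat \<Rightarrow> ('a, 'm) ring_scheme \<Rightarrow> (nat \<Rightarrow> 'a, 't, 'l) display \<Rightarrow> (nat \<Rightarrow> 'a, 't1, 'l1) display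
    \<Rightarrow> (nat \<Rightarrow> 'a, 't, 'l, 't1, 'l1) pair_map monoid" where
  "Hom_display p R P P' =
     (let T = disp_T P; L = disp_L P; T' = disp_T P'; L' = disp_L P'; IT' = I_tensor p R T'
      in \<lparr>carrier = display_homs p R P P',
          monoid.mult = (\<lambda>(a, b, c, d) (a', b', c', d').
            (map_add T T' a a', map_add L IT' b b', map_add T L' c c', map_add L L' d d')),
          one = (map_zero T T', map_zero L IT', map_zero T L', map_zero L L')\<rparr>)"

definition p_torsionfree :: "nat \<Rightarrow> ('g, 'm) monoid_scheme \<Rightarrow> bool" where
  "p_torsionfree p G \<longleftrightarrow> (\<forall>x\<in>carrier G. x [^]\<^bsub>G\<^esub> p = \<one>\<^bsub>G\<^esub> \<longrightarrow> x = \<one>\<^bsub>G\<^esub>)"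


section \<open>Nilpotence\<close>

definition p_nilpotent :: "nat \<Rightarrow> ('a, 'm) ring_scheme \<Rightarrow> bool" where
  "p_nilpotent p R \<longleftrightarrow> (\<exists>n::nat. ([p] \<cdot>\<^bsub>R\<^esub> \<one>\<^bsub>R\<^esub>) [^]\<^bsub>R\<^esub> n = \<zero>\<^bsub>R\<^esub>)"

definition p_ideal :: "nat \<Rightarrow> ('a, 'm) ring_scheme \<Rightarrow> 'a set" where
  "p_ideal p R = PIdl\<^bsub>R\<^esub> ([p] \<cdot>\<^bsub>R\<^esub> \<one>\<^bsub>R\<^esub>)"

definition mod_p :: "nat \<Rightarrow> ('a, 'm) ring_scheme \<Rightarrow> 'a set ring" where
  "mod_p p R = R Quot p_ideal p R"

definition witt_to_mod_p :: "nat \<Rightarrow> ('a, 'm) ring_scheme \<Rightarrow> (nat \<Rightarrow> 'a) \<Rightarrow> 'a set" where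
  "witt_to_mod_p p R x = p_ideal p R +>\<^bsub>R\<^esub> x 0"

definition frob_mod_p :: "nat \<Rightarrow> ('a, 'm) ring_scheme \<Rightarrow> nat \<Rightarrow> 'a set \<Rightarrow> 'a set" where
  "frob_mod_p p R i x = x [^]\<^bsub>mod_p p R\<^esub> (p ^ i)"

text \<open>\<open>(R/pR) \<otimes>\<^bsub>W(R)\<^esub> M\<close> and the twist \<open>N\<^bsup>(p^i)\<^esup>\<close> of an \<open>R/pR\<close>-module \<open>N\<close>.\<close>

definition module_mod_p ::
  "nat \<Rightarrow> ('a, 'm) ring_scheme \<Rightarrow> (nat \<Rightarrow> 'a, 'l, 'x) module_scheme
    \<Rightarrow> ('a set, ('a set, 'l) tensor) module" where
  "module_mod_p p R M = base_change (witt p R) (mod_p p R) (witt_to_mod_p p R) M"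

definition frob_twist ::
  "nat \<Rightarrow> ('a, 'm) ring_scheme \<Rightarrow> nat \<Rightarrow> ('a set, 'n, 'x) module_scheme
    \<Rightarrow> ('a set, ('a set, 'n) tensor) module" where
  "frob_twist p R i N = base_change (mod_p p R) (mod_p p R) (frob_mod_p p R i) N"

definition frob_twist_unit ::
  "nat \<Rightarrow> ('a, 'm) ring_scheme \<Rightarrow> nat \<Rightarrow> ('a set, 'n, 'x) module_scheme
    \<Rightarrow> 'n \<Rightarrow> ('a set, 'n) tensor" where
  "frob_twist_unit p R i N = base_change_unit (mod_p p R) (mod_p p R) (frob_mod_p p R i) N"

text \<open>The lower right component \<open>L \<rightarrow> L\<^sup>F\<close> of the inverse of \<open>\<Psi>\<close>.\<close>

definition z_map ::
  "nat \<Rightarrow> ('a, 'm) ring_scheme \<Rightarrow> (nat \<Rightarrow> 'a, 't, 'l) display \<Rightarrow> 'l \<Rightarrow> (nat \<Rightarrow> 'a, 'l) tensor" where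
  "z_map p R P y =
     snd (the_inv_into (carrier (disp_F p R P)) (disp_Psi P) (\<zero>\<^bsub>disp_T P\<^esub>, y))"

text \<open>The canonical isomorphism
  \<open>(R/pR) \<otimes>\<^bsub>W(R)\<^esub> M\<^sup>F \<rightarrow> ((R/pR) \<otimes>\<^bsub>W(R)\<^esub> M)\<^bsup>(p)\<^esup>\<close>,
  \<open>r \<otimes> (w \<otimes> y) \<mapsto> r w \<otimes> (1 \<otimes> y)\<close>: the Frobenius of \<open>W(R)\<close> reduces to that of \<open>R/pR\<close>.\<close>

definition mod_p_F_twist ::
  "nat \<Rightarrow> ('a, 'm) ring_scheme \<Rightarrow> (nat \<Rightarrow> 'a, 'l, 'x) module_scheme
    \<Rightarrow> ('a set, (nat \<Rightarrow> 'a, 'l) tensor) tensor \<Rightarrow> ('a set, ('a set, 'l) tensor) tensor" where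
  "mod_p_F_twist p R M =
     (let N = module_mod_p p R M
      in linearization (frob_twist p R 1 N)
           (semilinearization (frob_twist p R 1 N) (witt_to_mod_p p R)
             (\<lambda>y. frob_twist_unit p R 1 N
                    (base_change_unit (witt p R) (mod_p p R) (witt_to_mod_p p R) M y))))"

text \<open>The reduction \<open>(R/pR) \<otimes> L \<rightarrow> ((R/pR) \<otimes> L)\<^bsup>(p)\<^esup>\<close> of \<open>z_map\<close>.\<close>

definition z_mod_p ::
  "nat \<Rightarrow> ('a, 'm) ring_scheme \<Rightarrow> (nat \<Rightarrow> 'a, 't, 'l) display
    \<Rightarrow> ('a set, 'l) tensor \<Rightarrow> ('a set, ('a set, 'l) tensor) tensor" where
  "z_mod_p p R P =
     mod_p_F_twist p R (disp_L P) \<circ>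
     base_change_map (witt p R) (mod_p p R) (witt_to_mod_p p R) (F_twist p R (disp_L P))
       (z_map p R P)"

text \<open>The canonical isomorphism \<open>(N\<^bsup>(p)\<^esup>)\<^bsup>(p^i)\<^esup> \<rightarrow> N\<^bsup>(p^(i+1))\<^esup>\<close>,
  \<open>r \<otimes> (s \<otimes> x) \<mapsto> r s\<^bsup>p^i\<^esup> \<otimes> x\<close>.\<close>

definition frob_twist_twist ::
  "nat \<Rightarrow> ('a, 'm) ring_scheme \<Rightarrow> nat \<Rightarrow> ('a set, 'n, 'x) module_scheme
    \<Rightarrow> ('a set, ('a set, 'n) tensor) tensor \<Rightarrow> ('a set, 'n) tensor" where
  "frob_twist_twist p R i N =
     linearization (frob_twist p R (Suc i) N)
       (semilinearization (frob_twist p R (Suc i) N) (frob_mod_p p R i)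
         (frob_twist_unit p R (Suc i) N))"

definition z_twist ::
  "nat \<Rightarrow> ('a, 'm) ring_scheme \<Rightarrow> (nat \<Rightarrow> 'a, 't, 'l) display \<Rightarrow> nat
    \<Rightarrow> ('a set, ('a set, 'l) tensor) tensor \<Rightarrow> ('a set, ('a set, 'l) tensor) tensor" where
  "z_twist p R P i =
     (let N = module_mod_p p R (disp_L P)
      in frob_twist_twist p R i N \<circ>
         base_change_map (mod_p p R) (mod_p p R) (frob_mod_p p R i) (frob_twist p R 1 N)
           (z_mod_p p R P))"

text \<open>The composition of the twists \<open>0, \<dots>, e - 1\<close> of \<open>z_mod_p\<close>, with values in the twist by \<open>p^e\<close>.
  It starts with the canonical isomorphism of \<open>N\<close> with its trivial twist \<open>N\<^bsup>(p^0)\<^esup>\<close>.\<close>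

primrec z_iter ::
  "nat \<Rightarrow> ('a, 'm) ring_scheme \<Rightarrow> (nat \<Rightarrow> 'a, 't, 'l) display \<Rightarrow> nat
    \<Rightarrow> ('a set, 'l) tensor \<Rightarrow> ('a set, ('a set, 'l) tensor) tensor" where
  "z_iter p R P 0 = frob_twist_unit p R 0 (module_mod_p p R (disp_L P))"
| "z_iter p R P (Suc e) = z_twist p R P e \<circ> z_iter p R P e"

definition nilpotence_order_le ::
  "nat \<Rightarrow> ('a, 'm) ring_scheme \<Rightarrow> (nat \<Rightarrow> 'a, 't, 'l) display \<Rightarrow> nat \<Rightarrow> bool" where
  "nilpotence_order_le p R P e \<longleftrightarrow>
     (\<forall>x \<in> carrier (module_mod_p p R (disp_L P)).
        z_iter p R P e x = \<zero>\<^bsub>frob_twist p R e (module_mod_p p R (disp_L P))\<^esub>)"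

definition nilpotent_display ::
  "nat \<Rightarrow> ('a, 'm) ring_scheme \<Rightarrow> (nat \<Rightarrow> 'a, 't, 'l) display \<Rightarrow> bool" where
  "nilpotent_display p R P \<longleftrightarrow> (\<exists>e. nilpotence_order_le p R P e)"

end

theory Submission
  imports Defs
begin

text \<open>Write \<open>W = W(R)\<close> and let \<open>f = [a, b; c, d]\<close> be a homomorphism of displays with \<open>p f = 0\<close>.
  Choose dual bases of \<open>L\<close>, \<open>T'\<close> and \<open>L'\<close>. The essential datum is the matrix \<open>\<beta>\<close> of the divided
  Frobenius \<open>b\<^bsup>F,div\<^esup>\<close>: since \<open>V\<close> inverts the divided Frobenius, the entries of \<open>V \<beta>\<close> are the
  coordinates of \<open>b\<close> itself. Let \<open>G\<close> be the set of all coordinates of values of \<open>a\<close> and \<open>d\<close>.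
  Conjugating by \<open>\<Psi>\<close> and \<open>\<Psi>'\<close>, the homomorphism \<open>f\<close> is determined by \<open>a\<^sup>F\<close>, \<open>d\<^sup>F\<close>, \<open>\<beta>\<close> and
  \<open>p c\<^sup>F = 0\<close>; in coordinates this says that \<open>G\<close> lies in the ideal generated by \<open>F(G)\<close> and the
  entries of \<open>\<beta>\<close>, and that

  \<open>V \<beta> = X \<beta> Z\<close> modulo the ideal generated by \<open>F(G)\<close>,

  where \<open>Z\<close> is the matrix of \<open>L \<rightarrow> L\<^sup>F\<close>, whose Frobenius twisted powers vanish modulo \<open>p\<close> from some
  exponent on, and \<open>X\<close> is an upper left block of \<open>\<Psi>'\<close>. The theorem \<open>witt_matrix_rigidity\<close> deduces
  \<open>\<beta> = 0\<close> and \<open>G = 0\<close> from this, and then \<open>f = 0\<close>.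

  The rigidity has two parts. Over a ring of characteristic \<open>p\<close>, a \<open>p\<close>-torsion Witt vector is killed by
  \<open>F\<close>. If moreover \<open>\<beta> = V\<^sup>s \<gamma>\<close> with \<open>s\<close> large, then \<open>V \<gamma> = F\<^sup>s(X) \<gamma> F\<^sup>s(Z)\<close>, so that
  \<open>\<gamma> F\<^sup>s(Z) y = 0\<close> implies \<open>\<gamma> F(y) = 0\<close>; iterating this along the twisted powers of \<open>Z\<close>, starting
  from one whose entries lie in \<open>V W\<close> and are therefore annihilated by \<open>\<gamma>\<close>, gives \<open>\<gamma> = 0\<close>
  (\<open>V_matrix_eq_zero_char_p\<close>). Over a ring with an ideal \<open>I\<close> such that \<open>I I = p I = 0\<close>, Witt vectors with
  components in \<open>I\<close> are added componentwise, so that \<open>V \<beta> = X \<beta> Z\<close> expresses the \<open>n\<close>-th components of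
  \<open>\<beta>\<close> through the \<open>(n+1)\<close>-st ones and a twist of \<open>Z\<close>; after enough steps the twists of \<open>Z\<close> produce
  a factor \<open>p\<close> (\<open>V_matrix_eq_zero_square_zero\<close>). To combine the two, take the ideal \<open>C\<close> generated by \<open>p\<close>
  and the first \<open>s\<close> components of the entries of \<open>\<beta>\<close>. The first part applies over \<open>R/C\<close>. As \<open>p\<close>-torsion
  makes the \<open>p\<close>-th powers of these finitely many components divisible by \<open>p\<close>, and \<open>p\<close> is nilpotent, a
  finite chain of ideals leads from \<open>C\<close> down to \<open>0\<close> whose steps are governed by the second part
  (\<open>peel_generators\<close>, \<open>peel_p_powers\<close>). Finiteness is used here: the ideal of all components of
  \<open>p\<close>-torsion Witt vectors need not be nilpotent.

  Three translations prepare the ground. Witt vectors are given by universal polynomials; their ring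
  laws, \<open>F V = p\<close>, \<open>x V(y) = V(F(x) y)\<close> and the congruences satisfied by the polynomials are read off
  from ghost components over polynomial rings, where Dwork's lemma describes the sequences that are
  ghost components. Tensor products are cosets of formal sums, and are handled through additive maps
  determined on pure tensors. Finally the nilpotence of a display is expressed by its matrix \<open>Z\<close>.\<close>

section \<open>Sums over formal integer combinations\<close>

text \<open>Both the evaluation of integral polynomials and the lift of a balanced map to a tensor product
  are sums of this form.\<close>

definition frag_sum :: "('c, 'k) ring_scheme \<Rightarrow> ('v \<Rightarrow> 'c) \<Rightarrow> ('v \<Rightarrow>\<^sub>0 int) \<Rightarrow> 'c" where
  "frag_sum Q f c = (\<Oplus>\<^bsub>Q\<^esub>z\<in>Poly_Mapping.keys c. [Poly_Mapping.lookup c z] \<cdot>\<^bsub>Q\<^esub> f z)"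

context abelian_group
begin

lemma int_add_pow_closed: "x \<in> carrier G \<Longrightarrow> [(k::int)] \<cdot> x \<in> carrier G"
  unfolding add_pow_def using group.int_pow_closed[OF a_group] by simp

lemma int_add_pow_diff: "x \<in> carrier G \<Longrightarrow> [(i - j::int)] \<cdot> x = [i] \<cdot> x \<ominus> [j] \<cdot> x"
  unfolding add_pow_def a_minus_def a_inv_def using group.int_pow_diff[OF a_group] by simp

lemma int_add_pow_0: "[(0::int)] \<cdot> x = \<zero>"
  unfolding add_pow_def by simp

lemma finsum_minus:
  assumes "finite S" "f \<in> S \<rightarrow> carrier G" "g \<in> S \<rightarrow> carrier G"
  shows "(\<Oplus>z\<in>S. f z \<ominus> g z) = (\<Oplus>z\<in>S. f z) \<ominus> (\<Oplus>z\<in>S. g z)"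
  using assms
proof (induction S rule: finite_induct)
  case empty
  then show ?case by (simp add: a_minus_def r_neg)
next
  case (insert a S)
  then have "f a \<in> carrier G" "g a \<in> carrier G" "f \<in> S \<rightarrow> carrier G" "g \<in> S \<rightarrow> carrier G"
    "(\<lambda>z. f z \<ominus> g z) \<in> S \<rightarrow> carrier G"
    by (auto simp: Pi_def)
  moreover from this have "finsum G f S \<in> carrier G" "finsum G g S \<in> carrier G" by auto
  ultimately show ?case using insert
    by (simp add: a_minus_def minus_add a_ac)
qed

lemma frag_sum_superset:
  assumes "Poly_Mapping.keys c \<subseteq> S" "finite S" "f \<in> S \<rightarrow> carrier G"
  shows "frag_sum G f c = (\<Oplus>z\<in>S. [Poly_Mapping.lookup c z] \<cdot> f z)"
  unfolding frag_sum_def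
  by (rule add.finprod_mono_neutral_cong_left)
    (use assms in \<open>auto simp: in_keys_iff int_add_pow_0 intro!: int_add_pow_closed\<close>)

lemma frag_sum_closed:
  assumes "f \<in> Poly_Mapping.keys c \<rightarrow> carrier G"
  shows "frag_sum G f c \<in> carrier G"
  unfolding frag_sum_def using assms by (auto intro!: finsum_closed int_add_pow_closed)

lemma frag_sum_diff:
  assumes "f \<in> Poly_Mapping.keys c \<rightarrow> carrier G" "f \<in> Poly_Mapping.keys d \<rightarrow> carrier G"
  shows "frag_sum G f (c - d) = frag_sum G f c \<ominus> frag_sum G f d"
proof -
  let ?S = "Poly_Mapping.keys c \<union> Poly_Mapping.keys d"
  have f: "f \<in> ?S \<rightarrow> carrier G" using assms by auto
  have "frag_sum G f (c - d) = (\<Oplus>z\<in>?S. [Poly_Mapping.lookup (c - d) z] \<cdot> f z)"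
    by (rule frag_sum_superset) (use f keys_diff[of c d] in auto)
  also have "\<dots> = (\<Oplus>z\<in>?S. [Poly_Mapping.lookup c z] \<cdot> f z \<ominus> [Poly_Mapping.lookup d z] \<cdot> f z)"
    by (rule finsum_cong')
      (use f in \<open>auto simp: lookup_minus int_add_pow_diff Pi_iff intro!: int_add_pow_closed\<close>)
  also have "\<dots> = frag_sum G f c \<ominus> frag_sum G f d"
    by (subst finsum_minus) (use f in \<open>auto simp: frag_sum_superset[of c ?S] frag_sum_superset[of d ?S] intro!: int_add_pow_closed\<close>)
  finally show ?thesis .
qed

lemma frag_sum_zero: "frag_sum G f 0 = \<zero>"
  by (simp add: frag_sum_def)

lemma frag_sum_frag_of: "f z \<in> carrier G \<Longrightarrow> frag_sum G f (frag_of z) = f z"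
  by (simp add: frag_sum_def keys_frag_of)

lemma frag_sum_minus:
  assumes "f \<in> Poly_Mapping.keys d \<rightarrow> carrier G"
  shows "frag_sum G f (- d) = \<ominus> frag_sum G f d"
  using frag_sum_diff[of f 0 d] frag_sum_closed[OF assms] assms
  by (simp add: frag_sum_zero a_minus_def)

lemma frag_sum_add:
  assumes "f \<in> Poly_Mapping.keys c \<rightarrow> carrier G" "f \<in> Poly_Mapping.keys d \<rightarrow> carrier G"
  shows "frag_sum G f (c + d) = frag_sum G f c \<oplus> frag_sum G f d"
  using frag_sum_diff[of f c "- d"] frag_sum_minus[of f d] assms frag_sum_closed[of f d]
  by (simp add: a_minus_def)

end

section \<open>Evaluation of integral polynomials\<close>

definition monom_eval :: "('a, 'm) ring_scheme \<Rightarrow> ('v \<Rightarrow> 'a) \<Rightarrow> ('v \<Rightarrow>\<^sub>0 nat) \<Rightarrow> 'a" where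
  "monom_eval R x m = (\<Otimes>\<^bsub>R\<^esub>v\<in>Poly_Mapping.keys m. x v [^]\<^bsub>R\<^esub> Poly_Mapping.lookup m v)"

lemma mpoly_eval_frag_sum: "mpoly_eval R x P = frag_sum R (monom_eval R x) P"
  by (simp add: mpoly_eval_def frag_sum_def monom_eval_def)

context cring
begin

lemma monom_eval_closed:
  assumes "\<And>v. x v \<in> carrier R"
  shows "monom_eval R x m \<in> carrier R"
  unfolding monom_eval_def using assms by (auto intro!: finprod_closed)

lemma monom_eval_superset:
  assumes "\<And>v. x v \<in> carrier R" "Poly_Mapping.keys m \<subseteq> S" "finite S"
  shows "monom_eval R x m = (\<Otimes>v\<in>S. x v [^] Poly_Mapping.lookup m v)"
  unfolding monom_eval_def
  by (rule finprod_mono_neutral_cong_left) (use assms in \<open>auto simp: in_keys_iff\<close>)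

lemma monom_eval_add:
  assumes "\<And>v. x v \<in> carrier R"
  shows "monom_eval R x (m + k) = monom_eval R x m \<otimes> monom_eval R x k"
proof -
  let ?S = "Poly_Mapping.keys m \<union> Poly_Mapping.keys k"
  have "monom_eval R x (m + k) = (\<Otimes>v\<in>?S. x v [^] Poly_Mapping.lookup (m + k) v)"
    by (rule monom_eval_superset) (use assms keys_add[of m k] in auto)
  also have "\<dots> = (\<Otimes>v\<in>?S. x v [^] Poly_Mapping.lookup m v \<otimes> x v [^] Poly_Mapping.lookup k v)"
    by (rule finprod_cong') (use assms in \<open>auto simp: lookup_add nat_pow_mult\<close>)
  also have "\<dots> = monom_eval R x m \<otimes> monom_eval R x k"
    by (subst finprod_multf) (use assms in \<open>auto simp: monom_eval_superset[of x m ?S] monom_eval_superset[of x k ?S]\<close>)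
  finally show ?thesis .
qed

lemma monom_eval_zero: "monom_eval R x 0 = \<one>"
  by (simp add: monom_eval_def)

lemma monom_eval_single:
  "x v \<in> carrier R \<Longrightarrow> monom_eval R x (Poly_Mapping.single v 1) = x v"
  by (simp add: monom_eval_def)

context
  fixes x :: "'v \<Rightarrow> 'a"
  assumes x: "\<And>v. x v \<in> carrier R"
begin

lemma mpoly_eval_closed: "mpoly_eval R x P \<in> carrier R"
  unfolding mpoly_eval_frag_sum by (rule frag_sum_closed) (auto intro!: monom_eval_closed x)

lemma mpoly_eval_diff: "mpoly_eval R x (P - Q) = mpoly_eval R x P \<ominus> mpoly_eval R x Q"
  unfolding mpoly_eval_frag_sum by (rule frag_sum_diff) (auto intro!: monom_eval_closed x)

lemma mpoly_eval_add: "mpoly_eval R x (P + Q) = mpoly_eval R x P \<oplus> mpoly_eval R x Q"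
  unfolding mpoly_eval_frag_sum by (rule frag_sum_add) (auto intro!: monom_eval_closed x)

lemma mpoly_eval_uminus: "mpoly_eval R x (- P) = \<ominus> mpoly_eval R x P"
  unfolding mpoly_eval_frag_sum by (rule frag_sum_minus) (auto intro!: monom_eval_closed x)

lemma mpoly_eval_zero: "mpoly_eval R x 0 = \<zero>"
  unfolding mpoly_eval_frag_sum by (rule frag_sum_zero)

lemma mpoly_eval_frag_of: "mpoly_eval R x (frag_of m) = monom_eval R x m"
  unfolding mpoly_eval_frag_sum by (rule frag_sum_frag_of) (auto intro!: monom_eval_closed x)

lemma mpoly_eval_one: "mpoly_eval R x 1 = \<one>"
  using mpoly_eval_frag_of[of 0] by (simp add: monom_eval_zero)

lemma mpoly_eval_var: "mpoly_eval R x (mpoly_var v) = x v"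
  using mpoly_eval_frag_of[of "Poly_Mapping.single v 1"] monom_eval_single[of x v, OF x]
  by (simp add: mpoly_var_def)

lemma mpoly_eval_mult: "mpoly_eval R x (P * Q) = mpoly_eval R x P \<otimes> mpoly_eval R x Q"
proof (rule frag_induction[of P UNIV])
  show "mpoly_eval R x (0 * Q) = mpoly_eval R x 0 \<otimes> mpoly_eval R x Q"
    by (simp add: mpoly_eval_zero mpoly_eval_closed)
next
  fix a b assume "mpoly_eval R x (a * Q) = mpoly_eval R x a \<otimes> mpoly_eval R x Q"
    "mpoly_eval R x (b * Q) = mpoly_eval R x b \<otimes> mpoly_eval R x Q"
  then show "mpoly_eval R x ((a - b) * Q) = mpoly_eval R x (a - b) \<otimes> mpoly_eval R x Q"
    by (simp add: left_diff_distrib mpoly_eval_diff mpoly_eval_closed a_minus_def l_distr l_minus)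
next
  fix m
  show "mpoly_eval R x (frag_of m * Q) = mpoly_eval R x (frag_of m) \<otimes> mpoly_eval R x Q"
  proof (rule frag_induction[of Q UNIV])
    show "mpoly_eval R x (frag_of m * 0) = mpoly_eval R x (frag_of m) \<otimes> mpoly_eval R x 0"
      by (simp add: mpoly_eval_zero mpoly_eval_closed)
  next
    fix k
    show "mpoly_eval R x (frag_of m * frag_of k) = mpoly_eval R x (frag_of m) \<otimes> mpoly_eval R x (frag_of k)"
      by (simp add: mult_single mpoly_eval_frag_of monom_eval_add x)
  next
    fix a b assume "mpoly_eval R x (frag_of m * a) = mpoly_eval R x (frag_of m) \<otimes> mpoly_eval R x a"
      "mpoly_eval R x (frag_of m * b) = mpoly_eval R x (frag_of m) \<otimes> mpoly_eval R x b"
    then show "mpoly_eval R x (frag_of m * (a - b)) = mpoly_eval R x (frag_of m) \<otimes> mpoly_eval R x (a - b)"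
      by (simp add: right_diff_distrib mpoly_eval_diff mpoly_eval_closed a_minus_def r_distr r_minus)
  qed auto
qed auto

end
end

lemma (in ring_hom_cring) hom_nat_power: "x \<in> carrier R \<Longrightarrow> h (x [^] (n::nat)) = h x [^]\<^bsub>S\<^esub> n"
  by (induction n) simp_all

text \<open>Ring homomorphisms commute with polynomial evaluation; this is what makes the Witt vectors a
  functor and lets identities pass from polynomial rings to arbitrary rings.\<close>

lemma (in ring_hom_cring) hom_mpoly_eval:
  assumes "\<And>v. x v \<in> carrier R"
  shows "h (mpoly_eval R x P) = mpoly_eval S (\<lambda>v. h (x v)) P"
proof -
  have hx: "\<And>v. h (x v) \<in> carrier S" using assms by simp
  have mon: "h (monom_eval R x m) = monom_eval S (\<lambda>v. h (x v)) m" for m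
  proof -
    have "h (monom_eval R x m) = (\<Otimes>\<^bsub>S\<^esub>v\<in>Poly_Mapping.keys m. h (x v [^] Poly_Mapping.lookup m v))"
      unfolding monom_eval_def
      by (subst hom_finprod) (auto simp: assms o_def)
    also have "\<dots> = monom_eval S (\<lambda>v. h (x v)) m"
      unfolding monom_eval_def
      by (rule S.finprod_cong') (auto simp: assms hom_nat_power)
    finally show ?thesis .
  qed
  show ?thesis
    by (rule frag_induction[of P UNIV])
      (auto simp: R.mpoly_eval_zero R.mpoly_eval_frag_of R.mpoly_eval_diff assms hx S.mpoly_eval_zero
        S.mpoly_eval_frag_of S.mpoly_eval_diff mon R.mpoly_eval_closed a_minus_def)
qed

text \<open>The ring structure of a type, as a record: evaluation in polynomial rings then is a special
  case of evaluation in arbitrary rings.\<close>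

definition univ_ring :: "'r::comm_ring_1 ring" where
  "univ_ring = \<lparr>carrier = UNIV, monoid.mult = (*), one = 1, ring.zero = 0, ring.add = (+)\<rparr>"

lemma univ_ring_simps [simp]:
  "carrier univ_ring = UNIV" "\<one>\<^bsub>univ_ring\<^esub> = 1" "\<zero>\<^bsub>univ_ring\<^esub> = 0"
  "x \<oplus>\<^bsub>univ_ring\<^esub> y = x + y" "x \<otimes>\<^bsub>univ_ring\<^esub> y = x * y"
  by (simp_all add: univ_ring_def)

lemma cring_univ_ring: "cring univ_ring"
  by (intro cringI abelian_groupI comm_monoidI)
    (auto simp: algebra_simps intro: exI[of _ "- x" for x])

lemma univ_ring_minus [simp]: "\<ominus>\<^bsub>univ_ring\<^esub> x = - x"
proof -
  interpret cring univ_ring by (rule cring_univ_ring)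
  show ?thesis by (rule minus_equality) auto
qed

lemma univ_ring_diff [simp]: "x \<ominus>\<^bsub>univ_ring\<^esub> y = x - y"
  by (simp add: a_minus_def)

lemma univ_ring_pow [simp]: "x [^]\<^bsub>univ_ring\<^esub> (n::nat) = x ^ n"
  by (induction n) (simp_all add: nat_pow_def mult.commute)

abbreviation subst :: "('v \<Rightarrow> 'w int_mpoly) \<Rightarrow> 'v int_mpoly \<Rightarrow> 'w int_mpoly" where
  "subst \<equiv> mpoly_eval univ_ring"

lemma subst_simps:
  "subst x (P + Q) = subst x P + subst x Q"
  "subst x (P - Q) = subst x P - subst x Q"
  "subst x (- P) = - subst x P"
  "subst x (P * Q) = subst x P * subst x Q"
  "subst x 0 = 0" "subst x 1 = 1" "subst x (mpoly_var v) = x v"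
  using cring.mpoly_eval_add[OF cring_univ_ring, of x] cring.mpoly_eval_diff[OF cring_univ_ring, of x]
    cring.mpoly_eval_mult[OF cring_univ_ring, of x] cring.mpoly_eval_zero[OF cring_univ_ring, of x]
    cring.mpoly_eval_one[OF cring_univ_ring, of x] cring.mpoly_eval_var[OF cring_univ_ring, of x]
    cring.mpoly_eval_uminus[OF cring_univ_ring, of x]
  by simp_all

lemma subst_pow: "subst x (P ^ n) = subst x P ^ n"
  by (induction n) (simp_all add: subst_simps)

lemma subst_of_nat: "subst x (of_nat n) = of_nat n"
  by (induction n) (simp_all add: subst_simps)

lemma subst_sum: "subst x (sum f A) = (\<Sum>a\<in>A. subst x (f a))"
  by (induction A rule: infinite_finite_induct) (simp_all add: subst_simps)

section \<open>Ghost components and Dwork's lemma\<close>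

lemma of_nat_mult_int_mpoly: "of_nat c * (a :: 'v int_mpoly) = frag_cmul (int c) a"
  by (induction c) (simp_all add: frag_cmul_distrib distrib_right)

lemma of_nat_mult_eq_0_int_mpoly: "of_nat c * (a :: 'v int_mpoly) = 0 \<longleftrightarrow> c = 0 \<or> a = 0"
  by (simp add: of_nat_mult_int_mpoly)

lemma of_nat_dvd_cancel_int_mpoly:
  assumes "of_nat (c * d) dvd of_nat c * (a :: 'v int_mpoly)" "c > 0"
  shows "of_nat d dvd a"
proof -
  obtain k where "of_nat c * a = of_nat (c * d) * k" using assms(1) by (auto elim: dvdE)
  then have "of_nat c * (a - of_nat d * k) = 0" by (simp add: algebra_simps)
  then have "a = of_nat d * k" using assms(2) by (simp add: of_nat_mult_eq_0_int_mpoly)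
  then show ?thesis by simp
qed

text \<open>The endomorphism raising every variable to its \<open>p\<close>-th power. The exponent vector \<open>p m\<close> is written
  as a sum of \<open>p\<close> copies of \<open>m\<close>.\<close>

definition frob_lift :: "nat \<Rightarrow> 'v int_mpoly \<Rightarrow> 'v int_mpoly" where
  "frob_lift p = frag_extend (\<lambda>m. frag_of (\<Sum>i<p. m))"

lemma frob_lift_diff: "frob_lift p (a - b) = frob_lift p a - frob_lift p b"
  by (simp add: frob_lift_def frag_extend_diff)

lemma frob_lift_zero: "frob_lift p 0 = 0"
  by (simp add: frob_lift_def)

lemma frob_lift_add: "frob_lift p (a + b) = frob_lift p a + frob_lift p b"
  by (simp add: frob_lift_def frag_extend_add)

lemma frag_of_sum_copies: "frag_of (\<Sum>i<(n::nat). m) = (frag_of m :: 'v int_mpoly) ^ n"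
proof (induction n)
  case (Suc n)
  have "frag_of (\<Sum>i<Suc n. m) = (frag_of (\<Sum>i<n. m) * frag_of m :: 'v int_mpoly)"
    by (simp add: mult_single)
  then show ?case using Suc by (simp add: mult.commute)
qed simp

lemma frob_lift_frag_of: "frob_lift p (frag_of m) = frag_of m ^ p"
  by (simp only: frob_lift_def frag_extend_of frag_of_sum_copies)

lemma frob_lift_var: "frob_lift p (mpoly_var v) = mpoly_var v ^ p"
  unfolding mpoly_var_def by (rule frob_lift_frag_of)

lemma frob_lift_mult: "frob_lift p (a * b) = frob_lift p a * frob_lift p b"
proof (rule frag_induction[of a UNIV])
  fix m show "frob_lift p (frag_of m * b) = frob_lift p (frag_of m) * frob_lift p b"
  proof (rule frag_induction[of b UNIV])
    fix k
    have "frob_lift p (frag_of m * frag_of k) = frob_lift p (frag_of (m + k))"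
      by (simp add: mult_single)
    also have "\<dots> = (frag_of m * frag_of k) ^ p"
      by (simp only: frob_lift_frag_of) (simp add: mult_single)
    finally show "frob_lift p (frag_of m * frag_of k) = frob_lift p (frag_of m) * frob_lift p (frag_of k)"
      by (simp only: frob_lift_frag_of power_mult_distrib)
  qed (simp_all add: frob_lift_zero frob_lift_diff algebra_simps)
qed (simp_all add: frob_lift_zero frob_lift_diff algebra_simps)

lemma frob_lift_one: "frob_lift p 1 = 1"
  using frob_lift_frag_of[of p 0] by simp

lemma frob_lift_of_nat: "frob_lift p (of_nat n) = of_nat n"
  by (induction n) (simp_all add: frob_lift_zero frob_lift_one frob_lift_add)

lemma frob_lift_power: "frob_lift p (a ^ n) = frob_lift p a ^ n"
  by (induction n) (simp_all add: frob_lift_one frob_lift_mult)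

lemma frob_lift_sum: "frob_lift p (sum f A) = (\<Sum>a\<in>A. frob_lift p (f a))"
  by (induction A rule: infinite_finite_induct) (simp_all add: frob_lift_zero frob_lift_add)

lemma frob_lift_ghost: "frob_lift p (ghost q S n) = ghost q (\<lambda>i. frob_lift p (S i)) n"
  by (simp only: ghost_def frob_lift_sum frob_lift_mult frob_lift_of_nat frob_lift_power)

lemma subst_ghost: "subst x (ghost q S n) = ghost q (\<lambda>i. subst x (S i)) n"
  by (simp only: ghost_def subst_sum subst_simps subst_of_nat subst_pow)

lemma prime_dvd_power_add_diff:
  fixes a b :: "'r::comm_ring_1"
  assumes "Factorial_Ring.prime (p::nat)"
  shows "of_nat p dvd (a + b) ^ p - a ^ p - b ^ p"
proof -
  have p: "p > 0" using assms prime_gt_0_nat by blast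
  have "(a + b) ^ p = (\<Sum>k\<le>p. of_nat (p choose k) * a ^ k * b ^ (p - k))"
    by (rule binomial_ring)
  also have "{..p} = insert 0 (insert p {0<..<p})" using p by auto
  also have "(\<Sum>k\<in>insert 0 (insert p {0<..<p}). of_nat (p choose k) * a ^ k * b ^ (p - k))
     = b ^ p + (a ^ p + (\<Sum>k\<in>{0<..<p}. of_nat (p choose k) * a ^ k * b ^ (p - k)))"
    using p by simp
  finally have "(a + b) ^ p - a ^ p - b ^ p = (\<Sum>k\<in>{0<..<p}. of_nat (p choose k) * a ^ k * b ^ (p - k))"
    by simp
  moreover have "of_nat p dvd (of_nat (p choose k) :: 'r)" if "k \<in> {0<..<p}" for k
  proof -
    have "p dvd (p choose k)" using that assms by (intro dvd_choose_prime) auto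
    then show ?thesis by (metis dvdE of_nat_mult dvd_triv_left)
  qed
  ultimately show ?thesis by (auto intro!: dvd_sum dvd_mult2)
qed

text \<open>Write \<open>x\<^sup>p - y\<^sup>p\<close> as \<open>x - y\<close> times a sum of \<open>p\<close> terms that are all congruent modulo \<open>p\<close>.\<close>

lemma dvd_power_prime_diff:
  fixes x y :: "'r::comm_ring_1"
  assumes "of_nat (p ^ Suc k) dvd x - y"
  shows "of_nat (p ^ Suc (Suc k)) dvd x ^ p - y ^ p"
proof -
  have px: "of_nat p dvd x - y"
    using assms by (metis dvd_trans dvd_triv_left of_nat_mult power_Suc)
  have "(\<Sum>i<p. y ^ (p - Suc i) * x ^ i) - (\<Sum>i<p. y ^ (p - Suc i) * y ^ i)
      = (\<Sum>i<p. y ^ (p - Suc i) * (x ^ i - y ^ i))"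
    by (simp add: sum_subtractf right_diff_distrib)
  moreover have "of_nat p dvd (\<Sum>i<p. y ^ (p - Suc i) * (x ^ i - y ^ i))"
  proof (intro dvd_sum dvd_mult)
    fix i show "of_nat p dvd x ^ i - y ^ i"
      by (subst power_diff_sumr2) (rule dvd_mult2[OF px])
  qed
  moreover have "(\<Sum>i<p. y ^ (p - Suc i) * y ^ i) = of_nat p * y ^ (p - 1)"
  proof -
    have "(\<Sum>i<p. y ^ (p - Suc i) * y ^ i) = (\<Sum>i<p. y ^ (p - 1))"
      by (intro sum.cong) (auto simp: power_add[symmetric])
    then show ?thesis by simp
  qed
  ultimately have "of_nat p dvd (\<Sum>i<p. y ^ (p - Suc i) * x ^ i) - of_nat p * y ^ (p - 1)" by simp
  from dvd_add[OF this dvd_triv_left[of _ "y ^ (p - 1)"]]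
  have "of_nat p dvd (\<Sum>i<p. y ^ (p - Suc i) * x ^ i)" by simp
  then have "of_nat (p ^ Suc k) * of_nat p dvd (x - y) * (\<Sum>i<p. y ^ (p - Suc i) * x ^ i)"
    by (rule mult_dvd_mono[OF assms])
  then show ?thesis by (simp add: power_diff_sumr2 mult.commute mult.left_commute)
qed

lemma dvd_power_prime_power_diff:
  fixes x y :: "'r::comm_ring_1"
  assumes "of_nat (p ^ Suc k) dvd x - y"
  shows "of_nat (p ^ Suc (k + j)) dvd x ^ (p ^ j) - y ^ (p ^ j)"
proof (induction j)
  case (Suc j)
  from dvd_power_prime_diff[OF this] show ?case
    by (simp add: power_mult[symmetric] mult.commute)
qed (use assms in simp)

lemma ghost_0: "ghost p x 0 = x 0"
  by (simp add: ghost_def)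

lemma ghost_Suc:
  "ghost p x (Suc n) = ghost p (\<lambda>i. x i ^ p) n + of_nat (p ^ Suc n) * x (Suc n)"
proof -
  have "(x i ^ p) ^ (p ^ (n - i)) = x i ^ (p ^ (Suc n - i))" if "i \<le> n" for i
    using that by (simp add: Suc_diff_le power_mult[symmetric])
  then show ?thesis by (simp add: ghost_def)
qed

text \<open>The factor \<open>p\<^sup>i\<close> and the exponent \<open>p\<^bsup>n-i\<^esup>\<close> of the \<open>i\<close>-th summand together gain \<open>n\<close> powers of \<open>p\<close>.\<close>

lemma ghost_cong_dvd:
  fixes x y :: "nat \<Rightarrow> 'r::comm_ring_1"
  assumes "\<And>i. i \<le> n \<Longrightarrow> of_nat (p ^ Suc k) dvd x i - y i"
  shows "of_nat (p ^ Suc (k + n)) dvd ghost p x n - ghost p y n"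
proof -
  have "ghost p x n - ghost p y n = (\<Sum>i\<le>n. of_nat (p ^ i) * (x i ^ (p ^ (n - i)) - y i ^ (p ^ (n - i))))"
    by (simp add: ghost_def sum_subtractf right_diff_distrib)
  also have "of_nat (p ^ Suc (k + n)) dvd \<dots>"
  proof (rule dvd_sum)
    fix i assume "i \<in> {..n}"
    then have i: "i \<le> n" by simp
    have "(of_nat (p ^ Suc (k + n)) :: 'r) = of_nat (p ^ i) * of_nat (p ^ Suc (k + (n - i)))"
    proof -
      have "p ^ Suc (k + n) = p ^ i * p ^ Suc (k + (n - i))"
        using i by (simp add: power_add[symmetric])
      then show ?thesis by (simp only: of_nat_mult)
    qed
    also have "\<dots> dvd of_nat (p ^ i) * (x i ^ (p ^ (n - i)) - y i ^ (p ^ (n - i)))"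
      by (intro mult_dvd_mono dvd_refl dvd_power_prime_power_diff assms i)
    finally show "of_nat (p ^ Suc (k + n)) dvd of_nat (p ^ i) * (x i ^ (p ^ (n - i)) - y i ^ (p ^ (n - i)))" .
  qed
  finally show ?thesis .
qed

lemma ghost_inj:
  fixes x y :: "nat \<Rightarrow> 'v int_mpoly"
  assumes "p > 0" "ghost p x = ghost p y"
  shows "x = y"
proof
  fix n show "x n = y n"
  proof (induction n rule: less_induct)
    case (less n)
    have "ghost p x n = ghost p y n" using assms by simp
    moreover have "ghost p z n = (\<Sum>i<n. of_nat (p ^ i) * z i ^ (p ^ (n - i))) + of_nat (p ^ n) * z n"
      for z :: "nat \<Rightarrow> 'v int_mpoly"
      by (simp add: ghost_def lessThan_Suc_atMost[symmetric])
    moreover have "(\<Sum>i<n. of_nat (p ^ i) * x i ^ (p ^ (n - i))) = (\<Sum>i<n. of_nat (p ^ i) * y i ^ (p ^ (n - i)))"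
      using less by (intro sum.cong) auto
    ultimately have "of_nat (p ^ n) * (x n - y n) = 0" by (simp add: algebra_simps)
    then show ?case using assms(1) unfolding of_nat_mult_eq_0_int_mpoly by simp
  qed
qed

text \<open>A converse of \<open>ghost_cong_dvd\<close> for \<open>k = 0\<close>, by cancelling \<open>p\<^sup>n\<close> in the last summand of the ghost
  component.\<close>

lemma dvd_if_ghost_dvd:
  fixes x y :: "nat \<Rightarrow> 'v int_mpoly"
  assumes "p > 0" "\<And>n. of_nat (p ^ Suc n) dvd ghost p x n - ghost p y n"
  shows "of_nat p dvd x n - y n"
proof (induction n rule: less_induct)
  case (less n)
  show ?case
  proof (cases n)
    case 0
    then show ?thesis using assms(2)[of 0] by (simp add: ghost_0)
  next
    case (Suc m)
    have 1: "of_nat (p ^ Suc (Suc 0)) dvd x i ^ p - y i ^ p" if "i \<le> m" for i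
      by (rule dvd_power_prime_diff) (use less[of i] that Suc in simp)
    have "of_nat (p ^ Suc (Suc m)) dvd ghost p (\<lambda>i. x i ^ p) m - ghost p (\<lambda>i. y i ^ p) m"
      using ghost_cong_dvd[of m p "Suc 0" "\<lambda>i. x i ^ p" "\<lambda>i. y i ^ p", OF 1] by simp
    with assms(2)[of n] have
      "of_nat (p ^ Suc (Suc m)) dvd (ghost p x n - ghost p y n) - (ghost p (\<lambda>i. x i ^ p) m - ghost p (\<lambda>i. y i ^ p) m)"
      unfolding Suc by (rule dvd_diff)
    also have "\<dots> = of_nat (p ^ n) * (x n - y n)"
      by (simp add: Suc ghost_Suc algebra_simps)
    finally have "of_nat (p ^ n * p) dvd of_nat (p ^ n) * (x n - y n)"
      by (simp add: Suc mult.commute mult.left_commute)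
    then show ?thesis by (rule of_nat_dvd_cancel_int_mpoly) (use assms(1) in simp)
  qed
qed

text \<open>Dwork's condition on a sequence of polynomials. It is closed under sums, products and shifts, which
  gives all Witt polynomials at once.\<close>

definition dwork :: "nat \<Rightarrow> (nat \<Rightarrow> 'v int_mpoly) \<Rightarrow> bool" where
  "dwork p \<Phi> \<longleftrightarrow> (\<forall>n. of_nat (p ^ Suc n) dvd \<Phi> (Suc n) - frob_lift p (\<Phi> n))"

lemma dwork_ghost_vars: "dwork p (ghost p (\<lambda>i. mpoly_var (f i)))"
  by (simp add: dwork_def ghost_Suc frob_lift_ghost frob_lift_var)

lemma dwork_add:
  assumes "dwork p \<Phi>" "dwork p \<Psi>"
  shows "dwork p (\<lambda>n. \<Phi> n + \<Psi> n)"
  unfolding dwork_def frob_lift_add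
proof
  fix n
  have "of_nat (p ^ Suc n) dvd
      (\<Phi> (Suc n) - frob_lift p (\<Phi> n)) + (\<Psi> (Suc n) - frob_lift p (\<Psi> n))"
    using assms unfolding dwork_def by (intro dvd_add) blast+
  then show "of_nat (p ^ Suc n) dvd
      \<Phi> (Suc n) + \<Psi> (Suc n) - (frob_lift p (\<Phi> n) + frob_lift p (\<Psi> n))"
    by (simp only: add_diff_eq diff_add_eq diff_diff_eq2 diff_diff_add add.commute add.left_commute)
qed

lemma dwork_mult:
  assumes "dwork p \<Phi>" "dwork p \<Psi>"
  shows "dwork p (\<lambda>n. \<Phi> n * \<Psi> n)"
  unfolding dwork_def frob_lift_mult
proof
  fix n
  have "\<Phi> (Suc n) * \<Psi> (Suc n) - frob_lift p (\<Phi> n) * frob_lift p (\<Psi> n)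
      = (\<Phi> (Suc n) - frob_lift p (\<Phi> n)) * \<Psi> (Suc n) + frob_lift p (\<Phi> n) * (\<Psi> (Suc n) - frob_lift p (\<Psi> n))"
    by (simp add: algebra_simps)
  also have "of_nat (p ^ Suc n) dvd \<dots>"
    using assms unfolding dwork_def by (intro dvd_add dvd_mult dvd_mult2) blast+
  finally show "of_nat (p ^ Suc n) dvd
      \<Phi> (Suc n) * \<Psi> (Suc n) - frob_lift p (\<Phi> n) * frob_lift p (\<Psi> n)" .
qed

lemma dwork_uminus:
  assumes "dwork p \<Phi>"
  shows "dwork p (\<lambda>n. - \<Phi> n)"
  unfolding dwork_def
proof
  fix n
  have "- \<Phi> (Suc n) - frob_lift p (- \<Phi> n) = - (\<Phi> (Suc n) - frob_lift p (\<Phi> n))"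
    using frob_lift_diff[of p 0 "\<Phi> n"] by (simp add: frob_lift_zero)
  then show "of_nat (p ^ Suc n) dvd - \<Phi> (Suc n) - frob_lift p (- \<Phi> n)"
    using assms unfolding dwork_def by (simp only: dvd_minus_iff)
qed

lemma dwork_shift:
  assumes "dwork p \<Phi>" shows "dwork p (\<lambda>n. \<Phi> (Suc n))"
  unfolding dwork_def
proof
  fix n
  have "(of_nat (p ^ Suc n) :: 'a int_mpoly) dvd of_nat (p ^ Suc (Suc n))"
    by simp
  then show "of_nat (p ^ Suc n) dvd \<Phi> (Suc (Suc n)) - frob_lift p (\<Phi> (Suc n))"
    using assms dvd_trans unfolding dwork_def by blast
qed

context
  fixes p :: nat
  assumes p: "Factorial_Ring.prime p"
begin

text \<open>The endomorphism \<open>frob_lift p\<close> lifts the Frobenius modulo \<open>p\<close>.\<close>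

lemma frob_lift_cong: "of_nat p dvd a ^ p - frob_lift p (a :: 'v int_mpoly)"
proof (rule frag_induction[of a UNIV])
  show "of_nat p dvd 0 ^ p - frob_lift p (0 :: 'v int_mpoly)"
    using prime_gt_0_nat[OF p] by (simp add: frob_lift_zero zero_power)
next
  fix a b :: "'v int_mpoly"
  assume ab: "of_nat p dvd a ^ p - frob_lift p a" "of_nat p dvd b ^ p - frob_lift p b"
  have "of_nat p dvd ((a - b) + b) ^ p - (a - b) ^ p - b ^ p"
    by (rule prime_dvd_power_add_diff[OF p])
  then have "of_nat p dvd a ^ p - (a - b) ^ p - b ^ p" by simp
  from dvd_diff[OF dvd_diff[OF ab] this] show "of_nat p dvd (a - b) ^ p - frob_lift p (a - b)"
    by (simp add: frob_lift_diff algebra_simps)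
qed (simp_all only: frob_lift_frag_of, simp_all)

text \<open>Dwork's lemma. The components are found one at a time: once \<open>S\<close> is known up to \<open>n\<close>, the condition
  and \<open>frob_lift_cong\<close> show that the missing term of the next ghost component is divisible by \<open>p\<^bsup>n+1\<^esup>\<close>.\<close>

lemma dwork_imp_ghost:
  fixes \<Phi> :: "nat \<Rightarrow> 'v int_mpoly"
  assumes "dwork p \<Phi>"
  shows "\<exists>S. ghost p S = \<Phi>"
proof -
  let ?P = "\<lambda>n S. \<forall>k\<le>n. ghost p S k = \<Phi> k"
  have cong: "ghost p S n = ghost p T n" if "\<And>k. k \<le> n \<Longrightarrow> S k = T k" for S T :: "nat \<Rightarrow> 'v int_mpoly" and n
    using that by (simp add: ghost_def)
  have ex: "\<exists>f. \<forall>n. ?P n (f n) \<and> (\<forall>k\<le>n. f (Suc n) k = f n k)"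
  proof (rule dependent_nat_choice[of ?P "\<lambda>n S T. \<forall>k\<le>n. T k = S k"])
    show "\<exists>S. ?P 0 S" by (auto simp: ghost_0)
  next
    fix S n assume S: "?P n S"
    have "of_nat (p ^ Suc (0 + n)) dvd ghost p (\<lambda>i. S i ^ p) n - ghost p (\<lambda>i. frob_lift p (S i)) n"
      by (rule ghost_cong_dvd) (use frob_lift_cong in simp)
    also have "ghost p (\<lambda>i. frob_lift p (S i)) n = frob_lift p (\<Phi> n)"
      using S by (simp add: frob_lift_ghost[symmetric])
    finally have "of_nat (p ^ Suc n) dvd
        (\<Phi> (Suc n) - frob_lift p (\<Phi> n)) - (ghost p (\<lambda>i. S i ^ p) n - frob_lift p (\<Phi> n))"
      using assms unfolding dwork_def by (metis add_0 dvd_diff)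
    then have "of_nat (p ^ Suc n) dvd \<Phi> (Suc n) - ghost p (\<lambda>i. S i ^ p) n"
      by (simp del: of_nat_power power_Suc)
    then obtain s where s: "\<Phi> (Suc n) - ghost p (\<lambda>i. S i ^ p) n = of_nat (p ^ Suc n) * s"
      by (rule dvdE)
    define T where "T = S(Suc n := s)"
    have TS: "T k = S k" if "k \<le> n" for k using that by (simp add: T_def)
    have "ghost p T (Suc n) = \<Phi> (Suc n)"
      unfolding ghost_Suc using s cong[of n "\<lambda>i. T i ^ p" "\<lambda>i. S i ^ p"] TS
      by (simp add: T_def algebra_simps)
    moreover have "ghost p T k = \<Phi> k" if "k \<le> n" for k
      using that S cong[of k T S] TS by simp
    ultimately have "?P (Suc n) T" by (auto simp: le_Suc_eq)
    then show "\<exists>T. ?P (Suc n) T \<and> (\<forall>k\<le>n. T k = S k)" using TS by blast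
  qed
  then obtain f where f: "\<And>n. ?P n (f n)" "\<And>n k. k \<le> n \<Longrightarrow> f (Suc n) k = f n k" by blast
  have stable: "f (k + j) k = f k k" for k j
    by (induction j) (simp_all add: f(2))
  have "ghost p (\<lambda>k. f k k) n = \<Phi> n" for n
  proof -
    have "ghost p (\<lambda>k. f k k) n = ghost p (f n) n"
      by (rule cong) (metis stable le_Suc_ex)
    then show ?thesis using f(1)[of n] by simp
  qed
  then show ?thesis by blast
qed

lemma ghost_witt_poly:
  assumes "dwork p \<Phi>"
  shows "ghost p (witt_poly p \<Phi>) = \<Phi>"
proof -
  obtain S where S: "ghost p S = \<Phi>" using dwork_imp_ghost[OF assms] by blast
  have "\<forall>n. ghost p (witt_poly p \<Phi>) n = \<Phi> n"
    unfolding witt_poly_def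
  proof (rule theI[of "\<lambda>S. \<forall>n. ghost p S n = \<Phi> n" S])
    show "\<forall>n. ghost p S n = \<Phi> n" using S by simp
    fix T assume "\<forall>n. ghost p T n = \<Phi> n"
    then have "ghost p T = ghost p S" using S by auto
    then show "T = S" using ghost_inj prime_gt_0_nat[OF p] by blast
  qed
  then show ?thesis by auto
qed

lemma ghost_witt_add_poly:
  "ghost p (witt_add_poly p) n = ghost p (\<lambda>i. mpoly_var (Inl i)) n + ghost p (\<lambda>i. mpoly_var (Inr i)) n"
  unfolding witt_add_poly_def by (subst ghost_witt_poly) (auto intro: dwork_add dwork_ghost_vars)

lemma ghost_witt_mult_poly:
  "ghost p (witt_mult_poly p) n = ghost p (\<lambda>i. mpoly_var (Inl i)) n * ghost p (\<lambda>i. mpoly_var (Inr i)) n"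
  unfolding witt_mult_poly_def by (subst ghost_witt_poly) (auto intro: dwork_mult dwork_ghost_vars)

lemma ghost_witt_frob_poly: "ghost p (witt_frob_poly p) n = ghost p mpoly_var (Suc n)"
  unfolding witt_frob_poly_def
  by (subst ghost_witt_poly) (auto intro: dwork_shift dwork_ghost_vars[where f = "\<lambda>i. i", simplified])

end

section \<open>The ring of Witt vectors\<close>

abbreviation (input) witt_map :: "('a \<Rightarrow> 'b) \<Rightarrow> (nat \<Rightarrow> 'a) \<Rightarrow> (nat \<Rightarrow> 'b)" where
  "witt_map h x \<equiv> (\<lambda>n. h (x n))"

text \<open>Independent families of variables, one Witt vector for each \<open>k\<close>. Every Witt vector is the image of a
  generic one under a ring homomorphism.\<close>

definition generic_witt :: "nat \<Rightarrow> nat \<Rightarrow> (nat \<times> nat) int_mpoly" where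
  "generic_witt k n = mpoly_var (k, n)"

lemma carrier_witt: "x \<in> carrier (witt p R) \<longleftrightarrow> (\<forall>n. x n \<in> carrier R)"
  by (simp add: witt_def)

lemma carrier_witt_univ [simp]: "carrier (witt p univ_ring) = UNIV"
  by (simp add: witt_def)

lemma zero_witt: "\<zero>\<^bsub>witt p R\<^esub> = (\<lambda>n. \<zero>\<^bsub>R\<^esub>)"
  by (simp add: witt_def)

lemma one_witt: "\<one>\<^bsub>witt p R\<^esub> = (\<lambda>n. if n = 0 then \<one>\<^bsub>R\<^esub> else \<zero>\<^bsub>R\<^esub>)"
  by (simp add: witt_def)

lemma add_witt: "x \<oplus>\<^bsub>witt p R\<^esub> y = (\<lambda>n. mpoly_eval R (case_sum x y) (witt_add_poly p n))"
  by (simp add: witt_def)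

lemma mult_witt: "x \<otimes>\<^bsub>witt p R\<^esub> y = (\<lambda>n. mpoly_eval R (case_sum x y) (witt_mult_poly p n))"
  by (simp add: witt_def)

context cring
begin

lemma witt_add_closed:
  "x \<in> carrier (witt p R) \<Longrightarrow> y \<in> carrier (witt p R) \<Longrightarrow> x \<oplus>\<^bsub>witt p R\<^esub> y \<in> carrier (witt p R)"
  by (auto simp: carrier_witt add_witt intro!: mpoly_eval_closed split: sum.split)

lemma witt_mult_closed:
  "x \<in> carrier (witt p R) \<Longrightarrow> y \<in> carrier (witt p R) \<Longrightarrow> x \<otimes>\<^bsub>witt p R\<^esub> y \<in> carrier (witt p R)"
  by (auto simp: carrier_witt mult_witt intro!: mpoly_eval_closed split: sum.split)

lemma witt_F_closed: "x \<in> carrier (witt p R) \<Longrightarrow> witt_F p R x \<in> carrier (witt p R)"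
  by (auto simp: carrier_witt witt_F_def intro!: mpoly_eval_closed)

lemma witt_V_closed: "x \<in> carrier (witt p R) \<Longrightarrow> witt_V R x \<in> carrier (witt p R)"
  by (auto simp: carrier_witt witt_V_def split: nat.split)

lemma generic_witt_specialize:
  assumes "\<And>k. x k \<in> carrier (witt p R)"
  obtains h where "ring_hom_cring univ_ring R h" "\<And>k. witt_map h (generic_witt k) = x k"
proof -
  let ?x = "\<lambda>(k, n). x k n"
  have x: "\<And>v. ?x v \<in> carrier R" using assms by (auto simp: carrier_witt)
  have "ring_hom_cring univ_ring R (mpoly_eval R ?x)"
    by (intro ring_hom_cringI ring_hom_ringI2 ring_hom_memI cring_univ_ring cring_axioms
        cring.axioms(1)[OF cring_univ_ring] ring_axioms)
      (simp_all add: mpoly_eval_closed mpoly_eval_add mpoly_eval_mult mpoly_eval_one x)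
  moreover have "witt_map (mpoly_eval R ?x) (generic_witt k) = x k" for k
    by (simp add: generic_witt_def mpoly_eval_var x)
  ultimately show ?thesis by (rule that)
qed

lemma generic_witt_specialize3:
  assumes "x \<in> carrier (witt p R)" "y \<in> carrier (witt p R)" "z \<in> carrier (witt p R)"
  shows "\<exists>h. ring_hom_cring univ_ring R h \<and> witt_map h (generic_witt 0) = x \<and>
    witt_map h (generic_witt 1) = y \<and> witt_map h (generic_witt 2) = z"
proof -
  let ?x = "\<lambda>k::nat. if k = 0 then x else if k = 1 then y else z"
  obtain h where "ring_hom_cring univ_ring R h" "\<And>k. witt_map h (generic_witt k) = ?x k"
    using generic_witt_specialize[of ?x p] assms by (metis (full_types))
  from this(1) this(2)[of 0] this(2)[of 1] this(2)[of 2] show ?thesis by auto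
qed

end

context ring_hom_cring
begin

lemma witt_map_closed: "x \<in> carrier (witt p R) \<Longrightarrow> witt_map h x \<in> carrier (witt p S)"
  by (simp add: carrier_witt)

lemma witt_map_add:
  assumes "x \<in> carrier (witt p R)" "y \<in> carrier (witt p R)"
  shows "witt_map h (x \<oplus>\<^bsub>witt p R\<^esub> y) = witt_map h x \<oplus>\<^bsub>witt p S\<^esub> witt_map h y"
proof
  fix n
  have "\<And>v. case_sum x y v \<in> carrier R" using assms by (auto simp: carrier_witt split: sum.split)
  moreover have "(\<lambda>v. h (case_sum x y v)) = case_sum (witt_map h x) (witt_map h y)"
    by (auto split: sum.split)
  ultimately show "h ((x \<oplus>\<^bsub>witt p R\<^esub> y) n) = (witt_map h x \<oplus>\<^bsub>witt p S\<^esub> witt_map h y) n"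
    by (simp add: add_witt hom_mpoly_eval)
qed

lemma witt_map_mult:
  assumes "x \<in> carrier (witt p R)" "y \<in> carrier (witt p R)"
  shows "witt_map h (x \<otimes>\<^bsub>witt p R\<^esub> y) = witt_map h x \<otimes>\<^bsub>witt p S\<^esub> witt_map h y"
proof
  fix n
  have "\<And>v. case_sum x y v \<in> carrier R" using assms by (auto simp: carrier_witt split: sum.split)
  moreover have "(\<lambda>v. h (case_sum x y v)) = case_sum (witt_map h x) (witt_map h y)"
    by (auto split: sum.split)
  ultimately show "h ((x \<otimes>\<^bsub>witt p R\<^esub> y) n) = (witt_map h x \<otimes>\<^bsub>witt p S\<^esub> witt_map h y) n"
    by (simp add: mult_witt hom_mpoly_eval)
qed

lemma witt_map_zero: "witt_map h \<zero>\<^bsub>witt p R\<^esub> = \<zero>\<^bsub>witt p S\<^esub>"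
  by (simp add: zero_witt)

lemma witt_map_one: "witt_map h \<one>\<^bsub>witt p R\<^esub> = \<one>\<^bsub>witt p S\<^esub>"
  by (auto simp: one_witt)

lemma witt_map_F:
  assumes "x \<in> carrier (witt p R)"
  shows "witt_map h (witt_F p R x) = witt_F p S (witt_map h x)"
  using assms by (simp add: witt_F_def carrier_witt hom_mpoly_eval)

lemma witt_map_V: "witt_map h (witt_V R x) = witt_V S (witt_map h x)"
  by (auto simp: witt_V_def split: nat.split)

end

context
  fixes p :: nat
  assumes p: "Factorial_Ring.prime p"
begin

lemma ghost_add:
  "ghost p (x \<oplus>\<^bsub>witt p univ_ring\<^esub> y) n = ghost p x n + ghost p (y :: nat \<Rightarrow> 'v int_mpoly) n"
proof -
  have "ghost p (x \<oplus>\<^bsub>witt p univ_ring\<^esub> y) n = subst (case_sum x y) (ghost p (witt_add_poly p) n)"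
    by (simp add: add_witt subst_ghost)
  then show ?thesis by (simp add: ghost_witt_add_poly[OF p] subst_simps subst_ghost)
qed

lemma ghost_mult:
  "ghost p (x \<otimes>\<^bsub>witt p univ_ring\<^esub> y) n = ghost p x n * ghost p (y :: nat \<Rightarrow> 'v int_mpoly) n"
proof -
  have "ghost p (x \<otimes>\<^bsub>witt p univ_ring\<^esub> y) n = subst (case_sum x y) (ghost p (witt_mult_poly p) n)"
    by (simp add: mult_witt subst_ghost)
  then show ?thesis by (simp add: ghost_witt_mult_poly[OF p] subst_simps subst_ghost)
qed

lemma ghost_F: "ghost p (witt_F p univ_ring x) n = ghost p (x :: nat \<Rightarrow> 'v int_mpoly) (Suc n)"
proof -
  have "ghost p (witt_F p univ_ring x) n = subst x (ghost p (witt_frob_poly p) n)"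
    by (simp add: witt_F_def subst_ghost)
  then show ?thesis by (simp add: ghost_witt_frob_poly[OF p] subst_simps subst_ghost)
qed

lemma ghost_V_0: "ghost p (witt_V univ_ring (x :: nat \<Rightarrow> 'v int_mpoly)) 0 = 0"
  by (simp add: ghost_0 witt_V_def)

lemma ghost_V_Suc:
  "ghost p (witt_V univ_ring (x :: nat \<Rightarrow> 'v int_mpoly)) (Suc n) = of_nat p * ghost p x n"
proof -
  have "ghost p (witt_V univ_ring x) (Suc n) =
      (\<Sum>i\<le>n. of_nat (p ^ Suc i) * x i ^ (p ^ (n - i)))"
    using prime_gt_0_nat[OF p] unfolding ghost_def
    by (subst sum.atMost_Suc_shift) (simp add: witt_V_def zero_power)
  then show ?thesis by (simp add: ghost_def sum_distrib_left mult.assoc)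
qed

lemma ghost_zero: "ghost p (\<lambda>n. 0 :: 'v int_mpoly) n = 0"
  using prime_gt_0_nat[OF p] by (simp add: ghost_def zero_power)

lemma ghost_one: "ghost p (\<lambda>n. if n = 0 then 1 else 0 :: 'v int_mpoly) n = 1"
proof (cases n)
  case (Suc m)
  have "ghost p (\<lambda>n. if n = 0 then 1 else 0 :: 'v int_mpoly) (Suc m) = 1"
    using prime_gt_0_nat[OF p] unfolding ghost_def
    by (subst sum.atMost_Suc_shift) (simp add: zero_power)
  then show ?thesis using Suc by simp
qed (simp add: ghost_0)

lemma witt_univ_eqI:
  assumes "\<And>n. ghost p x n = ghost p (y :: nat \<Rightarrow> 'v int_mpoly) n"
  shows "x = y"
  using assms ghost_inj prime_gt_0_nat[OF p] by blast

lemma ghost_zero_witt: "ghost p \<zero>\<^bsub>witt p univ_ring\<^esub> n = (0 :: 'v int_mpoly)"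
  by (simp add: zero_witt ghost_zero)

lemma ghost_one_witt: "ghost p \<one>\<^bsub>witt p univ_ring\<^esub> n = (1 :: 'v int_mpoly)"
proof -
  have "\<one>\<^bsub>witt p univ_ring\<^esub> = (\<lambda>n. if n = 0 then 1 else 0 :: 'v int_mpoly)"
    by (simp add: one_witt cong: if_cong)
  then show ?thesis by (simp only: ghost_one)
qed

text \<open>Each ring law holds for generic Witt vectors, because the ghost components determine a Witt vector
  over a polynomial ring and turn the operations into those of polynomials; it is then specialized.
  Negatives exist because Dwork's condition is stable under negation.\<close>

lemma cring_witt:
  assumes "cring R"
  shows "cring (witt p R)"
proof -
  interpret cring R by fact
  let ?W = "witt p R" and ?U = "witt p (univ_ring :: (nat \<times> nat) int_mpoly ring)"
  note closed [simp] = witt_add_closed[of _ p] witt_mult_closed[of _ p]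
  let ?g = generic_witt
  note spec = generic_witt_specialize3
  have zero: "\<zero>\<^bsub>?W\<^esub> \<in> carrier ?W" and one: "\<one>\<^bsub>?W\<^esub> \<in> carrier ?W"
    by (simp_all add: carrier_witt zero_witt one_witt)
  show ?thesis
  proof (intro cringI abelian_groupI comm_monoidI)
    fix x y z assume xyz: "x \<in> carrier ?W" "y \<in> carrier ?W" "z \<in> carrier ?W"
    then obtain h where h: "ring_hom_cring univ_ring R h"
      and *: "witt_map h (?g 0) = x" "witt_map h (?g 1) = y" "witt_map h (?g 2) = z"
      using spec by blast
    interpret h: ring_hom_cring univ_ring R h by fact
    note maps = h.witt_map_add[of _ p, symmetric] h.witt_map_mult[of _ p, symmetric]
    have "(?g 0 \<oplus>\<^bsub>?U\<^esub> ?g 1) \<oplus>\<^bsub>?U\<^esub> ?g 2 = ?g 0 \<oplus>\<^bsub>?U\<^esub> (?g 1 \<oplus>\<^bsub>?U\<^esub> ?g 2)"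
      by (rule witt_univ_eqI) (simp only: ghost_add add.assoc)
    then show "(x \<oplus>\<^bsub>?W\<^esub> y) \<oplus>\<^bsub>?W\<^esub> z = x \<oplus>\<^bsub>?W\<^esub> (y \<oplus>\<^bsub>?W\<^esub> z)"
      unfolding *[symmetric] by (simp add: maps)
    have "(?g 0 \<otimes>\<^bsub>?U\<^esub> ?g 1) \<otimes>\<^bsub>?U\<^esub> ?g 2 = ?g 0 \<otimes>\<^bsub>?U\<^esub> (?g 1 \<otimes>\<^bsub>?U\<^esub> ?g 2)"
      by (rule witt_univ_eqI) (simp only: ghost_mult mult.assoc)
    then show "(x \<otimes>\<^bsub>?W\<^esub> y) \<otimes>\<^bsub>?W\<^esub> z = x \<otimes>\<^bsub>?W\<^esub> (y \<otimes>\<^bsub>?W\<^esub> z)"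
      unfolding *[symmetric] by (simp add: maps)
    have "(?g 0 \<oplus>\<^bsub>?U\<^esub> ?g 1) \<otimes>\<^bsub>?U\<^esub> ?g 2 = ?g 0 \<otimes>\<^bsub>?U\<^esub> ?g 2 \<oplus>\<^bsub>?U\<^esub> ?g 1 \<otimes>\<^bsub>?U\<^esub> ?g 2"
      by (rule witt_univ_eqI) (simp only: ghost_mult ghost_add distrib_right)
    then show "(x \<oplus>\<^bsub>?W\<^esub> y) \<otimes>\<^bsub>?W\<^esub> z = x \<otimes>\<^bsub>?W\<^esub> z \<oplus>\<^bsub>?W\<^esub> y \<otimes>\<^bsub>?W\<^esub> z"
      unfolding *[symmetric] by (simp add: maps)
  next
    fix x y assume xyz: "x \<in> carrier ?W" "y \<in> carrier ?W"
    then obtain h where h: "ring_hom_cring univ_ring R h"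
      and *: "witt_map h (?g 0) = x" "witt_map h (?g 1) = y"
      using spec[of x p y y] by blast
    interpret h: ring_hom_cring univ_ring R h by fact
    note maps = h.witt_map_add[of _ p, symmetric] h.witt_map_mult[of _ p, symmetric]
    have "?g 0 \<oplus>\<^bsub>?U\<^esub> ?g 1 = ?g 1 \<oplus>\<^bsub>?U\<^esub> ?g 0"
      by (rule witt_univ_eqI) (simp only: ghost_add add.commute)
    then show "x \<oplus>\<^bsub>?W\<^esub> y = y \<oplus>\<^bsub>?W\<^esub> x"
      unfolding *[symmetric] by (simp add: maps)
    have "?g 0 \<otimes>\<^bsub>?U\<^esub> ?g 1 = ?g 1 \<otimes>\<^bsub>?U\<^esub> ?g 0"
      by (rule witt_univ_eqI) (simp only: ghost_mult mult.commute)
    then show "x \<otimes>\<^bsub>?W\<^esub> y = y \<otimes>\<^bsub>?W\<^esub> x"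
      unfolding *[symmetric] by (simp add: maps)
  next
    fix x assume x: "x \<in> carrier ?W"
    then obtain h where h: "ring_hom_cring univ_ring R h" and *: "witt_map h (?g 0) = x"
      using spec[of x p x x] by blast
    interpret h: ring_hom_cring univ_ring R h by fact
    note maps = h.witt_map_add[of _ p, symmetric] h.witt_map_mult[of _ p, symmetric]
      h.witt_map_zero[of p, symmetric] h.witt_map_one[of p, symmetric]
    have "\<zero>\<^bsub>?U\<^esub> \<oplus>\<^bsub>?U\<^esub> ?g 0 = ?g 0"
      by (rule witt_univ_eqI) (simp only: ghost_add ghost_zero_witt add_0)
    then show "\<zero>\<^bsub>?W\<^esub> \<oplus>\<^bsub>?W\<^esub> x = x"
      unfolding *[symmetric] maps by (simp add: h.witt_map_add[symmetric])
    have "\<one>\<^bsub>?U\<^esub> \<otimes>\<^bsub>?U\<^esub> ?g 0 = ?g 0"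
      by (rule witt_univ_eqI) (simp only: ghost_mult ghost_one_witt mult_1)
    then show "\<one>\<^bsub>?W\<^esub> \<otimes>\<^bsub>?W\<^esub> x = x"
      unfolding *[symmetric] maps by (simp add: h.witt_map_mult[symmetric])
    obtain N where "ghost p N = (\<lambda>n. - ghost p (?g 0) n)"
      using dwork_imp_ghost[OF p dwork_uminus[OF dwork_ghost_vars]]
      unfolding generic_witt_def by blast
    then have "N \<oplus>\<^bsub>?U\<^esub> ?g 0 = \<zero>\<^bsub>?U\<^esub>"
      by (intro witt_univ_eqI) (simp add: ghost_add ghost_zero_witt)
    then have "witt_map h N \<oplus>\<^bsub>?W\<^esub> x = \<zero>\<^bsub>?W\<^esub>"
      unfolding *[symmetric] maps by (simp add: h.witt_map_add[symmetric])
    moreover have "witt_map h N \<in> carrier ?W" by (rule h.witt_map_closed) simp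
    ultimately show "\<exists>y\<in>carrier ?W. y \<oplus>\<^bsub>?W\<^esub> x = \<zero>\<^bsub>?W\<^esub>" by blast
  qed (simp_all add: zero one)
qed

end

section \<open>Low-order terms of the Witt polynomials\<close>

definition monom_deg :: "('v \<Rightarrow>\<^sub>0 nat) \<Rightarrow> nat" where
  "monom_deg m = (\<Sum>v\<in>Poly_Mapping.keys m. Poly_Mapping.lookup m v)"

definition order_ge :: "nat \<Rightarrow> 'v int_mpoly \<Rightarrow> bool" where
  "order_ge k P \<longleftrightarrow> (\<forall>m\<in>Poly_Mapping.keys P. k \<le> monom_deg m)"

lemma monom_deg_superset:
  "Poly_Mapping.keys m \<subseteq> S \<Longrightarrow> finite S \<Longrightarrow> monom_deg m = (\<Sum>v\<in>S. Poly_Mapping.lookup m v)"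
  unfolding monom_deg_def by (rule sum.mono_neutral_left) (auto simp: in_keys_iff)

lemma monom_deg_add: "monom_deg (m + k) = monom_deg m + monom_deg k"
proof -
  let ?S = "Poly_Mapping.keys m \<union> Poly_Mapping.keys k"
  have "monom_deg (m + k) = (\<Sum>v\<in>?S. Poly_Mapping.lookup (m + k) v)"
    by (rule monom_deg_superset) (use keys_add[of m k] in auto)
  then show ?thesis
    by (simp add: lookup_add sum.distrib monom_deg_superset[of m ?S] monom_deg_superset[of k ?S])
qed

lemma order_ge_zero: "order_ge k 0"
  by (simp add: order_ge_def)

lemma order_ge_0: "order_ge 0 P"
  by (simp add: order_ge_def)

lemma order_ge_add: "order_ge k P \<Longrightarrow> order_ge k Q \<Longrightarrow> order_ge k (P + Q)"
  unfolding order_ge_def using keys_add[of P Q] by blast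

lemma order_ge_diff: "order_ge k P \<Longrightarrow> order_ge k Q \<Longrightarrow> order_ge k (P - Q)"
  unfolding order_ge_def using keys_diff[of P Q] by blast

lemma order_ge_mult: "order_ge j P \<Longrightarrow> order_ge k Q \<Longrightarrow> order_ge (j + k) (P * Q)"
  unfolding order_ge_def using keys_mult[of P Q] by (fastforce simp: monom_deg_add intro: add_mono)

lemma order_ge_mono: "order_ge k P \<Longrightarrow> j \<le> k \<Longrightarrow> order_ge j P"
  unfolding order_ge_def by fastforce

lemma order_ge_of_nat_mult: "order_ge k P \<Longrightarrow> order_ge k (of_nat c * P)"
  using order_ge_mult[OF order_ge_0] by simp

lemma order_ge_of_nat_mult_cancel: "order_ge k (of_nat c * P) \<Longrightarrow> c > 0 \<Longrightarrow> order_ge k P"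
  by (auto simp: order_ge_def of_nat_mult_int_mpoly)

lemma order_ge_power: "order_ge 1 P \<Longrightarrow> order_ge n (P ^ n)"
proof (induction n)
  case (Suc n)
  then show ?case using order_ge_mult[of 1 P n "P ^ n"] by simp
qed (simp add: order_ge_0)

lemma order_ge_sum: "(\<And>i. i \<in> A \<Longrightarrow> order_ge k (f i)) \<Longrightarrow> order_ge k (sum f A)"
  by (induction A rule: infinite_finite_induct) (auto simp: order_ge_zero order_ge_add)

lemma order_ge_var: "order_ge 1 (mpoly_var v)"
  by (simp add: order_ge_def mpoly_var_def monom_deg_def)

lemma ghost_split:
  "ghost p x n = (\<Sum>i<n. of_nat (p ^ i) * x i ^ (p ^ (n - i))) + of_nat (p ^ n) * x n"
  by (simp add: ghost_def lessThan_Suc_atMost[symmetric])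

lemma order_ge_ghost:
  assumes "p > 0" "\<And>i. order_ge 1 (S i)"
  shows "order_ge 1 (ghost p S n)"
  unfolding ghost_def
proof (rule order_ge_sum, rule order_ge_of_nat_mult)
  fix i
  have "1 \<le> p ^ (n - i)" using assms(1) by simp
  then show "order_ge 1 (S i ^ p ^ (n - i))"
    using order_ge_power[OF assms(2)] order_ge_mono by blast
qed

lemma order_ge_if_ghost:
  assumes p: "p > 0" and g: "\<And>n. order_ge 1 (ghost p S n)"
  shows "order_ge 1 (S n)"
proof (induction n rule: less_induct)
  case (less n)
  have "order_ge 1 (\<Sum>i<n. of_nat (p ^ i) * S i ^ (p ^ (n - i)))"
  proof (rule order_ge_sum, rule order_ge_of_nat_mult)
    fix i assume i: "i \<in> {..<n}"
    have "1 \<le> p ^ (n - i)" using p by simp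
    then show "order_ge 1 (S i ^ p ^ (n - i))"
      using order_ge_power[OF less] i order_ge_mono by blast
  qed
  from order_ge_diff[OF g[of n] this]
  have "order_ge 1 (of_nat (p ^ n) * S n)" by (simp add: ghost_split)
  then show ?case by (rule order_ge_of_nat_mult_cancel) (use p in simp)
qed

text \<open>In the \<open>n\<close>-th ghost component only the last summand has linear terms, all other exponents being at
  least \<open>p\<close>.\<close>

lemma order_ge_2_ghost_diff:
  assumes p: "p \<ge> 2" and S: "\<And>n. order_ge 1 (S n)"
  shows "order_ge 2 (ghost p S n - of_nat (p ^ n) * S n)"
proof -
  have "order_ge 2 (\<Sum>i<n. of_nat (p ^ i) * S i ^ (p ^ (n - i)))"
  proof (rule order_ge_sum, rule order_ge_of_nat_mult)
    fix i assume "i \<in> {..<n}"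
    then have "p ^ 1 \<le> p ^ (n - i)" using p by (intro power_increasing) auto
    then have "2 \<le> p ^ (n - i)" using p by simp
    then show "order_ge 2 (S i ^ p ^ (n - i))"
      using order_ge_power[OF S] order_ge_mono by blast
  qed
  then show ?thesis by (simp add: ghost_split)
qed

text \<open>Addition of Witt vectors is componentwise up to terms of degree two.\<close>

lemma witt_add_poly_order:
  assumes p: "Factorial_Ring.prime p"
  shows "order_ge 2 (witt_add_poly p n - mpoly_var (Inl n) - mpoly_var (Inr n))"
proof -
  let ?S = "witt_add_poly p" and ?X = "\<lambda>n. mpoly_var (Inl n)" and ?Y = "\<lambda>n. mpoly_var (Inr n)"
  have p2: "p \<ge> 2" and p0: "p > 0" using prime_ge_2_nat[OF p] by simp_all
  have "order_ge 1 (ghost p ?S n)" for n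
    unfolding ghost_witt_add_poly[OF p]
    by (intro order_ge_add order_ge_ghost order_ge_var p0)
  then have S: "order_ge 1 (?S n)" for n by (rule order_ge_if_ghost[OF p0])
  have "order_ge 2 ((ghost p ?X n - of_nat (p ^ n) * ?X n) + (ghost p ?Y n - of_nat (p ^ n) * ?Y n)
      - (ghost p ?S n - of_nat (p ^ n) * ?S n))"
    by (intro order_ge_add order_ge_diff order_ge_2_ghost_diff p2 S order_ge_var)
  also have "\<dots> = of_nat (p ^ n) * (?S n - ?X n - ?Y n)"
    by (simp add: ghost_witt_add_poly[OF p] algebra_simps)
  finally show ?thesis by (rule order_ge_of_nat_mult_cancel) (use p0 in simp)
qed

text \<open>The ghost components of the Frobenius polynomials and of the powers \<open>X\<^sub>n\<^sup>p\<close> differ by \<open>p\<^bsup>n+1\<^esup> X\<^bsub>n+1\<^esub>\<close>.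
  The remainder \<open>G\<close> has no constant term, so it maps Witt vectors with components in an ideal into
  that ideal.\<close>

lemma witt_frob_poly_mod_p:
  assumes p: "Factorial_Ring.prime p"
  obtains G where "witt_frob_poly p n = mpoly_var n ^ p + of_nat p * G" "order_ge 1 G"
proof -
  have p0: "p > 0" using prime_gt_0_nat[OF p] .
  have "of_nat p dvd witt_frob_poly p n - mpoly_var n ^ p"
    by (rule dvd_if_ghost_dvd[OF p0, of "witt_frob_poly p" "\<lambda>n. mpoly_var n ^ p"])
      (simp add: ghost_witt_frob_poly[OF p] ghost_Suc)
  then obtain G where G: "witt_frob_poly p n - mpoly_var n ^ p = of_nat p * G" by (rule dvdE)
  have "order_ge 1 (ghost p (witt_frob_poly p) n)" for n
    unfolding ghost_witt_frob_poly[OF p] by (intro order_ge_ghost order_ge_var p0)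
  then have "order_ge 1 (witt_frob_poly p n)" by (rule order_ge_if_ghost[OF p0])
  moreover have "order_ge 1 (mpoly_var n ^ p)"
    using order_ge_power[OF order_ge_var] order_ge_mono p0 by (metis One_nat_def Suc_leI)
  ultimately have "order_ge 1 (of_nat p * G)" unfolding G[symmetric] by (rule order_ge_diff)
  then have "order_ge 1 G" by (rule order_ge_of_nat_mult_cancel) (rule p0)
  with G show ?thesis by (intro that[of G]) (simp_all add: algebra_simps)
qed

lemma (in abelian_group) finsum_in_subgroup:
  assumes "additive_subgroup H G" "\<And>i. i \<in> A \<Longrightarrow> f i \<in> H"
  shows "(\<Oplus>i\<in>A. f i) \<in> H"
proof -
  interpret additive_subgroup H G by fact
  show ?thesis
    using assms(2)
  proof (induction A rule: infinite_finite_induct)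
    case (insert a A)
    then have "f a \<in> H" "f \<in> A \<rightarrow> carrier G" "f a \<in> carrier G" by auto
    with insert show ?case by simp
  qed simp_all
qed

lemma (in abelian_group) int_add_pow_in_subgroup:
  assumes "additive_subgroup H G" "x \<in> H"
  shows "[(k::int)] \<cdot> x \<in> H"
proof -
  interpret additive_subgroup H G by fact
  have x: "x \<in> carrier G" using assms(2) by simp
  have nat: "[n] \<cdot> x \<in> H" for n :: nat
    by (induction n) (use assms(2) in \<open>simp_all add: add.nat_pow_Suc\<close>)
  have n: "[int n] \<cdot> x \<in> H" for n :: nat
    using nat[of n] by (simp add: add_pow_def int_pow_int)
  show ?thesis
  proof (cases k)
    case (neg n)
    then have "[k] \<cdot> x = \<ominus> ([int (Suc n)] \<cdot> x)"
      using group.int_pow_neg[OF a_group, of x "int (Suc n)"] x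
      by (simp add: add_pow_def a_inv_def)
    then show ?thesis using n[of "Suc n"] by simp
  qed (simp add: n)
qed

lemma monom_split:
  assumes "v \<in> Poly_Mapping.keys m"
  shows "(m :: 'v \<Rightarrow>\<^sub>0 nat) = Poly_Mapping.single v 1 + (m - Poly_Mapping.single v 1)"
proof (rule poly_mapping_eqI)
  fix w
  show "Poly_Mapping.lookup m w = Poly_Mapping.lookup (Poly_Mapping.single v 1 + (m - Poly_Mapping.single v 1)) w"
    using assms by (cases "w = v") (auto simp: lookup_add lookup_minus lookup_single in_keys_iff when_def)
qed

context cring
begin

lemma monom_eval_split:
  assumes "\<And>v. x v \<in> carrier R" "k < monom_deg m"
  shows "\<exists>v m'. monom_eval R x m = x v \<otimes> monom_eval R x m' \<and> k \<le> monom_deg m'"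
proof -
  have "Poly_Mapping.keys m \<noteq> {}" using assms(2) by (auto simp: monom_deg_def)
  then obtain v where v: "v \<in> Poly_Mapping.keys m" by blast
  let ?m' = "m - Poly_Mapping.single v 1"
  have "monom_deg m = 1 + monom_deg ?m'"
    by (subst monom_split[OF v], subst monom_deg_add) (simp add: monom_deg_def)
  moreover have "monom_eval R x m = x v \<otimes> monom_eval R x ?m'"
    by (subst monom_split[OF v], subst monom_eval_add) (use assms(1) in \<open>simp_all only: monom_eval_single\<close>)
  ultimately have "monom_eval R x m = x v \<otimes> monom_eval R x ?m' \<and> k \<le> monom_deg ?m'"
    using assms(2) by simp
  then show ?thesis by blast
qed

lemma monom_eval_in_ideal:
  assumes "ideal I R" "\<And>v. x v \<in> I" "0 < monom_deg m"
  shows "monom_eval R x m \<in> I"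
proof -
  interpret ideal I R by fact
  have x: "\<And>v. x v \<in> carrier R" using assms(2) by (rule a_Hcarr)
  obtain v m' where "monom_eval R x m = x v \<otimes> monom_eval R x m'"
    using monom_eval_split[of x, OF x assms(3)] by blast
  then show ?thesis using assms(2) monom_eval_closed[of x, OF x] by (simp add: I_r_closed)
qed

lemma mpoly_eval_in_subgroup:
  assumes "additive_subgroup H R" "\<And>m. m \<in> Poly_Mapping.keys P \<Longrightarrow> monom_eval R x m \<in> H"
  shows "mpoly_eval R x P \<in> H"
  unfolding mpoly_eval_frag_sum frag_sum_def
  by (intro finsum_in_subgroup int_add_pow_in_subgroup assms)

lemma mpoly_eval_in_ideal:
  assumes "ideal I R" "\<And>v. x v \<in> I" "order_ge 1 P"
  shows "mpoly_eval R x P \<in> I"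
  using assms(3) ideal.axioms(1)[OF assms(1)]
  by (intro mpoly_eval_in_subgroup monom_eval_in_ideal assms(1,2)) (auto simp: order_ge_def)

lemma mpoly_eval_square_zero:
  assumes "ideal I R" "\<And>v. x v \<in> I" "order_ge 2 P"
    and "\<And>u v. u \<in> I \<Longrightarrow> v \<in> I \<Longrightarrow> u \<otimes> v = \<zero>"
  shows "mpoly_eval R x P = \<zero>"
proof -
  have x: "\<And>v. x v \<in> carrier R" by (rule ideal.Icarr[OF assms(1,2)])
  have "monom_eval R x m = \<zero>" if "m \<in> Poly_Mapping.keys P" for m
  proof -
    have "1 < monom_deg m" using assms(3) that by (auto simp: order_ge_def)
    then obtain v m' where "monom_eval R x m = x v \<otimes> monom_eval R x m'" "1 \<le> monom_deg m'"
      using monom_eval_split[of x 1 m, OF x] by blast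
    then show ?thesis
      using assms(2,4) monom_eval_in_ideal[OF assms(1,2), of m'] by simp
  qed
  then have "mpoly_eval R x P \<in> {\<zero>}"
    using ideal.axioms(1)[OF zeroideal] by (intro mpoly_eval_in_subgroup) auto
  then show ?thesis by simp
qed

end

section \<open>Frobenius, Verschiebung and Teichmueller elements\<close>

definition teich :: "('a, 'm) ring_scheme \<Rightarrow> 'a \<Rightarrow> nat \<Rightarrow> 'a" where
  "teich R r = (\<lambda>n. if n = 0 then r else \<zero>\<^bsub>R\<^esub>)"

context ring_hom_cring
begin

lemma witt_map_teich: "witt_map h (teich R r) = teich S (h r)"
  by (auto simp: teich_def)

lemma witt_map_ring_hom_cring:
  assumes "Factorial_Ring.prime p"
  shows "ring_hom_cring (witt p R) (witt p S) (\<lambda>x. witt_map h x)"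
proof (intro ring_hom_cringI ring_hom_ringI2 ring_hom_memI)
  show R: "cring (witt p R)" and S: "cring (witt p S)"
    by (rule cring_witt[OF assms] R.cring_axioms S.cring_axioms)+
  show "Ring.ring (witt p R)" "Ring.ring (witt p S)" using R S cring.axioms(1) by blast+
qed (simp_all add: witt_map_closed witt_map_add witt_map_mult witt_map_one)

end

lemma ghost_teich:
  assumes "p > 0"
  shows "ghost p (teich univ_ring r) n = (r :: 'v int_mpoly) ^ (p ^ n)"
proof (cases n)
  case (Suc m)
  have "ghost p (teich univ_ring r) (Suc m) = r ^ (p ^ Suc m)"
    using assms unfolding ghost_def
    by (subst sum.atMost_Suc_shift) (simp add: zero_power teich_def)
  then show ?thesis using Suc by simp
qed (simp add: ghost_0 teich_def)

lemma ghost_witt_nat_multiple: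
  assumes "Factorial_Ring.prime p"
  shows "ghost p ([k] \<cdot>\<^bsub>witt p univ_ring\<^esub> (x :: nat \<Rightarrow> 'v int_mpoly)) n = of_nat k * ghost p x n"
proof (induction k)
  case (Suc k)
  interpret W: cring "witt p (univ_ring :: 'v int_mpoly ring)"
    by (rule cring_witt[OF assms cring_univ_ring])
  show ?case using Suc
    by (simp add: W.add.nat_pow_Suc ghost_add[OF assms] algebra_simps)
next
  case 0
  interpret W: cring "witt p (univ_ring :: 'v int_mpoly ring)"
    by (rule cring_witt[OF assms cring_univ_ring])
  show ?case by (simp add: ghost_zero_witt[OF assms])
qed

locale witt_ring = cring R for R (structure) +
  fixes p :: nat
  assumes prime_p: "Factorial_Ring.prime p"

sublocale witt_ring \<subseteq> W: cring "witt p R"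
  by (rule cring_witt[OF prime_p cring_axioms])

context witt_ring
begin

abbreviation "W \<equiv> witt p R"
abbreviation "F \<equiv> witt_F p R"
abbreviation "V \<equiv> witt_V R"

lemma p_pos: "p > 0" and p_ge_2: "p \<ge> 2"
  using prime_gt_0_nat[OF prime_p] prime_ge_2_nat[OF prime_p] by simp_all

lemmas F_closed [simp] = witt_F_closed[of _ p]
lemmas V_closed [simp] = witt_V_closed[of _ p]

lemma witt_comp_closed [simp]: "x \<in> carrier W \<Longrightarrow> x n \<in> carrier R"
  by (simp add: carrier_witt)

lemma teich_closed [simp]: "r \<in> carrier R \<Longrightarrow> teich R r \<in> carrier W"
  by (simp add: teich_def carrier_witt)

text \<open>Identities between Witt vectors hold over every ring once they hold for the ghost components
  of generic Witt vectors; the next lemmas are instances.\<close>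

lemma
  assumes x: "x \<in> carrier W" and y: "y \<in> carrier W"
  shows F_add: "F (x \<oplus>\<^bsub>W\<^esub> y) = F x \<oplus>\<^bsub>W\<^esub> F y"
    and F_mult: "F (x \<otimes>\<^bsub>W\<^esub> y) = F x \<otimes>\<^bsub>W\<^esub> F y"
    and V_add: "V (x \<oplus>\<^bsub>W\<^esub> y) = V x \<oplus>\<^bsub>W\<^esub> V y"
    and mult_V: "x \<otimes>\<^bsub>W\<^esub> V y = V (F x \<otimes>\<^bsub>W\<^esub> y)"
    and witt_add_0: "(x \<oplus>\<^bsub>W\<^esub> y) 0 = x 0 \<oplus> y 0"
    and witt_mult_0: "(x \<otimes>\<^bsub>W\<^esub> y) 0 = x 0 \<otimes> y 0"
    and F_V: "F (V x) = [p] \<cdot>\<^bsub>W\<^esub> x"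
proof -
  let ?U = "univ_ring :: (nat \<times> nat) int_mpoly ring"
  let ?WU = "witt p ?U" and ?g = generic_witt
  obtain h where h: "ring_hom_cring univ_ring R h"
    and *: "witt_map h (?g 0) = x" "witt_map h (?g 1) = y"
    using generic_witt_specialize3[OF x y y] by blast
  interpret h: ring_hom_cring univ_ring R h by fact
  interpret WU: cring ?WU by (rule cring_witt[OF prime_p cring_univ_ring])
  note maps = h.witt_map_add[of _ p, symmetric] h.witt_map_mult[of _ p, symmetric]
    h.witt_map_F[of _ p, symmetric] h.witt_map_V[symmetric]
  note ghosts = ghost_add[OF prime_p] ghost_mult[OF prime_p] ghost_F[OF prime_p]
    ghost_V_0[OF prime_p] ghost_V_Suc[OF prime_p]
  have "witt_F p ?U (?g 0 \<oplus>\<^bsub>?WU\<^esub> ?g 1) = witt_F p ?U (?g 0) \<oplus>\<^bsub>?WU\<^esub> witt_F p ?U (?g 1)"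
    by (rule witt_univ_eqI[OF prime_p]) (simp only: ghosts)
  then show "F (x \<oplus>\<^bsub>W\<^esub> y) = F x \<oplus>\<^bsub>W\<^esub> F y" unfolding *[symmetric] by (simp add: maps)
  have "witt_F p ?U (?g 0 \<otimes>\<^bsub>?WU\<^esub> ?g 1) = witt_F p ?U (?g 0) \<otimes>\<^bsub>?WU\<^esub> witt_F p ?U (?g 1)"
    by (rule witt_univ_eqI[OF prime_p]) (simp only: ghosts)
  then show "F (x \<otimes>\<^bsub>W\<^esub> y) = F x \<otimes>\<^bsub>W\<^esub> F y" unfolding *[symmetric] by (simp add: maps)
  have "witt_V ?U (?g 0 \<oplus>\<^bsub>?WU\<^esub> ?g 1) = witt_V ?U (?g 0) \<oplus>\<^bsub>?WU\<^esub> witt_V ?U (?g 1)"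
  proof (rule witt_univ_eqI[OF prime_p])
    fix n
    show "ghost p (witt_V ?U (?g 0 \<oplus>\<^bsub>?WU\<^esub> ?g 1)) n = ghost p (witt_V ?U (?g 0) \<oplus>\<^bsub>?WU\<^esub> witt_V ?U (?g 1)) n"
      by (cases n) (simp_all only: ghosts distrib_left add_0)
  qed
  then show "V (x \<oplus>\<^bsub>W\<^esub> y) = V x \<oplus>\<^bsub>W\<^esub> V y" unfolding *[symmetric] by (simp add: maps)
  have "?g 0 \<otimes>\<^bsub>?WU\<^esub> witt_V ?U (?g 1) = witt_V ?U (witt_F p ?U (?g 0) \<otimes>\<^bsub>?WU\<^esub> ?g 1)"
  proof (rule witt_univ_eqI[OF prime_p])
    fix n
    show "ghost p (?g 0 \<otimes>\<^bsub>?WU\<^esub> witt_V ?U (?g 1)) n = ghost p (witt_V ?U (witt_F p ?U (?g 0) \<otimes>\<^bsub>?WU\<^esub> ?g 1)) n"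
      by (cases n) (simp_all only: ghosts mult_zero_right mult.left_commute)
  qed
  then show "x \<otimes>\<^bsub>W\<^esub> V y = V (F x \<otimes>\<^bsub>W\<^esub> y)" unfolding *[symmetric] by (simp add: maps)
  have "witt_F p ?U (witt_V ?U (?g 0)) = [p] \<cdot>\<^bsub>?WU\<^esub> ?g 0"
    by (rule witt_univ_eqI[OF prime_p]) (simp only: ghosts ghost_witt_nat_multiple[OF prime_p])
  moreover have "witt_map h ([k] \<cdot>\<^bsub>?WU\<^esub> ?g 0) = [k] \<cdot>\<^bsub>W\<^esub> x" for k :: nat
    by (induction k) (simp_all add: WU.add.nat_pow_Suc W.add.nat_pow_Suc h.witt_map_zero h.witt_map_add *)
  ultimately show "F (V x) = [p] \<cdot>\<^bsub>W\<^esub> x"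
    unfolding *(1)[symmetric] by (simp add: maps)
  have "(?g 0 \<oplus>\<^bsub>?WU\<^esub> ?g 1) 0 = ?g 0 0 + ?g 1 0" "(?g 0 \<otimes>\<^bsub>?WU\<^esub> ?g 1) 0 = ?g 0 0 * ?g 1 0"
    using ghost_add[OF prime_p, of "?g 0" "?g 1" 0] ghost_mult[OF prime_p, of "?g 0" "?g 1" 0]
    by (simp_all add: ghost_0)
  then have "witt_map h (?g 0 \<oplus>\<^bsub>?WU\<^esub> ?g 1) 0 = h (?g 0 0) \<oplus> h (?g 1 0)"
     "witt_map h (?g 0 \<otimes>\<^bsub>?WU\<^esub> ?g 1) 0 = h (?g 0 0) \<otimes> h (?g 1 0)"
    using h.hom_add[of "?g 0 0" "?g 1 0"] h.hom_mult[of "?g 0 0" "?g 1 0"] by simp_all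
  moreover have "h (?g 0 0) = x 0" "h (?g 1 0) = y 0" using *[THEN fun_cong, of 0] by simp_all
  moreover have "x \<oplus>\<^bsub>W\<^esub> y = witt_map h (?g 0 \<oplus>\<^bsub>?WU\<^esub> ?g 1)" "x \<otimes>\<^bsub>W\<^esub> y = witt_map h (?g 0 \<otimes>\<^bsub>?WU\<^esub> ?g 1)"
    unfolding *[symmetric] by (simp_all add: maps)
  ultimately show "(x \<oplus>\<^bsub>W\<^esub> y) 0 = x 0 \<oplus> y 0" "(x \<otimes>\<^bsub>W\<^esub> y) 0 = x 0 \<otimes> y 0" by simp_all
qed

lemma F_one: "F \<one>\<^bsub>W\<^esub> = \<one>\<^bsub>W\<^esub>"
proof -
  let ?U = "univ_ring :: (nat \<times> nat) int_mpoly ring"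
  obtain h where h: "ring_hom_cring ?U R h"
    using generic_witt_specialize3[of "\<one>\<^bsub>W\<^esub>" p "\<one>\<^bsub>W\<^esub>" "\<one>\<^bsub>W\<^esub>"] by blast
  interpret h: ring_hom_cring ?U R h by fact
  have "witt_F p ?U \<one>\<^bsub>witt p ?U\<^esub> = \<one>\<^bsub>witt p ?U\<^esub>"
    by (rule witt_univ_eqI[OF prime_p]) (simp only: ghost_F[OF prime_p] ghost_one_witt[OF prime_p])
  then show ?thesis
    using h.witt_map_F[of "\<one>\<^bsub>witt p ?U\<^esub>" p] by (simp add: h.witt_map_one)
qed

lemma ring_hom_F: "ring_hom_cring W W F"
  by (intro ring_hom_cringI ring_hom_ringI2 ring_hom_memI W.cring_axioms W.ring_axioms)
    (simp_all add: F_add F_mult F_one)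

text \<open>Compare ghost components: those of a Teichmueller element are the powers \<open>r\<^bsup>p^n\<^esup>\<close>.\<close>

lemma teich_mult:
  assumes "r \<in> carrier R" "x \<in> carrier W"
  shows "(teich R r \<otimes>\<^bsub>W\<^esub> x) n = r [^] (p ^ n) \<otimes> x n"
proof -
  let ?U = "univ_ring :: (nat \<times> nat) int_mpoly ring"
  let ?WU = "witt p ?U" and ?g = generic_witt
  obtain h where h: "ring_hom_cring ?U R h"
    and *: "witt_map h (?g 0) = teich R r" "witt_map h (?g 1) = x"
    using generic_witt_specialize3[of "teich R r" p x x] assms by auto
  interpret h: ring_hom_cring ?U R h by fact
  let ?r = "?g 0 0"
  have r: "h ?r = r" using *(1)[THEN fun_cong, of 0] by (simp add: teich_def)
  have x: "h (?g 1 n) = x n" for n using *(2)[THEN fun_cong, of n] by simp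
  have "teich ?U ?r \<otimes>\<^bsub>?WU\<^esub> ?g 1 = (\<lambda>n. ?r ^ (p ^ n) * ?g 1 n)"
  proof (rule witt_univ_eqI[OF prime_p])
    fix n
    have "of_nat (p ^ i) * (?r ^ p ^ i * ?g 1 i) ^ p ^ (n - i) =
        ?r ^ p ^ n * (of_nat (p ^ i) * ?g 1 i ^ p ^ (n - i))" if "i \<le> n" for i
    proof -
      have "p ^ i * p ^ (n - i) = p ^ n" using that by (simp add: power_add[symmetric])
      then show ?thesis by (simp add: power_mult_distrib power_mult[symmetric] mult_ac)
    qed
    then have "ghost p (\<lambda>n. ?r ^ (p ^ n) * ?g 1 n) n = ?r ^ (p ^ n) * ghost p (?g 1) n"
      by (simp add: ghost_def sum_distrib_left)
    then show "ghost p (teich ?U ?r \<otimes>\<^bsub>?WU\<^esub> ?g 1) n = ghost p (\<lambda>n. ?r ^ (p ^ n) * ?g 1 n) n"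
      by (simp add: ghost_mult[OF prime_p] ghost_teich[OF p_pos])
  qed
  then have "witt_map h (teich ?U ?r \<otimes>\<^bsub>?WU\<^esub> ?g 1) n = h (?r [^]\<^bsub>?U\<^esub> (p ^ n) \<otimes>\<^bsub>?U\<^esub> ?g 1 n)"
    by simp
  also have "\<dots> = r [^] (p ^ n) \<otimes> x n"
    using h.hom_mult[of "?r [^]\<^bsub>?U\<^esub> (p ^ n)" "?g 1 n"]
      h.hom_nat_power[of ?r "p ^ n"]
    by (simp add: r x[unfolded One_nat_def])
  finally have "witt_map h (teich ?U ?r \<otimes>\<^bsub>?WU\<^esub> ?g 1) n = r [^] (p ^ n) \<otimes> x n" .
  moreover have "witt_map h (teich ?U ?r \<otimes>\<^bsub>?WU\<^esub> ?g 1) = teich R r \<otimes>\<^bsub>W\<^esub> x"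
    unfolding *(2)[symmetric] r[symmetric] h.witt_map_teich[symmetric]
    by (rule h.witt_map_mult) simp_all
  ultimately show ?thesis by metis
qed

text \<open>The summand \<open>i = 0\<close> of each ghost component belongs to the Teichmueller element, the others carry a
  common factor \<open>p\<close> and belong to the Verschiebung.\<close>

lemma witt_decompose:
  assumes x: "x \<in> carrier W"
  shows "x = teich R (x 0) \<oplus>\<^bsub>W\<^esub> V (\<lambda>n. x (Suc n))"
proof -
  let ?U = "univ_ring :: (nat \<times> nat) int_mpoly ring"
  let ?WU = "witt p ?U" and ?g = "generic_witt 0"
  obtain h where h: "ring_hom_cring ?U R h" and *: "witt_map h ?g = x"
    using generic_witt_specialize3[OF x x x] by auto
  interpret h: ring_hom_cring ?U R h by fact
  have "?g = teich ?U (?g 0) \<oplus>\<^bsub>?WU\<^esub> witt_V ?U (\<lambda>n. ?g (Suc n))"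
  proof (rule witt_univ_eqI[OF prime_p])
    fix n
    show "ghost p ?g n = ghost p (teich ?U (?g 0) \<oplus>\<^bsub>?WU\<^esub> witt_V ?U (\<lambda>n. ?g (Suc n))) n"
    proof (cases n)
      case 0
      then show ?thesis
        by (simp only: ghost_add[OF prime_p] ghost_V_0[OF prime_p] ghost_teich[OF p_pos]) (simp add: ghost_0)
    next
      case (Suc m)
      have "ghost p ?g (Suc m) = ?g 0 ^ (p ^ Suc m) + of_nat p * ghost p (\<lambda>n. ?g (Suc n)) m"
        unfolding ghost_def by (subst sum.atMost_Suc_shift) (simp add: sum_distrib_left mult.assoc)
      then show ?thesis
        by (simp only: Suc ghost_add[OF prime_p] ghost_V_Suc[OF prime_p] ghost_teich[OF p_pos])
    qed
  qed
  then have "witt_map h ?g = witt_map h (teich ?U (?g 0) \<oplus>\<^bsub>?WU\<^esub> witt_V ?U (\<lambda>n. ?g (Suc n)))"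
    by (rule arg_cong)
  then show ?thesis
    unfolding *[symmetric] by (simp add: h.witt_map_add h.witt_map_teich h.witt_map_V)
qed

end

section \<open>Matrices and their Frobenius twists\<close>

lemma (in abelian_group) minus_eq_zeroD:
  "x \<ominus> y = \<zero> \<Longrightarrow> x \<in> carrier G \<Longrightarrow> y \<in> carrier G \<Longrightarrow> x = y"
  by (metis a_minus_def a_assoc a_inv_closed l_neg l_zero r_zero)

lemma (in abelian_group) minus_add_cancel_right:
  "x \<in> carrier G \<Longrightarrow> y \<in> carrier G \<Longrightarrow> (x \<ominus> y) \<oplus> y = x"
  by (simp add: a_minus_def a_assoc l_neg)

lemma (in cring) matrix_assoc:
  assumes "finite H" "finite J" "\<And>h. h \<in> H \<Longrightarrow> a h \<in> carrier R"
    "\<And>h j. h \<in> H \<Longrightarrow> j \<in> J \<Longrightarrow> B h j \<in> carrier R" "\<And>j. j \<in> J \<Longrightarrow> y j \<in> carrier R"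
  shows "(\<Oplus>j\<in>J. (\<Oplus>h\<in>H. a h \<otimes> B h j) \<otimes> y j) = (\<Oplus>h\<in>H. a h \<otimes> (\<Oplus>j\<in>J. B h j \<otimes> y j))"
  using assms(1,3,4)
proof (induction H rule: finite_induct)
  case empty
  then show ?case using assms(5) by (simp add: finsum_zero cong: finsum_cong)
next
  case (insert g H)
  have "(\<Oplus>j\<in>J. (\<Oplus>h\<in>insert g H. a h \<otimes> B h j) \<otimes> y j)
      = (\<Oplus>j\<in>J. a g \<otimes> (B g j \<otimes> y j) \<oplus> (\<Oplus>h\<in>H. a h \<otimes> B h j) \<otimes> y j)"
    by (rule finsum_cong') (use insert assms(5) in \<open>auto simp: Pi_iff l_distr m_assoc\<close>)
  also have "\<dots> = (\<Oplus>j\<in>J. a g \<otimes> (B g j \<otimes> y j)) \<oplus> (\<Oplus>j\<in>J. (\<Oplus>h\<in>H. a h \<otimes> B h j) \<otimes> y j)"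
    by (rule finsum_addf) (use insert assms(5) in \<open>auto simp: Pi_iff\<close>)
  also have "(\<Oplus>j\<in>J. a g \<otimes> (B g j \<otimes> y j)) = a g \<otimes> (\<Oplus>j\<in>J. B g j \<otimes> y j)"
    by (rule finsum_rdistr[symmetric]) (use insert assms(2,5) in \<open>auto simp: Pi_iff\<close>)
  also have "(\<Oplus>j\<in>J. (\<Oplus>h\<in>H. a h \<otimes> B h j) \<otimes> y j) = (\<Oplus>h\<in>H. a h \<otimes> (\<Oplus>j\<in>J. B h j \<otimes> y j))"
    using insert by simp
  finally show ?case
    using insert assms(5) by (simp add: Pi_iff)
qed

lemma (in cring) finsum_mult_delta:
  assumes "finite J" "j \<in> J" "\<And>i. i \<in> J \<Longrightarrow> a i \<in> carrier R"
  shows "(\<Oplus>i\<in>J. a i \<otimes> (if i = j then \<one> else \<zero>)) = a j"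
proof -
  have "(\<Oplus>i\<in>J. a i \<otimes> (if i = j then \<one> else \<zero>)) = (\<Oplus>i\<in>J. if j = i then a i else \<zero>)"
    by (rule finsum_cong') (use assms in auto)
  also have "\<dots> = a j"
    using add.finprod_singleton[of j J a] assms by (simp add: Pi_iff)
  finally show ?thesis .
qed

text \<open>Column \<open>j\<close> of the product \<open>z\<^bsup>(p^(t+k-1))\<^esup> \<cdots> z\<^bsup>(p^t)\<^esup>\<close>, where \<open>z\<^bsup>(q)\<^esup>\<close> is the matrix of the \<open>q\<close>-th powers of the
  entries. For \<open>t = 0\<close> these products are the matrices of the iterates in the definition of
  nilpotence.\<close>

primrec frob_col ::
  "nat \<Rightarrow> ('a, 'm) ring_scheme \<Rightarrow> 'j set \<Rightarrow> ('j \<Rightarrow> 'j \<Rightarrow> 'a) \<Rightarrow> nat \<Rightarrow> 'j \<Rightarrow> nat \<Rightarrow> 'j \<Rightarrow> 'a" where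
  "frob_col p R J z t j 0 = (\<lambda>i. if i = j then \<one>\<^bsub>R\<^esub> else \<zero>\<^bsub>R\<^esub>)"
| "frob_col p R J z t j (Suc k) =
     (\<lambda>i. \<Oplus>\<^bsub>R\<^esub>l\<in>J. z i l [^]\<^bsub>R\<^esub> (p ^ (t + k)) \<otimes>\<^bsub>R\<^esub> frob_col p R J z t j k l)"

context cring
begin

lemma frob_col_closed:
  assumes "\<And>i l. i \<in> J \<Longrightarrow> l \<in> J \<Longrightarrow> z i l \<in> carrier R" "i \<in> J"
  shows "frob_col p R J z t j k i \<in> carrier R"
  using assms(2) by (induction k arbitrary: i) (auto intro!: finsum_closed simp: assms(1))

end

lemma (in ring_hom_cring) hom_frob_col:
  assumes "\<And>i l. i \<in> J \<Longrightarrow> l \<in> J \<Longrightarrow> z i l \<in> carrier R" "i \<in> J"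
  shows "h (frob_col p R J z t j k i) = frob_col p S J (\<lambda>i l. h (z i l)) t j k i"
  using assms(2)
proof (induction k arbitrary: i)
  case (Suc k)
  have "h (frob_col p R J z t j (Suc k) i) =
      (\<Oplus>\<^bsub>S\<^esub>l\<in>J. h (z i l [^] (p ^ (t + k)) \<otimes> frob_col p R J z t j k l))"
    using Suc.prems assms(1) by (simp add: Pi_iff R.frob_col_closed o_def)
  also have "\<dots> = frob_col p S J (\<lambda>i l. h (z i l)) t j (Suc k) i"
    using Suc assms(1)
    by (auto intro!: S.finsum_cong' S.frob_col_closed simp: R.frob_col_closed hom_nat_power)
  finally show ?case .
qed simp

lemma (in ring) p_ideal_iff:
  "x \<in> p_ideal p R \<longleftrightarrow> (\<exists>r\<in>carrier R. x = r \<otimes> ([p] \<cdot> \<one>))"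
  by (auto simp: p_ideal_def cgenideal_def)

lemma (in cring) nat_multiple_eq_mult:
  "x \<in> carrier R \<Longrightarrow> [k] \<cdot> x = ([(k::nat)] \<cdot> \<one>) \<otimes> x"
  by (induction k) (simp_all add: add.nat_pow_Suc l_distr)

lemma (in cring) ideal_p_ideal: "ideal (p_ideal p R) R"
  unfolding p_ideal_def by (rule cgenideal_ideal) simp

context witt_ring
begin

section \<open>Components of Witt vectors\<close>

lemma mpoly_eval_nat_multiple:
  assumes "\<And>v. x v \<in> carrier R"
  shows "mpoly_eval R x (of_nat k * P) = [k] \<cdot> mpoly_eval R x P"
  by (induction k)
    (simp_all add: mpoly_eval_zero mpoly_eval_add assms distrib_right add.nat_pow_Suc a_comm mpoly_eval_closed)

lemma mpoly_eval_power:
  assumes "\<And>v. x v \<in> carrier R"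
  shows "mpoly_eval R x (P ^ k) = mpoly_eval R x P [^] k"
  by (induction k)
    (simp_all add: mpoly_eval_one mpoly_eval_mult assms m_comm mpoly_eval_closed)

text \<open>The error term \<open>g\<close> depends on \<open>x\<close> polynomially without constant term, and so stays in every ideal
  that contains the components of \<open>x\<close>.\<close>

lemma F_comp:
  assumes x: "x \<in> carrier W"
  shows "\<exists>g\<in>carrier R. F x n = x n [^] p \<oplus> [p] \<cdot> g \<and>
    (\<forall>I. ideal I R \<longrightarrow> (\<forall>k. x k \<in> I) \<longrightarrow> g \<in> I)"
proof -
  obtain G where G: "witt_frob_poly p n = mpoly_var n ^ p + of_nat p * G" "order_ge 1 G"
    by (rule witt_frob_poly_mod_p[OF prime_p])
  have xc: "\<And>k. x k \<in> carrier R" using x by simp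
  have "F x n = x n [^] p \<oplus> [p] \<cdot> mpoly_eval R x G"
    by (simp add: witt_F_def G(1) mpoly_eval_add mpoly_eval_nat_multiple mpoly_eval_power mpoly_eval_var xc)
  moreover have "mpoly_eval R x G \<in> carrier R" by (simp add: mpoly_eval_closed xc)
  moreover have "mpoly_eval R x G \<in> I" if "ideal I R" "\<forall>k. x k \<in> I" for I
    using mpoly_eval_in_ideal[OF that(1) _ G(2)] that(2) by blast
  ultimately show ?thesis by blast
qed

lemma witt_add_square_zero:
  assumes "ideal I R" "\<And>u v. u \<in> I \<Longrightarrow> v \<in> I \<Longrightarrow> u \<otimes> v = \<zero>"
    and x: "\<And>n. x n \<in> I" and y: "\<And>n. y n \<in> I"
  shows "(x \<oplus>\<^bsub>W\<^esub> y) n = x n \<oplus> y n"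
proof -
  interpret I: ideal I R by fact
  let ?e = "mpoly_eval R (case_sum x y)"
  have v: "case_sum x y v \<in> I" for v using x y by (cases v) auto
  then have vc: "\<And>v. case_sum x y v \<in> carrier R" by simp
  have "?e (witt_add_poly p n - mpoly_var (Inl n) - mpoly_var (Inr n)) = \<zero>"
    by (rule mpoly_eval_square_zero[OF assms(1) v witt_add_poly_order[OF prime_p] assms(2)])
  then have "?e (witt_add_poly p n) \<ominus> x n \<ominus> y n = \<zero>"
    using mpoly_eval_var[of "case_sum x y", OF vc] by (simp add: mpoly_eval_diff vc)
  moreover have "?e (witt_add_poly p n) \<in> carrier R" "x n \<in> carrier R" "y n \<in> carrier R"
    using vc x y by (auto simp: mpoly_eval_closed)
  ultimately have "?e (witt_add_poly p n) = x n \<oplus> y n"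
    by (metis minus_eq_zeroD minus_closed minus_add_cancel_right a_comm)
  then show ?thesis by (simp add: add_witt)
qed

lemma V_inj:
  assumes "V x = V y"
  shows "x = y"
proof
  fix n show "x n = y n" using fun_cong[OF assms, of "Suc n"] by (simp add: witt_V_def)
qed

lemma V_zero: "V \<zero>\<^bsub>W\<^esub> = \<zero>\<^bsub>W\<^esub>"
  by (auto simp: witt_V_def zero_witt split: nat.split)

lemma V_eq_zero_iff: "V x = \<zero>\<^bsub>W\<^esub> \<longleftrightarrow> x = \<zero>\<^bsub>W\<^esub>"
  using V_inj V_zero by metis

lemma eq_V_if_comp_0:
  assumes "x 0 = \<zero>"
  shows "x = V (\<lambda>n. x (Suc n))"
  using assms by (auto simp: witt_V_def split: nat.split)

lemma V_finsum:
  assumes "finite A" "\<And>i. i \<in> A \<Longrightarrow> x i \<in> carrier W"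
  shows "V (\<Oplus>\<^bsub>W\<^esub>i\<in>A. x i) = (\<Oplus>\<^bsub>W\<^esub>i\<in>A. V (x i))"
  using assms by (induction A rule: finite_induct) (simp_all add: V_zero V_add Pi_iff)

lemma F_funpow_closed [simp]: "x \<in> carrier W \<Longrightarrow> (F ^^ k) x \<in> carrier W"
  by (induction k) simp_all

lemma V_funpow_closed [simp]: "x \<in> carrier W \<Longrightarrow> (V ^^ k) x \<in> carrier W"
  by (induction k) simp_all

lemma ring_hom_F_funpow: "ring_hom_cring W W (F ^^ k)"
proof (intro ring_hom_cringI ring_hom_ringI2 ring_hom_memI W.cring_axioms W.ring_axioms)
  fix x y assume xy: "x \<in> carrier W" "y \<in> carrier W"
  show "(F ^^ k) (x \<otimes>\<^bsub>W\<^esub> y) = (F ^^ k) x \<otimes>\<^bsub>W\<^esub> (F ^^ k) y"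
    by (induction k) (simp_all add: xy F_mult)
  show "(F ^^ k) (x \<oplus>\<^bsub>W\<^esub> y) = (F ^^ k) x \<oplus>\<^bsub>W\<^esub> (F ^^ k) y"
    by (induction k) (simp_all add: xy F_add)
next
  show "(F ^^ k) \<one>\<^bsub>W\<^esub> = \<one>\<^bsub>W\<^esub>" by (induction k) (simp_all add: F_one)
qed simp

lemma V_funpow_finsum:
  assumes "finite A" "\<And>i. i \<in> A \<Longrightarrow> x i \<in> carrier W"
  shows "(V ^^ k) (\<Oplus>\<^bsub>W\<^esub>i\<in>A. x i) = (\<Oplus>\<^bsub>W\<^esub>i\<in>A. (V ^^ k) (x i))"
  by (induction k) (simp_all add: V_finsum assms)

lemma mult_V_funpow:
  assumes "x \<in> carrier W" "y \<in> carrier W"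
  shows "x \<otimes>\<^bsub>W\<^esub> (V ^^ k) y = (V ^^ k) ((F ^^ k) x \<otimes>\<^bsub>W\<^esub> y)"
  using assms
proof (induction k arbitrary: x)
  case (Suc k)
  have "x \<otimes>\<^bsub>W\<^esub> (V ^^ Suc k) y = V (F x \<otimes>\<^bsub>W\<^esub> (V ^^ k) y)"
    using Suc.prems by (simp add: mult_V)
  also have "\<dots> = (V ^^ Suc k) ((F ^^ k) (F x) \<otimes>\<^bsub>W\<^esub> y)"
    using Suc by simp
  also have "(F ^^ k) (F x) = (F ^^ Suc k) x" by (simp add: funpow_swap1)
  finally show ?case .
qed simp

lemma V_funpow_inj: "(V ^^ k) x = (V ^^ k) y \<Longrightarrow> x = y"
  by (induction k) (auto dest: V_inj)

lemma V_funpow_zero: "(V ^^ k) \<zero>\<^bsub>W\<^esub> = \<zero>\<^bsub>W\<^esub>"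
  by (induction k) (simp_all add: V_zero)

lemma eq_V_funpow_shift:
  assumes "\<And>n. n < k \<Longrightarrow> x n = \<zero>"
  shows "x = (V ^^ k) (\<lambda>n. x (n + k))"
  using assms
proof (induction k)
  case (Suc k)
  have "(\<lambda>n. x (n + k)) = V (\<lambda>n. x (Suc n + k))"
    using Suc.prems[of k] eq_V_if_comp_0[of "\<lambda>n. x (n + k)"] by simp
  then have "(V ^^ k) (\<lambda>n. x (n + k)) = (V ^^ Suc k) (\<lambda>n. x (n + Suc k))"
    by (simp add: funpow_swap1)
  with Suc.IH Suc.prems show ?case by (metis less_SucI)
qed simp

end

text \<open>This is the kernel of \<open>W(R) \<rightarrow> W(R/I)\<close>, which is how it is shown to be an ideal.\<close>

definition witt_ideal :: "nat \<Rightarrow> ('a, 'm) ring_scheme \<Rightarrow> 'a set \<Rightarrow> (nat \<Rightarrow> 'a) set" where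
  "witt_ideal p R I = {x \<in> carrier (witt p R). \<forall>n. x n \<in> I}"

context witt_ring
begin

lemma witt_ring_quotient: "ideal I R \<Longrightarrow> witt_ring (R Quot I) p"
  by (simp add: witt_ring_def witt_ring_axioms_def prime_p ideal.quotient_is_cring cring_axioms)

lemma quotient_hom: "ideal I R \<Longrightarrow> ring_hom_cring R (R Quot I) ((+>) I)"
  by (rule ideal.rcos_ring_hom_cring[OF _ cring_axioms])

lemma quotient_eq_zero_iff:
  assumes "ideal I R" "r \<in> carrier R"
  shows "I +> r = \<zero>\<^bsub>R Quot I\<^esub> \<longleftrightarrow> r \<in> I"
proof -
  interpret I: ideal I R by fact
  show ?thesis
    using I.a_rcos_self[OF assms(2)] I.a_rcos_const[of r] by (auto simp: FactRing_def)
qed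

lemma witt_ideal_iff:
  assumes "ideal I R" "x \<in> carrier W"
  shows "x \<in> witt_ideal p R I \<longleftrightarrow> witt_map ((+>) I) x = \<zero>\<^bsub>witt p (R Quot I)\<^esub>"
  using assms by (auto simp: witt_ideal_def zero_witt fun_eq_iff quotient_eq_zero_iff)

lemma ideal_witt_ideal:
  assumes "ideal I R"
  shows "ideal (witt_ideal p R I) W"
proof -
  interpret h: ring_hom_cring R "R Quot I" "(+>) I" by (rule quotient_hom[OF assms])
  interpret H: ring_hom_cring W "witt p (R Quot I)" "\<lambda>x. witt_map ((+>) I) x"
    by (rule h.witt_map_ring_hom_cring[OF prime_p])
  have "witt_ideal p R I = a_kernel W (witt p (R Quot I)) (\<lambda>x. witt_map ((+>) I) x)"
  proof (rule Set.set_eqI)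
    fix x
    have "x \<in> witt_ideal p R I \<Longrightarrow> x \<in> carrier W" by (simp add: witt_ideal_def)
    then show "x \<in> witt_ideal p R I \<longleftrightarrow> x \<in> a_kernel W (witt p (R Quot I)) (\<lambda>x. witt_map ((+>) I) x)"
      unfolding a_kernel_def' using witt_ideal_iff[OF assms, of x] by blast
  qed
  then show ?thesis
    using ring_hom_ring.kernel_is_ideal[OF ring_hom_ringI2[OF W.ring_axioms H.S.ring_axioms H.homh]] by simp
qed

end

section \<open>Rigidity of matrices over Witt vectors\<close>

lemma (in cring) ideal_nat_multiple:
  assumes "ideal I R" "[(p::nat)] \<cdot> \<one> \<in> I" "x \<in> carrier R"
  shows "[p] \<cdot> x \<in> I"
proof -
  interpret I: ideal I R by fact
  show ?thesis unfolding nat_multiple_eq_mult[OF assms(3)] by (rule I.I_r_closed[OF assms(2,3)])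
qed

locale char_p_witt_ring = witt_ring +
  assumes char_p: "[p] \<cdot> \<one> = \<zero>"
begin

lemma p_multiple_zero: "x \<in> carrier R \<Longrightarrow> [p] \<cdot> x = \<zero>"
  by (subst nat_multiple_eq_mult) (simp_all add: char_p)

lemma F_comp_char_p:
  assumes "x \<in> carrier W" shows "F x n = x n [^] p"
  using F_comp[OF assms, of n] p_multiple_zero assms by auto

lemma V_F_eq_F_V:
  assumes "x \<in> carrier W"
  shows "V (F x) = F (V x)"
proof
  fix n
  have "V x \<in> carrier W" using assms by simp
  from F_comp_char_p[OF this, of n] show "V (F x) n = F (V x) n"
    using F_comp_char_p[OF assms] p_pos
    by (cases n) (simp_all add: witt_V_def nat_pow_zero)
qed

lemma F_V_funpow:
  assumes "x \<in> carrier W"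
  shows "F ((V ^^ k) x) = (V ^^ k) (F x)"
  using assms by (induction k) (simp_all add: V_F_eq_F_V[symmetric])

lemma F_funpow_comp_0:
  assumes "x \<in> carrier W"
  shows "(F ^^ k) x 0 = x 0 [^] (p ^ k)"
proof (induction k)
  case (Suc k)
  have "(F ^^ Suc k) x 0 = ((F ^^ k) x 0) [^] p"
    using assms by (simp add: F_comp_char_p)
  then show ?case using Suc assms by (simp add: nat_pow_pow mult.commute)
qed (use assms in simp)

text \<open>The \<open>p\<^sup>k\<close>-th power is additive in characteristic \<open>p\<close>, being the effect of \<open>F\<^sup>k\<close> on the zeroth components
  of Teichmueller elements.\<close>

lemma pow_p_power_hom: "ring_hom_cring R R (\<lambda>r. r [^] (p ^ k))"
proof (intro ring_hom_cringI ring_hom_ringI2 ring_hom_memI cring_axioms ring_axioms)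
  fix x y assume xy: "x \<in> carrier R" "y \<in> carrier R"
  show "(x \<otimes> y) [^] (p ^ k) = x [^] (p ^ k) \<otimes> y [^] (p ^ k)"
    using xy by (simp add: nat_pow_distrib)
  interpret Fk: ring_hom_cring W W "F ^^ k" by (rule ring_hom_F_funpow)
  have "(F ^^ k) (teich R x \<oplus>\<^bsub>W\<^esub> teich R y) 0 = ((F ^^ k) (teich R x) \<oplus>\<^bsub>W\<^esub> (F ^^ k) (teich R y)) 0"
    using xy by simp
  moreover have "(F ^^ k) (teich R x \<oplus>\<^bsub>W\<^esub> teich R y) 0 = ((teich R x \<oplus>\<^bsub>W\<^esub> teich R y) 0) [^] (p ^ k)"
    by (rule F_funpow_comp_0) (use xy in simp)
  moreover have "((F ^^ k) (teich R x) \<oplus>\<^bsub>W\<^esub> (F ^^ k) (teich R y)) 0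
      = teich R x 0 [^] (p ^ k) \<oplus> teich R y 0 [^] (p ^ k)"
    using xy by (simp add: witt_add_0 F_funpow_comp_0)
  moreover have "(teich R x \<oplus>\<^bsub>W\<^esub> teich R y) 0 = teich R x 0 \<oplus> teich R y 0"
    using xy by (simp add: witt_add_0)
  moreover have "teich R r 0 = r" for r by (simp add: teich_def)
  ultimately show "(x \<oplus> y) [^] (p ^ k) = x [^] (p ^ k) \<oplus> y [^] (p ^ k)"
    by metis
qed simp_all

end

text \<open>In characteristic \<open>p\<close>, where \<open>F\<^sup>k\<close> raises zeroth components to the power \<open>p\<^sup>k\<close>, this lifts
  \<open>frob_col\<close> along \<open>W(R) \<rightarrow> R\<close>.\<close>

primrec (in witt_ring) witt_col ::
  "'j set \<Rightarrow> ('j \<Rightarrow> 'j \<Rightarrow> nat \<Rightarrow> 'a) \<Rightarrow> 'j \<Rightarrow> nat \<Rightarrow> 'j \<Rightarrow> nat \<Rightarrow> 'a" where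
  "witt_col J Z j 0 = (\<lambda>i. if i = j then \<one>\<^bsub>W\<^esub> else \<zero>\<^bsub>W\<^esub>)"
| "witt_col J Z j (Suc k) = (\<lambda>i. \<Oplus>\<^bsub>W\<^esub>l\<in>J. (F ^^ k) (Z i l) \<otimes>\<^bsub>W\<^esub> witt_col J Z j k l)"

context witt_ring
begin

lemma witt_col_closed:
  assumes "\<And>i l. i \<in> J \<Longrightarrow> l \<in> J \<Longrightarrow> Z i l \<in> carrier W" "i \<in> J"
  shows "witt_col J Z j k i \<in> carrier W"
  using assms(2) by (induction k arbitrary: i) (auto intro!: W.finsum_closed simp: assms(1))

lemma witt_finsum_comp_0:
  assumes "\<And>i. i \<in> A \<Longrightarrow> x i \<in> carrier W"
  shows "(\<Oplus>\<^bsub>W\<^esub>i\<in>A. x i) 0 = (\<Oplus>i\<in>A. x i 0)"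
  using assms
  by (induction A rule: infinite_finite_induct)
    (simp_all add: zero_witt witt_add_0 Pi_iff)

end

lemma (in char_p_witt_ring) witt_col_comp_0:
  assumes Z: "\<And>i l. i \<in> J \<Longrightarrow> l \<in> J \<Longrightarrow> Z i l \<in> carrier W" "i \<in> J"
  shows "witt_col J Z j k i 0 = frob_col p R J (\<lambda>i l. Z i l 0) 0 j k i"
  using assms(2)
proof (induction k arbitrary: i)
  case 0
  then show ?case by (simp add: one_witt zero_witt)
next
  case (Suc k)
  have "witt_col J Z j (Suc k) i 0 = (\<Oplus>l\<in>J. ((F ^^ k) (Z i l) \<otimes>\<^bsub>W\<^esub> witt_col J Z j k l) 0)"
    by (simp add: witt_finsum_comp_0 Z(1) Suc.prems witt_col_closed)
  also have "\<dots> = frob_col p R J (\<lambda>i l. Z i l 0) 0 j (Suc k) i"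
    using Suc Z(1)
    by (auto intro!: finsum_cong' frob_col_closed simp: witt_mult_0 witt_col_closed F_funpow_comp_0)
  finally show ?case .
qed

text \<open>Suppose \<open>\<gamma> F\<^sup>s(Z) y = 0\<close> for a column \<open>y\<close>. Then \<open>V(\<gamma> F(y)) = V(\<gamma>) y = X \<gamma> F\<^sup>s(Z) y = 0\<close>, hence
  \<open>\<gamma> F(y) = 0\<close>. Let \<open>N\<^sub>k\<close> be the \<open>k\<close>-th column \<open>witt_col\<close>. The zeroth components of \<open>N\<^bsub>s+1\<^esub>\<close> vanish, so
  \<open>N\<^bsub>s+1\<^esub> = V w\<close> and \<open>\<gamma> N\<^bsub>s+1\<^esub> = V(F(\<gamma>) w) = 0\<close>. As \<open>F\<^sup>m(N\<^bsub>s+1-m\<^esub>) = F\<^sup>s(Z) F\<^sup>m(N\<^bsub>s-m\<^esub>)\<close>, the first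
  observation yields \<open>\<gamma> F\<^sup>m(N\<^bsub>s+1-m\<^esub>) = 0\<close> for all \<open>m \<le> s + 1\<close>; at \<open>m = s + 1\<close> the column is a unit
  vector.\<close>

lemma (in char_p_witt_ring) V_matrix_eq_zero_leading:
  fixes \<gamma> :: "'h \<Rightarrow> 'j \<Rightarrow> nat \<Rightarrow> 'a"
  assumes fin: "finite H" "finite J"
    and X: "\<And>k h. k \<in> H \<Longrightarrow> h \<in> H \<Longrightarrow> X k h \<in> carrier W"
    and Z: "\<And>i j. i \<in> J \<Longrightarrow> j \<in> J \<Longrightarrow> Z i j \<in> carrier W"
    and \<gamma>: "\<And>h j. h \<in> H \<Longrightarrow> j \<in> J \<Longrightarrow> \<gamma> h j \<in> carrier W"
    and F\<gamma>: "\<And>h j. h \<in> H \<Longrightarrow> j \<in> J \<Longrightarrow> F (\<gamma> h j) = \<zero>\<^bsub>W\<^esub>"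
    and eq: "\<And>k j. k \<in> H \<Longrightarrow> j \<in> J \<Longrightarrow>
      V (\<gamma> k j) = (\<Oplus>\<^bsub>W\<^esub>h\<in>H. X k h \<otimes>\<^bsub>W\<^esub> (\<Oplus>\<^bsub>W\<^esub>i\<in>J. \<gamma> h i \<otimes>\<^bsub>W\<^esub> (F ^^ s) (Z i j)))"
    and nil: "\<And>i j. i \<in> J \<Longrightarrow> j \<in> J \<Longrightarrow> frob_col p R J (\<lambda>i l. Z i l 0) 0 j (Suc s) i = \<zero>"
    and kj: "k \<in> H" "j \<in> J"
  shows "\<gamma> k j = \<zero>\<^bsub>W\<^esub>"
proof -
  let ?d = "\<lambda>h y. \<Oplus>\<^bsub>W\<^esub>i\<in>J. \<gamma> h i \<otimes>\<^bsub>W\<^esub> y i"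
  let ?col = "\<lambda>k. witt_col J Z j k"
  have col: "?col k i \<in> carrier W" if "i \<in> J" for k i
    using witt_col_closed[OF Z that] .
  have step: "?d k (\<lambda>i. F (y i)) = \<zero>\<^bsub>W\<^esub>"
    if d: "\<And>h. h \<in> H \<Longrightarrow> ?d h (\<lambda>i. \<Oplus>\<^bsub>W\<^esub>l\<in>J. (F ^^ s) (Z i l) \<otimes>\<^bsub>W\<^esub> y l) = \<zero>\<^bsub>W\<^esub>"
      and y: "\<And>i. i \<in> J \<Longrightarrow> y i \<in> carrier W" and k: "k \<in> H" for k y
  proof -
    have "V (?d k (\<lambda>i. F (y i))) = (\<Oplus>\<^bsub>W\<^esub>l\<in>J. V (\<gamma> k l \<otimes>\<^bsub>W\<^esub> F (y l)))"
      by (rule V_finsum) (use fin y k \<gamma> in auto)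
    also have "\<dots> = (\<Oplus>\<^bsub>W\<^esub>l\<in>J. (\<Oplus>\<^bsub>W\<^esub>h\<in>H. X k h \<otimes>\<^bsub>W\<^esub> (\<Oplus>\<^bsub>W\<^esub>i\<in>J. \<gamma> h i \<otimes>\<^bsub>W\<^esub> (F ^^ s) (Z i l))) \<otimes>\<^bsub>W\<^esub> y l)"
    proof (rule W.finsum_cong')
      fix l assume l: "l \<in> J"
      have "V (\<gamma> k l \<otimes>\<^bsub>W\<^esub> F (y l)) = V (\<gamma> k l) \<otimes>\<^bsub>W\<^esub> y l"
        using mult_V[of "y l" "\<gamma> k l"] y[OF l] \<gamma>[OF k l] by (simp add: W.m_comm)
      then show "V (\<gamma> k l \<otimes>\<^bsub>W\<^esub> F (y l)) = (\<Oplus>\<^bsub>W\<^esub>h\<in>H. X k h \<otimes>\<^bsub>W\<^esub> (\<Oplus>\<^bsub>W\<^esub>i\<in>J. \<gamma> h i \<otimes>\<^bsub>W\<^esub> (F ^^ s) (Z i l))) \<otimes>\<^bsub>W\<^esub> y l"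
        by (simp add: eq k l)
    qed (use k y \<gamma> X Z in \<open>auto intro!: W.finsum_closed W.m_closed\<close>)
    also have "\<dots> = (\<Oplus>\<^bsub>W\<^esub>h\<in>H. X k h \<otimes>\<^bsub>W\<^esub> (\<Oplus>\<^bsub>W\<^esub>l\<in>J. (\<Oplus>\<^bsub>W\<^esub>i\<in>J. \<gamma> h i \<otimes>\<^bsub>W\<^esub> (F ^^ s) (Z i l)) \<otimes>\<^bsub>W\<^esub> y l))"
      by (rule W.matrix_assoc) (use fin k y \<gamma> X Z in \<open>auto intro!: W.finsum_closed W.m_closed\<close>)
    also have "\<dots> = (\<Oplus>\<^bsub>W\<^esub>h\<in>H. X k h \<otimes>\<^bsub>W\<^esub> \<zero>\<^bsub>W\<^esub>)"
    proof (rule W.finsum_cong')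
      fix h assume h: "h \<in> H"
      have "(\<Oplus>\<^bsub>W\<^esub>l\<in>J. (\<Oplus>\<^bsub>W\<^esub>i\<in>J. \<gamma> h i \<otimes>\<^bsub>W\<^esub> (F ^^ s) (Z i l)) \<otimes>\<^bsub>W\<^esub> y l) = \<zero>\<^bsub>W\<^esub>"
        unfolding d[OF h, symmetric]
        by (rule W.matrix_assoc) (use fin h y \<gamma> Z in auto)
      then show "X k h \<otimes>\<^bsub>W\<^esub> (\<Oplus>\<^bsub>W\<^esub>l\<in>J. (\<Oplus>\<^bsub>W\<^esub>i\<in>J. \<gamma> h i \<otimes>\<^bsub>W\<^esub> (F ^^ s) (Z i l)) \<otimes>\<^bsub>W\<^esub> y l) = X k h \<otimes>\<^bsub>W\<^esub> \<zero>\<^bsub>W\<^esub>"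
        by simp
    qed (use k X in auto)
    also have "\<dots> = \<zero>\<^bsub>W\<^esub>" using X k by (simp add: W.finsum_zero cong: W.finsum_cong)
    finally show ?thesis by (simp only: V_eq_zero_iff)
  qed
  have chain: "\<forall>h\<in>H. ?d h (\<lambda>i. (F ^^ m) (?col (Suc s - m) i)) = \<zero>\<^bsub>W\<^esub>" if "m \<le> Suc s" for m
    using that
  proof (induction m)
    case 0
    show ?case
    proof
      fix h assume h: "h \<in> H"
      have z: "\<gamma> h i \<otimes>\<^bsub>W\<^esub> ?col (Suc s) i = \<zero>\<^bsub>W\<^esub>" if i: "i \<in> J" for i
      proof -
        let ?w = "\<lambda>n. ?col (Suc s) i (Suc n)"
        have w: "?w \<in> carrier W" using col[OF i, of "Suc s"] by (simp only: carrier_witt) blast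
        have "?col (Suc s) i 0 = \<zero>"
          by (rule trans[OF witt_col_comp_0[where J = J and Z = Z and i = i and j = j and k = "Suc s"] nil[OF i kj(2)]])
            (rule Z i | assumption)+
        then have "?col (Suc s) i = V ?w" by (rule eq_V_if_comp_0)
        then have "\<gamma> h i \<otimes>\<^bsub>W\<^esub> ?col (Suc s) i = \<gamma> h i \<otimes>\<^bsub>W\<^esub> V ?w" by (rule arg_cong)
        also have "\<dots> = V (F (\<gamma> h i) \<otimes>\<^bsub>W\<^esub> ?w)" by (rule mult_V[OF \<gamma>[OF h i] w])
        finally have "\<gamma> h i \<otimes>\<^bsub>W\<^esub> ?col (Suc s) i = V (F (\<gamma> h i) \<otimes>\<^bsub>W\<^esub> ?w)" .
        then show ?thesis using w by (simp only: F\<gamma>[OF h i] W.l_null V_zero)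
      qed
      have "?d h (?col (Suc s)) = (\<Oplus>\<^bsub>W\<^esub>i\<in>J. \<zero>\<^bsub>W\<^esub>)"
      proof (rule W.finsum_cong')
        fix i assume "i \<in> J"
        then show "\<gamma> h i \<otimes>\<^bsub>W\<^esub> ?col (Suc s) i = \<zero>\<^bsub>W\<^esub>" by (rule z)
      qed simp_all
      then show "?d h (\<lambda>i. (F ^^ 0) (?col (Suc s - 0) i)) = \<zero>\<^bsub>W\<^esub>"
        by (simp only: W.finsum_zero funpow_0 diff_zero)
    qed
  next
    case (Suc m)
    define k' where "k' = s - m"
    have sm: "Suc s - m = Suc k'" "Suc s - Suc m = k'" "m + k' = s" using Suc.prems by (auto simp: k'_def)
    interpret Fm: ring_hom_cring W W "F ^^ m" by (rule ring_hom_F_funpow)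
    have shift: "(F ^^ m) (?col (Suc k') i) = (\<Oplus>\<^bsub>W\<^esub>l\<in>J. (F ^^ s) (Z i l) \<otimes>\<^bsub>W\<^esub> (F ^^ m) (?col k' l))"
      if i: "i \<in> J" for i
    proof -
      have "(F ^^ m) (?col (Suc k') i) = (\<Oplus>\<^bsub>W\<^esub>l\<in>J. (F ^^ m) ((F ^^ k') (Z i l) \<otimes>\<^bsub>W\<^esub> ?col k' l))"
        using i Z col by (simp add: Pi_iff o_def)
      also have "\<dots> = (\<Oplus>\<^bsub>W\<^esub>l\<in>J. (F ^^ s) (Z i l) \<otimes>\<^bsub>W\<^esub> (F ^^ m) (?col k' l))"
      proof (rule W.finsum_cong')
        fix l assume l: "l \<in> J"
        have "(F ^^ m) ((F ^^ k') (Z i l)) = (F ^^ s) (Z i l)"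
          unfolding sm(3)[symmetric] funpow_add by simp
        then show "(F ^^ m) ((F ^^ k') (Z i l) \<otimes>\<^bsub>W\<^esub> ?col k' l) = (F ^^ s) (Z i l) \<otimes>\<^bsub>W\<^esub> (F ^^ m) (?col k' l)"
          using Fm.hom_mult[of "(F ^^ k') (Z i l)" "?col k' l"] Z[OF i l] col[OF l] by simp
      qed (use i Z col in auto)
      finally show ?thesis .
    qed
    have IH: "?d h (\<lambda>i. (F ^^ m) (?col (Suc k') i)) = \<zero>\<^bsub>W\<^esub>" if "h \<in> H" for h
      using Suc that by (simp only: sm)
    have "?d h (\<lambda>i. \<Oplus>\<^bsub>W\<^esub>l\<in>J. (F ^^ s) (Z i l) \<otimes>\<^bsub>W\<^esub> (F ^^ m) (?col k' l)) = \<zero>\<^bsub>W\<^esub>" if h: "h \<in> H" for h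
      unfolding IH[OF h, symmetric]
    proof (rule W.finsum_cong')
      fix i assume i: "i \<in> J"
      show "\<gamma> h i \<otimes>\<^bsub>W\<^esub> (\<Oplus>\<^bsub>W\<^esub>l\<in>J. (F ^^ s) (Z i l) \<otimes>\<^bsub>W\<^esub> (F ^^ m) (?col k' l))
          = \<gamma> h i \<otimes>\<^bsub>W\<^esub> (F ^^ m) (?col (Suc k') i)"
        by (simp only: shift[OF i])
    qed (use h \<gamma> col in \<open>simp_all add: Pi_iff del: witt_col.simps\<close>)
    then have "?d h (\<lambda>i. F ((F ^^ m) (?col k' i))) = \<zero>\<^bsub>W\<^esub>" if "h \<in> H" for h
      by (rule step) (use col that in auto)
    then show ?case unfolding sm funpow.simps o_apply by blast
  qed
  interpret Fs: ring_hom_cring W W "F ^^ Suc s" by (rule ring_hom_F_funpow)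
  have "?d k (\<lambda>i. (F ^^ Suc s) (?col 0 i)) = \<zero>\<^bsub>W\<^esub>"
    using chain[of "Suc s"] kj(1) by (simp only: diff_self_eq_0 order_refl)
  moreover have "(F ^^ Suc s) (?col 0 i) = (if i = j then \<one>\<^bsub>W\<^esub> else \<zero>\<^bsub>W\<^esub>)" for i
    by (simp add: Fs.hom_one Fs.hom_zero del: funpow.simps)
  ultimately have "(\<Oplus>\<^bsub>W\<^esub>i\<in>J. \<gamma> k i \<otimes>\<^bsub>W\<^esub> (if i = j then \<one>\<^bsub>W\<^esub> else \<zero>\<^bsub>W\<^esub>)) = \<zero>\<^bsub>W\<^esub>"
    by simp
  then show ?thesis
    using W.finsum_mult_delta[OF fin(2) kj(2), of "\<gamma> k"] \<gamma>[OF kj(1)] by simp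
qed

text \<open>Vanishing of the first \<open>s\<close> components makes \<open>\<beta> = V\<^sup>s \<gamma>\<close>. In characteristic \<open>p\<close> the operators \<open>F\<close> and
  \<open>V\<close> commute, so the equation for \<open>\<beta>\<close> becomes one for \<open>\<gamma>\<close> with \<open>X\<close> and \<open>Z\<close> replaced by their
  images under \<open>F\<^sup>s\<close>.\<close>

lemma (in char_p_witt_ring) V_matrix_eq_zero_char_p:
  fixes \<beta> :: "'h \<Rightarrow> 'j \<Rightarrow> nat \<Rightarrow> 'a"
  assumes fin: "finite H" "finite J"
    and X: "\<And>k h. k \<in> H \<Longrightarrow> h \<in> H \<Longrightarrow> X k h \<in> carrier W"
    and Z: "\<And>i j. i \<in> J \<Longrightarrow> j \<in> J \<Longrightarrow> Z i j \<in> carrier W"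
    and \<beta>: "\<And>h j. h \<in> H \<Longrightarrow> j \<in> J \<Longrightarrow> \<beta> h j \<in> carrier W"
    and F\<beta>: "\<And>h j. h \<in> H \<Longrightarrow> j \<in> J \<Longrightarrow> F (\<beta> h j) = \<zero>\<^bsub>W\<^esub>"
    and eq: "\<And>k j. k \<in> H \<Longrightarrow> j \<in> J \<Longrightarrow>
      V (\<beta> k j) = (\<Oplus>\<^bsub>W\<^esub>h\<in>H. X k h \<otimes>\<^bsub>W\<^esub> (\<Oplus>\<^bsub>W\<^esub>i\<in>J. \<beta> h i \<otimes>\<^bsub>W\<^esub> Z i j))"
    and nil: "\<And>i j. i \<in> J \<Longrightarrow> j \<in> J \<Longrightarrow> frob_col p R J (\<lambda>i l. Z i l 0) 0 j (Suc s) i = \<zero>"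
    and small: "\<And>h j n. h \<in> H \<Longrightarrow> j \<in> J \<Longrightarrow> n < s \<Longrightarrow> \<beta> h j n = \<zero>"
    and kj: "k \<in> H" "j \<in> J"
  shows "\<beta> k j = \<zero>\<^bsub>W\<^esub>"
proof -
  define \<gamma> where "\<gamma> = (\<lambda>h j n. \<beta> h j (n + s))"
  have \<gamma>: "\<gamma> h j \<in> carrier W" if "h \<in> H" "j \<in> J" for h j
    using \<beta>[OF that] by (auto simp: \<gamma>_def carrier_witt)
  have \<beta>\<gamma>: "\<beta> h j = (V ^^ s) (\<gamma> h j)" if "h \<in> H" "j \<in> J" for h j
    unfolding \<gamma>_def by (rule eq_V_funpow_shift) (rule small[OF that])
  have F\<gamma>: "F (\<gamma> h j) = \<zero>\<^bsub>W\<^esub>" if "h \<in> H" "j \<in> J" for h j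
    using F\<beta>[OF that] F_V_funpow[OF \<gamma>[OF that], of s] V_funpow_inj[of s] V_funpow_zero[of s]
    by (metis \<beta>\<gamma>[OF that])
  have mV: "(V ^^ s) y \<otimes>\<^bsub>W\<^esub> x = (V ^^ s) (y \<otimes>\<^bsub>W\<^esub> (F ^^ s) x)" if "x \<in> carrier W" "y \<in> carrier W" for x y
    using mult_V_funpow[OF that, of s] that by (simp add: W.m_comm)
  have eq': "V (\<gamma> k j) = (\<Oplus>\<^bsub>W\<^esub>h\<in>H. (F ^^ s) (X k h) \<otimes>\<^bsub>W\<^esub> (\<Oplus>\<^bsub>W\<^esub>i\<in>J. \<gamma> h i \<otimes>\<^bsub>W\<^esub> (F ^^ s) (Z i j)))"
    if k: "k \<in> H" and j: "j \<in> J" for k j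
  proof -
    let ?s = "\<lambda>h. \<Oplus>\<^bsub>W\<^esub>i\<in>J. \<gamma> h i \<otimes>\<^bsub>W\<^esub> (F ^^ s) (Z i j)"
    have s: "?s h \<in> carrier W" if "h \<in> H" for h
      using that \<gamma> Z j by (auto intro!: W.finsum_closed)
    have inner: "(\<Oplus>\<^bsub>W\<^esub>i\<in>J. \<beta> h i \<otimes>\<^bsub>W\<^esub> Z i j) = (V ^^ s) (?s h)" if h: "h \<in> H" for h
    proof -
      have "(\<Oplus>\<^bsub>W\<^esub>i\<in>J. \<beta> h i \<otimes>\<^bsub>W\<^esub> Z i j) = (\<Oplus>\<^bsub>W\<^esub>i\<in>J. (V ^^ s) (\<gamma> h i \<otimes>\<^bsub>W\<^esub> (F ^^ s) (Z i j)))"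
        by (rule W.finsum_cong') (use h j \<gamma> Z in \<open>auto simp: \<beta>\<gamma> mV\<close>)
      also have "\<dots> = (V ^^ s) (?s h)"
        by (rule V_funpow_finsum[symmetric]) (use fin h j \<gamma> Z in auto)
      finally show ?thesis .
    qed
    have "(V ^^ s) (V (\<gamma> k j)) = V (\<beta> k j)"
      unfolding \<beta>\<gamma>[OF k j] by (simp add: funpow_swap1)
    also have "\<dots> = (\<Oplus>\<^bsub>W\<^esub>h\<in>H. (V ^^ s) ((F ^^ s) (X k h) \<otimes>\<^bsub>W\<^esub> ?s h))"
      unfolding eq[OF k j]
      by (rule W.finsum_cong') (use k X s in \<open>auto simp: inner mult_V_funpow\<close>)
    also have "\<dots> = (V ^^ s) (\<Oplus>\<^bsub>W\<^esub>h\<in>H. (F ^^ s) (X k h) \<otimes>\<^bsub>W\<^esub> ?s h)"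
      by (rule V_funpow_finsum[symmetric]) (use fin k X s in auto)
    finally show ?thesis by (rule V_funpow_inj)
  qed
  have "\<gamma> k j = \<zero>\<^bsub>W\<^esub>"
    by (rule V_matrix_eq_zero_leading[where \<gamma> = \<gamma> and X = "\<lambda>k h. (F ^^ s) (X k h)" and Z = Z,
          OF fin _ Z \<gamma> F\<gamma> eq' nil kj]) (use X in auto)
  then show ?thesis using \<beta>\<gamma>[OF kj] V_funpow_zero by simp
qed

lemma (in ring_hom_cring) hom_nat_multiple: "x \<in> carrier R \<Longrightarrow> h ([(k::nat)] \<cdot> x) = [k] \<cdot>\<^bsub>S\<^esub> h x"
  by (induction k) (simp_all add: R.add.nat_pow_Suc S.add.nat_pow_Suc)

lemma (in ring_hom_cring) hom_minus:
  "x \<in> carrier R \<Longrightarrow> y \<in> carrier R \<Longrightarrow> h (x \<ominus> y) = h x \<ominus>\<^bsub>S\<^esub> h y"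
  by (simp add: a_minus_def)

lemma (in ring_hom_cring) hom_matrix_sum:
  assumes "\<And>h. h \<in> H \<Longrightarrow> X h \<in> carrier R" "\<And>h i. h \<in> H \<Longrightarrow> i \<in> J \<Longrightarrow> B h i \<in> carrier R"
    "\<And>i. i \<in> J \<Longrightarrow> z i \<in> carrier R"
  shows "h (\<Oplus>g\<in>H. X g \<otimes> (\<Oplus>i\<in>J. B g i \<otimes> z i))
    = (\<Oplus>\<^bsub>S\<^esub>g\<in>H. h (X g) \<otimes>\<^bsub>S\<^esub> (\<Oplus>\<^bsub>S\<^esub>i\<in>J. h (B g i) \<otimes>\<^bsub>S\<^esub> h (z i)))"
proof -
  have inner: "h (\<Oplus>i\<in>J. B g i \<otimes> z i) = (\<Oplus>\<^bsub>S\<^esub>i\<in>J. h (B g i) \<otimes>\<^bsub>S\<^esub> h (z i))" if "g \<in> H" for g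
    using assms that by (simp add: Pi_iff o_def cong: S.finsum_cong)
  have "h (\<Oplus>g\<in>H. X g \<otimes> (\<Oplus>i\<in>J. B g i \<otimes> z i)) = (\<Oplus>\<^bsub>S\<^esub>g\<in>H. h (X g \<otimes> (\<Oplus>i\<in>J. B g i \<otimes> z i)))"
    by (subst hom_finsum) (use assms in \<open>auto intro!: R.finsum_closed simp: o_def\<close>)
  also have "\<dots> = (\<Oplus>\<^bsub>S\<^esub>g\<in>H. h (X g) \<otimes>\<^bsub>S\<^esub> (\<Oplus>\<^bsub>S\<^esub>i\<in>J. h (B g i) \<otimes>\<^bsub>S\<^esub> h (z i)))"
    by (rule S.finsum_cong')
      (use assms in \<open>auto simp: inner[symmetric] intro!: R.finsum_closed\<close>)
  finally show ?thesis .
qed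

context witt_ring
begin

lemma char_p_witt_ring_quotient:
  assumes "ideal C R" "[p] \<cdot> \<one> \<in> C"
  shows "char_p_witt_ring (R Quot C) p"
proof -
  interpret Q: witt_ring "R Quot C" p by (rule witt_ring_quotient[OF assms(1)])
  interpret h: ring_hom_cring R "R Quot C" "(+>) C" by (rule quotient_hom[OF assms(1)])
  have "[p] \<cdot>\<^bsub>R Quot C\<^esub> \<one>\<^bsub>R Quot C\<^esub> = C +> ([p] \<cdot> \<one>)"
    using h.hom_nat_multiple[of \<one> p] by simp
  also have "\<dots> = \<zero>\<^bsub>R Quot C\<^esub>" using assms by (subst quotient_eq_zero_iff) auto
  finally show ?thesis by unfold_locales
qed

lemma p_one_in_p_ideal: "[p] \<cdot> \<one> \<in> p_ideal p R"
  unfolding p_ideal_iff by (rule bexI[of _ \<one>]) simp_all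

text \<open>Modulo \<open>p\<close> the shifted product is the image of the unshifted one under the \<open>p\<^sup>t\<close>-th power map.\<close>

lemma frob_col_shift_in_p_ideal:
  assumes z: "\<And>i l. i \<in> J \<Longrightarrow> l \<in> J \<Longrightarrow> z i l \<in> carrier R" and i: "i \<in> J"
    and nil: "frob_col p R J z 0 j k i \<in> p_ideal p R"
  shows "frob_col p R J z t j k i \<in> p_ideal p R"
proof -
  let ?C = "p_ideal p R"
  let ?Q = "R Quot ?C"
  interpret Q: char_p_witt_ring ?Q p
    by (rule char_p_witt_ring_quotient[OF ideal_p_ideal p_one_in_p_ideal])
  interpret h: ring_hom_cring R ?Q "(+>) ?C" by (rule quotient_hom[OF ideal_p_ideal])
  interpret f: ring_hom_cring ?Q ?Q "\<lambda>r. r [^]\<^bsub>?Q\<^esub> (p ^ t)" by (rule Q.pow_p_power_hom)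
  let ?z = "\<lambda>i l. ?C +> z i l"
  have hz: "?z i l \<in> carrier ?Q" if "i \<in> J" "l \<in> J" for i l using z[OF that] by simp
  have shift: "frob_col p ?Q J (\<lambda>i l. ?z i l [^]\<^bsub>?Q\<^esub> (p ^ t)) 0 j k i = frob_col p ?Q J ?z t j k i"
    if "i \<in> J" for i
    using that
  proof (induction k arbitrary: i)
    case (Suc k)
    show ?case
      unfolding frob_col.simps
    proof (rule Q.finsum_cong')
      fix l assume l: "l \<in> J"
      show "(?z i l [^]\<^bsub>?Q\<^esub> p ^ t) [^]\<^bsub>?Q\<^esub> p ^ (0 + k) \<otimes>\<^bsub>?Q\<^esub>
          frob_col p ?Q J (\<lambda>i l. ?z i l [^]\<^bsub>?Q\<^esub> p ^ t) 0 j k l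
        = ?z i l [^]\<^bsub>?Q\<^esub> p ^ (t + k) \<otimes>\<^bsub>?Q\<^esub> frob_col p ?Q J ?z t j k l"
        unfolding Suc.IH[OF l] using hz[OF Suc.prems l] by (simp add: Q.nat_pow_pow power_add)
    qed (use hz Suc.prems in \<open>simp_all add: Pi_iff Q.frob_col_closed\<close>)
  qed simp
  have cR: "frob_col p R J z t j k i \<in> carrier R" for t by (rule frob_col_closed[OF z i])
  have "?C +> frob_col p R J z t j k i = frob_col p ?Q J ?z t j k i"
    by (rule h.hom_frob_col[OF z i])
  also have "\<dots> = (frob_col p ?Q J ?z 0 j k i) [^]\<^bsub>?Q\<^esub> (p ^ t)"
    using shift[OF i] f.hom_frob_col[where J = J and z = ?z and i = i and t = 0 and j = j and k = k] hz i by simp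
  also have "frob_col p ?Q J ?z 0 j k i = ?C +> frob_col p R J z 0 j k i"
    by (rule h.hom_frob_col[OF z i, symmetric])
  also have "\<dots> = \<zero>\<^bsub>?Q\<^esub>"
    using nil quotient_eq_zero_iff[OF ideal_p_ideal cR] by (rule iffD2[rotated])
  also have "\<zero>\<^bsub>?Q\<^esub> [^]\<^bsub>?Q\<^esub> (p ^ t) = \<zero>\<^bsub>?Q\<^esub>"
    using p_pos by (simp add: Q.nat_pow_zero)
  finally show ?thesis
    using quotient_eq_zero_iff[OF ideal_p_ideal cR] by (rule iffD1[rotated])
qed

lemma nat_pow_ge_2_in_ideal:
  assumes "ideal A R" "x \<in> carrier R" "x \<otimes> x \<in> A" "2 \<le> (k::nat)"
  shows "x [^] k \<in> A"
proof -
  interpret A: ideal A R by fact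
  obtain q where q: "k = q + 2" using assms(4) by (metis add.commute le_Suc_ex)
  have "x [^] k = x [^] q \<otimes> (x \<otimes> x)"
    using assms(2) by (simp add: q m_assoc)
  then show ?thesis using A.I_l_closed[OF assms(3)] assms(2) by simp
qed

text \<open>Componentwise \<open>F x\<close> is \<open>x\<^sup>p + p g\<close>, and \<open>p \<ge> 2\<close>.\<close>

lemma F_in_witt_ideal:
  assumes "ideal A R" "ideal B R" "\<And>u v. u \<in> B \<Longrightarrow> v \<in> B \<Longrightarrow> u \<otimes> v \<in> A"
    "\<And>u. u \<in> B \<Longrightarrow> [p] \<cdot> u \<in> A" and x: "x \<in> witt_ideal p R B"
  shows "F x \<in> witt_ideal p R A"
proof -
  interpret A: ideal A R by fact
  have xW: "x \<in> carrier W" and xB: "\<And>n. x n \<in> B" using x by (auto simp: witt_ideal_def)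
  have "F x n \<in> A" for n
  proof -
    obtain g where "F x n = x n [^] p \<oplus> [p] \<cdot> g" "g \<in> B"
      using F_comp[OF xW, of n] assms(2) xB by blast
    then show ?thesis
      using nat_pow_ge_2_in_ideal[OF assms(1) _ assms(3)[OF xB xB] p_ge_2] assms(4) xW by simp
  qed
  then show ?thesis using xW by (simp add: witt_ideal_def)
qed

context
  fixes I
  assumes I: "ideal I R"
    and I2: "\<And>u v. u \<in> I \<Longrightarrow> v \<in> I \<Longrightarrow> u \<otimes> v = \<zero>"
    and pI: "\<And>u. u \<in> I \<Longrightarrow> [p] \<cdot> u = \<zero>"
begin

lemma F_zero_on_square_zero:
  assumes "x \<in> witt_ideal p R I"
  shows "F x = \<zero>\<^bsub>W\<^esub>"
proof -
  have "F x \<in> witt_ideal p R {\<zero>}"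
    by (rule F_in_witt_ideal[OF zeroideal I]) (use I2 pI assms in auto)
  then show ?thesis by (auto simp: witt_ideal_def zero_witt)
qed

text \<open>Split \<open>w\<close> into a Teichmueller element and \<open>V w'\<close>; the latter annihilates \<open>x\<close> because \<open>F x = 0\<close>.\<close>

lemma mult_comp_square_zero:
  assumes w: "w \<in> carrier W" and x: "x \<in> witt_ideal p R I"
  shows "(w \<otimes>\<^bsub>W\<^esub> x) n = w 0 [^] (p ^ n) \<otimes> x n"
proof -
  have xW: "x \<in> carrier W" using x by (simp add: witt_ideal_def)
  let ?w = "\<lambda>n. w (Suc n)"
  have wW: "?w \<in> carrier W" using w by (simp add: carrier_witt)
  have "V ?w \<otimes>\<^bsub>W\<^esub> x = V (F x \<otimes>\<^bsub>W\<^esub> ?w)"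
    using mult_V[OF xW wW] wW xW by (simp add: W.m_comm)
  also have "\<dots> = \<zero>\<^bsub>W\<^esub>" using wW by (simp add: F_zero_on_square_zero[OF x] V_zero)
  finally have V0: "V ?w \<otimes>\<^bsub>W\<^esub> x = \<zero>\<^bsub>W\<^esub>" .
  have "w \<otimes>\<^bsub>W\<^esub> x = (teich R (w 0) \<oplus>\<^bsub>W\<^esub> V ?w) \<otimes>\<^bsub>W\<^esub> x"
    using witt_decompose[OF w] by (rule arg_cong)
  also have "\<dots> = teich R (w 0) \<otimes>\<^bsub>W\<^esub> x"
    using w wW xW by (simp add: W.l_distr V0)
  finally show ?thesis using teich_mult[OF _ xW, of "w 0" n] w by simp
qed

lemma finsum_comp_square_zero:
  assumes "\<And>i. i \<in> A \<Longrightarrow> x i \<in> witt_ideal p R I"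
  shows "(\<Oplus>\<^bsub>W\<^esub>i\<in>A. x i) n = (\<Oplus>i\<in>A. x i n)"
  using assms
proof (induction A rule: infinite_finite_induct)
  case (insert a A)
  have xW: "\<And>i. i \<in> insert a A \<Longrightarrow> x i \<in> carrier W" using insert(4) by (simp add: witt_ideal_def)
  have xR: "\<And>i. i \<in> insert a A \<Longrightarrow> x i n \<in> carrier R" using xW by simp
  have s: "(\<Oplus>\<^bsub>W\<^esub>i\<in>A. x i) \<in> witt_ideal p R I"
    by (rule W.finsum_in_subgroup[OF ideal.axioms(1)[OF ideal_witt_ideal[OF I]]]) (simp add: insert(4))
  have "(\<Oplus>\<^bsub>W\<^esub>i\<in>insert a A. x i) n = (x a \<oplus>\<^bsub>W\<^esub> (\<Oplus>\<^bsub>W\<^esub>i\<in>A. x i)) n"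
    using insert(1,2) xW by (simp add: Pi_iff)
  also have "\<dots> = x a n \<oplus> (\<Oplus>\<^bsub>W\<^esub>i\<in>A. x i) n"
    by (rule witt_add_square_zero[OF I I2]) (use s insert(4)[of a] in \<open>auto simp: witt_ideal_def\<close>)
  also have "\<dots> = (\<Oplus>i\<in>insert a A. x i n)"
    using insert(1,2,3,4) xR by (subst finsum_insert) (auto simp: Pi_iff)
  finally show ?case .
qed (simp_all add: zero_witt)

text \<open>Let \<open>\<beta>\<^sub>n\<close> be the matrix of \<open>n\<close>-th components. The equation says
  \<open>\<beta>\<^sub>n = X\<^sub>0\<^bsup>(p^(n+1))\<^esup> \<beta>\<^bsub>n+1\<^esub> Z\<^sub>0\<^bsup>(p^(n+1))\<^esup>\<close>. After \<open>e\<close> iterations the right factors multiply to a matrix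
  that is divisible by \<open>p\<close>, and \<open>p\<close> kills \<open>\<beta>\<^bsub>n+e\<^esub>\<close>. The argument runs on columns, as before.\<close>

lemma V_matrix_eq_zero_square_zero:
  fixes \<beta> :: "'h \<Rightarrow> 'j \<Rightarrow> nat \<Rightarrow> 'a"
  assumes fin: "finite H" "finite J"
    and X: "\<And>k h. k \<in> H \<Longrightarrow> h \<in> H \<Longrightarrow> X k h \<in> carrier W"
    and Z: "\<And>i j. i \<in> J \<Longrightarrow> j \<in> J \<Longrightarrow> Z i j \<in> carrier W"
    and \<beta>: "\<And>h j. h \<in> H \<Longrightarrow> j \<in> J \<Longrightarrow> \<beta> h j \<in> witt_ideal p R I"
    and eq: "\<And>k j. k \<in> H \<Longrightarrow> j \<in> J \<Longrightarrow>
      V (\<beta> k j) = (\<Oplus>\<^bsub>W\<^esub>h\<in>H. X k h \<otimes>\<^bsub>W\<^esub> (\<Oplus>\<^bsub>W\<^esub>i\<in>J. \<beta> h i \<otimes>\<^bsub>W\<^esub> Z i j))"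
    and nil: "\<And>i j. i \<in> J \<Longrightarrow> j \<in> J \<Longrightarrow> frob_col p R J (\<lambda>i l. Z i l 0) 0 j e i \<in> p_ideal p R"
    and kj: "k \<in> H" "j \<in> J"
  shows "\<beta> k j = \<zero>\<^bsub>W\<^esub>"
proof -
  note WI = ideal_witt_ideal[OF I]
  have \<beta>I: "\<beta> h j n \<in> I" if "h \<in> H" "j \<in> J" for h j n
    using \<beta>[OF that] by (simp add: witt_ideal_def)
  have \<beta>R: "\<beta> h j n \<in> carrier R" if "h \<in> H" "j \<in> J" for h j n
    by (rule ideal.Icarr[OF I \<beta>I[OF that]])
  let ?d = "\<lambda>n h y. \<Oplus>i\<in>J. \<beta> h i n \<otimes> y i"
  let ?z = "\<lambda>n i l. Z i l 0 [^] (p ^ n)"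
  have zR: "?z n i l \<in> carrier R" if "i \<in> J" "l \<in> J" for n i l using Z[OF that] by simp
  have comp: "\<beta> k l n = (\<Oplus>h\<in>H. X k h 0 [^] (p ^ Suc n) \<otimes> (\<Oplus>i\<in>J. \<beta> h i (Suc n) \<otimes> ?z (Suc n) i l))"
    if k: "k \<in> H" and l: "l \<in> J" for k l n
  proof -
    have in1: "\<beta> h i \<otimes>\<^bsub>W\<^esub> Z i l \<in> witt_ideal p R I" if "h \<in> H" "i \<in> J" for h i
      using ideal.I_r_closed[OF WI \<beta>[OF that] Z[OF that(2) l]] .
    have in2: "(\<Oplus>\<^bsub>W\<^esub>i\<in>J. \<beta> h i \<otimes>\<^bsub>W\<^esub> Z i l) \<in> witt_ideal p R I" if "h \<in> H" for h
      by (rule W.finsum_in_subgroup[OF ideal.axioms(1)[OF WI]]) (rule in1[OF that])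
    have "\<beta> k l n = V (\<beta> k l) (Suc n)" by (simp add: witt_V_def)
    also have "\<dots> = (\<Oplus>h\<in>H. (X k h \<otimes>\<^bsub>W\<^esub> (\<Oplus>\<^bsub>W\<^esub>i\<in>J. \<beta> h i \<otimes>\<^bsub>W\<^esub> Z i l)) (Suc n))"
      unfolding eq[OF k l] by (rule finsum_comp_square_zero) (use ideal.I_l_closed[OF WI in2 X[OF k]] in simp)
    also have "\<dots> = (\<Oplus>h\<in>H. X k h 0 [^] (p ^ Suc n) \<otimes> (\<Oplus>i\<in>J. \<beta> h i (Suc n) \<otimes> ?z (Suc n) i l))"
    proof (rule finsum_cong')
      fix h assume h: "h \<in> H"
      have "(\<Oplus>\<^bsub>W\<^esub>i\<in>J. \<beta> h i \<otimes>\<^bsub>W\<^esub> Z i l) (Suc n) = (\<Oplus>i\<in>J. (\<beta> h i \<otimes>\<^bsub>W\<^esub> Z i l) (Suc n))"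
        by (rule finsum_comp_square_zero) (rule in1[OF h])
      also have "\<dots> = (\<Oplus>i\<in>J. \<beta> h i (Suc n) \<otimes> ?z (Suc n) i l)"
      proof (rule finsum_cong')
        fix i assume i: "i \<in> J"
        have "\<beta> h i \<otimes>\<^bsub>W\<^esub> Z i l = Z i l \<otimes>\<^bsub>W\<^esub> \<beta> h i"
          using ideal.Icarr[OF WI \<beta>[OF h i]] Z[OF i l] by (rule W.m_comm)
        then show "(\<beta> h i \<otimes>\<^bsub>W\<^esub> Z i l) (Suc n) = \<beta> h i (Suc n) \<otimes> ?z (Suc n) i l"
          using mult_comp_square_zero[OF Z[OF i l] \<beta>[OF h i], of "Suc n"] \<beta>R[OF h i] zR[OF i l]
          by (simp add: m_comm del: power_Suc)
      qed (use \<beta>R[OF h] zR l in \<open>auto simp del: power_Suc\<close>)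
      finally show "(X k h \<otimes>\<^bsub>W\<^esub> (\<Oplus>\<^bsub>W\<^esub>i\<in>J. \<beta> h i \<otimes>\<^bsub>W\<^esub> Z i l)) (Suc n)
          = X k h 0 [^] (p ^ Suc n) \<otimes> (\<Oplus>i\<in>J. \<beta> h i (Suc n) \<otimes> ?z (Suc n) i l)"
        using mult_comp_square_zero[OF X[OF k h] in2[OF h], of "Suc n"] by simp
    qed (use k l X \<beta>R zR in \<open>auto intro!: finsum_closed m_closed simp del: power_Suc\<close>)
    finally show ?thesis .
  qed
  have step: "?d n k y = \<zero>"
    if d: "\<And>h. h \<in> H \<Longrightarrow> ?d (Suc n) h (\<lambda>i. \<Oplus>l\<in>J. ?z (Suc n) i l \<otimes> y l) = \<zero>"
      and y: "\<And>i. i \<in> J \<Longrightarrow> y i \<in> carrier R" and k: "k \<in> H" for n k y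
  proof -
    have "?d n k y = (\<Oplus>l\<in>J. (\<Oplus>h\<in>H. X k h 0 [^] (p ^ Suc n) \<otimes> (\<Oplus>i\<in>J. \<beta> h i (Suc n) \<otimes> ?z (Suc n) i l)) \<otimes> y l)"
      by (rule finsum_cong')
        (use k y X \<beta>R zR comp in \<open>auto intro!: finsum_closed m_closed simp del: power_Suc\<close>)
    also have "\<dots> = (\<Oplus>h\<in>H. X k h 0 [^] (p ^ Suc n) \<otimes> (\<Oplus>l\<in>J. (\<Oplus>i\<in>J. \<beta> h i (Suc n) \<otimes> ?z (Suc n) i l) \<otimes> y l))"
      by (rule matrix_assoc) (use fin k y X \<beta>R zR in \<open>auto intro!: finsum_closed m_closed simp del: power_Suc\<close>)
    also have "\<dots> = (\<Oplus>h\<in>H. \<zero>)"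
    proof (rule finsum_cong')
      fix h assume h: "h \<in> H"
      have "(\<Oplus>l\<in>J. (\<Oplus>i\<in>J. \<beta> h i (Suc n) \<otimes> ?z (Suc n) i l) \<otimes> y l) = \<zero>"
        unfolding d[OF h, symmetric] by (rule matrix_assoc) (use fin h y \<beta>R zR in \<open>auto simp del: power_Suc\<close>)
      then show "X k h 0 [^] (p ^ Suc n) \<otimes> (\<Oplus>l\<in>J. (\<Oplus>i\<in>J. \<beta> h i (Suc n) \<otimes> ?z (Suc n) i l) \<otimes> y l) = \<zero>"
        using X[OF k h] by simp
    qed auto
    finally show ?thesis by (simp add: finsum_zero)
  qed
  have zR0: "Z i l 0 \<in> carrier R" if "i \<in> J" "l \<in> J" for i l using Z[OF that] by simp
  have "\<beta> k j n = \<zero>" for n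
  proof -
    let ?c = "\<lambda>m. frob_col p R J (\<lambda>i l. Z i l 0) (Suc n) j m"
    have cR: "?c m i \<in> carrier R" if "i \<in> J" for m i by (rule frob_col_closed[OF zR0 that])
    have "\<forall>h\<in>H. ?d (n + (e - m)) h (?c (e - m)) = \<zero>" if "m \<le> e" for m
      using that
    proof (induction m)
      case 0
      have "\<beta> h i (n + e) \<otimes> ?c e i = \<zero>" if h: "h \<in> H" and i: "i \<in> J" for h i
      proof -
        have "?c e i \<in> p_ideal p R"
          by (rule frob_col_shift_in_p_ideal[OF zR0 i nil[OF i kj(2)]])
        then obtain r where r: "r \<in> carrier R" "?c e i = r \<otimes> ([p] \<cdot> \<one>)" by (auto simp: p_ideal_iff)
        have "\<beta> h i (n + e) \<otimes> ?c e i = r \<otimes> (([p] \<cdot> \<one>) \<otimes> \<beta> h i (n + e))"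
          using r \<beta>R[OF h i] by (simp add: m_ac)
        also have "([p] \<cdot> \<one>) \<otimes> \<beta> h i (n + e) = \<zero>"
          using pI[OF \<beta>I[OF h i]] nat_multiple_eq_mult[OF \<beta>R[OF h i]] by metis
        finally show ?thesis using r by simp
      qed
      then have "?d (n + e) h (?c e) = (\<Oplus>i\<in>J. \<zero>)" if "h \<in> H" for h
        using that by (intro finsum_cong') auto
      then show ?case by (simp add: finsum_zero)
    next
      case (Suc m)
      define q where "q = e - Suc m"
      have q: "e - m = Suc q" using Suc.prems by (simp add: q_def)
      have "?d (n + q) h (?c q) = \<zero>" if "h \<in> H" for h
      proof (rule step[OF _ _ that])
        fix h assume h: "h \<in> H"
        show "?d (Suc (n + q)) h (\<lambda>i. \<Oplus>l\<in>J. ?z (Suc (n + q)) i l \<otimes> ?c q l) = \<zero>"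
          using Suc h by (simp add: q)
      qed (rule cR)
      then show ?case by (simp add: q_def)
    qed
    from this[of e] have "?d n k (?c 0) = \<zero>" using kj(1) by simp
    then show ?thesis using finsum_mult_delta[OF fin(2) kj(2), of "\<lambda>i. \<beta> k i n"] \<beta>R[OF kj(1)] by simp
  qed
  then show ?thesis by (auto simp: zero_witt)
qed

end

end

section \<open>Descent along a chain of ideals\<close>

context cring
begin

lemma add_principal_iff:
  assumes "ideal A R" "x \<in> carrier R"
  shows "u \<in> PIdl x <+>\<^bsub>R\<^esub> A \<longleftrightarrow> (\<exists>r\<in>carrier R. \<exists>a\<in>A. u = r \<otimes> x \<oplus> a)"
  by (auto simp: set_add_def' cgenideal_def)

lemma ideal_add_principal: "ideal A R \<Longrightarrow> x \<in> carrier R \<Longrightarrow> ideal (PIdl x <+>\<^bsub>R\<^esub> A) R"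
  by (rule add_ideals[OF cgenideal_ideal])

text \<open>A property \<open>S\<close> of ideals is assumed to descend from \<open>B\<close> to \<open>A\<close> when \<open>B B\<close> and \<open>p B\<close> lie in \<open>A\<close>.
  One generator \<open>b\<close> at a time is removed by replacing it with \<open>b\<^sup>2\<close>, \<open>b\<^sup>4\<close>, and so on, until the power
  falls into \<open>pR\<close>; the other generators stay in the ideal \<open>A\<close> provided by the induction.\<close>

lemma peel_generators:
  fixes S :: "'a set \<Rightarrow> bool"
  assumes step: "\<And>A B. ideal A R \<Longrightarrow> ideal B R \<Longrightarrow> p_ideal p R \<subseteq> B \<Longrightarrow> (\<And>u v. u \<in> B \<Longrightarrow> v \<in> B \<Longrightarrow> u \<otimes> v \<in> A)
      \<Longrightarrow> (\<And>u. u \<in> B \<Longrightarrow> [p] \<cdot> u \<in> A) \<Longrightarrow> S B \<Longrightarrow> S A"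
    and fin: "finite B" and B: "\<And>b. b \<in> B \<Longrightarrow> b \<in> carrier R \<and> b [^] p \<in> p_ideal p R"
  shows "\<exists>C. ideal C R \<and> p_ideal p R \<subseteq> C \<and> B \<subseteq> C \<and> (S C \<longrightarrow> S (p_ideal p R))"
  using fin B
proof (induction B rule: finite_induct)
  case empty
  then show ?case using ideal_p_ideal by blast
next
  case (insert b B)
  then obtain A where A: "ideal A R" "p_ideal p R \<subseteq> A" "B \<subseteq> A" "S A \<longrightarrow> S (p_ideal p R)" by auto
  interpret A: ideal A R by (rule A(1))
  have b: "b \<in> carrier R" "b [^] p \<in> p_ideal p R" using insert.prems by auto
  have pA: "[p] \<cdot> x \<in> A" if "x \<in> carrier R" for x
  proof -
    have "[p] \<cdot> \<one> \<in> A" using A(2) p_ideal_iff[of "[p] \<cdot> \<one>" p] by (metis l_one one_closed add.nat_pow_closed subsetD)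
    then show ?thesis using that A.I_r_closed by (subst nat_multiple_eq_mult) auto
  qed
  let ?C = "\<lambda>x. PIdl x <+>\<^bsub>R\<^esub> A"
  have AC: "A \<subseteq> ?C x" if x: "x \<in> carrier R" for x
  proof
    fix a assume "a \<in> A"
    then have "a = \<zero> \<otimes> x \<oplus> a" using x by simp
    then show "a \<in> ?C x" unfolding add_principal_iff[OF A(1) x] using \<open>a \<in> A\<close> by blast
  qed
  have square: "S (?C (x \<otimes> x))" if x: "x \<in> carrier R" and S: "S (?C x)" for x
  proof (rule step[OF _ _ _ _ _ S])
    show "ideal (?C (x \<otimes> x)) R" "ideal (?C x) R" using A(1) x by (auto intro: ideal_add_principal)
    show "p_ideal p R \<subseteq> ?C x" using AC[OF x] A(2) by blast
  next
    fix u v assume u: "u \<in> ?C x" and v: "v \<in> ?C x"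
    from u obtain r a where u': "u = r \<otimes> x \<oplus> a" and r: "r \<in> carrier R" and a: "a \<in> A"
      using add_principal_iff[OF A(1) x] by blast
    from v obtain r' a' where v': "v = r' \<otimes> x \<oplus> a'" and r': "r' \<in> carrier R" and a': "a' \<in> A"
      using add_principal_iff[OF A(1) x] by blast
    have "u \<otimes> v = (r \<otimes> r') \<otimes> (x \<otimes> x) \<oplus> ((r \<otimes> x) \<otimes> a' \<oplus> a \<otimes> v)"
      unfolding u' v' using r r' a a' x by (simp add: l_distr r_distr m_ac a_ac)
    moreover have "(r \<otimes> x) \<otimes> a' \<oplus> a \<otimes> v \<in> A"
      using r r' a a' x by (auto simp: v' A.I_l_closed A.I_r_closed)
    ultimately show "u \<otimes> v \<in> ?C (x \<otimes> x)"
      using add_principal_iff[OF A(1), of "x \<otimes> x" "u \<otimes> v"] x r r' by blast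
  next
    fix u assume u: "u \<in> ?C x"
    have "u \<in> carrier R" using ideal.Icarr[OF ideal_add_principal[OF A(1) x] u] .
    then show "[p] \<cdot> u \<in> ?C (x \<otimes> x)" using pA AC[of "x \<otimes> x"] x by blast
  qed
  have "S A" if S: "S (?C b)"
  proof -
    have pow: "S (?C (b [^] ((2::nat) ^ m)))" for m
    proof (induction m)
      case (Suc m)
      have "b [^] ((2::nat) ^ Suc m) = b [^] ((2::nat) ^ m) \<otimes> b [^] ((2::nat) ^ m)"
        using b by (simp add: nat_pow_mult mult_2)
      then show ?case using square[OF _ Suc] b by simp
    qed (use S b in simp)
    \<comment> \<open>\<open>p\<close> squarings suffice, since \<open>p \<le> 2\<^sup>p\<close>\<close>
    let ?x = "b [^] ((2::nat) ^ p)"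
    have x: "?x \<in> carrier R" using b by simp
    have "p \<le> 2 ^ p" by (rule less_imp_le) (rule less_exp)
    then have "?x = b [^] (2 ^ p - p) \<otimes> b [^] p" using b by (simp add: nat_pow_mult)
    then have xA: "?x \<in> A" using b A(2) A.I_l_closed by auto
    have CA: "?C ?x \<subseteq> A"
      using add_principal_iff[OF A(1) x] A.I_l_closed[OF xA] A.a_closed by auto
    show ?thesis
    proof (rule step[OF A(1) ideal_add_principal[OF A(1) x] _ _ _ pow[of p]])
      show "p_ideal p R \<subseteq> ?C ?x" using AC[OF x] A(2) by blast
      fix u assume u: "u \<in> ?C ?x"
      then show "[p] \<cdot> u \<in> A" using CA pA A.Icarr by blast
      fix v assume "v \<in> ?C ?x"
      then show "u \<otimes> v \<in> A" using CA u A.I_l_closed A.Icarr by blast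
    qed
  qed
  moreover have "b \<in> ?C b"
    unfolding add_principal_iff[OF A(1) b(1)]
    by (rule bexI[of _ \<one>], rule bexI[of _ \<zero>]) (use b in auto)
  moreover have "ideal (?C b) R" by (rule ideal_add_principal[OF A(1) b(1)])
  ultimately show ?case using AC[OF b(1)] A by blast
qed

text \<open>The same descent along \<open>pR\<close>, \<open>p\<^sup>2R\<close>, and so on.\<close>

lemma peel_p_powers:
  fixes S :: "'a set \<Rightarrow> bool"
  assumes step: "\<And>A B. ideal A R \<Longrightarrow> ideal B R \<Longrightarrow> (\<And>u v. u \<in> B \<Longrightarrow> v \<in> B \<Longrightarrow> u \<otimes> v \<in> A)
      \<Longrightarrow> (\<And>u. u \<in> B \<Longrightarrow> [p] \<cdot> u \<in> A) \<Longrightarrow> S B \<Longrightarrow> S A"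
    and nil: "p_nilpotent p R" and S: "S (p_ideal p R)"
  shows "S {\<zero>}"
proof -
  let ?q = "[p] \<cdot> \<one>"
  have q: "?q \<in> carrier R" by simp
  have pow: "S (PIdl (?q [^] Suc m))" for m
  proof (induction m)
    case 0
    then show ?case using S q by (simp add: p_ideal_def)
  next
    case (Suc m)
    show ?case
    proof (rule step[OF _ _ _ _ Suc])
      show "ideal (PIdl (?q [^] Suc (Suc m))) R" "ideal (PIdl (?q [^] Suc m)) R"
        by (auto intro!: cgenideal_ideal)
      fix u assume "u \<in> PIdl (?q [^] Suc m)"
      then obtain r where r: "r \<in> carrier R" "u = r \<otimes> ?q [^] Suc m" by (auto simp: cgenideal_def)
      have "[p] \<cdot> u = r \<otimes> ?q [^] Suc (Suc m)"
        using r by (subst nat_multiple_eq_mult) (simp_all add: m_ac)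
      then show "[p] \<cdot> u \<in> PIdl (?q [^] Suc (Suc m))" using r by (auto simp: cgenideal_def)
      fix v assume "v \<in> PIdl (?q [^] Suc m)"
      then obtain r' where r': "r' \<in> carrier R" "v = r' \<otimes> ?q [^] Suc m" by (auto simp: cgenideal_def)
      have "u \<otimes> v = (r \<otimes> r' \<otimes> ?q [^] m) \<otimes> ?q [^] Suc (Suc m)"
        using r r' by (simp add: m_ac)
      then show "u \<otimes> v \<in> PIdl (?q [^] Suc (Suc m))"
        using r r' by (auto simp: cgenideal_def)
    qed
  qed
  obtain n :: nat where "?q [^] n = \<zero>" using nil by (auto simp: p_nilpotent_def)
  then have "?q [^] Suc n = \<zero>" by simp
  then have "PIdl (?q [^] Suc n) = {\<zero>}" by (auto simp: cgenideal_def intro!: exI[of _ \<zero>])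
  then show ?thesis using pow[of n] by simp
qed

end

context witt_ring
begin

lemma witt_map_eq_if_diff_in_witt_ideal:
  assumes "ideal C R" "x \<in> carrier W" "y \<in> carrier W" "x \<ominus>\<^bsub>W\<^esub> y \<in> witt_ideal p R C"
  shows "witt_map ((+>) C) x = witt_map ((+>) C) y"
proof -
  interpret Q: witt_ring "R Quot C" p by (rule witt_ring_quotient[OF assms(1)])
  interpret h: ring_hom_cring R "R Quot C" "(+>) C" by (rule quotient_hom[OF assms(1)])
  note H = h.witt_map_ring_hom_cring[OF prime_p]
  have "witt_map ((+>) C) (x \<ominus>\<^bsub>W\<^esub> y) = \<zero>\<^bsub>witt p (R Quot C)\<^esub>"
    using witt_ideal_iff[OF assms(1) W.minus_closed[OF assms(2,3)]] assms(4) by (rule iffD1)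
  then have "witt_map ((+>) C) x \<ominus>\<^bsub>witt p (R Quot C)\<^esub> witt_map ((+>) C) y = \<zero>\<^bsub>witt p (R Quot C)\<^esub>"
    using ring_hom_cring.hom_minus[OF H assms(2,3)] by metis
  then show ?thesis
    by (rule Q.W.minus_eq_zeroD) (intro h.witt_map_closed assms(2,3))+
qed

text \<open>In \<open>F(V x) = p x = 0\<close> the component of index \<open>n + 1\<close> has the form \<open>x\<^sub>n\<^sup>p + p g\<close>.\<close>

lemma p_torsion_comp:
  assumes x: "x \<in> carrier W" and px: "[p] \<cdot>\<^bsub>W\<^esub> x = \<zero>\<^bsub>W\<^esub>"
  shows "x n [^] p \<in> p_ideal p R" "F x \<in> witt_ideal p R (p_ideal p R)"
proof -
  interpret I: ideal "p_ideal p R" R by (rule ideal_p_ideal)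
  have mult: "[p] \<cdot> g \<in> p_ideal p R" if "g \<in> carrier R" for g
    by (rule ideal_nat_multiple[OF ideal_p_ideal p_one_in_p_ideal that])
  have *: "x n [^] p \<in> p_ideal p R" for n
  proof -
    obtain g where g: "g \<in> carrier R" "F (V x) (Suc n) = V x (Suc n) [^] p \<oplus> [p] \<cdot> g"
      using F_comp[of "V x" "Suc n"] x by auto
    have "F (V x) (Suc n) = \<zero>" using F_V[OF x x] px by (simp add: zero_witt)
    then have "x n [^] p \<oplus> [p] \<cdot> g = \<zero>" using g by (simp add: witt_V_def)
    then have "x n [^] p = \<ominus> ([p] \<cdot> g)"
      using x g(1) minus_equality[of "x n [^] p" "[p] \<cdot> g"] by simp
    then show ?thesis using mult[OF g(1)] by simp
  qed
  then show "x n [^] p \<in> p_ideal p R" .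
  have "F x n \<in> p_ideal p R" for n
  proof -
    obtain g where g: "g \<in> carrier R" "F x n = x n [^] p \<oplus> [p] \<cdot> g"
      using F_comp[of x n] x by auto
    then show ?thesis using * mult by simp
  qed
  then show "F x \<in> witt_ideal p R (p_ideal p R)" using x by (simp add: witt_ideal_def)
qed

text \<open>The first assumption on ideals \<open>K\<close> expresses \<open>V \<beta> = X \<beta> Z\<close> modulo the ideal generated by \<open>F(G)\<close>,
  the second one that \<open>G\<close> lies in the ideal generated by \<open>F(G)\<close> and the entries of \<open>\<beta>\<close>. Both are
  applied to ideals \<open>K = W(I)\<close> for which \<open>F(G) \<subseteq> K\<close> is known: for \<open>I\<close> containing \<open>p\<close> since \<open>G\<close> is
  \<open>p\<close>-torsion, and in the descent from \<open>B\<close> to \<open>A\<close> since \<open>F\<close> maps \<open>W(B)\<close> into \<open>W(A)\<close>. Thus \<open>G\<close> becomes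
  small together with \<open>\<beta>\<close>, although it may be infinite and only the finitely many entries of \<open>\<beta>\<close>
  enter the choice of the ideal \<open>C\<close>.\<close>

theorem witt_matrix_rigidity:
  fixes \<beta> :: "'h \<Rightarrow> 'j \<Rightarrow> nat \<Rightarrow> 'a"
  assumes pn: "p_nilpotent p R"
    and fin: "finite H" "finite J"
    and X: "\<And>k h. k \<in> H \<Longrightarrow> h \<in> H \<Longrightarrow> X k h \<in> carrier W"
    and Z: "\<And>i j. i \<in> J \<Longrightarrow> j \<in> J \<Longrightarrow> Z i j \<in> carrier W"
    and \<beta>: "\<And>h j. h \<in> H \<Longrightarrow> j \<in> J \<Longrightarrow> \<beta> h j \<in> carrier W"
    and G: "G \<subseteq> carrier W"
    and tors_\<beta>: "\<And>h j. h \<in> H \<Longrightarrow> j \<in> J \<Longrightarrow> [p] \<cdot>\<^bsub>W\<^esub> \<beta> h j = \<zero>\<^bsub>W\<^esub>"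
    and tors_G: "\<And>g. g \<in> G \<Longrightarrow> [p] \<cdot>\<^bsub>W\<^esub> g = \<zero>\<^bsub>W\<^esub>"
    and eq: "\<And>K k j. ideal K W \<Longrightarrow> (\<And>g. g \<in> G \<Longrightarrow> F g \<in> K) \<Longrightarrow> k \<in> H \<Longrightarrow> j \<in> J \<Longrightarrow>
      V (\<beta> k j) \<ominus>\<^bsub>W\<^esub> (\<Oplus>\<^bsub>W\<^esub>h\<in>H. X k h \<otimes>\<^bsub>W\<^esub> (\<Oplus>\<^bsub>W\<^esub>i\<in>J. \<beta> h i \<otimes>\<^bsub>W\<^esub> Z i j)) \<in> K"
    and gen: "\<And>K. ideal K W \<Longrightarrow> (\<And>g. g \<in> G \<Longrightarrow> F g \<in> K) \<Longrightarrow>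
      (\<And>h j. h \<in> H \<Longrightarrow> j \<in> J \<Longrightarrow> \<beta> h j \<in> K) \<Longrightarrow> G \<subseteq> K"
    and nil: "\<And>i j. i \<in> J \<Longrightarrow> j \<in> J \<Longrightarrow> frob_col p R J (\<lambda>i l. Z i l 0) 0 j (Suc s) i \<in> p_ideal p R"
  shows "(\<forall>h\<in>H. \<forall>j\<in>J. \<beta> h j = \<zero>\<^bsub>W\<^esub>) \<and> G \<subseteq> {\<zero>\<^bsub>W\<^esub>}"
proof -
  let ?S = "\<lambda>I. (\<forall>h\<in>H. \<forall>j\<in>J. \<beta> h j \<in> witt_ideal p R I) \<and> G \<subseteq> witt_ideal p R I"
  let ?sum = "\<lambda>k j. \<Oplus>\<^bsub>W\<^esub>h\<in>H. X k h \<otimes>\<^bsub>W\<^esub> (\<Oplus>\<^bsub>W\<^esub>i\<in>J. \<beta> h i \<otimes>\<^bsub>W\<^esub> Z i j)"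
  have sumW: "?sum k j \<in> carrier W" if "k \<in> H" "j \<in> J" for k j
    using that X Z \<beta> by (intro W.finsum_closed Pi_I W.m_closed) auto
  have frob_nil: "frob_col p (R Quot C) J (\<lambda>i l. C +> Z i l 0) 0 j (Suc s) i = C +> frob_col p R J (\<lambda>i l. Z i l 0) 0 j (Suc s) i"
    if "ideal C R" "i \<in> J" "j \<in> J" for C i j
    by (rule ring_hom_cring.hom_frob_col[OF quotient_hom[OF that(1)], symmetric]) (use Z that in auto)
  have stepA: "\<beta> k j \<in> witt_ideal p R C"
    if C: "ideal C R" and pC: "p_ideal p R \<subseteq> C"
      and small: "\<And>h j n. h \<in> H \<Longrightarrow> j \<in> J \<Longrightarrow> n < s \<Longrightarrow> \<beta> h j n \<in> C"
      and FG: "\<And>g. g \<in> G \<Longrightarrow> F g \<in> witt_ideal p R C"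
      and kj: "k \<in> H" "j \<in> J" for C k j
  proof -
    let ?Q = "R Quot C" and ?h = "(+>) C"
    interpret Q: char_p_witt_ring ?Q p
      by (rule char_p_witt_ring_quotient[OF C]) (use pC p_one_in_p_ideal in blast)
    note hom = quotient_hom[OF C]
    note Hom = ring_hom_cring.witt_map_ring_hom_cring[OF hom prime_p]
    have closed: "witt_map ?h x \<in> carrier Q.W" if "x \<in> carrier W" for x
      by (rule ring_hom_cring.witt_map_closed[OF hom that])
    have "witt_map ?h (\<beta> k j) = \<zero>\<^bsub>Q.W\<^esub>"
    proof (rule Q.V_matrix_eq_zero_char_p[where \<beta> = "\<lambda>h j. witt_map ?h (\<beta> h j)" and s = s
          and X = "\<lambda>k h. witt_map ?h (X k h)" and Z = "\<lambda>i j. witt_map ?h (Z i j)", OF fin])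
      fix h j assume hj: "h \<in> H" "j \<in> J"
      have "F (\<beta> h j) \<in> witt_ideal p R C"
        using p_torsion_comp(2)[OF \<beta>[OF hj] tors_\<beta>[OF hj]] pC by (auto simp: witt_ideal_def)
      then have "witt_map ?h (F (\<beta> h j)) = \<zero>\<^bsub>Q.W\<^esub>"
        by (rule iffD1[OF witt_ideal_iff[OF C F_closed[OF \<beta>[OF hj]]]])
      then show "Q.F (witt_map ?h (\<beta> h j)) = \<zero>\<^bsub>Q.W\<^esub>"
        using ring_hom_cring.witt_map_F[OF hom \<beta>[OF hj]] by metis
      have "witt_map ?h (V (\<beta> h j)) = witt_map ?h (?sum h j)"
        by (rule witt_map_eq_if_diff_in_witt_ideal[OF C _ sumW[OF hj] eq[OF ideal_witt_ideal[OF C] FG hj]])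
          (use \<beta>[OF hj] in simp_all)
      also have "\<dots> = (\<Oplus>\<^bsub>Q.W\<^esub>g\<in>H. witt_map ?h (X h g) \<otimes>\<^bsub>Q.W\<^esub>
          (\<Oplus>\<^bsub>Q.W\<^esub>i\<in>J. witt_map ?h (\<beta> g i) \<otimes>\<^bsub>Q.W\<^esub> witt_map ?h (Z i j)))"
        by (rule ring_hom_cring.hom_matrix_sum[OF Hom]) (use X Z \<beta> hj in auto)
      finally show "Q.V (witt_map ?h (\<beta> h j)) = (\<Oplus>\<^bsub>Q.W\<^esub>g\<in>H. witt_map ?h (X h g) \<otimes>\<^bsub>Q.W\<^esub>
          (\<Oplus>\<^bsub>Q.W\<^esub>i\<in>J. witt_map ?h (\<beta> g i) \<otimes>\<^bsub>Q.W\<^esub> witt_map ?h (Z i j)))"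
        by (simp only: ring_hom_cring.witt_map_V[OF hom])
    next
      fix i j assume ij: "i \<in> J" "j \<in> J"
      have "frob_col p R J (\<lambda>i l. Z i l 0) 0 j (Suc s) i \<in> C" using nil[OF ij] pC by blast
      moreover have "frob_col p R J (\<lambda>i l. Z i l 0) 0 j (Suc s) i \<in> carrier R"
        by (rule frob_col_closed) (use Z ij in auto)
      ultimately show "frob_col p ?Q J (\<lambda>i l. C +> Z i l 0) 0 j (Suc s) i = \<zero>\<^bsub>?Q\<^esub>"
        using frob_nil[OF C ij] quotient_eq_zero_iff[OF C] by metis
    next
      fix h j n assume "h \<in> H" "j \<in> J" "n < s"
      then show "C +> \<beta> h j n = \<zero>\<^bsub>?Q\<^esub>"
        using small[of h j n] \<beta>[of h j] quotient_eq_zero_iff[OF C, of "\<beta> h j n"] by simp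
    qed (use X Z \<beta> closed kj in auto)
    then show ?thesis by (rule iffD2[OF witt_ideal_iff[OF C \<beta>[OF kj]]])
  qed
  have stepB: "?S A"
    if A: "ideal A R" and B: "ideal B R" and BB: "\<And>u v. u \<in> B \<Longrightarrow> v \<in> B \<Longrightarrow> u \<otimes> v \<in> A"
      and pB: "\<And>u. u \<in> B \<Longrightarrow> [p] \<cdot> u \<in> A" and S: "?S B" for A B
  proof -
    have FG: "F g \<in> witt_ideal p R A" if "g \<in> G" for g
      using F_in_witt_ideal[OF A B BB pB] S that by blast
    let ?Q = "R Quot A" and ?h = "(+>) A"
    interpret Q: witt_ring ?Q p by (rule witt_ring_quotient[OF A])
    note hom = quotient_hom[OF A]
    interpret h: ring_hom_cring R ?Q ?h by (rule hom)
    note Hom = ring_hom_cring.witt_map_ring_hom_cring[OF hom prime_p]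
    have closed: "witt_map ?h x \<in> carrier Q.W" if "x \<in> carrier W" for x
      by (rule ring_hom_cring.witt_map_closed[OF hom that])
    let ?I = "?h ` B"
    have I: "ideal ?I ?Q" by (rule ring_ideal_imp_quot_ideal[OF A B])
    have BR: "u \<in> carrier R" if "u \<in> B" for u by (rule ideal.Icarr[OF B that])
    have zero: "?h u = \<zero>\<^bsub>?Q\<^esub>" if "u \<in> A" for u
      using quotient_eq_zero_iff[OF A ideal.Icarr[OF A that]] that by (rule iffD2)
    have "witt_map ?h (\<beta> k j) = \<zero>\<^bsub>Q.W\<^esub>" if kj: "k \<in> H" "j \<in> J" for k j
    proof (rule Q.V_matrix_eq_zero_square_zero[where \<beta> = "\<lambda>h j. witt_map ?h (\<beta> h j)" and e = "Suc s" and I = ?I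
          and X = "\<lambda>k h. witt_map ?h (X k h)" and Z = "\<lambda>i j. witt_map ?h (Z i j)", OF I _ _ fin])
      fix u v assume "u \<in> ?I" "v \<in> ?I"
      then obtain u' v' where uv: "u' \<in> B" "v' \<in> B" "u = ?h u'" "v = ?h v'" by blast
      then show "u \<otimes>\<^bsub>?Q\<^esub> v = \<zero>\<^bsub>?Q\<^esub>"
        using h.hom_mult[OF BR BR, of u' v'] zero[OF BB[of u' v']] by simp
    next
      fix u assume "u \<in> ?I"
      then obtain u' where u: "u' \<in> B" "u = ?h u'" by blast
      then show "[p] \<cdot>\<^bsub>?Q\<^esub> u = \<zero>\<^bsub>?Q\<^esub>"
        using h.hom_nat_multiple[OF BR, of u' p] zero[OF pB[of u']] by simp
    next
      fix h j assume hj: "h \<in> H" "j \<in> J"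
      then have "\<beta> h j \<in> witt_ideal p R B" using S by blast
      then show "witt_map ?h (\<beta> h j) \<in> witt_ideal p ?Q ?I"
        using closed by (auto simp: witt_ideal_def)
      have "witt_map ?h (V (\<beta> h j)) = witt_map ?h (?sum h j)"
        by (rule witt_map_eq_if_diff_in_witt_ideal[OF A _ sumW[OF hj] eq[OF ideal_witt_ideal[OF A] FG hj]])
          (use \<beta>[OF hj] in simp_all)
      also have "\<dots> = (\<Oplus>\<^bsub>Q.W\<^esub>g\<in>H. witt_map ?h (X h g) \<otimes>\<^bsub>Q.W\<^esub>
          (\<Oplus>\<^bsub>Q.W\<^esub>i\<in>J. witt_map ?h (\<beta> g i) \<otimes>\<^bsub>Q.W\<^esub> witt_map ?h (Z i j)))"
        by (rule ring_hom_cring.hom_matrix_sum[OF Hom]) (use X Z \<beta> hj in auto)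
      finally show "Q.V (witt_map ?h (\<beta> h j)) = (\<Oplus>\<^bsub>Q.W\<^esub>g\<in>H. witt_map ?h (X h g) \<otimes>\<^bsub>Q.W\<^esub>
          (\<Oplus>\<^bsub>Q.W\<^esub>i\<in>J. witt_map ?h (\<beta> g i) \<otimes>\<^bsub>Q.W\<^esub> witt_map ?h (Z i j)))"
        by (simp only: ring_hom_cring.witt_map_V[OF hom])
    next
      fix i j assume ij: "i \<in> J" "j \<in> J"
      obtain r where r: "r \<in> carrier R" "frob_col p R J (\<lambda>i l. Z i l 0) 0 j (Suc s) i = r \<otimes> ([p] \<cdot> \<one>)"
        using nil[OF ij] unfolding p_ideal_iff by blast
      have "frob_col p ?Q J (\<lambda>i l. A +> Z i l 0) 0 j (Suc s) i = ?h r \<otimes>\<^bsub>?Q\<^esub> ([p] \<cdot>\<^bsub>?Q\<^esub> \<one>\<^bsub>?Q\<^esub>)"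
        unfolding frob_nil[OF A ij] r(2) using r(1) h.hom_nat_multiple[of \<one> p] by simp
      then show "frob_col p ?Q J (\<lambda>i l. A +> Z i l 0) 0 j (Suc s) i \<in> p_ideal p ?Q"
        unfolding Q.p_ideal_iff using h.hom_closed[OF r(1)] by blast
    qed (use X Z closed kj in auto)
    then have \<beta>A: "\<beta> k j \<in> witt_ideal p R A" if "k \<in> H" "j \<in> J" for k j
      using iffD2[OF witt_ideal_iff[OF A \<beta>[OF that]]] that by blast
    then show ?thesis using gen[OF ideal_witt_ideal[OF A] FG] by blast
  qed
  \<comment> \<open>the components that have to vanish before the argument in characteristic \<open>p\<close> applies\<close>
  define B where "B = (\<lambda>(h, j, n). \<beta> h j n) ` (H \<times> J \<times> {..<s})"
  have "\<exists>C. ideal C R \<and> p_ideal p R \<subseteq> C \<and> B \<subseteq> C \<and> (?S C \<longrightarrow> ?S (p_ideal p R))"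
  proof (rule peel_generators[where S = "?S" and B = B and p = p])
    show "finite B" using fin by (simp add: B_def)
    show "b \<in> carrier R \<and> b [^] p \<in> p_ideal p R" if "b \<in> B" for b
      using that \<beta> p_torsion_comp(1)[OF \<beta> tors_\<beta>] by (auto simp: B_def)
    fix A B'
    assume "ideal A R" "ideal B' R" "\<And>u v. u \<in> B' \<Longrightarrow> v \<in> B' \<Longrightarrow> u \<otimes> v \<in> A"
      "\<And>u. u \<in> B' \<Longrightarrow> [p] \<cdot> u \<in> A" "?S B'"
    then show "?S A" by (rule stepB)
  qed
  then obtain C where C: "ideal C R" "p_ideal p R \<subseteq> C" "B \<subseteq> C" "?S C \<longrightarrow> ?S (p_ideal p R)"
    by blast
  have FG: "F g \<in> witt_ideal p R C" if "g \<in> G" for g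
    using p_torsion_comp(2)[OF _ tors_G[OF that]] G that C(2) by (auto simp: witt_ideal_def)
  have \<beta>C: "\<beta> k j \<in> witt_ideal p R C" if "k \<in> H" "j \<in> J" for k j
  proof (rule stepA[OF C(1,2) _ FG that])
    fix h j n assume "h \<in> H" "j \<in> J" "n < s"
    then have "\<beta> h j n \<in> B" unfolding B_def by (intro image_eqI[of _ _ "(h, j, n)"]) auto
    then show "\<beta> h j n \<in> C" using C(3) by blast
  qed
  then have "?S C" using gen[OF ideal_witt_ideal[OF C(1)] FG] by blast
  then have "?S (p_ideal p R)" using C(4) by blast
  have "?S {\<zero>}"
  proof (rule peel_p_powers[where S = "?S" and p = p])
    show "p_nilpotent p R" by (rule pn)
    show "?S (p_ideal p R)" by fact
    fix A B'
    assume "ideal A R" "ideal B' R" "\<And>u v. u \<in> B' \<Longrightarrow> v \<in> B' \<Longrightarrow> u \<otimes> v \<in> A"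
      "\<And>u. u \<in> B' \<Longrightarrow> [p] \<cdot> u \<in> A" "?S B'"
    then show "?S A" by (rule stepB)
  qed
  moreover have "witt_ideal p R {\<zero>} \<subseteq> {\<zero>\<^bsub>W\<^esub>}" by (auto simp: witt_ideal_def zero_witt)
  ultimately show ?thesis by blast
qed

end

section \<open>Additive maps out of tensor products\<close>

definition add_hom :: "('a, 'm) ring_scheme \<Rightarrow> ('b, 'n) ring_scheme \<Rightarrow> ('a \<Rightarrow> 'b) \<Rightarrow> bool" where
  "add_hom M N g \<longleftrightarrow> g \<in> carrier M \<rightarrow> carrier N \<and>
    (\<forall>x\<in>carrier M. \<forall>y\<in>carrier M. g (x \<oplus>\<^bsub>M\<^esub> y) = g x \<oplus>\<^bsub>N\<^esub> g y)"

lemma add_homI: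
  assumes "\<And>x. x \<in> carrier M \<Longrightarrow> g x \<in> carrier N"
    "\<And>x y. x \<in> carrier M \<Longrightarrow> y \<in> carrier M \<Longrightarrow> g (x \<oplus>\<^bsub>M\<^esub> y) = g x \<oplus>\<^bsub>N\<^esub> g y"
  shows "add_hom M N g"
  using assms by (auto simp: add_hom_def)

lemma add_hom_closed: "add_hom M N g \<Longrightarrow> x \<in> carrier M \<Longrightarrow> g x \<in> carrier N"
  and add_hom_add: "add_hom M N g \<Longrightarrow> x \<in> carrier M \<Longrightarrow> y \<in> carrier M \<Longrightarrow> g (x \<oplus>\<^bsub>M\<^esub> y) = g x \<oplus>\<^bsub>N\<^esub> g y"
  by (auto simp: add_hom_def)

lemma add_hom_comp: "add_hom M N g \<Longrightarrow> add_hom N Q h \<Longrightarrow> add_hom M Q (\<lambda>x. h (g x))"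
  by (simp add: add_hom_def Pi_iff)

lemma add_hom_zero:
  assumes "abelian_group M" "abelian_group N" "add_hom M N g"
  shows "g \<zero>\<^bsub>M\<^esub> = \<zero>\<^bsub>N\<^esub>"
proof -
  interpret M: abelian_group M by fact
  interpret N: abelian_group N by fact
  have g0: "g \<zero>\<^bsub>M\<^esub> \<in> carrier N" using add_hom_closed[OF assms(3)] by simp
  have "g \<zero>\<^bsub>M\<^esub> \<oplus>\<^bsub>N\<^esub> g \<zero>\<^bsub>M\<^esub> = g \<zero>\<^bsub>M\<^esub>" using add_hom_add[OF assms(3), of "\<zero>\<^bsub>M\<^esub>" "\<zero>\<^bsub>M\<^esub>"] by simp
  then show ?thesis using g0 by (metis N.add.l_cancel_one')
qed

lemma add_hom_finsum:
  assumes "abelian_group M" "abelian_group N" "add_hom M N g" "\<And>i. i \<in> A \<Longrightarrow> x i \<in> carrier M"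
  shows "g (finsum M x A) = (\<Oplus>\<^bsub>N\<^esub>i\<in>A. g (x i))"
proof -
  interpret M: abelian_group M by fact
  interpret N: abelian_group N by fact
  show ?thesis
    using assms(4)
  proof (induction A rule: infinite_finite_induct)
    case (insert a A)
    then show ?case
      using add_hom_closed[OF assms(3)] by (simp add: add_hom_add[OF assms(3)] Pi_iff)
  qed (simp_all add: add_hom_zero[OF assms(1-3)])
qed

lemma add_hom_sum:
  assumes "abelian_group N" "add_hom M N g" "add_hom M N h"
  shows "add_hom M N (\<lambda>x. g x \<oplus>\<^bsub>N\<^esub> h x)"
proof -
  interpret N: abelian_group N by fact
  show ?thesis
    using assms(2,3) by (auto intro!: add_homI simp: add_hom_def Pi_iff N.add.m_ac)
qed

text \<open>The maps that factor through the tensor product; \<open>Q\<close> need only be an abelian group.\<close>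

definition balanced ::
  "('a, 'k) ring_scheme \<Rightarrow> ('a, 'm, 'x) module_scheme \<Rightarrow> ('a, 'n, 'y) module_scheme
    \<Rightarrow> ('c, 'q) ring_scheme \<Rightarrow> ('m \<times> 'n \<Rightarrow> 'c) \<Rightarrow> bool" where
  "balanced A M N Q f \<longleftrightarrow>
    (\<forall>y\<in>carrier N. add_hom M Q (\<lambda>x. f (x, y))) \<and>
    (\<forall>x\<in>carrier M. add_hom N Q (\<lambda>y. f (x, y))) \<and>
    (\<forall>a\<in>carrier A. \<forall>x\<in>carrier M. \<forall>y\<in>carrier N. f (a \<odot>\<^bsub>M\<^esub> x, y) = f (x, a \<odot>\<^bsub>N\<^esub> y))"

locale tensor_pair =
  M: abelian_group M + N: abelian_group N
  for A :: "('a, 'k) ring_scheme" and M :: "('a, 'm, 'x) module_scheme" and N :: "('a, 'n, 'y) module_scheme" +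
  assumes smult_M: "a \<in> carrier A \<Longrightarrow> x \<in> carrier M \<Longrightarrow> a \<odot>\<^bsub>M\<^esub> x \<in> carrier M"
    and smult_N: "a \<in> carrier A \<Longrightarrow> y \<in> carrier N \<Longrightarrow> a \<odot>\<^bsub>N\<^esub> y \<in> carrier N"
begin

abbreviation "FG \<equiv> free_Abelian_group (carrier M \<times> carrier N)"
abbreviation "TK \<equiv> tensor_kernel A M N"
abbreviation "pure \<equiv> pure_tensor A M N"

interpretation FG: comm_group FG by (rule abelian_free_Abelian_group)

lemma relations_subset: "tensor_relations A M N \<subseteq> carrier FG"
proof -
  have diff: "x - y \<in> carrier FG" if "x \<in> carrier FG" "y \<in> carrier FG" for x y
    using that keys_diff[of x y] by auto
  show ?thesis
    unfolding tensor_relations_def using smult_M smult_N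
    by (auto intro!: diff simp del: carrier_free_Abelian_group_iff)
qed

lemma subgroup_TK: "subgroup TK FG"
  unfolding tensor_kernel_def by (rule FG.generate_is_subgroup[OF relations_subset])

lemma normal_TK: "TK \<lhd> FG"
  by (rule FG.subgroup_imp_normal[OF subgroup_TK])

lemma coset_eq:
  assumes "c \<in> carrier FG" "d \<in> carrier FG" "c - d \<in> TK"
  shows "TK #>\<^bsub>FG\<^esub> c = TK #>\<^bsub>FG\<^esub> d"
proof -
  have "c \<in> TK #>\<^bsub>FG\<^esub> d"
    unfolding r_coset_def using assms(3) by (auto intro!: bexI[of _ "c - d"])
  then show ?thesis using FG.repr_independence[OF _ assms(2) subgroup_TK] by simp
qed

lemma coset_add:
  "c \<in> carrier FG \<Longrightarrow> d \<in> carrier FG \<Longrightarrow>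
    (TK #>\<^bsub>FG\<^esub> c) \<otimes>\<^bsub>tensor_group A M N\<^esub> (TK #>\<^bsub>FG\<^esub> d) = TK #>\<^bsub>FG\<^esub> (c + d)"
  unfolding tensor_group_def using normal.rcos_sum[OF normal_TK] by simp

lemma carrier_tensor_group: "carrier (tensor_group A M N) = (\<lambda>c. TK #>\<^bsub>FG\<^esub> c) ` carrier FG"
  by (simp add: tensor_group_def carrier_FactGroup)

lemma one_tensor_group: "\<one>\<^bsub>tensor_group A M N\<^esub> = TK #>\<^bsub>FG\<^esub> 0"
  using FG.coset_mult_one[OF subgroup.subset[OF subgroup_TK]] by (simp add: tensor_group_def)

lemma comm_group_tensor_group: "comm_group (tensor_group A M N)"
  unfolding tensor_group_def by (rule FG.abelian_FactGroup[OF subgroup_TK])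

lemma pure_closed: "x \<in> carrier M \<Longrightarrow> y \<in> carrier N \<Longrightarrow> pure x y \<in> carrier (tensor_group A M N)"
  unfolding carrier_tensor_group pure_tensor_def by (auto simp: keys_frag_of)

lemma relation_coset:
  assumes "c - d - e \<in> tensor_relations A M N" "c \<in> carrier FG" "d \<in> carrier FG" "e \<in> carrier FG"
  shows "TK #>\<^bsub>FG\<^esub> c = (TK #>\<^bsub>FG\<^esub> d) \<otimes>\<^bsub>tensor_group A M N\<^esub> (TK #>\<^bsub>FG\<^esub> e)"
proof -
  have "c - (d + e) \<in> TK"
    unfolding tensor_kernel_def using generate.incl[OF assms(1)] by (simp add: diff_diff_add)
  moreover have "d + e \<in> carrier FG" using FG.m_closed[OF assms(3,4)] by simp
  ultimately show ?thesis using assms by (simp add: coset_add coset_eq del: carrier_free_Abelian_group_iff)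
qed

lemma pure_add_left:
  assumes "x \<in> carrier M" "x' \<in> carrier M" "y \<in> carrier N"
  shows "pure (x \<oplus>\<^bsub>M\<^esub> x') y = pure x y \<otimes>\<^bsub>tensor_group A M N\<^esub> pure x' y"
  unfolding pure_tensor_def
  by (rule relation_coset) (use assms in \<open>auto simp: tensor_relations_def keys_frag_of\<close>)

lemma pure_add_right:
  assumes "x \<in> carrier M" "y \<in> carrier N" "y' \<in> carrier N"
  shows "pure x (y \<oplus>\<^bsub>N\<^esub> y') = pure x y \<otimes>\<^bsub>tensor_group A M N\<^esub> pure x y'"
  unfolding pure_tensor_def
  by (rule relation_coset) (use assms in \<open>auto simp: tensor_relations_def keys_frag_of\<close>)

lemma pure_balanced:
  assumes "a \<in> carrier A" "x \<in> carrier M" "y \<in> carrier N"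
  shows "pure (a \<odot>\<^bsub>M\<^esub> x) y = pure x (a \<odot>\<^bsub>N\<^esub> y)"
  unfolding pure_tensor_def
proof (rule coset_eq)
  show "frag_of (a \<odot>\<^bsub>M\<^esub> x, y) - frag_of (x, a \<odot>\<^bsub>N\<^esub> y) \<in> TK"
    unfolding tensor_kernel_def tensor_relations_def using assms by (intro generate.incl) blast
qed (use assms smult_M smult_N in \<open>auto simp: keys_frag_of\<close>)

interpretation TG: comm_group "tensor_group A M N" by (rule comm_group_tensor_group)

lemma pure_zero_left:
  assumes "y \<in> carrier N"
  shows "pure \<zero>\<^bsub>M\<^esub> y = \<one>\<^bsub>tensor_group A M N\<^esub>"
  using pure_add_left[of "\<zero>\<^bsub>M\<^esub>" "\<zero>\<^bsub>M\<^esub>" y] pure_closed[of "\<zero>\<^bsub>M\<^esub>" y] assms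
  by (metis M.zero_closed M.l_zero TG.l_cancel_one')

text \<open>The predicate is only assumed to be stable under sums, while induction over formal sums requires
  differences. Both \<open>c\<close> and \<open>- c\<close> are therefore carried along, using
  \<open>- (x \<otimes> y) = (- x) \<otimes> y\<close>.\<close>

lemma tensor_induct [consumes 1, case_names zero pure add]:
  assumes t: "t \<in> carrier (tensor_group A M N)"
    and zero: "P \<one>\<^bsub>tensor_group A M N\<^esub>"
    and pure: "\<And>x y. x \<in> carrier M \<Longrightarrow> y \<in> carrier N \<Longrightarrow> P (pure x y)"
    and add: "\<And>t u. t \<in> carrier (tensor_group A M N) \<Longrightarrow> u \<in> carrier (tensor_group A M N) \<Longrightarrow>
      P t \<Longrightarrow> P u \<Longrightarrow> P (t \<otimes>\<^bsub>tensor_group A M N\<^esub> u)"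
  shows "P t"
proof -
  obtain c where c: "c \<in> carrier FG" "t = TK #>\<^bsub>FG\<^esub> c" using t carrier_tensor_group by auto
  let ?Q = "\<lambda>c. c \<in> carrier FG \<and> P (TK #>\<^bsub>FG\<^esub> c) \<and> P (TK #>\<^bsub>FG\<^esub> (- c))"
  have keys: "Poly_Mapping.keys c \<subseteq> carrier M \<times> carrier N" using c(1) by simp
  have "?Q c"
    using keys
  proof (rule frag_induction[where P = ?Q])
    show "?Q 0" using zero by (simp add: one_tensor_group)
  next
    fix z assume z: "z \<in> carrier M \<times> carrier N"
    obtain x y where xy: "z = (x, y)" "x \<in> carrier M" "y \<in> carrier N" using z by auto
    have F: "frag_of (\<ominus>\<^bsub>M\<^esub> x, y) \<in> carrier FG" "frag_of (x, y) \<in> carrier FG" "- frag_of (x, y) \<in> carrier FG"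
      using xy by (auto simp: keys_frag_of)
    have "pure (\<ominus>\<^bsub>M\<^esub> x) y \<otimes>\<^bsub>tensor_group A M N\<^esub> pure x y = \<one>\<^bsub>tensor_group A M N\<^esub>"
      using pure_add_left[of "\<ominus>\<^bsub>M\<^esub> x" x y] xy pure_zero_left by (simp add: M.l_neg)
    moreover have "(TK #>\<^bsub>FG\<^esub> (- frag_of (x, y))) \<otimes>\<^bsub>tensor_group A M N\<^esub> pure x y = \<one>\<^bsub>tensor_group A M N\<^esub>"
      unfolding pure_tensor_def using F by (simp add: coset_add one_tensor_group del: carrier_free_Abelian_group_iff)
    moreover have "TK #>\<^bsub>FG\<^esub> (- frag_of (x, y)) \<in> carrier (tensor_group A M N)"
      using F(3) carrier_tensor_group by blast
    ultimately have "TK #>\<^bsub>FG\<^esub> (- frag_of (x, y)) = pure (\<ominus>\<^bsub>M\<^esub> x) y"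
      using xy pure_closed by (metis M.a_inv_closed TG.right_cancel)
    moreover have "P (pure (\<ominus>\<^bsub>M\<^esub> x) y)" "P (pure x y)" using xy pure by simp_all
    ultimately show "?Q (frag_of z)" using F(2) by (simp add: xy pure_tensor_def)
  next
    fix a b assume a: "?Q a" and b: "?Q b"
    then have mem: "a \<in> carrier FG" "b \<in> carrier FG" "- a \<in> carrier FG" "- b \<in> carrier FG" by simp_all
    then have T: "TK #>\<^bsub>FG\<^esub> a \<in> carrier (tensor_group A M N)" "TK #>\<^bsub>FG\<^esub> b \<in> carrier (tensor_group A M N)"
      "TK #>\<^bsub>FG\<^esub> (- a) \<in> carrier (tensor_group A M N)" "TK #>\<^bsub>FG\<^esub> (- b) \<in> carrier (tensor_group A M N)"
      using carrier_tensor_group by blast+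
    have "P (TK #>\<^bsub>FG\<^esub> (a + - b))"
      using add[OF T(1,4)] a b coset_add[OF mem(1,4)] by simp
    moreover have "P (TK #>\<^bsub>FG\<^esub> (- a + b))"
      using add[OF T(3,2)] a b coset_add[OF mem(3,2)] by simp
    moreover have "a - b \<in> carrier FG" using mem keys_diff[of a b] by auto
    ultimately show "?Q (a - b)" by (simp add: add.commute)
  qed
  then show ?thesis using c by simp
qed

text \<open>The lift is evaluated on a representative picked by choice; representatives differ by elements of the
  kernel, on whose generators the sum vanishes for a balanced map.\<close>

lemma tensor_lift_coset:
  assumes Q: "abelian_group Q" and f: "balanced A M N Q f" and c: "c \<in> carrier FG"
  shows "tensor_lift Q f (TK #>\<^bsub>FG\<^esub> c) = frag_sum Q f c"
proof -
  interpret Q: abelian_group Q by fact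
  have fc: "f z \<in> carrier Q" if "z \<in> carrier M \<times> carrier N" for z
    using that f by (cases z) (auto simp: balanced_def dest: add_hom_closed)
  have fk: "f \<in> Poly_Mapping.keys d \<rightarrow> carrier Q" if "d \<in> carrier FG" for d
    using that fc by auto
  have frag: "frag_sum Q f (frag_of z) = f z" if "z \<in> carrier M \<times> carrier N" for z
    using Q.frag_sum_frag_of[of f z] fc[OF that] .
  have rel0: "frag_sum Q f k = \<zero>\<^bsub>Q\<^esub>" if k: "k \<in> tensor_relations A M N" for k
  proof -
    have add: "frag_sum Q f (frag_of z - frag_of u - frag_of v) = \<zero>\<^bsub>Q\<^esub>"
      if "z \<in> carrier M \<times> carrier N" "u \<in> carrier M \<times> carrier N" "v \<in> carrier M \<times> carrier N" "f z = f u \<oplus>\<^bsub>Q\<^esub> f v" for z u v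
    proof -
      have K: "frag_of z - frag_of u \<in> carrier FG" "frag_of v \<in> carrier FG" "frag_of z \<in> carrier FG" "frag_of u \<in> carrier FG"
        using that keys_diff[of "frag_of z" "frag_of u"] by (auto simp: keys_frag_of)
      have uv: "f u \<in> carrier Q" "f v \<in> carrier Q" using that fc by simp_all
      then have "(f u \<oplus>\<^bsub>Q\<^esub> f v) \<oplus>\<^bsub>Q\<^esub> \<ominus>\<^bsub>Q\<^esub> f u \<oplus>\<^bsub>Q\<^esub> \<ominus>\<^bsub>Q\<^esub> f v = (f u \<oplus>\<^bsub>Q\<^esub> f v) \<oplus>\<^bsub>Q\<^esub> \<ominus>\<^bsub>Q\<^esub> (f u \<oplus>\<^bsub>Q\<^esub> f v)"
        by (simp add: Q.minus_add Q.a_assoc)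
      also have "\<dots> = \<zero>\<^bsub>Q\<^esub>" using uv by (simp add: Q.r_neg)
      finally show ?thesis
        using that uv by (simp add: Q.frag_sum_diff fk[OF K(1)] fk[OF K(2)] fk[OF K(3)] fk[OF K(4)] frag
            a_minus_def[of Q])
    qed
    have "frag_sum Q f (frag_of z - frag_of u) = \<zero>\<^bsub>Q\<^esub>"
      if "z \<in> carrier M \<times> carrier N" "u \<in> carrier M \<times> carrier N" "f z = f u" for z u
    proof -
      have K: "frag_of z \<in> carrier FG" "frag_of u \<in> carrier FG" using that by (auto simp: keys_frag_of)
      show ?thesis
        using that fc by (simp add: Q.frag_sum_diff fk[OF K(1)] fk[OF K(2)] frag a_minus_def[of Q] Q.r_neg)
    qed
    then show ?thesis
      using k f smult_M smult_N unfolding tensor_relations_def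
      by (auto intro!: add simp: balanced_def dest: add_hom_add)
  qed
  have K0: "frag_sum Q f k = \<zero>\<^bsub>Q\<^esub>" if "k \<in> TK" for k
    using that unfolding tensor_kernel_def
  proof (induction k rule: generate.induct)
    case one
    show ?case by (simp add: Q.frag_sum_zero)
  next
    case (incl h)
    then show ?case by (rule rel0)
  next
    case (inv h)
    then have "h \<in> carrier FG" using relations_subset by blast
    then show ?case using rel0[OF inv] Q.frag_sum_minus[OF fk] by simp
  next
    case (eng h k)
    then have "h \<in> carrier FG" "k \<in> carrier FG"
      using subgroup.subset[OF subgroup_TK] unfolding tensor_kernel_def by blast+
    then show ?case using eng Q.frag_sum_add[OF fk fk] by simp
  qed
  have "0 + c \<in> TK #>\<^bsub>FG\<^esub> c"
    unfolding r_coset_def using subgroup.one_closed[OF subgroup_TK] by auto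
  then have "(SOME d. d \<in> TK #>\<^bsub>FG\<^esub> c) \<in> TK #>\<^bsub>FG\<^esub> c" by (rule someI)
  then obtain k where k: "k \<in> TK" "(SOME d. d \<in> TK #>\<^bsub>FG\<^esub> c) = k + c"
    by (auto simp: r_coset_def)
  have kF: "k \<in> carrier FG" using k(1) subgroup.subset[OF subgroup_TK] by blast
  have "tensor_lift Q f (TK #>\<^bsub>FG\<^esub> c) = frag_sum Q f (k + c)"
    by (simp add: tensor_lift_def Let_def k(2) frag_sum_def)
  also have "\<dots> = frag_sum Q f c"
    using Q.frag_sum_add[OF fk[OF kF] fk[OF c]] K0[OF k(1)] Q.frag_sum_closed[OF fk[OF c]] by simp
  finally show ?thesis .
qed

lemma balanced_closed:
  "balanced A M N Q f \<Longrightarrow> x \<in> carrier M \<Longrightarrow> y \<in> carrier N \<Longrightarrow> f (x, y) \<in> carrier Q"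
  by (auto simp: balanced_def dest: add_hom_closed)

lemma tensor_lift_pure:
  assumes "abelian_group Q" "balanced A M N Q f" "x \<in> carrier M" "y \<in> carrier N"
  shows "tensor_lift Q f (pure x y) = f (x, y)"
proof -
  interpret Q: abelian_group Q by fact
  have "frag_of (x, y) \<in> carrier FG" using assms by (auto simp: keys_frag_of)
  then show ?thesis
    unfolding pure_tensor_def using assms
    by (simp add: tensor_lift_coset Q.frag_sum_frag_of balanced_closed del: carrier_free_Abelian_group_iff)
qed

lemma tensor_lift_closed_add:
  assumes Q: "abelian_group Q" and f: "balanced A M N Q f"
    and t: "t \<in> carrier (tensor_group A M N)" and u: "u \<in> carrier (tensor_group A M N)"
  shows "tensor_lift Q f t \<in> carrier Q"
    "tensor_lift Q f (t \<otimes>\<^bsub>tensor_group A M N\<^esub> u) = tensor_lift Q f t \<oplus>\<^bsub>Q\<^esub> tensor_lift Q f u"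
proof -
  interpret Q: abelian_group Q by fact
  have fc: "f z \<in> carrier Q" if "z \<in> carrier M \<times> carrier N" for z
    using that balanced_closed[OF f] by (cases z) simp
  have fk: "f \<in> Poly_Mapping.keys d \<rightarrow> carrier Q" if "d \<in> carrier FG" for d
    using that fc by auto
  obtain c d where c: "c \<in> carrier FG" "t = TK #>\<^bsub>FG\<^esub> c" and d: "d \<in> carrier FG" "u = TK #>\<^bsub>FG\<^esub> d"
    using t u carrier_tensor_group by auto
  have cd: "c + d \<in> carrier FG" using FG.m_closed[OF c(1) d(1)] by simp
  show "tensor_lift Q f t \<in> carrier Q"
    unfolding c(2) tensor_lift_coset[OF Q f c(1)] by (rule Q.frag_sum_closed[OF fk[OF c(1)]])
  show "tensor_lift Q f (t \<otimes>\<^bsub>tensor_group A M N\<^esub> u) = tensor_lift Q f t \<oplus>\<^bsub>Q\<^esub> tensor_lift Q f u"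
    unfolding c(2) d(2) coset_add[OF c(1) d(1)] tensor_lift_coset[OF Q f c(1)]
      tensor_lift_coset[OF Q f d(1)] tensor_lift_coset[OF Q f cd]
    by (rule Q.frag_sum_add[OF fk[OF c(1)] fk[OF d(1)]])
qed

end

section \<open>Tensor products with an action\<close>

locale tensor_action = tensor_pair A M N + B: cring B
  for A :: "('a, 'k) ring_scheme" and M :: "('a, 'm, 'x) module_scheme" and N :: "('a, 'n, 'y) module_scheme"
    and B :: "('b, 'l) ring_scheme" and s :: "'b \<Rightarrow> 'm \<Rightarrow> 'm" +
  assumes s_add_hom: "b \<in> carrier B \<Longrightarrow> add_hom M M (s b)"
    and s_smult: "b \<in> carrier B \<Longrightarrow> a \<in> carrier A \<Longrightarrow> x \<in> carrier M \<Longrightarrow> s b (a \<odot>\<^bsub>M\<^esub> x) = a \<odot>\<^bsub>M\<^esub> s b x"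
    and s_add: "b \<in> carrier B \<Longrightarrow> b' \<in> carrier B \<Longrightarrow> x \<in> carrier M \<Longrightarrow> s (b \<oplus>\<^bsub>B\<^esub> b') x = s b x \<oplus>\<^bsub>M\<^esub> s b' x"
    and s_mult: "b \<in> carrier B \<Longrightarrow> b' \<in> carrier B \<Longrightarrow> x \<in> carrier M \<Longrightarrow> s (b \<otimes>\<^bsub>B\<^esub> b') x = s b (s b' x)"
    and s_one: "x \<in> carrier M \<Longrightarrow> s \<one>\<^bsub>B\<^esub> x = x"
begin

abbreviation T :: "('b, ('m, 'n) tensor) module" where "T \<equiv> tensor_with_action A M N s"

lemma T_simps:
  "carrier T = carrier (tensor_group A M N)" "\<zero>\<^bsub>T\<^esub> = \<one>\<^bsub>tensor_group A M N\<^esub>"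
  "t \<oplus>\<^bsub>T\<^esub> u = t \<otimes>\<^bsub>tensor_group A M N\<^esub> u"
  by (simp_all add: tensor_with_action_def Let_def ring.defs module.defs)

lemma abelian_group_T: "abelian_group T"
proof -
  interpret TG: comm_group "tensor_group A M N" by (rule comm_group_tensor_group)
  show ?thesis
    by (rule abelian_groupI) (auto simp: T_simps TG.m_ac intro!: TG.l_inv_ex)
qed

lemma pure_in_T: "x \<in> carrier M \<Longrightarrow> y \<in> carrier N \<Longrightarrow> pure x y \<in> carrier T"
  by (simp add: T_simps pure_closed)

lemma pure_add_hom_left: "y \<in> carrier N \<Longrightarrow> add_hom M T (\<lambda>x. pure x y)"
  by (rule add_homI) (simp_all add: T_simps pure_closed pure_add_left)

lemma pure_add_hom_right: "x \<in> carrier M \<Longrightarrow> add_hom N T (\<lambda>y. pure x y)"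
  by (rule add_homI) (simp_all add: T_simps pure_closed pure_add_right)

lemma T_induct [consumes 1, case_names zero pure add]:
  assumes "t \<in> carrier T" "P \<zero>\<^bsub>T\<^esub>" "\<And>x y. x \<in> carrier M \<Longrightarrow> y \<in> carrier N \<Longrightarrow> P (pure x y)"
    "\<And>t u. t \<in> carrier T \<Longrightarrow> u \<in> carrier T \<Longrightarrow> P t \<Longrightarrow> P u \<Longrightarrow> P (t \<oplus>\<^bsub>T\<^esub> u)"
  shows "P t"
  using assms unfolding T_simps by (rule tensor_induct)

lemma tensor_lift_add_hom:
  "abelian_group Q \<Longrightarrow> balanced A M N Q f \<Longrightarrow> add_hom T Q (tensor_lift Q f)"
  by (rule add_homI) (simp_all add: T_simps tensor_lift_closed_add)

text \<open>All equalities of maps out of tensor products are proved through this criterion.\<close>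

lemma add_hom_eqI:
  assumes "abelian_group Q" "add_hom T Q g" "add_hom T Q h" "t \<in> carrier T"
    and "\<And>x y. x \<in> carrier M \<Longrightarrow> y \<in> carrier N \<Longrightarrow> g (pure x y) = h (pure x y)"
  shows "g t = h t"
  using assms(4)
proof (induction t rule: T_induct)
  case zero
  then show ?case using add_hom_zero[OF abelian_group_T] assms by metis
qed (use assms add_hom_add in \<open>simp_all add: add_hom_add\<close>)

text \<open>The additive group underlying \<open>T\<close>, through which the scalar action of \<open>T\<close> is defined.\<close>

abbreviation T_group :: "('m, 'n) tensor ring" where
  "T_group \<equiv> \<lparr>carrier = carrier (tensor_group A M N), monoid.mult = undefined, one = undefined,
     ring.zero = \<one>\<^bsub>tensor_group A M N\<^esub>, ring.add = monoid.mult (tensor_group A M N)\<rparr>"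

lemma smult_T_def: "b \<odot>\<^bsub>T\<^esub> t = tensor_lift T_group (\<lambda>(x, y). pure (s b x) y) t"
  by (simp add: tensor_with_action_def Let_def ring.defs module.defs)

lemma add_hom_T_group: "add_hom X T_group g \<longleftrightarrow> add_hom X T g" "add_hom T_group X g \<longleftrightarrow> add_hom T X g"
  by (simp_all add: add_hom_def T_simps)

lemma balanced_T_group: "balanced A M N T_group f \<longleftrightarrow> balanced A M N T f"
  by (simp add: balanced_def add_hom_def T_simps)

lemma abelian_group_T_group: "abelian_group T_group"
proof -
  interpret TG: comm_group "tensor_group A M N" by (rule comm_group_tensor_group)
  show ?thesis
    by (rule abelian_groupI) (auto simp: TG.m_ac intro!: TG.l_inv_ex)
qed

lemma balanced_action:
  assumes b: "b \<in> carrier B"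
  shows "balanced A M N T (\<lambda>(x, y). pure (s b x) y)"
proof -
  have sM: "s b x \<in> carrier M" if "x \<in> carrier M" for x using s_add_hom[OF b] that by (rule add_hom_closed)
  show ?thesis
    unfolding balanced_def
  proof (intro conjI ballI)
    fix y assume y: "y \<in> carrier N"
    show "add_hom M T (\<lambda>x. case (x, y) of (x, y) \<Rightarrow> pure (s b x) y)"
      using add_hom_comp[OF s_add_hom[OF b] pure_add_hom_left[OF y]] by simp
  next
    fix x assume "x \<in> carrier M"
    then show "add_hom N T (\<lambda>y. case (x, y) of (x, y) \<Rightarrow> pure (s b x) y)"
      using pure_add_hom_right[OF sM] by simp
  next
    fix a x y assume "a \<in> carrier A" "x \<in> carrier M" "y \<in> carrier N"
    then show "(case (a \<odot>\<^bsub>M\<^esub> x, y) of (x, y) \<Rightarrow> pure (s b x) y) = (case (x, a \<odot>\<^bsub>N\<^esub> y) of (x, y) \<Rightarrow> pure (s b x) y)"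
      using s_smult[OF b] sM by (simp add: pure_balanced)
  qed
qed

lemma smult_pure:
  "b \<in> carrier B \<Longrightarrow> x \<in> carrier M \<Longrightarrow> y \<in> carrier N \<Longrightarrow> b \<odot>\<^bsub>T\<^esub> pure x y = pure (s b x) y"
  unfolding smult_T_def
  by (subst tensor_lift_pure[OF abelian_group_T_group]) (simp_all add: balanced_T_group balanced_action)

lemma smult_add_hom: "b \<in> carrier B \<Longrightarrow> add_hom T T (\<lambda>t. b \<odot>\<^bsub>T\<^esub> t)"
  using tensor_lift_add_hom[OF abelian_group_T_group, of "\<lambda>(x, y). pure (s b x) y"]
  unfolding smult_T_def by (simp add: balanced_T_group balanced_action add_hom_T_group)

lemma module_T: "module B T"
proof (rule moduleI[OF B.cring_axioms abelian_group_T])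
  interpret T: abelian_group T by (rule abelian_group_T)
  have sM: "s b x \<in> carrier M" if "b \<in> carrier B" "x \<in> carrier M" for b x
    using s_add_hom that by (blast intro: add_hom_closed)
  fix a t assume a: "a \<in> carrier B" and t: "t \<in> carrier T"
  show "a \<odot>\<^bsub>T\<^esub> t \<in> carrier T" using add_hom_closed[OF smult_add_hom[OF a] t] .
  show "a \<odot>\<^bsub>T\<^esub> (t \<oplus>\<^bsub>T\<^esub> u) = a \<odot>\<^bsub>T\<^esub> t \<oplus>\<^bsub>T\<^esub> a \<odot>\<^bsub>T\<^esub> u" if "u \<in> carrier T" for u
    using add_hom_add[OF smult_add_hom[OF a] t that] .
  fix b assume b: "b \<in> carrier B"
  show "(a \<oplus>\<^bsub>B\<^esub> b) \<odot>\<^bsub>T\<^esub> t = a \<odot>\<^bsub>T\<^esub> t \<oplus>\<^bsub>T\<^esub> b \<odot>\<^bsub>T\<^esub> t"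
    by (rule add_hom_eqI[OF abelian_group_T smult_add_hom add_hom_sum[OF abelian_group_T smult_add_hom smult_add_hom] t])
      (use a b sM in \<open>simp_all add: smult_pure s_add add_hom_add[OF pure_add_hom_left]\<close>)
  show "(a \<otimes>\<^bsub>B\<^esub> b) \<odot>\<^bsub>T\<^esub> t = a \<odot>\<^bsub>T\<^esub> (b \<odot>\<^bsub>T\<^esub> t)"
    by (rule add_hom_eqI[OF abelian_group_T smult_add_hom add_hom_comp[OF smult_add_hom smult_add_hom] t])
      (use a b sM in \<open>simp_all add: smult_pure s_mult\<close>)
next
  fix t assume t: "t \<in> carrier T"
  show "\<one>\<^bsub>B\<^esub> \<odot>\<^bsub>T\<^esub> t = t"
    by (rule add_hom_eqI[OF abelian_group_T smult_add_hom _ t])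
      (auto intro: add_homI simp: smult_pure s_one)
qed

end

section \<open>Linear maps, dual bases and base change\<close>

definition linear_map ::
  "('a, 'k) ring_scheme \<Rightarrow> ('a, 'm, 'x) module_scheme \<Rightarrow> ('a, 'n, 'y) module_scheme \<Rightarrow> ('m \<Rightarrow> 'n) \<Rightarrow> bool" where
  "linear_map A M N g \<longleftrightarrow> add_hom M N g \<and> (\<forall>a\<in>carrier A. \<forall>x\<in>carrier M. g (a \<odot>\<^bsub>M\<^esub> x) = a \<odot>\<^bsub>N\<^esub> g x)"

lemma lin_maps_linear_map: "g \<in> lin_maps A M N \<Longrightarrow> linear_map A M N g"
  by (auto simp: lin_maps_def linear_map_def add_hom_def)

lemma linear_map_add_hom: "linear_map A M N g \<Longrightarrow> add_hom M N g"
  and linear_map_smult: "linear_map A M N g \<Longrightarrow> a \<in> carrier A \<Longrightarrow> x \<in> carrier M \<Longrightarrow> g (a \<odot>\<^bsub>M\<^esub> x) = a \<odot>\<^bsub>N\<^esub> g x"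
  by (auto simp: linear_map_def)

text \<open>The ring is its own target here, instead of the ring regarded as a module over itself: values of
  functionals are matrix entries.\<close>

definition functional :: "('a, 'k) ring_scheme \<Rightarrow> ('a, 'm, 'x) module_scheme \<Rightarrow> ('m \<Rightarrow> 'a) \<Rightarrow> bool" where
  "functional A M f \<longleftrightarrow> add_hom M A f \<and> (\<forall>a\<in>carrier A. \<forall>x\<in>carrier M. f (a \<odot>\<^bsub>M\<^esub> x) = a \<otimes>\<^bsub>A\<^esub> f x)"

lemma functional_add_hom: "functional A M f \<Longrightarrow> add_hom M A f"
  and functional_smult: "functional A M f \<Longrightarrow> a \<in> carrier A \<Longrightarrow> x \<in> carrier M \<Longrightarrow> f (a \<odot>\<^bsub>M\<^esub> x) = a \<otimes>\<^bsub>A\<^esub> f x"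
  by (auto simp: functional_def)

lemma functional_comp_linear_map: "linear_map A M N g \<Longrightarrow> functional A N f \<Longrightarrow> functional A M (\<lambda>x. f (g x))"
  by (auto simp: functional_def linear_map_def intro: add_hom_comp dest: add_hom_closed)

definition dual_basis ::
  "('a, 'k) ring_scheme \<Rightarrow> ('a, 'm, 'x) module_scheme \<Rightarrow> nat \<Rightarrow> (nat \<Rightarrow> 'm) \<Rightarrow> (nat \<Rightarrow> 'm \<Rightarrow> 'a) \<Rightarrow> bool" where
  "dual_basis A M n l f \<longleftrightarrow> (\<forall>j<n. l j \<in> carrier M) \<and> (\<forall>j<n. functional A M (f j)) \<and>
    (\<forall>x\<in>carrier M. x = (\<Oplus>\<^bsub>M\<^esub>j\<in>{..<n}. f j x \<odot>\<^bsub>M\<^esub> l j))"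

lemma dual_basisD:
  assumes "dual_basis A M n l f"
  shows "j < n \<Longrightarrow> l j \<in> carrier M" "j < n \<Longrightarrow> functional A M (f j)"
    "x \<in> carrier M \<Longrightarrow> (\<Oplus>\<^bsub>M\<^esub>j\<in>{..<n}. f j x \<odot>\<^bsub>M\<^esub> l j) = x"
  using assms by (auto simp: dual_basis_def)

lemma dual_basis_closed:
  "dual_basis A M n l f \<Longrightarrow> j < n \<Longrightarrow> x \<in> carrier M \<Longrightarrow> f j x \<in> carrier A"
  by (auto simp: dual_basis_def functional_def dest: add_hom_closed)

text \<open>The images of the unit vectors under the retraction \<open>q\<close>, with the coordinates of the embedding \<open>i\<close>.\<close>

lemma finite_projective_dual_basis:
  assumes "finite_projective A M"
  obtains n l f where "dual_basis A M n l f"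
proof -
  interpret M: module A M using assms by (simp add: finite_projective_def)
  obtain n i q where i: "i \<in> lin_maps A M (free_module A n)"
    and q: "q \<in> lin_maps A (free_module A n) M" and qi: "\<And>x. x \<in> carrier M \<Longrightarrow> q (i x) = x"
    using assms by (auto simp: finite_projective_def)
  let ?F = "free_module A n"
  define e where "e j = (\<lambda>k\<in>{..<n}. if k = j then \<one>\<^bsub>A\<^esub> else \<zero>\<^bsub>A\<^esub>)" for j
  have e: "e j \<in> carrier ?F" for j by (auto simp: e_def free_module_def)
  have q_closed: "q v \<in> carrier M" if "v \<in> carrier ?F" for v using q that by (auto simp: lin_maps_def)
  have expand: "q v = (\<Oplus>\<^bsub>M\<^esub>j\<in>{..<n}. v j \<odot>\<^bsub>M\<^esub> q (e j))" if v: "v \<in> carrier ?F" for v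
  proof -
    have vA: "v j \<in> carrier A" if "j < n" for j using v that by (auto simp: free_module_def)
    \<comment> \<open>truncations, to write a vector as a sum of multiples of unit vectors by induction\<close>
    define tr where "tr k = (\<lambda>m\<in>{..<n}. if m < k then v m else \<zero>\<^bsub>A\<^esub>)" for k
    have tr: "tr k \<in> carrier ?F" for k using vA by (auto simp: tr_def free_module_def)
    have "q (tr k) = (\<Oplus>\<^bsub>M\<^esub>j\<in>{..<k}. v j \<odot>\<^bsub>M\<^esub> q (e j))" if "k \<le> n" for k
      using that
    proof (induction k)
      case 0
      have "tr 0 = \<zero>\<^bsub>A\<^esub> \<odot>\<^bsub>?F\<^esub> v" using vA by (auto simp: tr_def free_module_def)
      then have "q (tr 0) = \<zero>\<^bsub>A\<^esub> \<odot>\<^bsub>M\<^esub> q v" using q v by (simp add: lin_maps_def)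
      then show ?case using q_closed[OF v] by simp
    next
      case (Suc k)
      have "tr (Suc k) = tr k \<oplus>\<^bsub>?F\<^esub> v k \<odot>\<^bsub>?F\<^esub> e k"
        using Suc.prems vA by (auto simp: tr_def e_def free_module_def less_Suc_eq)
      moreover have "v k \<odot>\<^bsub>?F\<^esub> e k \<in> carrier ?F" using Suc.prems vA by (auto simp: e_def free_module_def)
      ultimately have "q (tr (Suc k)) = q (tr k) \<oplus>\<^bsub>M\<^esub> v k \<odot>\<^bsub>M\<^esub> q (e k)"
        using q tr e vA Suc.prems by (simp add: lin_maps_def)
      then show ?case
        using Suc vA q_closed[OF e] by (simp add: lessThan_Suc M.a_comm Pi_iff)
    qed
    from this[of n] have "q (tr n) = (\<Oplus>\<^bsub>M\<^esub>j\<in>{..<n}. v j \<odot>\<^bsub>M\<^esub> q (e j))" by simp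
    moreover have "tr n = v"
      using v by (auto simp: tr_def free_module_def PiE_iff extensional_def fun_eq_iff)
    ultimately show ?thesis by simp
  qed
  have iF: "i x \<in> carrier ?F" if "x \<in> carrier M" for x using i that by (auto simp: lin_maps_def)
  have "functional A M (\<lambda>x. i x j)" if "j < n" for j
    unfolding functional_def
  proof (intro conjI ballI add_homI)
    fix x assume "x \<in> carrier M"
    then show "i x j \<in> carrier A" using iF[of x] that by (auto simp: free_module_def)
  next
    fix x y assume "x \<in> carrier M" "y \<in> carrier M"
    then show "i (x \<oplus>\<^bsub>M\<^esub> y) j = i x j \<oplus>\<^bsub>A\<^esub> i y j" using i that by (simp add: lin_maps_def free_module_def)
  next
    fix a x assume "a \<in> carrier A" "x \<in> carrier M"
    then show "i (a \<odot>\<^bsub>M\<^esub> x) j = a \<otimes>\<^bsub>A\<^esub> i x j" using i that by (simp add: lin_maps_def free_module_def)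
  qed
  then have "dual_basis A M n (\<lambda>j. q (e j)) (\<lambda>j x. i x j)"
    unfolding dual_basis_def using expand[OF iF] qi q_closed[OF e] by simp
  then show ?thesis by (rule that)
qed

lemma linear_map_expand:
  assumes "module A M" "module A N" "linear_map A M N g" "dual_basis A M n l f" "x \<in> carrier M"
  shows "g x = (\<Oplus>\<^bsub>N\<^esub>j\<in>{..<n}. f j x \<odot>\<^bsub>N\<^esub> g (l j))"
proof -
  interpret M: module A M by fact
  interpret N: module A N by fact
  have fl: "f j x \<in> carrier A" "l j \<in> carrier M" if "j < n" for j
    using dual_basis_closed[OF assms(4) that assms(5)] dual_basisD(1)[OF assms(4) that] by simp_all
  have "g x = g (\<Oplus>\<^bsub>M\<^esub>j\<in>{..<n}. f j x \<odot>\<^bsub>M\<^esub> l j)"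
    using dual_basisD(3)[OF assms(4,5)] by simp
  also have "\<dots> = (\<Oplus>\<^bsub>N\<^esub>j\<in>{..<n}. g (f j x \<odot>\<^bsub>M\<^esub> l j))"
    by (rule add_hom_finsum[OF M.abelian_group_axioms N.abelian_group_axioms linear_map_add_hom[OF assms(3)]])
      (use fl in simp)
  also have "\<dots> = (\<Oplus>\<^bsub>N\<^esub>j\<in>{..<n}. f j x \<odot>\<^bsub>N\<^esub> g (l j))"
    by (rule N.finsum_cong')
      (use fl in \<open>auto simp: linear_map_smult[OF assms(3)] dest: add_hom_closed[OF linear_map_add_hom[OF assms(3)]]\<close>)
  finally show ?thesis .
qed

lemma ring_as_module_simps [simp]:
  "carrier (ring_as_module B \<phi>) = carrier B" "x \<oplus>\<^bsub>ring_as_module B \<phi>\<^esub> y = x \<oplus>\<^bsub>B\<^esub> y"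
  "\<zero>\<^bsub>ring_as_module B \<phi>\<^esub> = \<zero>\<^bsub>B\<^esub>" "a \<odot>\<^bsub>ring_as_module B \<phi>\<^esub> x = \<phi> a \<otimes>\<^bsub>B\<^esub> x"
  by (simp_all add: ring_as_module_def)

lemma (in ring_hom_cring) module_ring_as_module: "module R (ring_as_module S h)"
proof (rule moduleI[OF R.cring_axioms])
  show "abelian_group (ring_as_module S h)"
    by (rule abelian_groupI) (auto simp: S.a_ac intro!: S.add.l_inv_ex)
qed (auto simp: S.l_distr S.r_distr S.m_assoc)

lemma (in cring) ring_hom_cring_id: "ring_hom_cring R R (\<lambda>x. x)"
  by (intro ring_hom_cringI ring_hom_ringI2 ring_hom_memI cring_axioms ring_axioms) simp_all

lemma functional_iff_linear_map: "functional A M f \<longleftrightarrow> linear_map A M (ring_as_module A (\<lambda>x. x)) f"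
  by (simp add: functional_def linear_map_def add_hom_def)

lemma functional_expand:
  assumes "module A M" "functional A M g" "dual_basis A M n l f" "x \<in> carrier M"
  shows "g x = (\<Oplus>\<^bsub>A\<^esub>j\<in>{..<n}. f j x \<otimes>\<^bsub>A\<^esub> g (l j))"
proof -
  interpret M: module A M by fact
  interpret N: module A "ring_as_module A (\<lambda>x. x)"
    by (rule ring_hom_cring.module_ring_as_module[OF M.R.ring_hom_cring_id])
  have id: "add_hom (ring_as_module A (\<lambda>x. x)) A (\<lambda>x. x)" by (rule add_homI) simp_all
  have fl: "f j x \<otimes>\<^bsub>A\<^esub> g (l j) \<in> carrier A" if "j < n" for j
    using dual_basis_closed[OF assms(3) that assms(4)] dual_basisD(1)[OF assms(3) that]
      add_hom_closed[OF functional_add_hom[OF assms(2)]] by simp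
  have "g x = (\<Oplus>\<^bsub>ring_as_module A (\<lambda>x. x)\<^esub>j\<in>{..<n}. f j x \<otimes>\<^bsub>A\<^esub> g (l j))"
    using linear_map_expand[OF assms(1) N.module_axioms _ assms(3,4), of g] assms(2)
    by (simp add: functional_iff_linear_map)
  also have "\<dots> = (\<Oplus>\<^bsub>A\<^esub>j\<in>{..<n}. f j x \<otimes>\<^bsub>A\<^esub> g (l j))"
    by (rule add_hom_finsum[OF N.abelian_group_axioms M.R.abelian_group_axioms id]) (use fl in simp)
  finally show ?thesis .
qed

locale base_change_module = hom: ring_hom_cring A B \<phi> + module A M
  for A :: "('a, 'k) ring_scheme" and B :: "('b, 'l) ring_scheme" and \<phi> :: "'a \<Rightarrow> 'b"
    and M :: "('a, 'm, 'x) module_scheme"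

sublocale base_change_module \<subseteq> bc: tensor_action A "ring_as_module B \<phi>" M B "monoid.mult B"
proof (intro tensor_action.intro tensor_pair.intro tensor_pair_axioms.intro tensor_action_axioms.intro)
  interpret BM: module A "ring_as_module B \<phi>" by (rule hom.module_ring_as_module)
  show "abelian_group (ring_as_module B \<phi>)" by (rule BM.abelian_group_axioms)
qed (auto intro!: add_homI M.abelian_group_axioms hom.S.cring_axioms simp: hom.S.r_distr hom.S.l_distr hom.S.m_ac)

context base_change_module
begin

abbreviation "BM \<equiv> base_change A B \<phi> M"
abbreviation "unit \<equiv> base_change_unit A B \<phi> M"

lemma BM_eq: "BM = bc.T"
  by (simp add: base_change_def)

lemma module_BM: "module B BM"
  unfolding BM_eq by (rule bc.module_T)

lemma abelian_group_BM: "abelian_group BM"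
  unfolding BM_eq by (rule bc.abelian_group_T)

lemma pure_BM: "b \<in> carrier B \<Longrightarrow> x \<in> carrier M \<Longrightarrow> bc.pure b x \<in> carrier BM"
  unfolding BM_eq by (rule bc.pure_in_T) simp_all

lemma unit_closed: "x \<in> carrier M \<Longrightarrow> unit x \<in> carrier BM"
  by (simp add: base_change_unit_def pure_BM)

lemma smult_unit: "b \<in> carrier B \<Longrightarrow> x \<in> carrier M \<Longrightarrow> b \<odot>\<^bsub>BM\<^esub> unit x = bc.pure b x"
  by (simp add: base_change_unit_def BM_eq bc.smult_pure)

lemma unit_add_hom: "add_hom M BM unit"
  unfolding base_change_unit_def BM_eq by (rule bc.pure_add_hom_right) simp

lemma unit_smult:
  assumes "a \<in> carrier A" "x \<in> carrier M"
  shows "unit (a \<odot>\<^bsub>M\<^esub> x) = \<phi> a \<odot>\<^bsub>BM\<^esub> unit x"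
  using bc.pure_balanced[of a "\<one>\<^bsub>B\<^esub>" x] assms
  by (simp add: smult_unit) (simp add: base_change_unit_def)

lemma BM_induct [consumes 1, case_names zero pure add]:
  assumes "t \<in> carrier BM" "P \<zero>\<^bsub>BM\<^esub>" "\<And>b x. b \<in> carrier B \<Longrightarrow> x \<in> carrier M \<Longrightarrow> P (b \<odot>\<^bsub>BM\<^esub> unit x)"
    "\<And>t u. t \<in> carrier BM \<Longrightarrow> u \<in> carrier BM \<Longrightarrow> P t \<Longrightarrow> P u \<Longrightarrow> P (t \<oplus>\<^bsub>BM\<^esub> u)"
  shows "P t"
proof -
  have pure: "P (bc.pure b x)" if "b \<in> carrier B" "x \<in> carrier M" for b x
    using assms(3)[OF that] smult_unit[OF that] by simp
  show ?thesis
    by (rule bc.T_induct[OF assms(1)[unfolded BM_eq], where P = P])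
      (use assms(2,4) pure in \<open>simp_all add: BM_eq\<close>)
qed

lemma BM_eqI:
  assumes "abelian_group Q" "add_hom BM Q g" "add_hom BM Q h" "t \<in> carrier BM"
    and "\<And>b x. b \<in> carrier B \<Longrightarrow> x \<in> carrier M \<Longrightarrow> g (b \<odot>\<^bsub>BM\<^esub> unit x) = h (b \<odot>\<^bsub>BM\<^esub> unit x)"
  shows "g t = h t"
  by (rule bc.add_hom_eqI[OF assms(1) assms(2,3,4)[unfolded BM_eq]])
    (use assms(5) smult_unit in \<open>auto simp: BM_eq\<close>)

lemma
  assumes "module C N" "ring_hom_cring B C \<psi>" "add_hom M N h"
    and "\<And>a x. a \<in> carrier A \<Longrightarrow> x \<in> carrier M \<Longrightarrow> h (a \<odot>\<^bsub>M\<^esub> x) = \<psi> (\<phi> a) \<odot>\<^bsub>N\<^esub> h x"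
  shows semilinearization_add_hom: "add_hom BM N (semilinearization N \<psi> h)"
    and semilinearization_unit: "b \<in> carrier B \<Longrightarrow> x \<in> carrier M \<Longrightarrow>
      semilinearization N \<psi> h (b \<odot>\<^bsub>BM\<^esub> unit x) = \<psi> b \<odot>\<^bsub>N\<^esub> h x"
    and semilinearization_smult: "b \<in> carrier B \<Longrightarrow> t \<in> carrier BM \<Longrightarrow>
      semilinearization N \<psi> h (b \<odot>\<^bsub>BM\<^esub> t) = \<psi> b \<odot>\<^bsub>N\<^esub> semilinearization N \<psi> h t"
proof -
  interpret N: module C N by fact
  interpret \<psi>: ring_hom_cring B C \<psi> by fact
  interpret BM: module B BM by (rule module_BM)
  have hN: "h x \<in> carrier N" if "x \<in> carrier M" for x using add_hom_closed[OF assms(3) that] .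
  have bal: "balanced A (ring_as_module B \<phi>) M N (\<lambda>(b, x). \<psi> b \<odot>\<^bsub>N\<^esub> h x)"
    unfolding balanced_def
    by (auto intro!: add_homI simp: hN N.smult_l_distr N.smult_r_distr add_hom_add[OF assms(3)] assms(4)
        N.smult_assoc1[symmetric] N.R.m_comm)
  show ah: "add_hom BM N (semilinearization N \<psi> h)"
    unfolding semilinearization_def BM_eq by (rule bc.tensor_lift_add_hom[OF N.abelian_group_axioms bal])
  show pure: "semilinearization N \<psi> h (b \<odot>\<^bsub>BM\<^esub> unit x) = \<psi> b \<odot>\<^bsub>N\<^esub> h x"
    if "b \<in> carrier B" "x \<in> carrier M" for b x
    using that unfolding smult_unit[OF that] semilinearization_def
    by (subst bc.tensor_lift_pure[OF N.abelian_group_axioms bal]) simp_all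
  show "semilinearization N \<psi> h (b \<odot>\<^bsub>BM\<^esub> t) = \<psi> b \<odot>\<^bsub>N\<^esub> semilinearization N \<psi> h t"
    if b: "b \<in> carrier B" and t: "t \<in> carrier BM" for b t
  proof (rule BM_eqI[OF N.abelian_group_axioms _ _ t])
    show "add_hom BM N (\<lambda>t. semilinearization N \<psi> h (b \<odot>\<^bsub>BM\<^esub> t))"
      by (rule add_hom_comp[OF _ ah], rule add_homI) (use b in \<open>simp_all add: BM.smult_r_distr\<close>)
    show "add_hom BM N (\<lambda>t. \<psi> b \<odot>\<^bsub>N\<^esub> semilinearization N \<psi> h t)"
      by (rule add_hom_comp[OF ah], rule add_homI) (use b in \<open>simp_all add: N.smult_r_distr\<close>)
    fix b' x assume "b' \<in> carrier B" "x \<in> carrier M"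
    then show "semilinearization N \<psi> h (b \<odot>\<^bsub>BM\<^esub> (b' \<odot>\<^bsub>BM\<^esub> unit x)) = \<psi> b \<odot>\<^bsub>N\<^esub> semilinearization N \<psi> h (b' \<odot>\<^bsub>BM\<^esub> unit x)"
      using b hN by (simp add: BM.smult_assoc1[symmetric] unit_closed pure N.smult_assoc1)
  qed
qed

lemma
  assumes N: "module B N" and h: "add_hom M N h"
    and hs: "\<And>a x. a \<in> carrier A \<Longrightarrow> x \<in> carrier M \<Longrightarrow> h (a \<odot>\<^bsub>M\<^esub> x) = \<phi> a \<odot>\<^bsub>N\<^esub> h x"
  shows linearization_linear: "linear_map B BM N (linearization N h)"
    and linearization_unit: "b \<in> carrier B \<Longrightarrow> x \<in> carrier M \<Longrightarrow>
      linearization N h (b \<odot>\<^bsub>BM\<^esub> unit x) = b \<odot>\<^bsub>N\<^esub> h x"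
proof -
  note id = hom.S.ring_hom_cring_id
  show "linear_map B BM N (linearization N h)"
    unfolding linear_map_def
    using semilinearization_add_hom[OF N id h] semilinearization_smult[OF N id h] hs by blast
  show "b \<in> carrier B \<Longrightarrow> x \<in> carrier M \<Longrightarrow> linearization N h (b \<odot>\<^bsub>BM\<^esub> unit x) = b \<odot>\<^bsub>N\<^esub> h x"
    using semilinearization_unit[OF N id h] hs by blast
qed

text \<open>The base change \<open>b \<otimes> x \<mapsto> b \<phi>(f(x))\<close> of a functional.\<close>

definition extend_functional :: "('m \<Rightarrow> 'a) \<Rightarrow> ('b, 'm) tensor \<Rightarrow> 'b" where
  "extend_functional f = linearization (ring_as_module B (\<lambda>x. x)) (\<lambda>x. \<phi> (f x))"

lemma
  assumes "functional A M f"
  shows functional_extend_functional: "functional B BM (extend_functional f)"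
    and extend_functional_unit: "b \<in> carrier B \<Longrightarrow> x \<in> carrier M \<Longrightarrow>
      extend_functional f (b \<odot>\<^bsub>BM\<^esub> unit x) = b \<otimes>\<^bsub>B\<^esub> \<phi> (f x)"
proof -
  let ?N = "ring_as_module B (\<lambda>x. x)"
  have fA: "f x \<in> carrier A" if "x \<in> carrier M" for x
    using add_hom_closed[OF functional_add_hom[OF assms] that] .
  have 1: "module B ?N" by (rule ring_hom_cring.module_ring_as_module[OF hom.S.ring_hom_cring_id])
  have 2: "add_hom M ?N (\<lambda>x. \<phi> (f x))"
    by (rule add_homI) (simp_all add: fA add_hom_add[OF functional_add_hom[OF assms]])
  have 3: "\<phi> (f (a \<odot>\<^bsub>M\<^esub> x)) = \<phi> a \<odot>\<^bsub>?N\<^esub> \<phi> (f x)" if "a \<in> carrier A" "x \<in> carrier M" for a x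
    using that fA by (simp add: functional_smult[OF assms])
  show "functional B BM (extend_functional f)"
    unfolding extend_functional_def functional_iff_linear_map by (rule linearization_linear[OF 1 2 3])
  show "b \<in> carrier B \<Longrightarrow> x \<in> carrier M \<Longrightarrow> extend_functional f (b \<odot>\<^bsub>BM\<^esub> unit x) = b \<otimes>\<^bsub>B\<^esub> \<phi> (f x)"
    unfolding extend_functional_def using linearization_unit[OF 1 2 3] by simp
qed

lemma dual_basis_BM:
  assumes db: "dual_basis A M n l f"
  shows "dual_basis B BM n (\<lambda>j. unit (l j)) (\<lambda>j. extend_functional (f j))"
  unfolding dual_basis_def
proof (intro conjI allI impI ballI)
  interpret BM: module B BM by (rule module_BM)
  note l = dual_basisD(1)[OF db] and f = dual_basisD(2)[OF db]
  fix j assume "j < n"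
  then show "unit (l j) \<in> carrier BM" "functional B BM (extend_functional (f j))"
    using l f by (auto intro: unit_closed functional_extend_functional)
next
  interpret BM: module B BM by (rule module_BM)
  note l = dual_basisD(1)[OF db] and f = dual_basisD(2)[OF db]
  note ef = functional_add_hom[OF functional_extend_functional[OF f]]
  fix t assume t: "t \<in> carrier BM"
  show "t = (\<Oplus>\<^bsub>BM\<^esub>j\<in>{..<n}. extend_functional (f j) t \<odot>\<^bsub>BM\<^esub> unit (l j))"
  proof (rule BM_eqI[OF abelian_group_BM _ _ t, where g = "\<lambda>t. t"])
    show "add_hom BM BM (\<lambda>t. t)" by (rule add_homI) simp_all
    show "add_hom BM BM (\<lambda>t. \<Oplus>\<^bsub>BM\<^esub>j\<in>{..<n}. extend_functional (f j) t \<odot>\<^bsub>BM\<^esub> unit (l j))"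
    proof (rule add_homI)
      fix t u assume t: "t \<in> carrier BM" and u: "u \<in> carrier BM"
      have c: "extend_functional (f j) t \<odot>\<^bsub>BM\<^esub> unit (l j) \<in> carrier BM" if "j < n" "t \<in> carrier BM" for j t
        using add_hom_closed[OF ef] that unit_closed[OF l] by simp
      show "(\<Oplus>\<^bsub>BM\<^esub>j\<in>{..<n}. extend_functional (f j) t \<odot>\<^bsub>BM\<^esub> unit (l j)) \<in> carrier BM"
        using c t by (intro BM.M.finsum_closed) simp
      have "(\<Oplus>\<^bsub>BM\<^esub>j\<in>{..<n}. extend_functional (f j) (t \<oplus>\<^bsub>BM\<^esub> u) \<odot>\<^bsub>BM\<^esub> unit (l j))
          = (\<Oplus>\<^bsub>BM\<^esub>j\<in>{..<n}. extend_functional (f j) t \<odot>\<^bsub>BM\<^esub> unit (l j) \<oplus>\<^bsub>BM\<^esub> extend_functional (f j) u \<odot>\<^bsub>BM\<^esub> unit (l j))"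
        by (rule BM.M.finsum_cong')
          (use t u c add_hom_closed[OF ef] unit_closed[OF l] in \<open>auto simp: add_hom_add[OF ef] BM.smult_l_distr\<close>)
      also have "\<dots> = (\<Oplus>\<^bsub>BM\<^esub>j\<in>{..<n}. extend_functional (f j) t \<odot>\<^bsub>BM\<^esub> unit (l j)) \<oplus>\<^bsub>BM\<^esub>
          (\<Oplus>\<^bsub>BM\<^esub>j\<in>{..<n}. extend_functional (f j) u \<odot>\<^bsub>BM\<^esub> unit (l j))"
        by (rule BM.M.finsum_addf) (use t u c in auto)
      finally show "(\<Oplus>\<^bsub>BM\<^esub>j\<in>{..<n}. extend_functional (f j) (t \<oplus>\<^bsub>BM\<^esub> u) \<odot>\<^bsub>BM\<^esub> unit (l j))
          = (\<Oplus>\<^bsub>BM\<^esub>j\<in>{..<n}. extend_functional (f j) t \<odot>\<^bsub>BM\<^esub> unit (l j)) \<oplus>\<^bsub>BM\<^esub>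
          (\<Oplus>\<^bsub>BM\<^esub>j\<in>{..<n}. extend_functional (f j) u \<odot>\<^bsub>BM\<^esub> unit (l j))" .
    qed
    fix b x assume b: "b \<in> carrier B" and x: "x \<in> carrier M"
    have fA: "f j x \<in> carrier A" if "j < n" for j using dual_basis_closed[OF db that x] .
    have "b \<odot>\<^bsub>BM\<^esub> unit x = b \<odot>\<^bsub>BM\<^esub> unit (\<Oplus>\<^bsub>M\<^esub>j\<in>{..<n}. f j x \<odot>\<^bsub>M\<^esub> l j)"
      using dual_basisD(3)[OF db x] by simp
    also have "\<dots> = (\<Oplus>\<^bsub>BM\<^esub>j\<in>{..<n}. b \<odot>\<^bsub>BM\<^esub> unit (f j x \<odot>\<^bsub>M\<^esub> l j))"
    proof -
      have "add_hom M BM (\<lambda>x. b \<odot>\<^bsub>BM\<^esub> unit x)"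
        by (rule add_hom_comp[OF unit_add_hom], rule add_homI) (use b in \<open>simp_all add: BM.smult_r_distr\<close>)
      from add_hom_finsum[OF M.abelian_group_axioms abelian_group_BM this, of "{..<n}" "\<lambda>j. f j x \<odot>\<^bsub>M\<^esub> l j"]
      show ?thesis using fA l by simp
    qed
    also have "\<dots> = (\<Oplus>\<^bsub>BM\<^esub>j\<in>{..<n}. extend_functional (f j) (b \<odot>\<^bsub>BM\<^esub> unit x) \<odot>\<^bsub>BM\<^esub> unit (l j))"
      by (rule BM.M.finsum_cong')
        (use b x l fA in \<open>auto simp: unit_smult extend_functional_unit[OF f] BM.smult_assoc1 unit_closed\<close>)
    finally show "b \<odot>\<^bsub>BM\<^esub> unit x = (\<Oplus>\<^bsub>BM\<^esub>j\<in>{..<n}. extend_functional (f j) (b \<odot>\<^bsub>BM\<^esub> unit x) \<odot>\<^bsub>BM\<^esub> unit (l j))" .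
  qed
qed

lemma
  assumes "module A M'" "linear_map A M M' g"
  shows base_change_map_linear: "linear_map B BM (base_change A B \<phi> M') (base_change_map A B \<phi> M' g)"
    and base_change_map_unit: "b \<in> carrier B \<Longrightarrow> x \<in> carrier M \<Longrightarrow>
      base_change_map A B \<phi> M' g (b \<odot>\<^bsub>BM\<^esub> unit x) = b \<odot>\<^bsub>base_change A B \<phi> M'\<^esub> base_change_unit A B \<phi> M' (g x)"
proof -
  interpret M': base_change_module A B \<phi> M'
    by (rule base_change_module.intro[OF hom.ring_hom_cring_axioms assms(1)])
  have 1: "add_hom M M'.BM (\<lambda>x. M'.unit (g x))"
    by (rule add_hom_comp[OF linear_map_add_hom[OF assms(2)] M'.unit_add_hom])
  have 2: "M'.unit (g (a \<odot>\<^bsub>M\<^esub> x)) = \<phi> a \<odot>\<^bsub>M'.BM\<^esub> M'.unit (g x)" if "a \<in> carrier A" "x \<in> carrier M" for a x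
    using that add_hom_closed[OF linear_map_add_hom[OF assms(2)]]
    by (simp add: linear_map_smult[OF assms(2)] M'.unit_smult)
  show "linear_map B BM M'.BM (base_change_map A B \<phi> M' g)"
    unfolding base_change_map_def by (rule linearization_linear[OF M'.module_BM 1 2])
  show "b \<in> carrier B \<Longrightarrow> x \<in> carrier M \<Longrightarrow>
      base_change_map A B \<phi> M' g (b \<odot>\<^bsub>BM\<^esub> unit x) = b \<odot>\<^bsub>M'.BM\<^esub> M'.unit (g x)"
    unfolding base_change_map_def by (rule linearization_unit[OF M'.module_BM 1 2])
qed

end

section \<open>The divided Frobenius on tensor products with \<open>I\<close>\<close>

lemma tensor_action_product:
  assumes "module A M" "module A N"
  shows "tensor_action A M N A (smult M)"
proof -
  interpret M: module A M by fact
  interpret N: module A N by fact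
  show ?thesis
    by (intro tensor_action.intro tensor_pair.intro tensor_pair_axioms.intro tensor_action_axioms.intro
        M.abelian_group_axioms N.abelian_group_axioms M.R.cring_axioms add_homI)
      (simp_all add: M.smult_l_distr M.smult_r_distr M.smult_assoc1[symmetric] M.R.m_comm)
qed

context witt_ring
begin

lemma witt_I_simps:
  "carrier (witt_I p R) = {x \<in> carrier W. x 0 = \<zero>}" "x \<oplus>\<^bsub>witt_I p R\<^esub> y = x \<oplus>\<^bsub>W\<^esub> y"
  "\<zero>\<^bsub>witt_I p R\<^esub> = \<zero>\<^bsub>W\<^esub>" "a \<odot>\<^bsub>witt_I p R\<^esub> x = a \<otimes>\<^bsub>W\<^esub> x"
  by (simp_all add: witt_I_def ring_as_module_def)

lemma witt_I_carrier_iff: "x \<in> carrier (witt_I p R) \<longleftrightarrow> x \<in> carrier W \<and> x 0 = \<zero>"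
  by (simp add: witt_I_simps)

lemma module_witt_I: "module W (witt_I p R)"
proof (rule moduleI[OF W.cring_axioms])
  have zero_0: "\<zero>\<^bsub>W\<^esub> 0 = \<zero>" by (simp add: zero_witt)
  show "abelian_group (witt_I p R)"
  proof (rule abelian_groupI)
    fix x assume "x \<in> carrier (witt_I p R)"
    then have x: "x \<in> carrier W" "x 0 = \<zero>" by (simp_all add: witt_I_simps)
    have "(\<ominus>\<^bsub>W\<^esub> x \<oplus>\<^bsub>W\<^esub> x) 0 = \<zero>" using x by (simp add: W.l_neg zero_witt)
    then have "(\<ominus>\<^bsub>W\<^esub> x) 0 = \<zero>" using x by (simp add: witt_add_0)
    then show "\<exists>y\<in>carrier (witt_I p R). y \<oplus>\<^bsub>witt_I p R\<^esub> x = \<zero>\<^bsub>witt_I p R\<^esub>"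
      using x by (intro bexI[of _ "\<ominus>\<^bsub>W\<^esub> x"]) (simp_all add: witt_I_simps W.l_neg)
  qed (auto simp: witt_I_simps W.a_ac witt_add_0 zero_0)
qed (auto simp: witt_I_simps witt_mult_0 W.l_distr W.r_distr W.m_assoc)

abbreviation "Fdiv \<equiv> witt_Fdiv p R"

lemma
  assumes "x \<in> carrier (witt_I p R)"
  shows Fdiv_closed: "Fdiv x \<in> carrier W" and V_Fdiv: "V (Fdiv x) = x"
proof -
  have inj: "inj_on V (carrier W)" by (rule inj_onI) (rule V_inj)
  have "x = V (\<lambda>n. x (Suc n))" by (rule eq_V_if_comp_0) (use assms in \<open>simp add: witt_I_simps\<close>)
  moreover have "(\<lambda>n. x (Suc n)) \<in> carrier W"
    using assms by (simp add: witt_I_simps carrier_witt)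
  ultimately have x: "x \<in> V ` carrier W" by blast
  show "Fdiv x \<in> carrier W" unfolding witt_Fdiv_def using the_inv_into_into[OF inj x] by simp
  show "V (Fdiv x) = x" unfolding witt_Fdiv_def using f_the_inv_into_f[OF inj x] .
qed

lemma Fdiv_add:
  assumes "x \<in> carrier (witt_I p R)" "y \<in> carrier (witt_I p R)"
  shows "Fdiv (x \<oplus>\<^bsub>W\<^esub> y) = Fdiv x \<oplus>\<^bsub>W\<^esub> Fdiv y"
proof (rule V_inj)
  interpret I: module W "witt_I p R" by (rule module_witt_I)
  have "x \<oplus>\<^bsub>W\<^esub> y \<in> carrier (witt_I p R)" using I.M.a_closed[OF assms] by (simp add: witt_I_simps(2))
  then show "V (Fdiv (x \<oplus>\<^bsub>W\<^esub> y)) = V (Fdiv x \<oplus>\<^bsub>W\<^esub> Fdiv y)"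
    using assms by (simp add: V_Fdiv V_add Fdiv_closed)
qed

lemma Fdiv_mult:
  assumes "a \<in> carrier W" "x \<in> carrier (witt_I p R)"
  shows "Fdiv (a \<otimes>\<^bsub>W\<^esub> x) = F a \<otimes>\<^bsub>W\<^esub> Fdiv x"
proof (rule V_inj)
  interpret I: module W "witt_I p R" by (rule module_witt_I)
  have "a \<otimes>\<^bsub>W\<^esub> x \<in> carrier (witt_I p R)" using I.smult_closed[OF assms] by (simp add: witt_I_simps(4))
  then show "V (Fdiv (a \<otimes>\<^bsub>W\<^esub> x)) = V (F a \<otimes>\<^bsub>W\<^esub> Fdiv x)"
    using assms mult_V[of a "Fdiv x"] by (simp add: V_Fdiv Fdiv_closed)
qed

end

text \<open>The divided Frobenius involves the tensor products \<open>M\<^sup>F\<close>, \<open>I\<^sup>F\<close>, \<open>I \<otimes> M\<close> and \<open>I\<^sup>F \<otimes> M\<^sup>F\<close>, which the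
  following instances provide in this order.\<close>

locale witt_module = witt_ring R p + M: module "witt p R" M
  for R :: "('a, 'k) ring_scheme" (structure) and p :: nat and M :: "(nat \<Rightarrow> 'a, 'm, 'x) module_scheme"

sublocale witt_module \<subseteq> MF: base_change_module "witt p R" "witt p R" "witt_F p R" M
  by (rule base_change_module.intro[OF ring_hom_F M.module_axioms])

sublocale witt_module \<subseteq> IF: base_change_module "witt p R" "witt p R" "witt_F p R" "witt_I p R"
  by (rule base_change_module.intro[OF ring_hom_F module_witt_I])

sublocale witt_module \<subseteq> it: tensor_action "witt p R" "witt_I p R" M "witt p R" "smult (witt_I p R)"
  by (rule tensor_action_product[OF module_witt_I M.module_axioms])

sublocale witt_module \<subseteq> iq: tensor_action "witt p R"
    "base_change (witt p R) (witt p R) (witt_F p R) (witt_I p R)"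
    "base_change (witt p R) (witt p R) (witt_F p R) M" "witt p R"
    "smult (base_change (witt p R) (witt p R) (witt_F p R) (witt_I p R))"
  by (rule tensor_action_product[OF IF.module_BM MF.module_BM])

context witt_module
begin

abbreviation "IM \<equiv> I_tensor p R M"

lemma F_twist_eq: "F_twist p R M = MF.BM"
  by (simp add: F_twist_def)

lemma IM_eq: "IM = it.T"
  by (simp add: I_tensor_def tensor_product_def)

lemma module_IM: "module W IM"
  unfolding IM_eq by (rule it.module_T)

lemma balanced_I_incl: "balanced W (witt_I p R) M M (\<lambda>(b, x). b \<odot>\<^bsub>M\<^esub> x)"
  unfolding balanced_def
  by (auto intro!: add_homI simp: witt_I_simps M.smult_l_distr M.smult_r_distr M.smult_assoc1[symmetric] W.m_comm)

lemma I_incl_pure: "x \<in> carrier (witt_I p R) \<Longrightarrow> y \<in> carrier M \<Longrightarrow> I_incl M (it.pure x y) = x \<odot>\<^bsub>M\<^esub> y"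
  unfolding I_incl_def semilinearization_def
  by (subst it.tensor_lift_pure[OF M.abelian_group_axioms balanced_I_incl]) simp_all

lemma I_incl_add_hom: "add_hom IM M (I_incl M)"
  unfolding I_incl_def semilinearization_def IM_eq
  by (rule it.tensor_lift_add_hom[OF M.abelian_group_axioms balanced_I_incl])

lemma Fdiv_lin_linear: "linear_map W IF.BM (ring_as_module W (\<lambda>x. x)) (Fdiv_lin p R)"
  and Fdiv_lin_unit: "w \<in> carrier W \<Longrightarrow> x \<in> carrier (witt_I p R) \<Longrightarrow>
    Fdiv_lin p R (w \<odot>\<^bsub>IF.BM\<^esub> IF.unit x) = w \<otimes>\<^bsub>W\<^esub> Fdiv x"
proof -
  let ?N = "ring_as_module W (\<lambda>x. x)"
  have 1: "module W ?N" by (rule ring_hom_cring.module_ring_as_module[OF W.ring_hom_cring_id])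
  have 2: "add_hom (witt_I p R) ?N Fdiv"
    by (rule add_homI) (simp_all add: Fdiv_closed Fdiv_add witt_I_simps(2))
  have 3: "Fdiv (a \<odot>\<^bsub>witt_I p R\<^esub> x) = F a \<odot>\<^bsub>?N\<^esub> Fdiv x" if "a \<in> carrier W" "x \<in> carrier (witt_I p R)" for a x
    using that by (simp add: Fdiv_mult witt_I_simps(4))
  show "linear_map W IF.BM ?N (Fdiv_lin p R)"
    unfolding Fdiv_lin_def by (rule IF.linearization_linear[OF 1 2 3])
  show "w \<in> carrier W \<Longrightarrow> x \<in> carrier (witt_I p R) \<Longrightarrow> Fdiv_lin p R (w \<odot>\<^bsub>IF.BM\<^esub> IF.unit x) = w \<otimes>\<^bsub>W\<^esub> Fdiv x"
    unfolding Fdiv_lin_def ring_as_module_simps(4)[where \<phi> = "\<lambda>x. x" and B = W, symmetric]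
    by (rule IF.linearization_unit[OF 1 2 3])
qed

definition Fdiv_contract :: "((nat \<Rightarrow> 'a, nat \<Rightarrow> 'a) tensor, (nat \<Rightarrow> 'a, 'm) tensor) tensor \<Rightarrow> (nat \<Rightarrow> 'a, 'm) tensor" where
  "Fdiv_contract = tensor_lift MF.BM (\<lambda>(u, y). Fdiv_lin p R u \<odot>\<^bsub>MF.BM\<^esub> y)"

text \<open>The \<open>F\<close>-linear map \<open>I \<otimes> M \<rightarrow> M\<^sup>F\<close>, \<open>x \<otimes> y \<mapsto> F\<^bsup>div\<^esup>(x) (1 \<otimes> y)\<close>, obtained by passing through
  \<open>I\<^sup>F \<otimes> M\<^sup>F\<close>. The map \<open>Fdiv_map p R M b\<close> is the linearization of its composition with \<open>b\<close>.\<close>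

definition Fdiv_tensor :: "(nat \<Rightarrow> 'a, 'm) tensor \<Rightarrow> (nat \<Rightarrow> 'a, 'm) tensor" where
  "Fdiv_tensor t = Fdiv_contract (tensor_lift iq.T (\<lambda>(x, y). iq.pure (IF.unit x) (MF.unit y)) t)"

lemma Fdiv_lin_closed: "u \<in> carrier IF.BM \<Longrightarrow> Fdiv_lin p R u \<in> carrier W"
  using add_hom_closed[OF linear_map_add_hom[OF Fdiv_lin_linear]] by simp

lemma balanced_Fdiv_contract: "balanced W IF.BM MF.BM MF.BM (\<lambda>(u, y). Fdiv_lin p R u \<odot>\<^bsub>MF.BM\<^esub> y)"
proof -
  interpret MB: module W MF.BM by (rule MF.module_BM)
  have add: "Fdiv_lin p R (u \<oplus>\<^bsub>IF.BM\<^esub> v) = Fdiv_lin p R u \<oplus>\<^bsub>W\<^esub> Fdiv_lin p R v"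
    if "u \<in> carrier IF.BM" "v \<in> carrier IF.BM" for u v
    using add_hom_add[OF linear_map_add_hom[OF Fdiv_lin_linear] that] by simp
  have smult: "Fdiv_lin p R (a \<odot>\<^bsub>IF.BM\<^esub> u) = a \<otimes>\<^bsub>W\<^esub> Fdiv_lin p R u"
    if "a \<in> carrier W" "u \<in> carrier IF.BM" for a u
    using linear_map_smult[OF Fdiv_lin_linear that] by simp
  show ?thesis
    unfolding balanced_def split_conv
  proof (intro conjI ballI)
    fix y assume y: "y \<in> carrier MF.BM"
    show "add_hom IF.BM MF.BM (\<lambda>u. Fdiv_lin p R u \<odot>\<^bsub>MF.BM\<^esub> y)"
      by (rule add_homI) (simp_all add: y Fdiv_lin_closed add MB.smult_l_distr)
  next
    fix u assume u: "u \<in> carrier IF.BM"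
    show "add_hom MF.BM MF.BM (\<lambda>y. Fdiv_lin p R u \<odot>\<^bsub>MF.BM\<^esub> y)"
      by (rule add_homI) (simp_all add: u Fdiv_lin_closed MB.smult_r_distr)
  next
    fix a u y assume a: "a \<in> carrier W" and u: "u \<in> carrier IF.BM" and y: "y \<in> carrier MF.BM"
    show "Fdiv_lin p R (a \<odot>\<^bsub>IF.BM\<^esub> u) \<odot>\<^bsub>MF.BM\<^esub> y = Fdiv_lin p R u \<odot>\<^bsub>MF.BM\<^esub> (a \<odot>\<^bsub>MF.BM\<^esub> y)"
      unfolding smult[OF a u] W.m_comm[OF a Fdiv_lin_closed[OF u]]
      by (rule MB.smult_assoc1[OF Fdiv_lin_closed[OF u] a y])
  qed
qed

lemma Fdiv_contract_add_hom: "add_hom iq.T MF.BM Fdiv_contract"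
  unfolding Fdiv_contract_def by (rule iq.tensor_lift_add_hom[OF MF.abelian_group_BM balanced_Fdiv_contract])

lemma Fdiv_contract_pure:
  "u \<in> carrier IF.BM \<Longrightarrow> y \<in> carrier MF.BM \<Longrightarrow> Fdiv_contract (iq.pure u y) = Fdiv_lin p R u \<odot>\<^bsub>MF.BM\<^esub> y"
  unfolding Fdiv_contract_def
  by (subst iq.tensor_lift_pure[OF MF.abelian_group_BM balanced_Fdiv_contract]) simp_all

lemma Fdiv_contract_smult:
  assumes w: "w \<in> carrier W" and t: "t \<in> carrier iq.T"
  shows "Fdiv_contract (w \<odot>\<^bsub>iq.T\<^esub> t) = w \<odot>\<^bsub>MF.BM\<^esub> Fdiv_contract t"
proof (rule iq.add_hom_eqI[OF MF.abelian_group_BM _ _ t])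
  interpret MB: module W MF.BM by (rule MF.module_BM)
  interpret IB: module W IF.BM by (rule IF.module_BM)
  show "add_hom iq.T MF.BM (\<lambda>t. Fdiv_contract (w \<odot>\<^bsub>iq.T\<^esub> t))"
    by (rule add_hom_comp[OF iq.smult_add_hom[OF w] Fdiv_contract_add_hom])
  show "add_hom iq.T MF.BM (\<lambda>t. w \<odot>\<^bsub>MF.BM\<^esub> Fdiv_contract t)"
    by (rule add_hom_comp[OF Fdiv_contract_add_hom], rule add_homI) (use w in \<open>simp_all add: MB.smult_r_distr\<close>)
  fix u y assume "u \<in> carrier IF.BM" "y \<in> carrier MF.BM"
  then show "Fdiv_contract (w \<odot>\<^bsub>iq.T\<^esub> iq.pure u y) = w \<odot>\<^bsub>MF.BM\<^esub> Fdiv_contract (iq.pure u y)"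
    using w linear_map_smult[OF Fdiv_lin_linear]
    by (simp add: iq.smult_pure Fdiv_contract_pure MB.smult_assoc1 Fdiv_lin_closed)
qed

lemma balanced_I_unit: "balanced W (witt_I p R) M iq.T (\<lambda>(x, y). iq.pure (IF.unit x) (MF.unit y))"
proof -
  have l: "add_hom (witt_I p R) iq.T (\<lambda>x. iq.pure (IF.unit x) (MF.unit y))" if "y \<in> carrier M" for y
    by (rule add_hom_comp[OF IF.unit_add_hom iq.pure_add_hom_left[OF MF.unit_closed[OF that]]])
  have r: "add_hom M iq.T (\<lambda>y. iq.pure (IF.unit x) (MF.unit y))" if "x \<in> carrier (witt_I p R)" for x
    by (rule add_hom_comp[OF MF.unit_add_hom iq.pure_add_hom_right[OF IF.unit_closed[OF that]]])
  show ?thesis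
    unfolding balanced_def
    using l r by (auto simp: IF.unit_smult MF.unit_smult iq.pure_balanced IF.unit_closed MF.unit_closed)
qed

lemma Fdiv_tensor_add_hom: "add_hom IM MF.BM Fdiv_tensor"
  unfolding Fdiv_tensor_def IM_eq
  by (rule add_hom_comp[OF it.tensor_lift_add_hom[OF iq.abelian_group_T balanced_I_unit] Fdiv_contract_add_hom])

lemma Fdiv_tensor_pure:
  assumes "x \<in> carrier (witt_I p R)" "y \<in> carrier M"
  shows "Fdiv_tensor (it.pure x y) = Fdiv x \<odot>\<^bsub>MF.BM\<^esub> MF.unit y"
proof -
  interpret IB: module W IF.BM by (rule IF.module_BM)
  have u: "IF.unit x \<in> carrier IF.BM" "MF.unit y \<in> carrier MF.BM"
    using assms by (simp_all add: IF.unit_closed MF.unit_closed)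
  have "Fdiv_tensor (it.pure x y) = Fdiv_lin p R (\<one>\<^bsub>W\<^esub> \<odot>\<^bsub>IF.BM\<^esub> IF.unit x) \<odot>\<^bsub>MF.BM\<^esub> MF.unit y"
    unfolding Fdiv_tensor_def
    by (subst it.tensor_lift_pure[OF iq.abelian_group_T balanced_I_unit assms]) (simp add: u Fdiv_contract_pure)
  then show ?thesis using assms by (simp only: Fdiv_lin_unit W.one_closed W.l_one Fdiv_closed)
qed

text \<open>On pure tensors, \<open>V(F\<^bsup>div\<^esup>(x) F(f(y))) = V(F\<^bsup>div\<^esup>(x)) f(y) = x f(y)\<close>. Hence \<open>V\<close> recovers the coordinates
  of \<open>b\<close> from those of its divided Frobenius.\<close>

lemma V_extend_functional_Fdiv_tensor:
  assumes f: "functional W M f" and t: "t \<in> carrier IM"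
  shows "V (MF.extend_functional f (Fdiv_tensor t)) = f (I_incl M t)"
proof -
  note fF = functional_add_hom[OF MF.functional_extend_functional[OF f]]
  have fW: "f y \<in> carrier W" if "y \<in> carrier M" for y using add_hom_closed[OF functional_add_hom[OF f] that] .
  show ?thesis
  proof (rule it.add_hom_eqI[OF W.abelian_group_axioms _ _ t[unfolded IM_eq]])
    have "add_hom W W V" by (rule add_homI) (simp_all add: V_add)
    from add_hom_comp[OF add_hom_comp[OF Fdiv_tensor_add_hom fF] this]
    show "add_hom it.T W (\<lambda>t. V (MF.extend_functional f (Fdiv_tensor t)))" by (simp add: IM_eq)
    show "add_hom it.T W (\<lambda>t. f (I_incl M t))"
      using add_hom_comp[OF I_incl_add_hom functional_add_hom[OF f]] by (simp add: IM_eq)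
    fix x y assume x: "x \<in> carrier (witt_I p R)" and y: "y \<in> carrier M"
    have "V (MF.extend_functional f (Fdiv_tensor (it.pure x y))) = V (Fdiv x \<otimes>\<^bsub>W\<^esub> F (f y))"
      using x y by (simp add: Fdiv_tensor_pure MF.extend_functional_unit[OF f] Fdiv_closed)
    also have "\<dots> = f y \<otimes>\<^bsub>W\<^esub> V (Fdiv x)"
      using fW[OF y] Fdiv_closed[OF x] by (simp add: mult_V W.m_comm)
    also have "\<dots> = f (x \<odot>\<^bsub>M\<^esub> y)"
      using fW[OF y] x y by (simp add: V_Fdiv functional_smult[OF f] W.m_comm witt_I_carrier_iff)
    finally show "V (MF.extend_functional f (Fdiv_tensor (it.pure x y))) = f (I_incl M (it.pure x y))"
      using x y by (simp add: I_incl_pure)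
  qed
qed

text \<open>A finite projective module is flat, so \<open>I \<otimes> M \<rightarrow> M\<close> is injective. Explicitly, \<open>t\<close> is the sum of
  \<open>f\<^sub>j(t) \<otimes> l\<^sub>j\<close>, where \<open>t\<close> is identified with its image in \<open>M\<close>; the coefficients lie in \<open>I\<close> because they
  are values of \<open>V\<close>.\<close>

lemma I_incl_eq_zeroD:
  assumes db: "dual_basis W M n l f" and t: "t \<in> carrier IM" and 0: "I_incl M t = \<zero>\<^bsub>M\<^esub>"
  shows "t = \<zero>\<^bsub>IM\<^esub>"
proof -
  interpret IB: module W IM by (rule module_IM)
  note l = dual_basisD(1)[OF db] and fn = dual_basisD(2)[OF db]
  have fI: "f j (I_incl M t) \<in> carrier (witt_I p R)" if "j < n" "t \<in> carrier IM" for j t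
  proof -
    have "MF.extend_functional (f j) (Fdiv_tensor t) \<in> carrier W"
      using functional_add_hom[OF MF.functional_extend_functional[OF fn[OF that(1)]]]
        Fdiv_tensor_add_hom that(2) by (blast intro: add_hom_closed)
    then show ?thesis
      using V_extend_functional_Fdiv_tensor[OF fn[OF that(1)] that(2), symmetric]
      by (simp add: witt_I_carrier_iff) (simp add: witt_V_def)
  qed
  have ah: "add_hom IM (witt_I p R) (\<lambda>t. f j (I_incl M t))" if "j < n" for j
  proof (rule add_homI)
    fix t u assume "t \<in> carrier IM" "u \<in> carrier IM"
    then show "f j (I_incl M (t \<oplus>\<^bsub>IM\<^esub> u)) = f j (I_incl M t) \<oplus>\<^bsub>witt_I p R\<^esub> f j (I_incl M u)"
      using add_hom_add[OF add_hom_comp[OF I_incl_add_hom functional_add_hom[OF fn[OF that]]]]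
      by (simp add: witt_I_simps(2))
  qed (rule fI[OF that])
  have ahp: "add_hom IM IM (\<lambda>t. it.pure (f j (I_incl M t)) (l j))" if "j < n" for j
    using add_hom_comp[OF ah[OF that] it.pure_add_hom_left[OF l[OF that]]] by (simp add: IM_eq)
  have "t = (\<Oplus>\<^bsub>IM\<^esub>j\<in>{..<n}. it.pure (f j (I_incl M t)) (l j))"
  proof (rule it.add_hom_eqI[OF _ _ _ t[unfolded IM_eq], where g = "\<lambda>t. t" and Q = IM])
    show "abelian_group IM" by (rule IB.M.abelian_group_axioms)
    show "add_hom it.T IM (\<lambda>t. t)" by (rule add_homI) (simp_all add: IM_eq)
    show "add_hom it.T IM (\<lambda>t. \<Oplus>\<^bsub>IM\<^esub>j\<in>{..<n}. it.pure (f j (I_incl M t)) (l j))"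
      unfolding IM_eq[symmetric]
    proof (rule add_homI)
      fix t assume t: "t \<in> carrier IM"
      show "(\<Oplus>\<^bsub>IM\<^esub>j\<in>{..<n}. it.pure (f j (I_incl M t)) (l j)) \<in> carrier IM"
        by (rule IB.M.finsum_closed) (use add_hom_closed[OF ahp] t in auto)
      fix u assume u: "u \<in> carrier IM"
      have "(\<Oplus>\<^bsub>IM\<^esub>j\<in>{..<n}. it.pure (f j (I_incl M (t \<oplus>\<^bsub>IM\<^esub> u))) (l j)) =
          (\<Oplus>\<^bsub>IM\<^esub>j\<in>{..<n}. it.pure (f j (I_incl M t)) (l j) \<oplus>\<^bsub>IM\<^esub> it.pure (f j (I_incl M u)) (l j))"
        by (rule IB.M.finsum_cong') (use t u add_hom_add[OF ahp] add_hom_closed[OF ahp] in auto)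
      also have "\<dots> = (\<Oplus>\<^bsub>IM\<^esub>j\<in>{..<n}. it.pure (f j (I_incl M t)) (l j)) \<oplus>\<^bsub>IM\<^esub> (\<Oplus>\<^bsub>IM\<^esub>j\<in>{..<n}. it.pure (f j (I_incl M u)) (l j))"
        by (rule IB.M.finsum_addf) (use t u add_hom_closed[OF ahp] in auto)
      finally show "(\<Oplus>\<^bsub>IM\<^esub>j\<in>{..<n}. it.pure (f j (I_incl M (t \<oplus>\<^bsub>IM\<^esub> u))) (l j)) =
          (\<Oplus>\<^bsub>IM\<^esub>j\<in>{..<n}. it.pure (f j (I_incl M t)) (l j)) \<oplus>\<^bsub>IM\<^esub> (\<Oplus>\<^bsub>IM\<^esub>j\<in>{..<n}. it.pure (f j (I_incl M u)) (l j))" .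
    qed
    fix x y assume x: "x \<in> carrier (witt_I p R)" and y: "y \<in> carrier M"
    have fW: "f j y \<in> carrier W" if "j < n" for j using dual_basis_closed[OF db that y] .
    have "it.pure x y = it.pure x (\<Oplus>\<^bsub>M\<^esub>j\<in>{..<n}. f j y \<odot>\<^bsub>M\<^esub> l j)" using dual_basisD(3)[OF db y] by simp
    also have "\<dots> = (\<Oplus>\<^bsub>it.T\<^esub>j\<in>{..<n}. it.pure x (f j y \<odot>\<^bsub>M\<^esub> l j))"
      by (rule add_hom_finsum[OF M.abelian_group_axioms it.abelian_group_T it.pure_add_hom_right[OF x]])
        (use fW l in simp)
    also have "\<dots> = (\<Oplus>\<^bsub>it.T\<^esub>j\<in>{..<n}. it.pure (f j (I_incl M (it.pure x y))) (l j))"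
    proof (rule abelian_monoid.finsum_cong'[OF abelian_group.axioms(1)[OF it.abelian_group_T]])
      fix j assume "j \<in> {..<n}"
      then have j: "j < n" by simp
      have "it.pure x (f j y \<odot>\<^bsub>M\<^esub> l j) = it.pure (f j y \<odot>\<^bsub>witt_I p R\<^esub> x) (l j)"
        using it.pure_balanced[OF fW[OF j] x l[OF j]] by simp
      also have "f j y \<odot>\<^bsub>witt_I p R\<^esub> x = f j (I_incl M (it.pure x y))"
        using x y fW[OF j] by (simp add: I_incl_pure functional_smult[OF fn[OF j]] witt_I_carrier_iff witt_I_simps(4) W.m_comm)
      finally show "it.pure x (f j y \<odot>\<^bsub>M\<^esub> l j) = it.pure (f j (I_incl M (it.pure x y))) (l j)" .
    qed (use fI it.pure_in_T[OF x y] l in \<open>auto intro!: it.pure_in_T simp: IM_eq\<close>)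
    finally show "it.pure x y = (\<Oplus>\<^bsub>IM\<^esub>j\<in>{..<n}. it.pure (f j (I_incl M (it.pure x y))) (l j))"
      by (simp add: IM_eq)
  qed
  also have "\<dots> = (\<Oplus>\<^bsub>IM\<^esub>j\<in>{..<n}. \<zero>\<^bsub>IM\<^esub>)"
  proof (rule IB.M.finsum_cong')
    fix j assume "j \<in> {..<n}"
    then have j: "j < n" by simp
    have "f j (I_incl M t) = \<zero>\<^bsub>witt_I p R\<^esub>"
      using add_hom_zero[OF M.abelian_group_axioms W.abelian_group_axioms functional_add_hom[OF fn[OF j]]]
      by (simp add: 0 witt_I_simps(3))
    then show "it.pure (f j (I_incl M t)) (l j) = \<zero>\<^bsub>IM\<^esub>"
      using it.pure_zero_left[OF l[OF j]] by (simp add: IM_eq it.T_simps)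
  qed auto
  finally show ?thesis by (simp add: IB.M.finsum_zero)
qed

lemma
  assumes L: "module W L" and b: "linear_map W L IM b"
  shows Fdiv_map_linear: "linear_map W (F_twist p R L) MF.BM (Fdiv_map p R M b)"
    and Fdiv_map_unit: "w \<in> carrier W \<Longrightarrow> y \<in> carrier L \<Longrightarrow>
      Fdiv_map p R M b (w \<odot>\<^bsub>F_twist p R L\<^esub> base_change_unit W W F L y) = w \<odot>\<^bsub>MF.BM\<^esub> Fdiv_tensor (b y)"
proof -
  interpret LF: base_change_module W W F L by (rule base_change_module.intro[OF ring_hom_F L])
  interpret IMF: base_change_module W W F IM by (rule base_change_module.intro[OF ring_hom_F module_IM])
  interpret MB: module W MF.BM by (rule MF.module_BM)
  let ?g = "tensor_lift iq.T (\<lambda>(x, y). iq.pure (IF.unit x) (MF.unit y))"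
  have g: "add_hom IM iq.T ?g"
    unfolding IM_eq by (rule it.tensor_lift_add_hom[OF iq.abelian_group_T balanced_I_unit])
  have gs: "?g (a \<odot>\<^bsub>IM\<^esub> t) = F a \<odot>\<^bsub>iq.T\<^esub> ?g t" if a: "a \<in> carrier W" and t: "t \<in> carrier IM" for a t
  proof (rule it.add_hom_eqI[OF iq.abelian_group_T _ _ t[unfolded IM_eq]])
    show "add_hom it.T iq.T (\<lambda>t. ?g (a \<odot>\<^bsub>IM\<^esub> t))"
      using add_hom_comp[OF it.smult_add_hom[OF a] g[unfolded IM_eq]] by (simp add: IM_eq)
    show "add_hom it.T iq.T (\<lambda>t. F a \<odot>\<^bsub>iq.T\<^esub> ?g t)"
      using add_hom_comp[OF g[unfolded IM_eq] iq.smult_add_hom[OF F_closed[OF a]]] by simp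
    fix x y assume x: "x \<in> carrier (witt_I p R)" and y: "y \<in> carrier M"
    note pure = it.tensor_lift_pure[OF iq.abelian_group_T balanced_I_unit]
    have ax: "a \<odot>\<^bsub>witt_I p R\<^esub> x \<in> carrier (witt_I p R)" using it.smult_M[OF a x] .
    have "?g (a \<odot>\<^bsub>IM\<^esub> it.pure x y) = iq.pure (IF.unit (a \<odot>\<^bsub>witt_I p R\<^esub> x)) (MF.unit y)"
      unfolding IM_eq it.smult_pure[OF a x y] by (subst pure[OF ax y]) simp
    also have "\<dots> = F a \<odot>\<^bsub>iq.T\<^esub> iq.pure (IF.unit x) (MF.unit y)"
      using a x y by (simp add: IF.unit_smult iq.smult_pure IF.unit_closed MF.unit_closed)
    also have "iq.pure (IF.unit x) (MF.unit y) = ?g (it.pure x y)"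
      by (subst pure[OF x y]) simp
    finally show "?g (a \<odot>\<^bsub>IM\<^esub> it.pure x y) = F a \<odot>\<^bsub>iq.T\<^esub> ?g (it.pure x y)" .
  qed
  have bct: "base_change_tensor W W F (witt_I p R) M = linearization iq.T ?g"
    by (simp add: base_change_tensor_def Let_def tensor_product_def)
  have E: "linear_map W IMF.BM iq.T (linearization iq.T ?g)"
    by (rule IMF.linearization_linear[OF iq.module_T g gs])
  have B: "linear_map W LF.BM IMF.BM (F_twist_map p R IM b)"
    unfolding F_twist_map_def by (rule LF.base_change_map_linear[OF module_IM b])
  have eq: "Fdiv_map p R M b t = Fdiv_contract (linearization iq.T ?g (F_twist_map p R IM b t))" for t
    by (simp add: Fdiv_map_def F_twist_eq Fdiv_contract_def bct)
  have closedB: "F_twist_map p R IM b t \<in> carrier IMF.BM" if "t \<in> carrier LF.BM" for t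
    using add_hom_closed[OF linear_map_add_hom[OF B] that] .
  have closedE: "linearization iq.T ?g t \<in> carrier iq.T" if "t \<in> carrier IMF.BM" for t
    using add_hom_closed[OF linear_map_add_hom[OF E] that] .
  have "add_hom LF.BM MF.BM (\<lambda>t. Fdiv_contract (linearization iq.T ?g (F_twist_map p R IM b t)))"
    by (rule add_hom_comp[OF add_hom_comp[OF linear_map_add_hom[OF B] linear_map_add_hom[OF E]] Fdiv_contract_add_hom])
  then show "linear_map W (F_twist p R L) MF.BM (Fdiv_map p R M b)"
    unfolding linear_map_def F_twist_def eq[abs_def]
    by (auto simp: linear_map_smult[OF B] linear_map_smult[OF E] closedB closedE Fdiv_contract_smult)
  fix w y assume w: "w \<in> carrier W" and y: "y \<in> carrier L"
  have bM: "b y \<in> carrier IM" using add_hom_closed[OF linear_map_add_hom[OF b] y] .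
  have "F_twist_map p R IM b (w \<odot>\<^bsub>LF.BM\<^esub> LF.unit y) = w \<odot>\<^bsub>IMF.BM\<^esub> IMF.unit (b y)"
    unfolding F_twist_map_def by (rule LF.base_change_map_unit[OF module_IM b w y])
  then have "Fdiv_map p R M b (w \<odot>\<^bsub>LF.BM\<^esub> LF.unit y) = Fdiv_contract (w \<odot>\<^bsub>iq.T\<^esub> ?g (b y))"
    unfolding eq using IMF.linearization_unit[OF iq.module_T g gs w bM] by simp
  also have "\<dots> = w \<odot>\<^bsub>MF.BM\<^esub> Fdiv_tensor (b y)"
    unfolding Fdiv_tensor_def by (rule Fdiv_contract_smult[OF w add_hom_closed[OF g bM]])
  finally show "Fdiv_map p R M b (w \<odot>\<^bsub>F_twist p R L\<^esub> LF.unit y) = w \<odot>\<^bsub>MF.BM\<^esub> Fdiv_tensor (b y)"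
    by (simp add: F_twist_def)
qed

end

section \<open>Nilpotence of a display in terms of matrices\<close>

context witt_ring
begin

abbreviation "Rp \<equiv> mod_p p R"

lemma mod_p_eq: "Rp = R Quot p_ideal p R"
  by (simp add: mod_p_def)

lemma char_p_witt_ring_mod_p: "char_p_witt_ring Rp p"
  unfolding mod_p_eq by (rule char_p_witt_ring_quotient[OF ideal_p_ideal p_one_in_p_ideal])

lemma witt_to_mod_p_hom: "ring_hom_cring W Rp (witt_to_mod_p p R)"
proof -
  interpret h: ring_hom_cring R "R Quot p_ideal p R" "(+>) (p_ideal p R)" by (rule quotient_hom[OF ideal_p_ideal])
  show ?thesis
    unfolding mod_p_eq witt_to_mod_p_def
    by (intro ring_hom_cringI ring_hom_ringI2 ring_hom_memI W.cring_axioms W.ring_axioms h.S.cring_axioms h.S.ring_axioms)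
      (simp_all add: witt_add_0 witt_mult_0 one_witt)
qed

lemma witt_to_mod_p_F:
  assumes "x \<in> carrier W"
  shows "witt_to_mod_p p R (F x) = witt_to_mod_p p R x [^]\<^bsub>Rp\<^esub> p"
proof -
  interpret h: ring_hom_cring R "R Quot p_ideal p R" "(+>) (p_ideal p R)" by (rule quotient_hom[OF ideal_p_ideal])
  interpret Q: char_p_witt_ring "R Quot p_ideal p R" p
    by (rule char_p_witt_ring_quotient[OF ideal_p_ideal p_one_in_p_ideal])
  obtain g where "g \<in> carrier R" "F x 0 = x 0 [^] p \<oplus> [p] \<cdot> g"
    using F_comp[OF assms, of 0] by blast
  then show ?thesis
    using assms by (simp add: witt_to_mod_p_def mod_p_eq h.hom_nat_multiple h.hom_nat_power Q.p_multiple_zero)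
qed

lemma frob_mod_p_hom: "ring_hom_cring Rp Rp (frob_mod_p p R i)"
proof -
  have "frob_mod_p p R i = (\<lambda>r. r [^]\<^bsub>Rp\<^esub> (p ^ i))" by (rule ext) (simp add: frob_mod_p_def)
  then show ?thesis using char_p_witt_ring.pow_p_power_hom[OF char_p_witt_ring_mod_p] by simp
qed

end

sublocale witt_module \<subseteq> Rp: char_p_witt_ring "mod_p p R" p
  by (rule char_p_witt_ring_mod_p)

sublocale witt_module \<subseteq> N: base_change_module "witt p R" "mod_p p R" "witt_to_mod_p p R" M
  by (rule base_change_module.intro[OF witt_to_mod_p_hom M.module_axioms])

sublocale witt_module \<subseteq> Nt: base_change_module "mod_p p R" "mod_p p R" "frob_mod_p p R i"
    "base_change (witt p R) (mod_p p R) (witt_to_mod_p p R) M" for i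
  by (rule base_change_module.intro[OF frob_mod_p_hom N.module_BM])

context witt_module
begin

abbreviation "\<rho> \<equiv> witt_to_mod_p p R"

lemma module_mod_p_eq: "module_mod_p p R M = N.BM"
  by (simp add: module_mod_p_def)

lemma frob_twist_eq: "frob_twist p R i N.BM = Nt.BM i"
  by (simp add: frob_twist_def)

lemma frob_twist_unit_eq: "frob_twist_unit p R i N.BM = Nt.unit i"
  by (simp add: frob_twist_unit_def)

text \<open>Coordinates on the twist \<open>N\<^bsup>(p^i)\<^esup>\<close> of \<open>N = (R/pR) \<otimes> M\<close>; they detect the vanishing of the maps in the definition
  of nilpotence.\<close>

definition coord :: "(nat \<Rightarrow> 'm \<Rightarrow> nat \<Rightarrow> 'a) \<Rightarrow> nat \<Rightarrow> nat \<Rightarrow> ('a set, ('a set, 'm) tensor) tensor \<Rightarrow> 'a set" where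
  "coord f i j = Nt.extend_functional i (N.extend_functional (f j))"

context
  fixes f :: "nat \<Rightarrow> 'm \<Rightarrow> nat \<Rightarrow> 'a" and j :: nat
  assumes f: "functional W M (f j)"
begin

lemma functional_coord: "functional Rp (Nt.BM i) (coord f i j)"
  unfolding coord_def by (intro Nt.functional_extend_functional N.functional_extend_functional f)

lemma coord_unit:
  "r \<in> carrier Rp \<Longrightarrow> x \<in> carrier N.BM \<Longrightarrow>
    coord f i j (r \<odot>\<^bsub>Nt.BM i\<^esub> Nt.unit i x) = r \<otimes>\<^bsub>Rp\<^esub> N.extend_functional (f j) x [^]\<^bsub>Rp\<^esub> (p ^ i)"
  unfolding coord_def
  by (subst Nt.extend_functional_unit[OF N.functional_extend_functional[OF f]]) (simp_all add: frob_mod_p_def)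

end

text \<open>The restriction of \<open>mod_p_F_twist\<close> to elements \<open>1 \<otimes> v\<close> with \<open>v\<close> in \<open>M\<^sup>F\<close>.\<close>

definition mod_p_F_inner :: "(nat \<Rightarrow> 'a, 'm) tensor \<Rightarrow> ('a set, ('a set, 'm) tensor) tensor" where
  "mod_p_F_inner = semilinearization (Nt.BM 1) \<rho> (\<lambda>y. Nt.unit 1 (N.unit y))"

lemma mod_p_F_twist_eq: "mod_p_F_twist p R M = linearization (Nt.BM 1) mod_p_F_inner"
  unfolding mod_p_F_twist_def module_mod_p_eq Let_def frob_twist_eq frob_twist_unit_eq mod_p_F_inner_def ..

lemma
  shows mod_p_F_inner_add_hom: "add_hom MF.BM (Nt.BM 1) mod_p_F_inner"
    and mod_p_F_inner_unit: "w \<in> carrier W \<Longrightarrow> x \<in> carrier M \<Longrightarrow>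
      mod_p_F_inner (w \<odot>\<^bsub>MF.BM\<^esub> MF.unit x) = \<rho> w \<odot>\<^bsub>Nt.BM 1\<^esub> Nt.unit 1 (N.unit x)"
    and mod_p_F_inner_smult: "w \<in> carrier W \<Longrightarrow> v \<in> carrier MF.BM \<Longrightarrow>
      mod_p_F_inner (w \<odot>\<^bsub>MF.BM\<^esub> v) = \<rho> w \<odot>\<^bsub>Nt.BM 1\<^esub> mod_p_F_inner v"
proof -
  let ?h = "\<lambda>y. Nt.unit 1 (N.unit y)"
  have h: "add_hom M (Nt.BM 1) ?h" by (rule add_hom_comp[OF N.unit_add_hom Nt.unit_add_hom])
  have hs: "?h (a \<odot>\<^bsub>M\<^esub> x) = \<rho> (F a) \<odot>\<^bsub>Nt.BM 1\<^esub> ?h x" if "a \<in> carrier W" "x \<in> carrier M" for a x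
    using that by (simp add: N.unit_smult Nt.unit_smult N.unit_closed N.hom.hom_closed witt_to_mod_p_F)
      (simp add: frob_mod_p_def)
  show "add_hom MF.BM (Nt.BM 1) mod_p_F_inner"
    unfolding mod_p_F_inner_def
    by (rule MF.semilinearization_add_hom[OF Nt.module_BM witt_to_mod_p_hom h]) (rule hs)
  show "mod_p_F_inner (w \<odot>\<^bsub>MF.BM\<^esub> MF.unit x) = \<rho> w \<odot>\<^bsub>Nt.BM 1\<^esub> Nt.unit 1 (N.unit x)"
    if "w \<in> carrier W" "x \<in> carrier M" for w x
    unfolding mod_p_F_inner_def
    by (rule MF.semilinearization_unit[OF Nt.module_BM witt_to_mod_p_hom h]) (assumption | rule hs that)+
  show "mod_p_F_inner (w \<odot>\<^bsub>MF.BM\<^esub> v) = \<rho> w \<odot>\<^bsub>Nt.BM 1\<^esub> mod_p_F_inner v"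
    if "w \<in> carrier W" "v \<in> carrier MF.BM" for w v
    unfolding mod_p_F_inner_def
    by (rule MF.semilinearization_smult[OF Nt.module_BM witt_to_mod_p_hom h]) (assumption | rule hs that)+
qed

lemma
  shows mod_p_F_twist_linear: "linear_map Rp (base_change W Rp \<rho> MF.BM) (Nt.BM 1) (mod_p_F_twist p R M)"
    and mod_p_F_twist_unit: "r \<in> carrier Rp \<Longrightarrow> v \<in> carrier MF.BM \<Longrightarrow>
      mod_p_F_twist p R M (r \<odot>\<^bsub>base_change W Rp \<rho> MF.BM\<^esub> base_change_unit W Rp \<rho> MF.BM v)
        = r \<odot>\<^bsub>Nt.BM 1\<^esub> mod_p_F_inner v"
proof -
  interpret Fp: base_change_module W Rp \<rho> MF.BM
    by (rule base_change_module.intro[OF witt_to_mod_p_hom MF.module_BM])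
  show "linear_map Rp Fp.BM (Nt.BM 1) (mod_p_F_twist p R M)"
    unfolding mod_p_F_twist_eq
    by (rule Fp.linearization_linear[OF Nt.module_BM mod_p_F_inner_add_hom]) (rule mod_p_F_inner_smult)
  show "mod_p_F_twist p R M (r \<odot>\<^bsub>Fp.BM\<^esub> Fp.unit v) = r \<odot>\<^bsub>Nt.BM 1\<^esub> mod_p_F_inner v"
    if "r \<in> carrier Rp" "v \<in> carrier MF.BM" for r v
    unfolding mod_p_F_twist_eq
    by (rule Fp.linearization_unit[OF Nt.module_BM mod_p_F_inner_add_hom])
      (assumption | rule mod_p_F_inner_smult that)+
qed

text \<open>Reduction modulo \<open>p\<close> turns \<open>F\<close> into the \<open>p\<close>-th power map, so coordinates on \<open>M\<^sup>F\<close> reduce to coordinates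
  on the first Frobenius twist.\<close>

lemma coord_mod_p_F_twist:
  assumes f: "functional W M (f j)" and r: "r \<in> carrier Rp" and v: "v \<in> carrier MF.BM"
  shows "coord f 1 j (mod_p_F_twist p R M (r \<odot>\<^bsub>base_change W Rp \<rho> MF.BM\<^esub> base_change_unit W Rp \<rho> MF.BM v))
      = r \<otimes>\<^bsub>Rp\<^esub> \<rho> (MF.extend_functional (f j) v)"
proof -
  have gv: "mod_p_F_inner v \<in> carrier (Nt.BM 1)" by (rule add_hom_closed[OF mod_p_F_inner_add_hom v])
  have "coord f 1 j (mod_p_F_inner v) = \<rho> (MF.extend_functional (f j) v)"
  proof (rule MF.BM_eqI[OF Rp.abelian_group_axioms _ _ v])
    show "add_hom MF.BM Rp (\<lambda>v. coord f 1 j (mod_p_F_inner v))"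
      by (rule add_hom_comp[OF mod_p_F_inner_add_hom functional_add_hom[OF functional_coord[of f j, OF f]]])
    show "add_hom MF.BM Rp (\<lambda>v. \<rho> (MF.extend_functional (f j) v))"
      by (rule add_hom_comp[OF functional_add_hom[OF MF.functional_extend_functional[OF f]]], rule add_homI)
        (simp_all add: N.hom.hom_closed)
    fix w x assume w: "w \<in> carrier W" and x: "x \<in> carrier M"
    have fx: "f j x \<in> carrier W" by (rule add_hom_closed[OF functional_add_hom[OF f] x])
    have "coord f 1 j (mod_p_F_inner (w \<odot>\<^bsub>MF.BM\<^esub> MF.unit x)) = \<rho> w \<otimes>\<^bsub>Rp\<^esub> N.extend_functional (f j) (N.unit x) [^]\<^bsub>Rp\<^esub> (p ^ 1)"
      unfolding mod_p_F_inner_unit[OF w x]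
      by (rule coord_unit[of f j, OF f]) (use w x in \<open>simp_all add: N.hom.hom_closed N.unit_closed\<close>)
    also have "N.extend_functional (f j) (N.unit x) = \<rho> (f j x)"
    proof -
      interpret NB: module Rp N.BM by (rule N.module_BM)
      have "N.extend_functional (f j) (\<one>\<^bsub>Rp\<^esub> \<odot>\<^bsub>N.BM\<^esub> N.unit x) = \<one>\<^bsub>Rp\<^esub> \<otimes>\<^bsub>Rp\<^esub> \<rho> (f j x)"
        by (rule N.extend_functional_unit[OF f]) (use x in simp_all)
      then show ?thesis using x fx by (simp add: N.unit_closed N.hom.hom_closed)
    qed
    also have "\<rho> w \<otimes>\<^bsub>Rp\<^esub> \<rho> (f j x) [^]\<^bsub>Rp\<^esub> (p ^ 1) = \<rho> (MF.extend_functional (f j) (w \<odot>\<^bsub>MF.BM\<^esub> MF.unit x))"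
      using w fx by (simp add: MF.extend_functional_unit[OF f w x] witt_to_mod_p_F)
    finally show "coord f 1 j (mod_p_F_inner (w \<odot>\<^bsub>MF.BM\<^esub> MF.unit x)) = \<rho> (MF.extend_functional (f j) (w \<odot>\<^bsub>MF.BM\<^esub> MF.unit x))" .
  qed
  then show ?thesis
    unfolding mod_p_F_twist_unit[OF r v] functional_smult[OF functional_coord[of f j, OF f] r gv] by simp
qed

end

text \<open>The module \<open>L\<close> of a display with a dual basis, and the map \<open>L \<rightarrow> L\<^sup>F\<close> whose iterates define nilpotence.\<close>

locale witt_display_L = witt_module R p "disp_L P"
  for R :: "('a, 'k) ring_scheme" (structure) and p :: nat and P :: "(nat \<Rightarrow> 'a, 't, 'l) display" +
  fixes n :: nat and l :: "nat \<Rightarrow> 'l" and f :: "nat \<Rightarrow> 'l \<Rightarrow> nat \<Rightarrow> 'a"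
  assumes db: "dual_basis (witt p R) (disp_L P) n l f"
    and z_linear: "linear_map (witt p R) (disp_L P) (F_twist p R (disp_L P)) (z_map p R P)"
begin

abbreviation "L \<equiv> disp_L P"

definition z_matrix :: "nat \<Rightarrow> nat \<Rightarrow> nat \<Rightarrow> 'a" where
  "z_matrix i j = MF.extend_functional (f i) (z_map p R P (l j))"

lemmas l_closed = dual_basisD(1)[OF db]
lemmas f_functional = dual_basisD(2)[OF db]

lemma z_closed: "y \<in> carrier L \<Longrightarrow> z_map p R P y \<in> carrier MF.BM"
  using add_hom_closed[OF linear_map_add_hom[OF z_linear]] by (simp add: F_twist_eq)

lemma functional_z: "i < n \<Longrightarrow> functional W L (\<lambda>y. MF.extend_functional (f i) (z_map p R P y))"
  using functional_comp_linear_map[OF z_linear] MF.functional_extend_functional[OF f_functional]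
  by (simp add: F_twist_eq)

lemma z_matrix_closed: "i < n \<Longrightarrow> j < n \<Longrightarrow> z_matrix i j \<in> carrier W"
  unfolding z_matrix_def using add_hom_closed[OF functional_add_hom[OF functional_z]] l_closed by blast

lemma z_expand:
  assumes "i < n" "y \<in> carrier L"
  shows "MF.extend_functional (f i) (z_map p R P y) = (\<Oplus>\<^bsub>W\<^esub>j\<in>{..<n}. f j y \<otimes>\<^bsub>W\<^esub> z_matrix i j)"
  unfolding z_matrix_def by (rule functional_expand[OF M.module_axioms functional_z[OF assms(1)] db assms(2)])

lemma z_mod_p_eq: "z_mod_p p R P x = mod_p_F_twist p R L (base_change_map W Rp \<rho> MF.BM (z_map p R P) x)"
  by (simp add: z_mod_p_def F_twist_eq)

lemma
  shows base_change_z_linear: "linear_map Rp N.BM (base_change W Rp \<rho> MF.BM) (base_change_map W Rp \<rho> MF.BM (z_map p R P))"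
    and base_change_z_unit: "r \<in> carrier Rp \<Longrightarrow> y \<in> carrier L \<Longrightarrow>
      base_change_map W Rp \<rho> MF.BM (z_map p R P) (r \<odot>\<^bsub>N.BM\<^esub> N.unit y)
        = r \<odot>\<^bsub>base_change W Rp \<rho> MF.BM\<^esub> base_change_unit W Rp \<rho> MF.BM (z_map p R P y)"
  using N.base_change_map_linear[OF MF.module_BM z_linear[unfolded F_twist_eq]]
    N.base_change_map_unit[OF MF.module_BM z_linear[unfolded F_twist_eq]] by blast+

lemma z_mod_p_add_hom: "add_hom N.BM (Nt.BM 1) (z_mod_p p R P)"
  unfolding z_mod_p_eq[abs_def]
  by (rule add_hom_comp[OF linear_map_add_hom[OF base_change_z_linear] linear_map_add_hom[OF mod_p_F_twist_linear]])

lemma coord_sum_add_hom: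
  assumes "\<And>j. j < n \<Longrightarrow> add_hom X Rp (g j)" "\<And>j. j < n \<Longrightarrow> a j \<in> carrier Rp"
  shows "add_hom X Rp (\<lambda>x. \<Oplus>\<^bsub>Rp\<^esub>j\<in>{..<n}. a j \<otimes>\<^bsub>Rp\<^esub> g j x)"
proof (rule add_homI)
  have c: "g j x \<in> carrier Rp" if "j < n" "x \<in> carrier X" for j x using add_hom_closed[OF assms(1)] that by blast
  fix x assume x: "x \<in> carrier X"
  show "(\<Oplus>\<^bsub>Rp\<^esub>j\<in>{..<n}. a j \<otimes>\<^bsub>Rp\<^esub> g j x) \<in> carrier Rp"
    by (rule Rp.finsum_closed) (use assms(2) c x in auto)
  fix y assume y: "y \<in> carrier X"
  have "(\<Oplus>\<^bsub>Rp\<^esub>j\<in>{..<n}. a j \<otimes>\<^bsub>Rp\<^esub> g j (x \<oplus>\<^bsub>X\<^esub> y)) = (\<Oplus>\<^bsub>Rp\<^esub>j\<in>{..<n}. a j \<otimes>\<^bsub>Rp\<^esub> g j x \<oplus>\<^bsub>Rp\<^esub> a j \<otimes>\<^bsub>Rp\<^esub> g j y)"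
    by (rule Rp.finsum_cong') (use assms(2) c x y in \<open>auto simp: add_hom_add[OF assms(1)] Rp.r_distr\<close>)
  also have "\<dots> = (\<Oplus>\<^bsub>Rp\<^esub>j\<in>{..<n}. a j \<otimes>\<^bsub>Rp\<^esub> g j x) \<oplus>\<^bsub>Rp\<^esub> (\<Oplus>\<^bsub>Rp\<^esub>j\<in>{..<n}. a j \<otimes>\<^bsub>Rp\<^esub> g j y)"
    by (rule Rp.finsum_addf) (use assms(2) c x y in auto)
  finally show "(\<Oplus>\<^bsub>Rp\<^esub>j\<in>{..<n}. a j \<otimes>\<^bsub>Rp\<^esub> g j (x \<oplus>\<^bsub>X\<^esub> y))
      = (\<Oplus>\<^bsub>Rp\<^esub>j\<in>{..<n}. a j \<otimes>\<^bsub>Rp\<^esub> g j x) \<oplus>\<^bsub>Rp\<^esub> (\<Oplus>\<^bsub>Rp\<^esub>j\<in>{..<n}. a j \<otimes>\<^bsub>Rp\<^esub> g j y)" .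
qed

lemma N_extend_add_hom: "j < n \<Longrightarrow> add_hom N.BM Rp (N.extend_functional (f j))"
  by (rule functional_add_hom[OF N.functional_extend_functional[OF f_functional]])

lemma coord_add_hom: "j < n \<Longrightarrow> add_hom (Nt.BM i) Rp (coord f i j)"
  by (rule functional_add_hom[OF functional_coord[of f j, OF f_functional]])

lemma \<rho>_z_closed: "i < n \<Longrightarrow> j < n \<Longrightarrow> \<rho> (z_matrix i j) \<in> carrier Rp"
  by (simp add: z_matrix_closed N.hom.hom_closed)

lemma coord_z_mod_p:
  assumes h: "h < n" and x: "x \<in> carrier N.BM"
  shows "coord f 1 h (z_mod_p p R P x) = (\<Oplus>\<^bsub>Rp\<^esub>j\<in>{..<n}. \<rho> (z_matrix h j) \<otimes>\<^bsub>Rp\<^esub> N.extend_functional (f j) x)"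
proof (rule N.BM_eqI[OF Rp.abelian_group_axioms _ _ x])
  show "add_hom N.BM Rp (\<lambda>x. coord f 1 h (z_mod_p p R P x))"
    by (rule add_hom_comp[OF z_mod_p_add_hom coord_add_hom[OF h]])
  show "add_hom N.BM Rp (\<lambda>x. \<Oplus>\<^bsub>Rp\<^esub>j\<in>{..<n}. \<rho> (z_matrix h j) \<otimes>\<^bsub>Rp\<^esub> N.extend_functional (f j) x)"
    by (rule coord_sum_add_hom) (use N_extend_add_hom \<rho>_z_closed h in auto)
  fix r y assume r: "r \<in> carrier Rp" and y: "y \<in> carrier L"
  have fy: "f j y \<in> carrier W" if "j < n" for j using dual_basis_closed[OF db that y] .
  have \<rho>f: "\<rho> (f j y) \<in> carrier Rp" if "j < n" for j using N.hom.hom_closed[OF fy[OF that]] .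
  have "coord f 1 h (z_mod_p p R P (r \<odot>\<^bsub>N.BM\<^esub> N.unit y)) = r \<otimes>\<^bsub>Rp\<^esub> \<rho> (MF.extend_functional (f h) (z_map p R P y))"
    unfolding z_mod_p_eq base_change_z_unit[OF r y]
    by (rule coord_mod_p_F_twist[of f h, OF f_functional[OF h] r z_closed[OF y]])
  also have "\<rho> (MF.extend_functional (f h) (z_map p R P y)) = (\<Oplus>\<^bsub>Rp\<^esub>j\<in>{..<n}. \<rho> (f j y) \<otimes>\<^bsub>Rp\<^esub> \<rho> (z_matrix h j))"
    unfolding z_expand[OF h y]
  proof (subst N.hom.hom_finsum)
    show "(\<Oplus>\<^bsub>Rp\<^esub>j\<in>{..<n}. (\<rho> \<circ> (\<lambda>j. f j y \<otimes>\<^bsub>W\<^esub> z_matrix h j)) j)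
        = (\<Oplus>\<^bsub>Rp\<^esub>j\<in>{..<n}. \<rho> (f j y) \<otimes>\<^bsub>Rp\<^esub> \<rho> (z_matrix h j))"
      by (rule Rp.finsum_cong') (use fy z_matrix_closed[OF h] \<rho>f \<rho>_z_closed[OF h] in auto)
  qed (use fy z_matrix_closed[OF h] in auto)
  also have "r \<otimes>\<^bsub>Rp\<^esub> \<dots> = (\<Oplus>\<^bsub>Rp\<^esub>j\<in>{..<n}. r \<otimes>\<^bsub>Rp\<^esub> (\<rho> (f j y) \<otimes>\<^bsub>Rp\<^esub> \<rho> (z_matrix h j)))"
    by (rule Rp.finsum_rdistr) (use r \<rho>f \<rho>_z_closed[OF h] in auto)
  also have "\<dots> = (\<Oplus>\<^bsub>Rp\<^esub>j\<in>{..<n}. \<rho> (z_matrix h j) \<otimes>\<^bsub>Rp\<^esub> N.extend_functional (f j) (r \<odot>\<^bsub>N.BM\<^esub> N.unit y))"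
    by (rule Rp.finsum_cong')
      (use r y \<rho>f \<rho>_z_closed[OF h] in \<open>auto simp: N.extend_functional_unit[OF f_functional] Rp.m_ac\<close>)
  finally show "coord f 1 h (z_mod_p p R P (r \<odot>\<^bsub>N.BM\<^esub> N.unit y)) =
      (\<Oplus>\<^bsub>Rp\<^esub>j\<in>{..<n}. \<rho> (z_matrix h j) \<otimes>\<^bsub>Rp\<^esub> N.extend_functional (f j) (r \<odot>\<^bsub>N.BM\<^esub> N.unit y))" .
qed

text \<open>The \<open>e\<close>-th twist of the map is described by the matrix \<open>Z\<close> with its entries raised to the power \<open>p\<^sup>e\<close>.\<close>

lemma
  shows z_twist_add_hom: "add_hom (Nt.BM e) (Nt.BM (Suc e)) (z_twist p R P e)"
    and coord_z_twist: "h < n \<Longrightarrow> t \<in> carrier (Nt.BM e) \<Longrightarrow> coord f (Suc e) h (z_twist p R P e t)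
      = (\<Oplus>\<^bsub>Rp\<^esub>j\<in>{..<n}. \<rho> (z_matrix h j) [^]\<^bsub>Rp\<^esub> (p ^ e) \<otimes>\<^bsub>Rp\<^esub> coord f e j t)"
proof -
  let ?fr = "frob_mod_p p R"
  interpret D: base_change_module Rp Rp "?fr e" "Nt.BM 1"
    by (rule base_change_module.intro[OF frob_mod_p_hom Nt.module_BM])
  interpret S: module Rp "Nt.BM (Suc e)" by (rule Nt.module_BM)
  have us: "Nt.unit (Suc e) (a \<odot>\<^bsub>N.BM\<^esub> x) = ?fr e (?fr 1 a) \<odot>\<^bsub>Nt.BM (Suc e)\<^esub> Nt.unit (Suc e) x"
    if "a \<in> carrier Rp" "x \<in> carrier N.BM" for a x
  proof -
    have "?fr (Suc e) a = ?fr e (?fr 1 a)"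
      by (simp only: frob_mod_p_def Rp.nat_pow_pow[OF that(1)] power_one_right power_Suc)
    then show ?thesis unfolding Nt.unit_smult[OF that] by simp
  qed
  let ?g = "semilinearization (Nt.BM (Suc e)) (?fr e) (Nt.unit (Suc e))"
  have g: "add_hom (Nt.BM 1) (Nt.BM (Suc e)) ?g"
    by (rule Nt.semilinearization_add_hom[OF Nt.module_BM frob_mod_p_hom Nt.unit_add_hom]) (rule us)
  have gu: "?g (r \<odot>\<^bsub>Nt.BM 1\<^esub> Nt.unit 1 x) = ?fr e r \<odot>\<^bsub>Nt.BM (Suc e)\<^esub> Nt.unit (Suc e) x"
    if "r \<in> carrier Rp" "x \<in> carrier N.BM" for r x
    by (rule Nt.semilinearization_unit[OF Nt.module_BM frob_mod_p_hom Nt.unit_add_hom]) (assumption | rule us that)+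
  have gs: "?g (r \<odot>\<^bsub>Nt.BM 1\<^esub> y) = ?fr e r \<odot>\<^bsub>Nt.BM (Suc e)\<^esub> ?g y"
    if "r \<in> carrier Rp" "y \<in> carrier (Nt.BM 1)" for r y
    by (rule Nt.semilinearization_smult[OF Nt.module_BM frob_mod_p_hom Nt.unit_add_hom]) (assumption | rule us that)+
  have zl: "linear_map Rp N.BM (Nt.BM 1) (z_mod_p p R P)"
    unfolding linear_map_def
  proof (intro conjI ballI)
    show "add_hom N.BM (Nt.BM 1) (z_mod_p p R P)" by (rule z_mod_p_add_hom)
    fix a x assume a: "a \<in> carrier Rp" and x: "x \<in> carrier N.BM"
    show "z_mod_p p R P (a \<odot>\<^bsub>N.BM\<^esub> x) = a \<odot>\<^bsub>Nt.BM 1\<^esub> z_mod_p p R P x"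
      unfolding z_mod_p_eq linear_map_smult[OF base_change_z_linear a x]
      by (rule linear_map_smult[OF mod_p_F_twist_linear a add_hom_closed[OF linear_map_add_hom[OF base_change_z_linear] x]])
  qed
  let ?b = "base_change_map Rp Rp (?fr e) (Nt.BM 1) (z_mod_p p R P)"
  have b: "linear_map Rp (Nt.BM e) D.BM ?b"
    by (rule Nt.base_change_map_linear[OF Nt.module_BM zl])
  have bu: "?b (r \<odot>\<^bsub>Nt.BM e\<^esub> Nt.unit e x) = r \<odot>\<^bsub>D.BM\<^esub> D.unit (z_mod_p p R P x)"
    if "r \<in> carrier Rp" "x \<in> carrier N.BM" for r x
    by (rule Nt.base_change_map_unit[OF Nt.module_BM zl that])
  have ftt: "frob_twist_twist p R e N.BM = linearization (Nt.BM (Suc e)) ?g"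
    unfolding frob_twist_twist_def frob_twist_eq frob_twist_unit_eq ..
  have c: "linear_map Rp D.BM (Nt.BM (Suc e)) (frob_twist_twist p R e N.BM)"
    unfolding ftt by (rule D.linearization_linear[OF Nt.module_BM g]) (rule gs)
  have cu: "frob_twist_twist p R e N.BM (r \<odot>\<^bsub>D.BM\<^esub> D.unit y) = r \<odot>\<^bsub>Nt.BM (Suc e)\<^esub> ?g y"
    if "r \<in> carrier Rp" "y \<in> carrier (Nt.BM 1)" for r y
    unfolding ftt by (rule D.linearization_unit[OF Nt.module_BM g]) (assumption | rule gs that)+
  have zt: "z_twist p R P e t = frob_twist_twist p R e N.BM (?b t)" for t
    unfolding z_twist_def module_mod_p_eq Let_def frob_twist_eq by simp
  show ah: "add_hom (Nt.BM e) (Nt.BM (Suc e)) (z_twist p R P e)"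
    unfolding zt[abs_def] by (rule add_hom_comp[OF linear_map_add_hom[OF b] linear_map_add_hom[OF c]])
  assume h: "h < n" and t: "t \<in> carrier (Nt.BM e)"
  note fh = f_functional[OF h]
  have gc: "coord f (Suc e) h (?g y) = coord f 1 h y [^]\<^bsub>Rp\<^esub> (p ^ e)" if y: "y \<in> carrier (Nt.BM 1)" for y
  proof (rule Nt.BM_eqI[OF Rp.abelian_group_axioms _ _ y])
    show "add_hom (Nt.BM 1) Rp (\<lambda>y. coord f (Suc e) h (?g y))"
      by (rule add_hom_comp[OF g coord_add_hom[OF h]])
    have "add_hom Rp Rp (\<lambda>r. r [^]\<^bsub>Rp\<^esub> (p ^ e))"
      by (rule add_homI) (use ring_hom_cring.homh[OF frob_mod_p_hom[of e]] in \<open>simp_all add: ring_hom_def frob_mod_p_def\<close>)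
    from add_hom_comp[OF coord_add_hom[OF h] this]
    show "add_hom (Nt.BM 1) Rp (\<lambda>y. coord f 1 h y [^]\<^bsub>Rp\<^esub> (p ^ e))" .
    fix r x assume r: "r \<in> carrier Rp" and x: "x \<in> carrier N.BM"
    have ex: "N.extend_functional (f h) x \<in> carrier Rp" by (rule add_hom_closed[OF N_extend_add_hom[OF h] x])
    have "coord f (Suc e) h (?g (r \<odot>\<^bsub>Nt.BM 1\<^esub> Nt.unit 1 x)) = ?fr e r \<otimes>\<^bsub>Rp\<^esub> N.extend_functional (f h) x [^]\<^bsub>Rp\<^esub> (p ^ Suc e)"
      unfolding gu[OF r x] by (rule coord_unit[of f h, OF fh Nt.hom.hom_closed[OF r] x])
    also have "\<dots> = (r \<otimes>\<^bsub>Rp\<^esub> N.extend_functional (f h) x [^]\<^bsub>Rp\<^esub> (p ^ 1)) [^]\<^bsub>Rp\<^esub> (p ^ e)"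
      using r ex by (simp add: frob_mod_p_def Rp.nat_pow_distrib Rp.nat_pow_pow)
    finally show "coord f (Suc e) h (?g (r \<odot>\<^bsub>Nt.BM 1\<^esub> Nt.unit 1 x)) = coord f 1 h (r \<odot>\<^bsub>Nt.BM 1\<^esub> Nt.unit 1 x) [^]\<^bsub>Rp\<^esub> (p ^ e)"
      unfolding coord_unit[of f h, OF fh r x] .
  qed
  have pz: "\<rho> (z_matrix h j) [^]\<^bsub>Rp\<^esub> (p ^ e) \<in> carrier Rp" if "j < n" for j
    using \<rho>_z_closed[OF h that] by simp
  show "coord f (Suc e) h (z_twist p R P e t)
      = (\<Oplus>\<^bsub>Rp\<^esub>j\<in>{..<n}. \<rho> (z_matrix h j) [^]\<^bsub>Rp\<^esub> (p ^ e) \<otimes>\<^bsub>Rp\<^esub> coord f e j t)"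
  proof (rule Nt.BM_eqI[OF Rp.abelian_group_axioms _ _ t])
    show "add_hom (Nt.BM e) Rp (\<lambda>t. coord f (Suc e) h (z_twist p R P e t))"
      by (rule add_hom_comp[OF ah coord_add_hom[OF h]])
    show "add_hom (Nt.BM e) Rp (\<lambda>t. \<Oplus>\<^bsub>Rp\<^esub>j\<in>{..<n}. \<rho> (z_matrix h j) [^]\<^bsub>Rp\<^esub> (p ^ e) \<otimes>\<^bsub>Rp\<^esub> coord f e j t)"
      by (rule coord_sum_add_hom) (use coord_add_hom pz in auto)
    fix r x assume r: "r \<in> carrier Rp" and x: "x \<in> carrier N.BM"
    have ex: "N.extend_functional (f j) x \<in> carrier Rp" if "j < n" for j by (rule add_hom_closed[OF N_extend_add_hom[OF that] x])
    have zx: "z_mod_p p R P x \<in> carrier (Nt.BM 1)" by (rule add_hom_closed[OF z_mod_p_add_hom x])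
    have "coord f (Suc e) h (z_twist p R P e (r \<odot>\<^bsub>Nt.BM e\<^esub> Nt.unit e x)) = r \<otimes>\<^bsub>Rp\<^esub> ?fr e (coord f 1 h (z_mod_p p R P x))"
      unfolding zt bu[OF r x] cu[OF r zx]
        functional_smult[OF functional_coord[of f h, OF fh] r add_hom_closed[OF g zx]] gc[OF zx]
      by (simp add: frob_mod_p_def)
    also have "?fr e (coord f 1 h (z_mod_p p R P x)) =
        (\<Oplus>\<^bsub>Rp\<^esub>j\<in>{..<n}. \<rho> (z_matrix h j) [^]\<^bsub>Rp\<^esub> (p ^ e) \<otimes>\<^bsub>Rp\<^esub> N.extend_functional (f j) x [^]\<^bsub>Rp\<^esub> (p ^ e))"
      unfolding coord_z_mod_p[OF h x]
    proof (subst ring_hom_cring.hom_finsum[OF frob_mod_p_hom])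
      show "(\<Oplus>\<^bsub>Rp\<^esub>j\<in>{..<n}. (?fr e \<circ> (\<lambda>j. \<rho> (z_matrix h j) \<otimes>\<^bsub>Rp\<^esub> N.extend_functional (f j) x)) j)
          = (\<Oplus>\<^bsub>Rp\<^esub>j\<in>{..<n}. \<rho> (z_matrix h j) [^]\<^bsub>Rp\<^esub> (p ^ e) \<otimes>\<^bsub>Rp\<^esub> N.extend_functional (f j) x [^]\<^bsub>Rp\<^esub> (p ^ e))"
        by (rule Rp.finsum_cong')
          (use ex \<rho>_z_closed[OF h] in \<open>auto simp: frob_mod_p_def Rp.nat_pow_distrib\<close>)
    qed (use ex \<rho>_z_closed[OF h] in auto)
    also have "r \<otimes>\<^bsub>Rp\<^esub> \<dots> = (\<Oplus>\<^bsub>Rp\<^esub>j\<in>{..<n}. r \<otimes>\<^bsub>Rp\<^esub> (\<rho> (z_matrix h j) [^]\<^bsub>Rp\<^esub> (p ^ e) \<otimes>\<^bsub>Rp\<^esub> N.extend_functional (f j) x [^]\<^bsub>Rp\<^esub> (p ^ e)))"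
      by (rule Rp.finsum_rdistr) (use r ex pz in auto)
    also have "\<dots> = (\<Oplus>\<^bsub>Rp\<^esub>j\<in>{..<n}. \<rho> (z_matrix h j) [^]\<^bsub>Rp\<^esub> (p ^ e) \<otimes>\<^bsub>Rp\<^esub> coord f e j (r \<odot>\<^bsub>Nt.BM e\<^esub> Nt.unit e x))"
      by (rule Rp.finsum_cong')
        (use r x ex pz in \<open>auto simp: coord_unit[of f, OF f_functional] Rp.m_ac\<close>)
    finally show "coord f (Suc e) h (z_twist p R P e (r \<odot>\<^bsub>Nt.BM e\<^esub> Nt.unit e x)) =
        (\<Oplus>\<^bsub>Rp\<^esub>j\<in>{..<n}. \<rho> (z_matrix h j) [^]\<^bsub>Rp\<^esub> (p ^ e) \<otimes>\<^bsub>Rp\<^esub> coord f e j (r \<odot>\<^bsub>Nt.BM e\<^esub> Nt.unit e x))" .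
  qed
qed

abbreviation "zcol j k i \<equiv> frob_col p Rp {..<n} (\<lambda>i l. \<rho> (z_matrix i l)) 0 j k i"

lemma zcol_closed: "i < n \<Longrightarrow> zcol j k i \<in> carrier Rp"
  by (rule Rp.frob_col_closed) (use \<rho>_z_closed in auto)

lemma coord_z_iter:
  assumes x: "x \<in> carrier N.BM"
  shows "z_iter p R P e x \<in> carrier (Nt.BM e) \<and>
    (\<forall>h<n. coord f e h (z_iter p R P e x) = (\<Oplus>\<^bsub>Rp\<^esub>j\<in>{..<n}. zcol j e h \<otimes>\<^bsub>Rp\<^esub> N.extend_functional (f j) x))"
proof (induction e)
  have ex: "N.extend_functional (f j) x \<in> carrier Rp" if "j < n" for j by (rule add_hom_closed[OF N_extend_add_hom[OF that] x])
  case 0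
  have "coord f 0 h (Nt.unit 0 x) = (\<Oplus>\<^bsub>Rp\<^esub>j\<in>{..<n}. zcol j 0 h \<otimes>\<^bsub>Rp\<^esub> N.extend_functional (f j) x)" if h: "h < n" for h
  proof -
    interpret B0: module Rp "Nt.BM 0" by (rule Nt.module_BM)
    have "coord f 0 h (\<one>\<^bsub>Rp\<^esub> \<odot>\<^bsub>Nt.BM 0\<^esub> Nt.unit 0 x) = \<one>\<^bsub>Rp\<^esub> \<otimes>\<^bsub>Rp\<^esub> N.extend_functional (f h) x [^]\<^bsub>Rp\<^esub> (p ^ 0)"
      by (rule coord_unit[of f h, OF f_functional[OF h] _ x]) simp
    then have 1: "coord f 0 h (Nt.unit 0 x) = N.extend_functional (f h) x"
      using x ex[OF h] by (simp add: Nt.unit_closed)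
    have "(\<Oplus>\<^bsub>Rp\<^esub>j\<in>{..<n}. zcol j 0 h \<otimes>\<^bsub>Rp\<^esub> N.extend_functional (f j) x)
        = (\<Oplus>\<^bsub>Rp\<^esub>j\<in>{..<n}. N.extend_functional (f j) x \<otimes>\<^bsub>Rp\<^esub> (if j = h then \<one>\<^bsub>Rp\<^esub> else \<zero>\<^bsub>Rp\<^esub>))"
      by (rule Rp.finsum_cong') (use ex in auto)
    also have "\<dots> = N.extend_functional (f h) x"
      by (rule Rp.finsum_mult_delta) (use ex h in auto)
    finally show ?thesis using 1 by simp
  qed
  then show ?case using Nt.unit_closed[OF x, of 0] by (simp add: module_mod_p_eq frob_twist_unit_eq)
next
  have ex: "N.extend_functional (f j) x \<in> carrier Rp" if "j < n" for j by (rule add_hom_closed[OF N_extend_add_hom[OF that] x])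
  case (Suc e)
  let ?t = "z_iter p R P e x"
  have t: "?t \<in> carrier (Nt.BM e)" using Suc by blast
  have "coord f (Suc e) h (z_twist p R P e ?t) = (\<Oplus>\<^bsub>Rp\<^esub>j\<in>{..<n}. zcol j (Suc e) h \<otimes>\<^bsub>Rp\<^esub> N.extend_functional (f j) x)"
    if h: "h < n" for h
  proof -
    have "coord f (Suc e) h (z_twist p R P e ?t)
        = (\<Oplus>\<^bsub>Rp\<^esub>i\<in>{..<n}. \<rho> (z_matrix h i) [^]\<^bsub>Rp\<^esub> (p ^ e) \<otimes>\<^bsub>Rp\<^esub> coord f e i ?t)"
      by (rule coord_z_twist[OF h t])
    also have "\<dots> = (\<Oplus>\<^bsub>Rp\<^esub>i\<in>{..<n}. \<rho> (z_matrix h i) [^]\<^bsub>Rp\<^esub> (p ^ e) \<otimes>\<^bsub>Rp\<^esub>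
        (\<Oplus>\<^bsub>Rp\<^esub>j\<in>{..<n}. zcol j e i \<otimes>\<^bsub>Rp\<^esub> N.extend_functional (f j) x))"
      by (rule Rp.finsum_cong')
        (use Suc ex zcol_closed \<rho>_z_closed[OF h] in \<open>auto intro!: Rp.m_closed Rp.finsum_closed\<close>)
    also have "\<dots> = (\<Oplus>\<^bsub>Rp\<^esub>j\<in>{..<n}. (\<Oplus>\<^bsub>Rp\<^esub>i\<in>{..<n}. \<rho> (z_matrix h i) [^]\<^bsub>Rp\<^esub> (p ^ e) \<otimes>\<^bsub>Rp\<^esub> zcol j e i) \<otimes>\<^bsub>Rp\<^esub> N.extend_functional (f j) x)"
      by (rule Rp.matrix_assoc[symmetric]) (use ex zcol_closed \<rho>_z_closed[OF h] in auto)
    finally show ?thesis by simp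
  qed
  then show ?case using add_hom_closed[OF z_twist_add_hom t] by simp
qed

text \<open>Let \<open>N\<^sub>k\<close> be the twisted product of \<open>k\<close> factors \<open>Z\<close> modulo \<open>p\<close>, and let \<open>E = (f\<^sub>j(l\<^sub>c))\<close> be the
  idempotent matrix of the dual basis. Nilpotence of order \<open>e\<close> only yields \<open>N\<^sub>e E = 0\<close>, as the basis
  elements \<open>l\<^sub>c\<close> need not be independent. But \<open>Z = Z E\<close>, hence \<open>N\<^bsub>e+1\<^esub> = N\<^bsub>e+1\<^esub> E = Z\<^bsup>(p^e)\<^esup> N\<^sub>e E = 0\<close>. This
  is the reason for the additional factor.\<close>

lemma nilpotent_frob_col:
  assumes nil: "nilpotent_display p R P"
  obtains s where "\<And>i j. i < n \<Longrightarrow> j < n \<Longrightarrow>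
    frob_col p R {..<n} (\<lambda>i l. z_matrix i l 0) 0 j (Suc s) i \<in> p_ideal p R"
proof -
  obtain e where e: "nilpotence_order_le p R P e" using nil by (auto simp: nilpotent_display_def)
  let ?E = "\<lambda>j c. \<rho> (f j (l c))"
  have fl: "f j (l c) \<in> carrier W" if "j < n" "c < n" for j c
    using dual_basis_closed[OF db that(1) l_closed[OF that(2)]] .
  have E: "?E j c \<in> carrier Rp" if "j < n" "c < n" for j c using N.hom.hom_closed[OF fl[OF that]] .
  have ME: "(\<Oplus>\<^bsub>Rp\<^esub>j\<in>{..<n}. zcol j e h \<otimes>\<^bsub>Rp\<^esub> ?E j c) = \<zero>\<^bsub>Rp\<^esub>" if h: "h < n" and c: "c < n" for h c
  proof -
    interpret NB: module Rp N.BM by (rule N.module_BM)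
    let ?x = "N.unit (l c)"
    have x: "?x \<in> carrier N.BM" by (rule N.unit_closed[OF l_closed[OF c]])
    have ev: "N.extend_functional (f j) ?x = ?E j c" if j: "j < n" for j
    proof -
      have "N.extend_functional (f j) (\<one>\<^bsub>Rp\<^esub> \<odot>\<^bsub>N.BM\<^esub> ?x) = \<one>\<^bsub>Rp\<^esub> \<otimes>\<^bsub>Rp\<^esub> ?E j c"
        by (rule N.extend_functional_unit[OF f_functional[OF j] _ l_closed[OF c]]) simp
      then show ?thesis using x E[OF j c] by simp
    qed
    have "z_iter p R P e ?x = \<zero>\<^bsub>Nt.BM e\<^esub>"
      using e x by (simp add: nilpotence_order_le_def module_mod_p_eq frob_twist_eq)
    then have "coord f e h (z_iter p R P e ?x) = \<zero>\<^bsub>Rp\<^esub>"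
      using add_hom_zero[OF Nt.abelian_group_BM Rp.abelian_group_axioms coord_add_hom[OF h]] by simp
    then have "(\<Oplus>\<^bsub>Rp\<^esub>j\<in>{..<n}. zcol j e h \<otimes>\<^bsub>Rp\<^esub> N.extend_functional (f j) ?x) = \<zero>\<^bsub>Rp\<^esub>"
      using coord_z_iter[OF x, of e] h by simp
    moreover have "(\<Oplus>\<^bsub>Rp\<^esub>j\<in>{..<n}. zcol j e h \<otimes>\<^bsub>Rp\<^esub> N.extend_functional (f j) ?x) = (\<Oplus>\<^bsub>Rp\<^esub>j\<in>{..<n}. zcol j e h \<otimes>\<^bsub>Rp\<^esub> ?E j c)"
      by (rule Rp.finsum_cong') (use h c E zcol_closed ev in auto)
    ultimately show ?thesis by simp
  qed
  have rec: "(\<Oplus>\<^bsub>Rp\<^esub>j\<in>{..<n}. zcol j (Suc k) h \<otimes>\<^bsub>Rp\<^esub> ?E j c)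
      = (\<Oplus>\<^bsub>Rp\<^esub>i\<in>{..<n}. \<rho> (z_matrix h i) [^]\<^bsub>Rp\<^esub> (p ^ k) \<otimes>\<^bsub>Rp\<^esub> (\<Oplus>\<^bsub>Rp\<^esub>j\<in>{..<n}. zcol j k i \<otimes>\<^bsub>Rp\<^esub> ?E j c))"
    if h: "h < n" and c: "c < n" for h c k
    unfolding frob_col.simps add_0
    by (rule Rp.matrix_assoc) (use h c E zcol_closed \<rho>_z_closed in auto)
  have absorb: "\<forall>h<n. (\<Oplus>\<^bsub>Rp\<^esub>j\<in>{..<n}. zcol j (Suc k) h \<otimes>\<^bsub>Rp\<^esub> ?E j c) = zcol c (Suc k) h" if c: "c < n" for c k
  proof (induction k)
    case 0
    show ?case
    proof (intro allI impI)
      fix h assume h: "h < n"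
      have z1: "zcol j (Suc 0) h = \<rho> (z_matrix h j)" if j: "j < n" for j
      proof -
        have "zcol j (Suc 0) h = (\<Oplus>\<^bsub>Rp\<^esub>i\<in>{..<n}. \<rho> (z_matrix h i) \<otimes>\<^bsub>Rp\<^esub> (if i = j then \<one>\<^bsub>Rp\<^esub> else \<zero>\<^bsub>Rp\<^esub>))"
          unfolding frob_col.simps by (rule Rp.finsum_cong') (use \<rho>_z_closed[OF h] in auto)
        also have "\<dots> = \<rho> (z_matrix h j)" by (rule Rp.finsum_mult_delta) (use \<rho>_z_closed[OF h] j in auto)
        finally show ?thesis .
      qed
      have "z_matrix h c = (\<Oplus>\<^bsub>W\<^esub>j\<in>{..<n}. f j (l c) \<otimes>\<^bsub>W\<^esub> z_matrix h j)"
        using z_expand[OF h l_closed[OF c]] by (simp add: z_matrix_def)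
      then have "\<rho> (z_matrix h c) = \<rho> (\<Oplus>\<^bsub>W\<^esub>j\<in>{..<n}. f j (l c) \<otimes>\<^bsub>W\<^esub> z_matrix h j)" by simp
      also have "\<dots> = (\<Oplus>\<^bsub>Rp\<^esub>j\<in>{..<n}. (\<rho> \<circ> (\<lambda>j. f j (l c) \<otimes>\<^bsub>W\<^esub> z_matrix h j)) j)"
        by (subst N.hom.hom_finsum) (use fl[OF _ c] z_matrix_closed[OF h] in auto)
      also have "\<dots> = (\<Oplus>\<^bsub>Rp\<^esub>j\<in>{..<n}. zcol j (Suc 0) h \<otimes>\<^bsub>Rp\<^esub> ?E j c)"
      proof (rule Rp.finsum_cong')
        fix j assume "j \<in> {..<n}"
        then have j: "j < n" by simp
        show "(\<rho> \<circ> (\<lambda>j. f j (l c) \<otimes>\<^bsub>W\<^esub> z_matrix h j)) j = zcol j (Suc 0) h \<otimes>\<^bsub>Rp\<^esub> ?E j c"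
          unfolding z1[OF j] o_def N.hom.hom_mult[OF fl[OF j c] z_matrix_closed[OF h j]]
          by (rule Rp.m_comm[OF E[OF j c] \<rho>_z_closed[OF h j]])
      qed (use zcol_closed[OF h] E[OF _ c] in \<open>auto simp del: frob_col.simps\<close>)
      finally show "(\<Oplus>\<^bsub>Rp\<^esub>j\<in>{..<n}. zcol j (Suc 0) h \<otimes>\<^bsub>Rp\<^esub> ?E j c) = zcol c (Suc 0) h"
        using z1[OF c] by simp
    qed
  next
    case (Suc k)
    show ?case
    proof (intro allI impI)
      fix h assume h: "h < n"
      have "(\<Oplus>\<^bsub>Rp\<^esub>j\<in>{..<n}. zcol j (Suc (Suc k)) h \<otimes>\<^bsub>Rp\<^esub> ?E j c)
          = (\<Oplus>\<^bsub>Rp\<^esub>i\<in>{..<n}. \<rho> (z_matrix h i) [^]\<^bsub>Rp\<^esub> (p ^ Suc k) \<otimes>\<^bsub>Rp\<^esub> (\<Oplus>\<^bsub>Rp\<^esub>j\<in>{..<n}. zcol j (Suc k) i \<otimes>\<^bsub>Rp\<^esub> ?E j c))"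
        by (rule rec[OF h c])
      also have "\<dots> = (\<Oplus>\<^bsub>Rp\<^esub>i\<in>{..<n}. \<rho> (z_matrix h i) [^]\<^bsub>Rp\<^esub> (p ^ Suc k) \<otimes>\<^bsub>Rp\<^esub> zcol c (Suc k) i)"
      proof (rule Rp.finsum_cong')
        fix i assume "i \<in> {..<n}"
        then have i: "i < n" by simp
        show "\<rho> (z_matrix h i) [^]\<^bsub>Rp\<^esub> (p ^ Suc k) \<otimes>\<^bsub>Rp\<^esub> (\<Oplus>\<^bsub>Rp\<^esub>j\<in>{..<n}. zcol j (Suc k) i \<otimes>\<^bsub>Rp\<^esub> ?E j c)
            = \<rho> (z_matrix h i) [^]\<^bsub>Rp\<^esub> (p ^ Suc k) \<otimes>\<^bsub>Rp\<^esub> zcol c (Suc k) i"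
          by (simp only: Suc[rule_format, OF i])
      qed (use zcol_closed \<rho>_z_closed[OF h] in \<open>auto simp del: frob_col.simps\<close>)
      also have "\<dots> = zcol c (Suc (Suc k)) h" by (simp only: frob_col.simps(2)[of p Rp _ _ _ _ "Suc k"] add_0)
      finally show "(\<Oplus>\<^bsub>Rp\<^esub>j\<in>{..<n}. zcol j (Suc (Suc k)) h \<otimes>\<^bsub>Rp\<^esub> ?E j c) = zcol c (Suc (Suc k)) h" .
    qed
  qed
  have zero: "zcol c (Suc e) h = \<zero>\<^bsub>Rp\<^esub>" if h: "h < n" and c: "c < n" for h c
  proof -
    have "zcol c (Suc e) h = (\<Oplus>\<^bsub>Rp\<^esub>i\<in>{..<n}. \<rho> (z_matrix h i) [^]\<^bsub>Rp\<^esub> (p ^ e) \<otimes>\<^bsub>Rp\<^esub> (\<Oplus>\<^bsub>Rp\<^esub>j\<in>{..<n}. zcol j e i \<otimes>\<^bsub>Rp\<^esub> ?E j c))"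
      using absorb[OF c, of e, rule_format, OF h, symmetric] rec[OF h c, of e] by (rule trans)
    also have "\<dots> = (\<Oplus>\<^bsub>Rp\<^esub>i\<in>{..<n}. \<zero>\<^bsub>Rp\<^esub>)"
      by (rule Rp.finsum_cong') (use ME c \<rho>_z_closed[OF h] in auto)
    finally show ?thesis by (simp add: Rp.finsum_zero)
  qed
  show ?thesis
  proof (rule that[of e])
    fix i j assume i: "i < n" and j: "j < n"
    have c: "frob_col p R {..<n} (\<lambda>i l. z_matrix i l 0) 0 j (Suc e) i \<in> carrier R"
      by (rule frob_col_closed) (use z_matrix_closed i in auto)
    have "p_ideal p R +> frob_col p R {..<n} (\<lambda>i l. z_matrix i l 0) 0 j (Suc e) i
        = frob_col p (R Quot p_ideal p R) {..<n} (\<lambda>i l. p_ideal p R +> z_matrix i l 0) 0 j (Suc e) i"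
      by (rule ring_hom_cring.hom_frob_col[OF quotient_hom[OF ideal_p_ideal]]) (use z_matrix_closed i in auto)
    also have "\<dots> = \<zero>\<^bsub>R Quot p_ideal p R\<^esub>"
      using zero[OF i j] unfolding witt_to_mod_p_def mod_p_eq .
    finally show "frob_col p R {..<n} (\<lambda>i l. z_matrix i l 0) 0 j (Suc e) i \<in> p_ideal p R"
      using quotient_eq_zero_iff[OF ideal_p_ideal c] by (rule iffD1[rotated])
  qed
qed

end

section \<open>The group of homomorphisms\<close>

lemma module_direct_sum:
  assumes "module A M" "module A N"
  shows "module A (direct_sum M N)"
proof -
  interpret M: module A M by fact
  interpret N: module A N by fact
  show ?thesis
  proof (rule moduleI[OF M.R.cring_axioms])
    show "abelian_group (direct_sum M N)"
    proof (rule abelian_groupI)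
      fix x assume "x \<in> carrier (direct_sum M N)"
      then show "\<exists>y\<in>carrier (direct_sum M N). y \<oplus>\<^bsub>direct_sum M N\<^esub> x = \<zero>\<^bsub>direct_sum M N\<^esub>"
        by (intro bexI[of _ "(\<ominus>\<^bsub>M\<^esub> fst x, \<ominus>\<^bsub>N\<^esub> snd x)"])
          (auto simp: direct_sum_def M.M.l_neg N.M.l_neg)
    qed (auto simp: direct_sum_def M.M.a_ac N.M.a_ac)
  qed (auto simp: direct_sum_def M.smult_l_distr N.smult_l_distr M.smult_r_distr N.smult_r_distr
      M.smult_assoc1 N.smult_assoc1)
qed

lemma direct_sum_simps:
  "carrier (direct_sum M N) = carrier M \<times> carrier N" "\<zero>\<^bsub>direct_sum M N\<^esub> = (\<zero>\<^bsub>M\<^esub>, \<zero>\<^bsub>N\<^esub>)"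
  "(x, y) \<oplus>\<^bsub>direct_sum M N\<^esub> (x', y') = (x \<oplus>\<^bsub>M\<^esub> x', y \<oplus>\<^bsub>N\<^esub> y')"
  "a \<odot>\<^bsub>direct_sum M N\<^esub> (x, y) = (a \<odot>\<^bsub>M\<^esub> x, a \<odot>\<^bsub>N\<^esub> y)"
  by (simp_all add: direct_sum_def)

definition map_neg ::
  "('a, 'b, 'x) module_scheme \<Rightarrow> ('a, 'c, 'y) module_scheme \<Rightarrow> ('b \<Rightarrow> 'c) \<Rightarrow> ('b \<Rightarrow> 'c)" where
  "map_neg M N f = (\<lambda>x\<in>carrier M. \<ominus>\<^bsub>N\<^esub> f x)"

lemma
  assumes "module A M" "module A N"
  shows map_zero_lin: "map_zero M N \<in> lin_maps A M N"
    and map_add_lin: "f \<in> lin_maps A M N \<Longrightarrow> g \<in> lin_maps A M N \<Longrightarrow> map_add M N f g \<in> lin_maps A M N"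
    and map_neg_lin: "f \<in> lin_maps A M N \<Longrightarrow> map_neg M N f \<in> lin_maps A M N"
    and map_add_assoc: "f \<in> lin_maps A M N \<Longrightarrow> g \<in> lin_maps A M N \<Longrightarrow> h \<in> lin_maps A M N \<Longrightarrow>
      map_add M N (map_add M N f g) h = map_add M N f (map_add M N g h)"
    and map_add_comm: "f \<in> lin_maps A M N \<Longrightarrow> g \<in> lin_maps A M N \<Longrightarrow> map_add M N f g = map_add M N g f"
    and map_zero_add: "f \<in> lin_maps A M N \<Longrightarrow> map_add M N (map_zero M N) f = f"
    and map_neg_add: "f \<in> lin_maps A M N \<Longrightarrow> map_add M N (map_neg M N f) f = map_zero M N"
proof -
  interpret M: module A M by fact
  interpret N: module A N by fact
  have c: "f x \<in> carrier N" if "f \<in> lin_maps A M N" "x \<in> carrier M" for f x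
    using that by (auto simp: lin_maps_def)
  have ad: "f (x \<oplus>\<^bsub>M\<^esub> y) = f x \<oplus>\<^bsub>N\<^esub> f y" if "f \<in> lin_maps A M N" "x \<in> carrier M" "y \<in> carrier M" for f x y
    using that by (auto simp: lin_maps_def)
  have sm: "f (a \<odot>\<^bsub>M\<^esub> x) = a \<odot>\<^bsub>N\<^esub> f x" if "f \<in> lin_maps A M N" "a \<in> carrier A" "x \<in> carrier M" for f a x
    using that by (auto simp: lin_maps_def)
  have ext: "f \<in> extensional (carrier M)" if "f \<in> lin_maps A M N" for f
    using that by (simp add: lin_maps_def PiE_def)
  show "map_zero M N \<in> lin_maps A M N"
    by (auto simp: lin_maps_def map_zero_def)
  show "map_add M N f g \<in> lin_maps A M N" if "f \<in> lin_maps A M N" "g \<in> lin_maps A M N"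
    unfolding lin_maps_def map_add_def
    by (auto simp: c[OF that(1)] c[OF that(2)] ad[OF that(1)] ad[OF that(2)] sm[OF that(1)] sm[OF that(2)]
        N.M.a_ac N.smult_r_distr)
  show "map_neg M N f \<in> lin_maps A M N" if "f \<in> lin_maps A M N"
    unfolding lin_maps_def map_neg_def
    by (auto simp: c[OF that] ad[OF that] sm[OF that] N.M.minus_add N.smult_r_minus)
  show "map_add M N (map_add M N f g) h = map_add M N f (map_add M N g h)"
    if "f \<in> lin_maps A M N" "g \<in> lin_maps A M N" "h \<in> lin_maps A M N"
    unfolding map_add_def by (rule restrict_ext) (simp add: c[OF that(1)] c[OF that(2)] c[OF that(3)] N.M.a_assoc)
  show "map_add M N f g = map_add M N g f" if "f \<in> lin_maps A M N" "g \<in> lin_maps A M N"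
    unfolding map_add_def by (rule restrict_ext) (simp add: c[OF that(1)] c[OF that(2)] N.M.a_comm)
  show "map_add M N (map_zero M N) f = f" if "f \<in> lin_maps A M N"
    unfolding map_add_def map_zero_def
    by (rule extensionalityI[OF restrict_extensional ext[OF that]]) (simp add: c[OF that])
  show "map_add M N (map_neg M N f) f = map_zero M N" if "f \<in> lin_maps A M N"
    unfolding map_add_def map_zero_def map_neg_def by (rule restrict_ext) (simp add: c[OF that] N.M.l_neg)
qed

lemma map_add_apply: "x \<in> carrier M \<Longrightarrow> map_add M N f g x = f x \<oplus>\<^bsub>N\<^esub> g x"
  by (simp add: map_add_def)

text \<open>The base change depends additively on the map. The sum is given as a third map \<open>h\<close>, because maps of
  modules agree with their pointwise sum only on the carrier.\<close>

lemma (in witt_module) F_twist_map_add: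
  assumes "module W M'" "linear_map W M M' f" "linear_map W M M' g" "linear_map W M M' h"
    and "\<And>x. x \<in> carrier M \<Longrightarrow> h x = f x \<oplus>\<^bsub>M'\<^esub> g x" and t: "t \<in> carrier (F_twist p R M)"
  shows "F_twist_map p R M' h t = F_twist_map p R M' f t \<oplus>\<^bsub>F_twist p R M'\<^esub> F_twist_map p R M' g t"
proof -
  interpret M': base_change_module W W F M' by (rule base_change_module.intro[OF ring_hom_F assms(1)])
  interpret B: module W M'.BM by (rule M'.module_BM)
  note lin = MF.base_change_map_linear[OF assms(1)] and unit = MF.base_change_map_unit[OF assms(1)]
  have c: "f x \<in> carrier M'" "g x \<in> carrier M'" if "x \<in> carrier M" for x
    using add_hom_closed[OF linear_map_add_hom[OF assms(2)] that] add_hom_closed[OF linear_map_add_hom[OF assms(3)] that] .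
  show ?thesis
    unfolding F_twist_map_def F_twist_def
  proof (rule MF.BM_eqI[OF M'.abelian_group_BM linear_map_add_hom[OF lin[OF assms(4)]] add_hom_sum[OF M'.abelian_group_BM
          linear_map_add_hom[OF lin[OF assms(2)]] linear_map_add_hom[OF lin[OF assms(3)]]] t[unfolded F_twist_def]])
    fix b x assume b: "b \<in> carrier W" and x: "x \<in> carrier M"
    show "base_change_map W W F M' h (b \<odot>\<^bsub>MF.BM\<^esub> MF.unit x)
      = base_change_map W W F M' f (b \<odot>\<^bsub>MF.BM\<^esub> MF.unit x) \<oplus>\<^bsub>M'.BM\<^esub> base_change_map W W F M' g (b \<odot>\<^bsub>MF.BM\<^esub> MF.unit x)"
      unfolding unit[OF assms(2) b x] unit[OF assms(3) b x] unit[OF assms(4) b x] assms(5)[OF x]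
        add_hom_add[OF M'.unit_add_hom c[OF x]]
      by (rule B.smult_r_distr[OF b M'.unit_closed[OF c(1)[OF x]] M'.unit_closed[OF c(2)[OF x]]])
  qed
qed

lemma (in witt_module) Fdiv_map_add:
  assumes "module W L" "linear_map W L IM f" "linear_map W L IM g" "linear_map W L IM h"
    and "\<And>x. x \<in> carrier L \<Longrightarrow> h x = f x \<oplus>\<^bsub>IM\<^esub> g x" and t: "t \<in> carrier (F_twist p R L)"
  shows "Fdiv_map p R M h t = Fdiv_map p R M f t \<oplus>\<^bsub>F_twist p R M\<^esub> Fdiv_map p R M g t"
proof -
  interpret L: base_change_module W W F L by (rule base_change_module.intro[OF ring_hom_F assms(1)])
  interpret B: module W MF.BM by (rule MF.module_BM)
  note lin = Fdiv_map_linear[OF assms(1), unfolded F_twist_def] and unit = Fdiv_map_unit[OF assms(1), unfolded F_twist_def]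
  have c: "f x \<in> carrier IM" "g x \<in> carrier IM" if "x \<in> carrier L" for x
    using add_hom_closed[OF linear_map_add_hom[OF assms(2)] that] add_hom_closed[OF linear_map_add_hom[OF assms(3)] that] .
  note Fc = add_hom_closed[OF Fdiv_tensor_add_hom]
  show ?thesis
    unfolding F_twist_def
  proof (rule L.BM_eqI[OF MF.abelian_group_BM linear_map_add_hom[OF lin[OF assms(4)]] add_hom_sum[OF MF.abelian_group_BM
          linear_map_add_hom[OF lin[OF assms(2)]] linear_map_add_hom[OF lin[OF assms(3)]]] t[unfolded F_twist_def]])
    fix b x assume b: "b \<in> carrier W" and x: "x \<in> carrier L"
    show "Fdiv_map p R M h (b \<odot>\<^bsub>L.BM\<^esub> L.unit x)
      = Fdiv_map p R M f (b \<odot>\<^bsub>L.BM\<^esub> L.unit x) \<oplus>\<^bsub>MF.BM\<^esub> Fdiv_map p R M g (b \<odot>\<^bsub>L.BM\<^esub> L.unit x)"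
      unfolding unit[OF assms(2) b x] unit[OF assms(3) b x] unit[OF assms(4) b x] assms(5)[OF x]
        add_hom_add[OF Fdiv_tensor_add_hom c[OF x]]
      by (rule B.smult_r_distr[OF b Fc[OF c(1)[OF x]] Fc[OF c(2)[OF x]]])
  qed
qed

lemma (in witt_module) module_F_twist: "module W (F_twist p R M)"
  unfolding F_twist_def by (rule MF.module_BM)

lemma (in witt_module) F_twist_map_linear:
  "module W M' \<Longrightarrow> linear_map W M M' g \<Longrightarrow> linear_map W (F_twist p R M) (F_twist p R M') (F_twist_map p R M' g)"
  unfolding F_twist_def F_twist_map_def by (rule MF.base_change_map_linear)

lemma (in witt_module) Fdiv_map_linear':
  "module W L \<Longrightarrow> linear_map W L IM b \<Longrightarrow> linear_map W (F_twist p R L) (F_twist p R M) (Fdiv_map p R M b)"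
  using Fdiv_map_linear by (simp add: F_twist_eq)

lemma (in abelian_group) nat_multiple_add: "x \<in> carrier G \<Longrightarrow> y \<in> carrier G \<Longrightarrow> [(k::nat)] \<cdot> (x \<oplus> y) = [k] \<cdot> x \<oplus> [k] \<cdot> y"
  using add.nat_pow_distrib by simp

lemma add_hom_nat_multiple:
  assumes "abelian_group M" "abelian_group N" "add_hom M N g" "x \<in> carrier M"
  shows "g ([(k::nat)] \<cdot>\<^bsub>M\<^esub> x) = [k] \<cdot>\<^bsub>N\<^esub> g x"
proof -
  interpret M: abelian_group M by fact
  interpret N: abelian_group N by fact
  show ?thesis
    by (induction k)
      (simp_all add: add_hom_zero[OF assms(1-3)] M.add.nat_pow_Suc N.add.nat_pow_Suc add_hom_add[OF assms(3)] assms(4))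
qed

locale display_pair = witt_ring R p
  for R :: "('a, 'k) ring_scheme" (structure) and p :: nat +
  fixes P :: "(nat \<Rightarrow> 'a, 't, 'l) display" and P' :: "(nat \<Rightarrow> 'a, 't1, 'l1) display"
  assumes P: "is_display p R P" and P': "is_display p R P'"
begin

abbreviation "T \<equiv> disp_T P"
abbreviation "L \<equiv> disp_L P"
abbreviation "T' \<equiv> disp_T P'"
abbreviation "L' \<equiv> disp_L P'"
abbreviation "\<Psi> \<equiv> disp_Psi P"
abbreviation "\<Psi>' \<equiv> disp_Psi P'"

lemma mT: "module W T" and mL: "module W L" and mT': "module W T'" and mL': "module W L'"
  using P P' by (simp_all add: is_display_def finite_projective_def)

lemma witt_moduleI: "module W M \<Longrightarrow> witt_module R p M"
  by (rule witt_module.intro[OF witt_ring_axioms])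

lemmas wT = witt_moduleI[OF mT] and wL = witt_moduleI[OF mL]
  and wT' = witt_moduleI[OF mT'] and wL' = witt_moduleI[OF mL']

lemmas mFT = witt_module.module_F_twist[OF wT] and mFL = witt_module.module_F_twist[OF wL]
  and mFT' = witt_module.module_F_twist[OF wT'] and mFL' = witt_module.module_F_twist[OF wL']

abbreviation "IT' \<equiv> I_tensor p R T'"

lemmas mIT' = witt_module.module_IM[OF wT']

lemma module_disp_F: "module W (disp_F p R P)" "module W (disp_F p R P')"
  and module_disp_sum: "module W (disp_sum P)" "module W (disp_sum P')"
  unfolding disp_F_def disp_sum_def
  using mT mL mT' mL' mFT mFL mFT' mFL' by (auto intro: module_direct_sum)

lemma Psi_linear: "linear_map W (disp_F p R P) (disp_sum P) \<Psi>" "linear_map W (disp_F p R P') (disp_sum P') \<Psi>'"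
  and Psi_bij: "bij_betw \<Psi> (carrier (disp_F p R P)) (carrier (disp_sum P))"
  using P P' by (auto simp: is_display_def module_isos_def intro: lin_maps_linear_map)

lemma pair_homsD:
  assumes "(a, b, c, d) \<in> pair_homs p R P P'"
  shows "a \<in> lin_maps W T T'" "b \<in> lin_maps W L IT'" "c \<in> lin_maps W T L'" "d \<in> lin_maps W L L'"
  using assms by (auto simp: pair_homs_def)

lemma F_map_closed:
  assumes "(a, b, c, d) \<in> pair_homs p R P P'" "u \<in> carrier (disp_F p R P)"
  shows "F_map p R P' (a, b, c, d) u \<in> carrier (disp_F p R P')"
proof -
  note lin = pair_homsD[OF assms(1), THEN lin_maps_linear_map]
  interpret FT': module W "F_twist p R T'" by (rule mFT')
  interpret FL': module W "F_twist p R L'" by (rule mFL')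
  obtain u1 u2 where u: "u = (u1, u2)" "u1 \<in> carrier (F_twist p R T)" "u2 \<in> carrier (F_twist p R L)"
    using assms(2) by (auto simp: disp_F_def direct_sum_simps)
  show ?thesis
    using add_hom_closed[OF linear_map_add_hom[OF witt_module.F_twist_map_linear[OF wT mT' lin(1)]] u(2)]
      add_hom_closed[OF linear_map_add_hom[OF witt_module.Fdiv_map_linear'[OF wT' mL lin(2)]] u(3)]
      add_hom_closed[OF linear_map_add_hom[OF witt_module.F_twist_map_linear[OF wT mL' lin(3)]] u(2)]
      add_hom_closed[OF linear_map_add_hom[OF witt_module.F_twist_map_linear[OF wL mL' lin(4)]] u(3)]
    by (simp add: u(1) disp_F_def direct_sum_simps)
qed

lemma induced_map_closed:
  assumes "(a, b, c, d) \<in> pair_homs p R P P'" "m \<in> carrier (disp_sum P)"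
  shows "induced_map P' (a, b, c, d) m \<in> carrier (disp_sum P')"
proof -
  note lin = pair_homsD[OF assms(1), THEN lin_maps_linear_map, THEN linear_map_add_hom]
  interpret T': module W T' by (rule mT')
  interpret L': module W L' by (rule mL')
  obtain x y where m: "m = (x, y)" "x \<in> carrier T" "y \<in> carrier L"
    using assms(2) by (auto simp: disp_sum_def direct_sum_simps)
  show ?thesis
    using add_hom_closed[OF lin(1) m(2)] add_hom_closed[OF add_hom_comp[OF lin(2) witt_module.I_incl_add_hom[OF wT']] m(3)]
      add_hom_closed[OF lin(3) m(2)] add_hom_closed[OF lin(4) m(3)]
    by (simp add: m(1) disp_sum_def direct_sum_simps)
qed

fun pair_add where
  "pair_add (a, b, c, d) (a', b', c', d') =
    (map_add T T' a a', map_add L IT' b b', map_add T L' c c', map_add L L' d d')"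

lemma pair_add_in_pair_homs:
  "f \<in> pair_homs p R P P' \<Longrightarrow> g \<in> pair_homs p R P P' \<Longrightarrow> pair_add f g \<in> pair_homs p R P P'"
  by (cases f; cases g)
    (simp add: pair_homs_def map_add_lin[OF mT mT'] map_add_lin[OF mL mIT'] map_add_lin[OF mT mL'] map_add_lin[OF mL mL'])

lemma F_map_add:
  assumes f: "f \<in> pair_homs p R P P'" and g: "g \<in> pair_homs p R P P'" and u: "u \<in> carrier (disp_F p R P)"
  shows "F_map p R P' (pair_add f g) u = F_map p R P' f u \<oplus>\<^bsub>disp_F p R P'\<^esub> F_map p R P' g u"
proof -
  obtain a b c d where f': "f = (a, b, c, d)" by (cases f)
  obtain a' b' c' d' where g': "g = (a', b', c', d')" by (cases g)
  obtain u1 u2 where u': "u = (u1, u2)" "u1 \<in> carrier (F_twist p R T)" "u2 \<in> carrier (F_twist p R L)"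
    using u by (auto simp: disp_F_def direct_sum_simps)
  note lf = pair_homsD[OF f[unfolded f'], THEN lin_maps_linear_map]
  note lg = pair_homsD[OF g[unfolded g'], THEN lin_maps_linear_map]
  note lh = pair_homsD[OF pair_add_in_pair_homs[OF f g, unfolded f' g' pair_add.simps], THEN lin_maps_linear_map]
  interpret FT': module W "F_twist p R T'" by (rule mFT')
  interpret FL': module W "F_twist p R L'" by (rule mFL')
  note closed = add_hom_closed[OF linear_map_add_hom]
  have cl: "F_twist_map p R T' a u1 \<in> carrier (F_twist p R T')" "F_twist_map p R T' a' u1 \<in> carrier (F_twist p R T')"
    "Fdiv_map p R T' b u2 \<in> carrier (F_twist p R T')" "Fdiv_map p R T' b' u2 \<in> carrier (F_twist p R T')"
    "F_twist_map p R L' c u1 \<in> carrier (F_twist p R L')" "F_twist_map p R L' c' u1 \<in> carrier (F_twist p R L')"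
    "F_twist_map p R L' d u2 \<in> carrier (F_twist p R L')" "F_twist_map p R L' d' u2 \<in> carrier (F_twist p R L')"
    using closed[OF witt_module.F_twist_map_linear[OF wT mT' lf(1)] u'(2)] closed[OF witt_module.F_twist_map_linear[OF wT mT' lg(1)] u'(2)]
      closed[OF witt_module.Fdiv_map_linear'[OF wT' mL lf(2)] u'(3)] closed[OF witt_module.Fdiv_map_linear'[OF wT' mL lg(2)] u'(3)]
      closed[OF witt_module.F_twist_map_linear[OF wT mL' lf(3)] u'(2)] closed[OF witt_module.F_twist_map_linear[OF wT mL' lg(3)] u'(2)]
      closed[OF witt_module.F_twist_map_linear[OF wL mL' lf(4)] u'(3)] closed[OF witt_module.F_twist_map_linear[OF wL mL' lg(4)] u'(3)]
    by blast+
  have e: "F_twist_map p R T' (map_add T T' a a') u1 = F_twist_map p R T' a u1 \<oplus>\<^bsub>F_twist p R T'\<^esub> F_twist_map p R T' a' u1"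
    "Fdiv_map p R T' (map_add L IT' b b') u2 = Fdiv_map p R T' b u2 \<oplus>\<^bsub>F_twist p R T'\<^esub> Fdiv_map p R T' b' u2"
    "F_twist_map p R L' (map_add T L' c c') u1 = F_twist_map p R L' c u1 \<oplus>\<^bsub>F_twist p R L'\<^esub> F_twist_map p R L' c' u1"
    "F_twist_map p R L' (map_add L L' d d') u2 = F_twist_map p R L' d u2 \<oplus>\<^bsub>F_twist p R L'\<^esub> F_twist_map p R L' d' u2"
    by (rule witt_module.F_twist_map_add[OF wT mT' lf(1) lg(1) lh(1) map_add_apply u'(2)]
        witt_module.Fdiv_map_add[OF wT' mL lf(2) lg(2) lh(2) map_add_apply u'(3)]
        witt_module.F_twist_map_add[OF wT mL' lf(3) lg(3) lh(3) map_add_apply u'(2)]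
        witt_module.F_twist_map_add[OF wL mL' lf(4) lg(4) lh(4) map_add_apply u'(3)]; assumption)+
  show ?thesis
    unfolding f' g' u'(1)
    by (simp add: e cl disp_F_def direct_sum_simps FT'.M.a_ac FL'.M.a_ac FL'.nat_multiple_add)
qed

lemma induced_map_add:
  assumes f: "f \<in> pair_homs p R P P'" and g: "g \<in> pair_homs p R P P'" and m: "m \<in> carrier (disp_sum P)"
  shows "induced_map P' (pair_add f g) m = induced_map P' f m \<oplus>\<^bsub>disp_sum P'\<^esub> induced_map P' g m"
proof -
  obtain a b c d where f': "f = (a, b, c, d)" by (cases f)
  obtain a' b' c' d' where g': "g = (a', b', c', d')" by (cases g)
  obtain x y where m': "m = (x, y)" "x \<in> carrier T" "y \<in> carrier L"
    using m by (auto simp: disp_sum_def direct_sum_simps)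
  note lf = pair_homsD[OF f[unfolded f'], THEN lin_maps_linear_map, THEN linear_map_add_hom]
  note lg = pair_homsD[OF g[unfolded g'], THEN lin_maps_linear_map, THEN linear_map_add_hom]
  interpret T': module W T' by (rule mT')
  interpret L': module W L' by (rule mL')
  note I = witt_module.I_incl_add_hom[OF wT']
  have cl: "a x \<in> carrier T'" "a' x \<in> carrier T'" "I_incl T' (b y) \<in> carrier T'" "I_incl T' (b' y) \<in> carrier T'"
    "c x \<in> carrier L'" "c' x \<in> carrier L'" "d y \<in> carrier L'" "d' y \<in> carrier L'"
    using m' lf lg I add_hom_closed add_hom_comp by metis+
  have "I_incl T' (b y \<oplus>\<^bsub>IT'\<^esub> b' y) = I_incl T' (b y) \<oplus>\<^bsub>T'\<^esub> I_incl T' (b' y)"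
    by (rule add_hom_add[OF I add_hom_closed[OF lf(2) m'(3)] add_hom_closed[OF lg(2) m'(3)]])
  then show ?thesis
    unfolding f' g' m'(1) using m'(2,3) cl
    by (simp add: map_add_apply disp_sum_def direct_sum_simps T'.M.a_ac L'.M.a_ac)
qed

definition pair_zero where "pair_zero = (map_zero T T', map_zero L IT', map_zero T L', map_zero L L')"

fun pair_neg where
  "pair_neg (a, b, c, d) = (map_neg T T' a, map_neg L IT' b, map_neg T L' c, map_neg L L' d)"

lemma pair_zero_in_pair_homs: "pair_zero \<in> pair_homs p R P P'"
  by (simp add: pair_homs_def pair_zero_def map_zero_lin[OF mT mT'] map_zero_lin[OF mL mIT'] map_zero_lin[OF mT mL'] map_zero_lin[OF mL mL'])

lemma pair_neg_in_pair_homs: "f \<in> pair_homs p R P P' \<Longrightarrow> pair_neg f \<in> pair_homs p R P P'"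
  by (cases f)
    (simp add: pair_homs_def map_neg_lin[OF mT mT'] map_neg_lin[OF mL mIT'] map_neg_lin[OF mT mL'] map_neg_lin[OF mL mL'])

lemma pair_add_zero: "f \<in> pair_homs p R P P' \<Longrightarrow> pair_add pair_zero f = f"
  by (cases f)
    (simp add: pair_homs_def pair_zero_def map_zero_add[OF mT mT'] map_zero_add[OF mL mIT'] map_zero_add[OF mT mL'] map_zero_add[OF mL mL'])

lemma pair_add_neg: "f \<in> pair_homs p R P P' \<Longrightarrow> pair_add (pair_neg f) f = pair_zero"
  by (cases f)
    (simp add: pair_homs_def pair_zero_def map_neg_add[OF mT mT'] map_neg_add[OF mL mIT'] map_neg_add[OF mT mL'] map_neg_add[OF mL mL'])

lemma pair_add_comm: "f \<in> pair_homs p R P P' \<Longrightarrow> g \<in> pair_homs p R P P' \<Longrightarrow> pair_add f g = pair_add g f"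
  by (cases f; cases g)
    (simp add: pair_homs_def map_add_comm[OF mT mT'] map_add_comm[OF mL mIT'] map_add_comm[OF mT mL'] map_add_comm[OF mL mL'])

lemma pair_add_assoc:
  "f \<in> pair_homs p R P P' \<Longrightarrow> g \<in> pair_homs p R P P' \<Longrightarrow> h \<in> pair_homs p R P P' \<Longrightarrow>
    pair_add (pair_add f g) h = pair_add f (pair_add g h)"
  by (cases f; cases g; cases h)
    (simp add: pair_homs_def map_add_assoc[OF mT mT'] map_add_assoc[OF mL mIT'] map_add_assoc[OF mT mL'] map_add_assoc[OF mL mL'])

lemma Hom_display_simps:
  "carrier (Hom_display p R P P') = display_homs p R P P'"
  "\<one>\<^bsub>Hom_display p R P P'\<^esub> = pair_zero"
  "f \<otimes>\<^bsub>Hom_display p R P P'\<^esub> g = pair_add f g"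
  by (cases f; cases g; simp add: Hom_display_def pair_zero_def Let_def)+

lemma display_homs_pair_homs: "f \<in> display_homs p R P P' \<Longrightarrow> f \<in> pair_homs p R P P'"
  and display_homsD: "f \<in> display_homs p R P P' \<Longrightarrow> u \<in> carrier (disp_F p R P) \<Longrightarrow>
    induced_map P' f (\<Psi> u) = \<Psi>' (F_map p R P' f u)"
  by (auto simp: display_homs_def)

lemma Psi_closed: "u \<in> carrier (disp_F p R P) \<Longrightarrow> \<Psi> u \<in> carrier (disp_sum P)"
  by (rule add_hom_closed[OF linear_map_add_hom[OF Psi_linear(1)]])

lemma pair_add_defect:
  assumes "f \<in> pair_homs p R P P'" "g \<in> pair_homs p R P P'" "u \<in> carrier (disp_F p R P)"
  shows "induced_map P' (pair_add f g) (\<Psi> u) = induced_map P' f (\<Psi> u) \<oplus>\<^bsub>disp_sum P'\<^esub> induced_map P' g (\<Psi> u)"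
    "\<Psi>' (F_map p R P' (pair_add f g) u) = \<Psi>' (F_map p R P' f u) \<oplus>\<^bsub>disp_sum P'\<^esub> \<Psi>' (F_map p R P' g u)"
  using induced_map_add[OF assms(1,2) Psi_closed[OF assms(3)]] F_map_add[OF assms]
    add_hom_add[OF linear_map_add_hom[OF Psi_linear(2)]] F_map_closed assms
  by (simp_all) (metis prod_cases4)

lemma pair_image_closed:
  assumes "f \<in> pair_homs p R P P'" "u \<in> carrier (disp_F p R P)"
  shows "induced_map P' f (\<Psi> u) \<in> carrier (disp_sum P')" "\<Psi>' (F_map p R P' f u) \<in> carrier (disp_sum P')"
proof -
  obtain a b c d where f: "f = (a, b, c, d)" by (cases f)
  show "induced_map P' f (\<Psi> u) \<in> carrier (disp_sum P')"
    using induced_map_closed[OF _ Psi_closed[OF assms(2)]] assms(1) unfolding f by blast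
  show "\<Psi>' (F_map p R P' f u) \<in> carrier (disp_sum P')"
    using F_map_closed[OF _ assms(2)] assms(1) add_hom_closed[OF linear_map_add_hom[OF Psi_linear(2)]] unfolding f by blast
qed

text \<open>Both sides of the compatibility with \<open>\<Psi>\<close> and \<open>\<Psi>'\<close> are additive in the pair of maps, so the
  homomorphisms of displays form a subgroup.\<close>

lemma pair_add_in_display_homs:
  assumes "f \<in> display_homs p R P P'" "g \<in> display_homs p R P P'"
  shows "pair_add f g \<in> display_homs p R P P'"
  using assms pair_add_defect[OF display_homs_pair_homs display_homs_pair_homs]
  by (auto simp: display_homs_def pair_add_in_pair_homs)

lemma pair_zero_in_display_homs: "pair_zero \<in> display_homs p R P P'"
proof -
  interpret S: module W "disp_sum P'" by (rule module_disp_sum(2))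
  note z = pair_zero_in_pair_homs
  have "induced_map P' pair_zero (\<Psi> u) = \<Psi>' (F_map p R P' pair_zero u)" if u: "u \<in> carrier (disp_F p R P)" for u
    \<comment> \<open>apply additivity to \<open>0 + 0 = 0\<close> and cancel\<close>
    using pair_add_defect[OF z z u] pair_image_closed[OF z u] pair_add_zero[OF z] by (metis S.M.add.l_cancel_one')
  then show ?thesis using z by (auto simp: display_homs_def)
qed

lemma pair_neg_in_display_homs:
  assumes f: "f \<in> display_homs p R P P'"
  shows "pair_neg f \<in> display_homs p R P P'"
proof -
  interpret S: module W "disp_sum P'" by (rule module_disp_sum(2))
  note fp = display_homs_pair_homs[OF f] and n = pair_neg_in_pair_homs[OF display_homs_pair_homs[OF f]]
  have "induced_map P' (pair_neg f) (\<Psi> u) = \<Psi>' (F_map p R P' (pair_neg f) u)" if u: "u \<in> carrier (disp_F p R P)" for u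
    using pair_add_defect[OF n fp u] pair_image_closed[OF n u] pair_image_closed[OF fp u] display_homsD[OF f u]
      display_homsD[OF pair_zero_in_display_homs u] pair_add_neg[OF fp]
    by (metis S.M.add.right_cancel)
  then show ?thesis using n by (auto simp: display_homs_def)
qed

lemma comm_group_Hom_display: "comm_group (Hom_display p R P P')"
proof (rule comm_groupI)
  fix f assume "f \<in> carrier (Hom_display p R P P')"
  then show "\<exists>g\<in>carrier (Hom_display p R P P'). g \<otimes>\<^bsub>Hom_display p R P P'\<^esub> f = \<one>\<^bsub>Hom_display p R P P'\<^esub>"
    unfolding Hom_display_simps
    by (intro bexI[of _ "pair_neg f"] pair_add_neg pair_neg_in_display_homs display_homs_pair_homs)
qed (auto simp: Hom_display_simps pair_add_in_display_homs pair_zero_in_display_homs display_homs_pair_homs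
    intro: pair_add_assoc pair_add_comm pair_add_zero)

lemma pow_Hom_display:
  fixes k :: nat
  assumes "(a, b, c, d) \<in> pair_homs p R P P'"
  shows "(a, b, c, d) [^]\<^bsub>Hom_display p R P P'\<^esub> k =
    ((\<lambda>x\<in>carrier T. [k] \<cdot>\<^bsub>T'\<^esub> a x), (\<lambda>x\<in>carrier L. [k] \<cdot>\<^bsub>IT'\<^esub> b x),
     (\<lambda>x\<in>carrier T. [k] \<cdot>\<^bsub>L'\<^esub> c x), (\<lambda>x\<in>carrier L. [k] \<cdot>\<^bsub>L'\<^esub> d x))"
proof -
  interpret T': module W T' by (rule mT')
  interpret L': module W L' by (rule mL')
  interpret IT': module W IT' by (rule mIT')
  interpret H: comm_group "Hom_display p R P P'" by (rule comm_group_Hom_display)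
  show ?thesis
  proof (induction k)
    case 0
    then show ?case by (simp add: Hom_display_simps pair_zero_def map_zero_def restrict_def)
  next
    case (Suc k)
    show ?case
      unfolding H.nat_pow_Suc Suc Hom_display_simps
      by (simp add: map_add_def T'.M.add.nat_pow_Suc L'.M.add.nat_pow_Suc IT'.M.add.nat_pow_Suc restrict_def cong: if_cong)
  qed
qed

end

section \<open>Homomorphisms out of a nilpotent display\<close>

lemma linear_map_inverse:
  assumes "module A M" "linear_map A M N g" "bij_betw g (carrier M) (carrier N)"
  shows "linear_map A N M (the_inv_into (carrier M) g)"
proof -
  interpret M: module A M by fact
  let ?h = "the_inv_into (carrier M) g"
  have inj: "inj_on g (carrier M)" and im: "g ` carrier M = carrier N"
    using assms(3) by (auto simp: bij_betw_def)
  have hM: "?h y \<in> carrier M" and gh: "g (?h y) = y" if "y \<in> carrier N" for y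
    using the_inv_into_into[OF inj, of y] f_the_inv_into_f[OF inj, of y] that im by auto
  have hg: "?h (g x) = x" if "x \<in> carrier M" for x by (rule the_inv_into_f_f[OF inj that])
  show ?thesis
    unfolding linear_map_def
  proof (intro conjI ballI add_homI)
    fix x y assume x: "x \<in> carrier N" and y: "y \<in> carrier N"
    have "x \<oplus>\<^bsub>N\<^esub> y = g (?h x \<oplus>\<^bsub>M\<^esub> ?h y)"
      using add_hom_add[OF linear_map_add_hom[OF assms(2)] hM[OF x] hM[OF y]] by (simp add: gh x y)
    then show "?h (x \<oplus>\<^bsub>N\<^esub> y) = ?h x \<oplus>\<^bsub>M\<^esub> ?h y" using hg[of "?h x \<oplus>\<^bsub>M\<^esub> ?h y"] hM x y by simp
  next
    fix a x assume a: "a \<in> carrier A" and x: "x \<in> carrier N"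
    have "a \<odot>\<^bsub>N\<^esub> x = g (a \<odot>\<^bsub>M\<^esub> ?h x)"
      using linear_map_smult[OF assms(2) a hM[OF x]] by (simp add: gh x)
    then show "?h (a \<odot>\<^bsub>N\<^esub> x) = a \<odot>\<^bsub>M\<^esub> ?h x" using hg[of "a \<odot>\<^bsub>M\<^esub> ?h x"] hM a x by simp
  qed (rule hM)
qed

lemma dual_basis_eq_zeroI:
  assumes "module A M" "dual_basis A M n l f" "x \<in> carrier M" "\<And>j. j < n \<Longrightarrow> f j x = \<zero>\<^bsub>A\<^esub>"
  shows "x = \<zero>\<^bsub>M\<^esub>"
proof -
  interpret M: module A M by fact
  have "(\<Oplus>\<^bsub>M\<^esub>j\<in>{..<n}. f j x \<odot>\<^bsub>M\<^esub> l j) = (\<Oplus>\<^bsub>M\<^esub>j\<in>{..<n}. \<zero>\<^bsub>M\<^esub>)"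
    by (rule M.M.finsum_cong') (use assms(4) dual_basisD(1)[OF assms(2)] in auto)
  then show ?thesis using dual_basisD(3)[OF assms(2,3)] by (simp add: M.M.finsum_zero)
qed

text \<open>An element with coordinates in \<open>K\<close> lies in \<open>K M\<close>.\<close>

lemma functional_in_ideal:
  assumes "module A M" "functional A M g" "dual_basis A M n l f" "x \<in> carrier M"
    and "ideal K A" "\<And>j. j < n \<Longrightarrow> f j x \<in> K"
  shows "g x \<in> K"
proof -
  interpret M: module A M by fact
  interpret K: ideal K A by fact
  have "g (l j) \<in> carrier A" if "j < n" for j
    by (rule add_hom_closed[OF functional_add_hom[OF assms(2)] dual_basisD(1)[OF assms(3) that]])
  then show ?thesis
    unfolding functional_expand[OF assms(1-4)]
    by (intro M.R.finsum_in_subgroup K.additive_subgroup_axioms) (auto intro: K.I_r_closed assms(6))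
qed

lemma (in base_change_module) extend_functional_in_ideal:
  assumes "functional B BM g" "ideal K B" "\<And>x. x \<in> carrier M \<Longrightarrow> g (unit x) \<in> K" "t \<in> carrier BM"
  shows "g t \<in> K"
  using assms(4)
proof (induction t rule: BM_induct)
  interpret K: ideal K B by fact
  case zero
  then show ?case
    using add_hom_zero[OF abelian_group_BM hom.S.abelian_group_axioms functional_add_hom[OF assms(1)]] by simp
next
  interpret K: ideal K B by fact
  case (pure b x)
  then show ?case
    by (simp add: functional_smult[OF assms(1)] unit_closed K.I_l_closed assms(3))
next
  interpret K: ideal K B by fact
  case (add t u)
  then show ?case by (simp add: add_hom_add[OF functional_add_hom[OF assms(1)]])
qed

lemma (in cring) ideal_add: "ideal K R \<Longrightarrow> x \<in> K \<Longrightarrow> y \<in> K \<Longrightarrow> x \<oplus> y \<in> K"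
  by (rule additive_subgroup.a_closed[OF ideal.axioms(1)])

lemma linear_map_comp:
  assumes f: "linear_map R M N f" and g: "linear_map R N Q g"
  shows "linear_map R M Q (\<lambda>x. g (f x))"
proof -
  have f': "add_hom M N f" and g': "add_hom N Q g" using f g by (auto simp: linear_map_def)
  have "f x \<in> carrier N" if "x \<in> carrier M" for x by (rule add_hom_closed[OF f' that])
  then show ?thesis using f g add_hom_comp[OF f' g'] by (simp add: linear_map_def)
qed

text \<open>Here \<open>f\<close> on \<open>T \<oplus> L\<close> equals \<open>\<Psi>' f\<^sup>F \<Psi>\<^sup>-\<^sup>1\<close>. The coordinates of \<open>a\<^sup>F\<close> and \<open>d\<^sup>F\<close> lie in the ideal generated
  by \<open>F(G)\<close>, those of the divided Frobenius of \<open>b\<close> in the ideal generated by the entries of \<open>\<beta>\<close>, and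
  \<open>p c\<^sup>F = 0\<close>. This gives both hypotheses of \<open>witt_matrix_rigidity\<close>: for the equation one evaluates
  \<open>f\<close> at \<open>(0, l\<^sub>j)\<close>, whose image under \<open>\<Psi>\<^sup>-\<^sup>1\<close> has second component \<open>z(l\<^sub>j)\<close>.\<close>

theorem (in display_pair) p_torsion_display_hom_zero:
  assumes nil: "nilpotent_display p R P" and pn: "p_nilpotent p R"
    and hom: "(a, b, c, d) \<in> display_homs p R P P'"
    and pa: "\<And>x. x \<in> carrier T \<Longrightarrow> [p] \<cdot>\<^bsub>T'\<^esub> a x = \<zero>\<^bsub>T'\<^esub>"
    and pb: "\<And>y. y \<in> carrier L \<Longrightarrow> [p] \<cdot>\<^bsub>IT'\<^esub> b y = \<zero>\<^bsub>IT'\<^esub>"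
    and pc: "\<And>x. x \<in> carrier T \<Longrightarrow> [p] \<cdot>\<^bsub>L'\<^esub> c x = \<zero>\<^bsub>L'\<^esub>"
    and pd: "\<And>y. y \<in> carrier L \<Longrightarrow> [p] \<cdot>\<^bsub>L'\<^esub> d y = \<zero>\<^bsub>L'\<^esub>"
  shows "\<forall>x\<in>carrier T. a x = \<zero>\<^bsub>T'\<^esub> \<and> c x = \<zero>\<^bsub>L'\<^esub>" "\<forall>y\<in>carrier L. b y = \<zero>\<^bsub>IT'\<^esub> \<and> d y = \<zero>\<^bsub>L'\<^esub>"
proof -
  interpret MoT: module W T by (rule mT)
  interpret MoL: module W L by (rule mL)
  interpret MoT': module W T' by (rule mT')
  interpret MoL': module W L' by (rule mL')
  interpret MI: module W IT' by (rule mIT')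
  note ph = display_homs_pair_homs[OF hom]
  note lin = pair_homsD[OF ph, THEN lin_maps_linear_map]
  note ah = lin[THEN linear_map_add_hom]
  have fpP: "finite_projective W L" "finite_projective W T'" "finite_projective W L'"
    using P P' by (simp_all add: is_display_def)
  obtain nL l lam where dbL: "dual_basis W L nL l lam" by (rule finite_projective_dual_basis[OF fpP(1)])
  obtain nT t \<tau> where dbT: "dual_basis W T' nT t \<tau>" by (rule finite_projective_dual_basis[OF fpP(2)])
  obtain nL' l' lam' where dbL': "dual_basis W L' nL' l' lam'" by (rule finite_projective_dual_basis[OF fpP(3)])
  note mF = module_disp_F(1) and mF' = module_disp_F(2) and mS = module_disp_sum(1) and mS' = module_disp_sum(2)

  define \<Phi> where "\<Phi> = the_inv_into (carrier (disp_F p R P)) \<Psi>"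
  have \<Phi>_lin: "linear_map W (disp_sum P) (disp_F p R P) \<Phi>"
    unfolding \<Phi>_def by (rule linear_map_inverse[OF mF Psi_linear(1) Psi_bij])
  have \<Phi>_closed: "\<Phi> m \<in> carrier (disp_F p R P)" if "m \<in> carrier (disp_sum P)" for m
    by (rule add_hom_closed[OF linear_map_add_hom[OF \<Phi>_lin] that])
  have \<Psi>\<Phi>: "\<Psi> (\<Phi> m) = m" if "m \<in> carrier (disp_sum P)" for m
    unfolding \<Phi>_def using f_the_inv_into_f_bij_betw[OF Psi_bij] that by blast
  have z_lin: "linear_map W L (F_twist p R L) (z_map p R P)"
  proof -
    have "linear_map W L (disp_sum P) (\<lambda>y. (\<zero>\<^bsub>T\<^esub>, y))"
      by (auto simp: linear_map_def disp_sum_def direct_sum_simps intro!: add_homI)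
    moreover have "linear_map W (disp_F p R P) (F_twist p R L) snd"
      by (auto simp: linear_map_def disp_F_def direct_sum_simps intro!: add_homI)
    ultimately have "linear_map W L (F_twist p R L) (\<lambda>y. snd (\<Phi> (\<zero>\<^bsub>T\<^esub>, y)))"
      using linear_map_comp[OF linear_map_comp[OF _ \<Phi>_lin]] by blast
    then show ?thesis by (simp add: z_map_def[abs_def] \<Phi>_def)
  qed
  interpret D: witt_display_L R p P nL l lam
    using wL dbL z_lin by (simp add: witt_display_L_def witt_display_L_axioms_def)
  interpret T': witt_module R p T' by (rule wT')
  interpret L': witt_module R p L' by (rule wL')
  interpret TT: witt_module R p T by (rule wT)
  let ?\<tau> = "\<lambda>k. T'.MF.extend_functional (\<tau> k)" and ?lam' = "\<lambda>k. L'.MF.extend_functional (lam' k)"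
  note dbFT = T'.MF.dual_basis_BM[OF dbT, folded F_twist_def] and dbFL' = L'.MF.dual_basis_BM[OF dbL', folded F_twist_def]
    and dbFL = D.MF.dual_basis_BM[OF dbL, folded F_twist_def]
  note \<tau>_fun = dual_basisD(2)[OF dbT] and lam'_fun = dual_basisD(2)[OF dbL']
  note \<tau>F_fun = dual_basisD(2)[OF dbFT] and lam'F_fun = dual_basisD(2)[OF dbFL']

  let ?aF = "F_twist_map p R T' a" and ?bF = "Fdiv_map p R T' b" and ?dF = "F_twist_map p R L' d" and ?cF = "F_twist_map p R L' c"
  note aF = TT.F_twist_map_linear[OF mT' lin(1)] and cF = TT.F_twist_map_linear[OF mL' lin(3)]
    and dF = D.F_twist_map_linear[OF mL' lin(4)] and bF = T'.Fdiv_map_linear'[OF mL lin(2)]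
  have closedF: "?aF u1 \<in> carrier (F_twist p R T')" "?cF u1 \<in> carrier (F_twist p R L')"
      "?bF u2 \<in> carrier (F_twist p R T')" "?dF u2 \<in> carrier (F_twist p R L')"
    if "u1 \<in> carrier (F_twist p R T)" "u2 \<in> carrier (F_twist p R L)" for u1 u2
    using add_hom_closed[OF linear_map_add_hom[OF aF] that(1)] add_hom_closed[OF linear_map_add_hom[OF cF] that(1)]
      add_hom_closed[OF linear_map_add_hom[OF bF] that(2)] add_hom_closed[OF linear_map_add_hom[OF dF] that(2)] by blast+

  \<comment> \<open>the element \<open>Fdiv_tensor (b (l j))\<close> is the divided Frobenius of \<open>b\<close> at \<open>1 \<otimes> l j\<close>\<close>
  define \<beta> where "\<beta> k j = ?\<tau> k (T'.Fdiv_tensor (b (l j)))" for k j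
  have bI: "b y \<in> carrier IT'" if "y \<in> carrier L" for y by (rule add_hom_closed[OF ah(2) that])
  have \<phi>b: "T'.Fdiv_tensor (b y) \<in> carrier (F_twist p R T')" if "y \<in> carrier L" for y
    using add_hom_closed[OF T'.Fdiv_tensor_add_hom bI[OF that]] by (simp add: F_twist_def)
  have \<beta>W: "\<beta> k j \<in> carrier W" if "k < nT" "j < nL" for k j
    unfolding \<beta>_def by (rule add_hom_closed[OF functional_add_hom[OF \<tau>F_fun[OF that(1)]] \<phi>b[OF D.l_closed[OF that(2)]]])
  have V\<beta>: "V (\<beta> k j) = \<tau> k (I_incl T' (b (l j)))" if "k < nT" "j < nL" for k j
    unfolding \<beta>_def by (rule T'.V_extend_functional_Fdiv_tensor[OF \<tau>_fun[OF that(1)] bI[OF D.l_closed[OF that(2)]]])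
  have bF_unit: "?bF (base_change_unit W W F L y) = T'.Fdiv_tensor (b y)" if y: "y \<in> carrier L" for y
  proof -
    interpret FL: module W "D.MF.BM" by (rule D.MF.module_BM)
    interpret FT: module W "T'.MF.BM" by (rule T'.MF.module_BM)
    show ?thesis
      using T'.Fdiv_map_unit[OF mL lin(2) W.one_closed y] D.MF.unit_closed[OF y] \<phi>b[OF y] by (simp add: F_twist_def)
  qed
  have \<tau>bF: "?\<tau> k (?bF u2) = (\<Oplus>\<^bsub>W\<^esub>i\<in>{..<nL}. D.MF.extend_functional (lam i) u2 \<otimes>\<^bsub>W\<^esub> \<beta> k i)"
    if "k < nT" "u2 \<in> carrier (F_twist p R L)" for k u2
  proof -
    have "?\<tau> k (?bF u2) = (\<Oplus>\<^bsub>W\<^esub>i\<in>{..<nL}. D.MF.extend_functional (lam i) u2 \<otimes>\<^bsub>W\<^esub> ?\<tau> k (?bF (D.MF.unit (l i))))"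
      by (rule functional_expand[OF mFL functional_comp_linear_map[OF bF \<tau>F_fun[OF that(1)]] dbFL that(2)])
    also have "\<dots> = (\<Oplus>\<^bsub>W\<^esub>i\<in>{..<nL}. D.MF.extend_functional (lam i) u2 \<otimes>\<^bsub>W\<^esub> \<beta> k i)"
      by (rule W.finsum_cong')
        (use that dual_basis_closed[OF dbFL _ that(2)] \<beta>W in \<open>auto simp: bF_unit D.l_closed \<beta>_def\<close>)
    finally show ?thesis .
  qed

  \<comment> \<open>the coordinates of \<open>c\<close> are not included: \<open>c\<close> enters \<open>f\<^sup>F\<close> only through \<open>p c\<^sup>F = 0\<close>\<close>
  define G where "G = {\<tau> k (a x) | k x. k < nT \<and> x \<in> carrier T} \<union> {lam' k (d y) | k y. k < nL' \<and> y \<in> carrier L}"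
  have aF_unit: "?aF (base_change_unit W W F T x) = base_change_unit W W F T' (a x)" if x: "x \<in> carrier T" for x
  proof -
    interpret FT0: module W "TT.MF.BM" by (rule TT.MF.module_BM)
    interpret FT: module W "T'.MF.BM" by (rule T'.MF.module_BM)
    show ?thesis
      using TT.MF.base_change_map_unit[OF mT' lin(1) W.one_closed x] TT.MF.unit_closed[OF x]
        T'.MF.unit_closed[OF add_hom_closed[OF ah(1) x]] by (simp add: F_twist_map_def)
  qed
  have dF_unit: "?dF (base_change_unit W W F L y) = base_change_unit W W F L' (d y)" if y: "y \<in> carrier L" for y
  proof -
    interpret FL0: module W "D.MF.BM" by (rule D.MF.module_BM)
    interpret FL: module W "L'.MF.BM" by (rule L'.MF.module_BM)
    show ?thesis
      using D.MF.base_change_map_unit[OF mL' lin(4) W.one_closed y] D.MF.unit_closed[OF y]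
        L'.MF.unit_closed[OF add_hom_closed[OF ah(4) y]] by (simp add: F_twist_map_def)
  qed
  have ext_unit: "base_change_module.extend_functional W F g (base_change_unit W W F N x) = F (g x)"
    if "module W N" "functional W N g" "x \<in> carrier N" for N :: "(nat \<Rightarrow> 'a, 'z) module" and g x
  proof -
    interpret N: base_change_module W W F N by (rule base_change_module.intro[OF ring_hom_F that(1)])
    interpret B: module W N.BM by (rule N.module_BM)
    have "g x \<in> carrier W" by (rule add_hom_closed[OF functional_add_hom[OF that(2)] that(3)])
    then show ?thesis
      using N.extend_functional_unit[OF that(2) W.one_closed that(3)] N.unit_closed[OF that(3)] by simp
  qed
  have aF_K: "?\<tau> k (?aF u1) \<in> K" if K: "ideal K W" "\<And>g. g \<in> G \<Longrightarrow> F g \<in> K" and k: "k < nT" and u1: "u1 \<in> carrier (F_twist p R T)" for K k u1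
  proof (rule TT.MF.extend_functional_in_ideal[where g = "\<lambda>u. ?\<tau> k (?aF u)", OF _ K(1) _ u1[unfolded F_twist_def]])
    show "functional W TT.MF.BM (\<lambda>u. ?\<tau> k (?aF u))"
      using functional_comp_linear_map[OF aF \<tau>F_fun[OF k]] by (simp add: F_twist_def)
    fix x assume x: "x \<in> carrier T"
    have "\<tau> k (a x) \<in> G" using k x by (auto simp: G_def)
    then show "?\<tau> k (?aF (TT.MF.unit x)) \<in> K"
      unfolding aF_unit[OF x] ext_unit[OF mT' \<tau>_fun[OF k] add_hom_closed[OF ah(1) x]] by (rule K(2))
  qed
  have dF_K: "?lam' k (?dF u2) \<in> K" if K: "ideal K W" "\<And>g. g \<in> G \<Longrightarrow> F g \<in> K" and k: "k < nL'" and u2: "u2 \<in> carrier (F_twist p R L)" for K k u2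
  proof (rule D.MF.extend_functional_in_ideal[where g = "\<lambda>u. ?lam' k (?dF u)", OF _ K(1) _ u2[unfolded F_twist_def]])
    show "functional W D.MF.BM (\<lambda>u. ?lam' k (?dF u))"
      using functional_comp_linear_map[OF dF lam'F_fun[OF k]] by (simp add: F_twist_def)
    fix y assume y: "y \<in> carrier L"
    have "lam' k (d y) \<in> G" using k y by (auto simp: G_def)
    then show "?lam' k (?dF (D.MF.unit y)) \<in> K"
      unfolding dF_unit[OF y] ext_unit[OF mL' lam'_fun[OF k] add_hom_closed[OF ah(4) y]] by (rule K(2))
  qed

  interpret FT': module W "F_twist p R T'" by (rule mFT')
  interpret FL': module W "F_twist p R L'" by (rule mFL')
  interpret S': module W "disp_sum P'" by (rule mS')
  have pcF: "[p] \<cdot>\<^bsub>F_twist p R L'\<^esub> ?cF u1 = \<zero>\<^bsub>F_twist p R L'\<^esub>" if u1: "u1 \<in> carrier (F_twist p R T)" for u1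
  proof -
    have mult: "add_hom (F_twist p R L') (F_twist p R L') (\<lambda>v. [p] \<cdot>\<^bsub>F_twist p R L'\<^esub> v)"
      by (rule add_homI) (simp_all add: FL'.M.nat_multiple_add)
    show ?thesis
    proof (rule TT.MF.BM_eqI[OF FL'.M.abelian_group_axioms _ _ u1[unfolded F_twist_def]])
      show "add_hom TT.MF.BM (F_twist p R L') (\<lambda>u. [p] \<cdot>\<^bsub>F_twist p R L'\<^esub> ?cF u)"
        using add_hom_comp[OF linear_map_add_hom[OF cF] mult] by (simp add: F_twist_def)
      show "add_hom TT.MF.BM (F_twist p R L') (\<lambda>u. \<zero>\<^bsub>F_twist p R L'\<^esub>)" by (rule add_homI) simp_all
      fix w x assume w: "w \<in> carrier W" and x: "x \<in> carrier T"
      have sm: "add_hom L' (F_twist p R L') (\<lambda>y. w \<odot>\<^bsub>F_twist p R L'\<^esub> L'.MF.unit y)"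
        unfolding F_twist_def
        by (rule add_hom_comp[OF L'.MF.unit_add_hom], rule add_homI)
          (use w FL'.smult_r_distr FL'.smult_closed in \<open>simp_all add: F_twist_def\<close>)
      have "?cF (w \<odot>\<^bsub>TT.MF.BM\<^esub> TT.MF.unit x) = w \<odot>\<^bsub>F_twist p R L'\<^esub> L'.MF.unit (c x)"
        unfolding F_twist_map_def F_twist_def by (rule TT.MF.base_change_map_unit[OF mL' lin(3) w x])
      then have "[p] \<cdot>\<^bsub>F_twist p R L'\<^esub> ?cF (w \<odot>\<^bsub>TT.MF.BM\<^esub> TT.MF.unit x)
          = w \<odot>\<^bsub>F_twist p R L'\<^esub> L'.MF.unit ([p] \<cdot>\<^bsub>L'\<^esub> c x)"
        using add_hom_nat_multiple[OF MoL'.M.abelian_group_axioms FL'.M.abelian_group_axioms sm add_hom_closed[OF ah(3) x], of p] by simp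
      also have "\<dots> = \<zero>\<^bsub>F_twist p R L'\<^esub>"
        unfolding pc[OF x] by (rule add_hom_zero[OF MoL'.M.abelian_group_axioms FL'.M.abelian_group_axioms sm])
      finally show "[p] \<cdot>\<^bsub>F_twist p R L'\<^esub> ?cF (w \<odot>\<^bsub>TT.MF.BM\<^esub> TT.MF.unit x) = \<zero>\<^bsub>F_twist p R L'\<^esub>" .
    qed
  qed
  have Fmap: "F_map p R P' (a, b, c, d) (u1, u2) = (?aF u1 \<oplus>\<^bsub>F_twist p R T'\<^esub> ?bF u2, ?dF u2)"
    if "u1 \<in> carrier (F_twist p R T)" "u2 \<in> carrier (F_twist p R L)" for u1 u2
    using closedF[OF that] by (simp add: pcF[OF that(1)])

  have incl: "linear_map W (F_twist p R T') (disp_F p R P') (\<lambda>v. (v, \<zero>\<^bsub>F_twist p R L'\<^esub>))"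
      "linear_map W (F_twist p R L') (disp_F p R P') (\<lambda>v. (\<zero>\<^bsub>F_twist p R T'\<^esub>, v))"
    by (auto simp: linear_map_def disp_F_def direct_sum_simps intro!: add_homI)
  have split: "g (v1, v2) = g (v1, \<zero>\<^bsub>F_twist p R L'\<^esub>) \<oplus>\<^bsub>W\<^esub> g (\<zero>\<^bsub>F_twist p R T'\<^esub>, v2)"
    if g: "functional W (disp_F p R P') g" and v: "v1 \<in> carrier (F_twist p R T')" "v2 \<in> carrier (F_twist p R L')" for g v1 v2
  proof -
    have "(v1, v2) = (v1, \<zero>\<^bsub>F_twist p R L'\<^esub>) \<oplus>\<^bsub>disp_F p R P'\<^esub> (\<zero>\<^bsub>F_twist p R T'\<^esub>, v2)"
      using v by (simp add: disp_F_def direct_sum_simps)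
    moreover have "(v1, \<zero>\<^bsub>F_twist p R L'\<^esub>) \<in> carrier (disp_F p R P')" "(\<zero>\<^bsub>F_twist p R T'\<^esub>, v2) \<in> carrier (disp_F p R P')"
      using v by (simp_all add: disp_F_def direct_sum_simps)
    ultimately show ?thesis using add_hom_add[OF functional_add_hom[OF g]] by metis
  qed
  have g_K: "g (v1, v2) \<in> K"
    if g: "functional W (disp_F p R P') g" and v: "v1 \<in> carrier (F_twist p R T')" "v2 \<in> carrier (F_twist p R L')"
      and K: "ideal K W" and "\<And>k. k < nT \<Longrightarrow> ?\<tau> k v1 \<in> K" "\<And>k. k < nL' \<Longrightarrow> ?lam' k v2 \<in> K" for g v1 v2 K
    unfolding split[OF g v]
    using functional_in_ideal[OF mFT' functional_comp_linear_map[OF incl(1) g] dbFT v(1) K that(5)]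
      functional_in_ideal[OF mFL' functional_comp_linear_map[OF incl(2) g] dbFL' v(2) K that(6)]
    by (rule W.ideal_add[OF K])

  have fst_fun: "functional W (disp_F p R P') (\<lambda>v. \<tau> k (fst (\<Psi>' v)))" if "k < nT" for k
  proof -
    have "linear_map W (disp_sum P') T' fst"
      by (auto simp: linear_map_def disp_sum_def direct_sum_simps intro!: add_homI)
    from functional_comp_linear_map[OF Psi_linear(2) functional_comp_linear_map[OF this \<tau>_fun[OF that]]] show ?thesis .
  qed
  have snd_fun: "functional W (disp_F p R P') (\<lambda>v. lam' k (snd (\<Psi>' v)))" if "k < nL'" for k
  proof -
    have "linear_map W (disp_sum P') L' snd"
      by (auto simp: linear_map_def disp_sum_def direct_sum_simps intro!: add_homI)
    from functional_comp_linear_map[OF Psi_linear(2) functional_comp_linear_map[OF this lam'_fun[OF that]]] show ?thesis .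
  qed
  have zeros: "a \<zero>\<^bsub>T\<^esub> = \<zero>\<^bsub>T'\<^esub>" "b \<zero>\<^bsub>L\<^esub> = \<zero>\<^bsub>IT'\<^esub>" "c \<zero>\<^bsub>T\<^esub> = \<zero>\<^bsub>L'\<^esub>" "d \<zero>\<^bsub>L\<^esub> = \<zero>\<^bsub>L'\<^esub>" "I_incl T' \<zero>\<^bsub>IT'\<^esub> = \<zero>\<^bsub>T'\<^esub>"
    using add_hom_zero[OF MoT.M.abelian_group_axioms MoT'.M.abelian_group_axioms ah(1)]
      add_hom_zero[OF MoL.M.abelian_group_axioms MI.M.abelian_group_axioms ah(2)]
      add_hom_zero[OF MoT.M.abelian_group_axioms MoL'.M.abelian_group_axioms ah(3)]
      add_hom_zero[OF MoL.M.abelian_group_axioms MoL'.M.abelian_group_axioms ah(4)]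
      add_hom_zero[OF MI.M.abelian_group_axioms MoT'.M.abelian_group_axioms T'.I_incl_add_hom] by blast+
  have ind_T: "induced_map P' (a, b, c, d) (x, \<zero>\<^bsub>L\<^esub>) = (a x, c x)" if "x \<in> carrier T" for x
    using add_hom_closed[OF ah(1) that] add_hom_closed[OF ah(3) that] by (simp add: zeros)
  have ind_L: "induced_map P' (a, b, c, d) (\<zero>\<^bsub>T\<^esub>, y) = (I_incl T' (b y), d y)" if "y \<in> carrier L" for y
    using add_hom_closed[OF T'.I_incl_add_hom bI[OF that]] add_hom_closed[OF ah(4) that] by (simp add: zeros)
  have in_sum: "(x, \<zero>\<^bsub>L\<^esub>) \<in> carrier (disp_sum P)" "(\<zero>\<^bsub>T\<^esub>, y) \<in> carrier (disp_sum P)"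
    if "x \<in> carrier T" "y \<in> carrier L" for x y
    using that by (simp_all add: disp_sum_def direct_sum_simps)
  have ind: "\<exists>u1 u2. u1 \<in> carrier (F_twist p R T) \<and> u2 \<in> carrier (F_twist p R L) \<and> u2 = snd (\<Phi> m) \<and>
      induced_map P' (a, b, c, d) m = \<Psi>' (?aF u1 \<oplus>\<^bsub>F_twist p R T'\<^esub> ?bF u2, ?dF u2)" if m: "m \<in> carrier (disp_sum P)" for m
  proof -
    obtain u1 u2 where u: "\<Phi> m = (u1, u2)" "u1 \<in> carrier (F_twist p R T)" "u2 \<in> carrier (F_twist p R L)"
      using \<Phi>_closed[OF m] by (auto simp: disp_F_def direct_sum_simps)
    have "induced_map P' (a, b, c, d) m = \<Psi>' (F_map p R P' (a, b, c, d) (\<Phi> m))"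
      using display_homsD[OF hom \<Phi>_closed[OF m]] by (simp only: \<Psi>\<Phi>[OF m])
    then show ?thesis using u Fmap[OF u(2,3)] by (intro exI[of _ u1] exI[of _ u2]) simp
  qed
  have bF_K: "?\<tau> k (?bF u2) \<in> K" if k: "k < nT" and u2: "u2 \<in> carrier (F_twist p R L)"
    and K: "ideal K W" "\<And>h j. h < nT \<Longrightarrow> j < nL \<Longrightarrow> \<beta> h j \<in> K" for k u2 K
    unfolding \<tau>bF[OF k u2]
    by (rule W.finsum_in_subgroup[OF ideal.axioms(1)[OF K(1)]])
      (use k K(2) ideal.I_l_closed[OF K(1)] dual_basis_closed[OF dbFL _ u2] in auto)
  have g_ind_K: "g (?aF u1 \<oplus>\<^bsub>F_twist p R T'\<^esub> ?bF u2, ?dF u2) \<in> K"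
    if g: "functional W (disp_F p R P') g" and u: "u1 \<in> carrier (F_twist p R T)" "u2 \<in> carrier (F_twist p R L)"
      and K: "ideal K W" "\<And>g. g \<in> G \<Longrightarrow> F g \<in> K" "\<And>h j. h < nT \<Longrightarrow> j < nL \<Longrightarrow> \<beta> h j \<in> K" for g u1 u2 K
  proof (rule g_K[OF g _ closedF(4)[OF u] K(1)])
    show "?aF u1 \<oplus>\<^bsub>F_twist p R T'\<^esub> ?bF u2 \<in> carrier (F_twist p R T')" using closedF[OF u] by simp
    show "?\<tau> k (?aF u1 \<oplus>\<^bsub>F_twist p R T'\<^esub> ?bF u2) \<in> K" if k: "k < nT" for k
      unfolding add_hom_add[OF functional_add_hom[OF \<tau>F_fun[OF k]] closedF(1,3)[OF u]]
      by (rule W.ideal_add[OF K(1) aF_K[OF K(1,2) k u(1)] bF_K[OF k u(2) K(1,3)]])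
    show "?lam' k (?dF u2) \<in> K" if k: "k < nL'" for k by (rule dF_K[OF K(1,2) k u(2)])
  qed
  have fst_K: "\<tau> k (fst (induced_map P' (a, b, c, d) m)) \<in> K" if k: "k < nT"
    and K: "ideal K W" "\<And>g. g \<in> G \<Longrightarrow> F g \<in> K" "\<And>h j. h < nT \<Longrightarrow> j < nL \<Longrightarrow> \<beta> h j \<in> K" and m: "m \<in> carrier (disp_sum P)" for k K m
  proof -
    obtain u1 u2 where u: "u1 \<in> carrier (F_twist p R T)" "u2 \<in> carrier (F_twist p R L)"
      and im: "induced_map P' (a, b, c, d) m = \<Psi>' (?aF u1 \<oplus>\<^bsub>F_twist p R T'\<^esub> ?bF u2, ?dF u2)"
      using ind[OF m] by blast
    show ?thesis unfolding im by (rule g_ind_K[OF fst_fun[OF k] u K])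
  qed
  have snd_K: "lam' k (snd (induced_map P' (a, b, c, d) m)) \<in> K" if k: "k < nL'"
    and K: "ideal K W" "\<And>g. g \<in> G \<Longrightarrow> F g \<in> K" "\<And>h j. h < nT \<Longrightarrow> j < nL \<Longrightarrow> \<beta> h j \<in> K" and m: "m \<in> carrier (disp_sum P)" for k K m
  proof -
    obtain u1 u2 where u: "u1 \<in> carrier (F_twist p R T)" "u2 \<in> carrier (F_twist p R L)"
      and im: "induced_map P' (a, b, c, d) m = \<Psi>' (?aF u1 \<oplus>\<^bsub>F_twist p R T'\<^esub> ?bF u2, ?dF u2)"
      using ind[OF m] by blast
    show ?thesis unfolding im by (rule g_ind_K[OF snd_fun[OF k] u K])
  qed

  obtain s where s: "\<And>i j. i < nL \<Longrightarrow> j < nL \<Longrightarrow>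
      frob_col p R {..<nL} (\<lambda>i l. D.z_matrix i l 0) 0 j (Suc s) i \<in> p_ideal p R"
    by (rule D.nilpotent_frob_col[OF nil]) blast
  define X where "X k h = \<tau> k (fst (\<Psi>' (T'.MF.unit (t h), \<zero>\<^bsub>F_twist p R L'\<^esub>)))" for k h
  have unit_t: "T'.MF.unit (t h) \<in> carrier (F_twist p R T')" if "h < nT" for h
    by (rule dual_basisD(1)[OF dbFT that])
  have XW: "X k h \<in> carrier W" if "k < nT" "h < nT" for k h
    unfolding X_def using add_hom_closed[OF functional_add_hom[OF functional_comp_linear_map[OF incl(1) fst_fun[OF that(1)]]] unit_t[OF that(2)]] .
  \<comment> \<open>the block \<open>X\<close> is the composition of \<open>\<Psi>'\<close> with the inclusion of \<open>T'\<^sup>F\<close> and the projection to \<open>T'\<close>\<close>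
  have rigid: "(\<forall>h\<in>{..<nT}. \<forall>j\<in>{..<nL}. \<beta> h j = \<zero>\<^bsub>W\<^esub>) \<and> G \<subseteq> {\<zero>\<^bsub>W\<^esub>}"
  proof (rule witt_matrix_rigidity[where X = X and Z = D.z_matrix and s = s, OF pn])
    show "G \<subseteq> carrier W"
      using dual_basis_closed[OF dbT] dual_basis_closed[OF dbL'] add_hom_closed[OF ah(1)] add_hom_closed[OF ah(4)]
      by (auto simp: G_def)
    fix g assume "g \<in> G"
    then show "[p] \<cdot>\<^bsub>W\<^esub> g = \<zero>\<^bsub>W\<^esub>"
      using add_hom_nat_multiple[OF MoT'.M.abelian_group_axioms W.abelian_group_axioms functional_add_hom[OF \<tau>_fun] add_hom_closed[OF ah(1)], of _ _ p]
        add_hom_nat_multiple[OF MoL'.M.abelian_group_axioms W.abelian_group_axioms functional_add_hom[OF lam'_fun] add_hom_closed[OF ah(4)], of _ _ p]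
        add_hom_zero[OF MoT'.M.abelian_group_axioms W.abelian_group_axioms functional_add_hom[OF \<tau>_fun]]
        add_hom_zero[OF MoL'.M.abelian_group_axioms W.abelian_group_axioms functional_add_hom[OF lam'_fun]]
      unfolding G_def by (auto simp: pa pd)
  next
    fix h j assume "h \<in> {..<nT}" "j \<in> {..<nL}"
    then have hj: "h < nT" "j < nL" by simp_all
    have "add_hom IT' W (\<lambda>v. ?\<tau> h (T'.Fdiv_tensor v))"
      using add_hom_comp[OF T'.Fdiv_tensor_add_hom functional_add_hom[OF \<tau>F_fun[OF hj(1), unfolded F_twist_def]]] .
    from add_hom_nat_multiple[OF MI.M.abelian_group_axioms W.abelian_group_axioms this bI[OF D.l_closed[OF hj(2)]], of p]
      add_hom_zero[OF MI.M.abelian_group_axioms W.abelian_group_axioms this]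
    show "[p] \<cdot>\<^bsub>W\<^esub> \<beta> h j = \<zero>\<^bsub>W\<^esub>" unfolding \<beta>_def by (simp add: pb D.l_closed[OF hj(2)])
  next
    fix K k j
    assume K: "ideal K W" "\<And>g. g \<in> G \<Longrightarrow> F g \<in> K" and "k \<in> {..<nT}" "j \<in> {..<nL}"
    then have k: "k < nT" and j: "j < nL" by simp_all
    let ?m = "(\<zero>\<^bsub>T\<^esub>, l j)" and ?g = "\<lambda>v. \<tau> k (fst (\<Psi>' v))"
    obtain u1 u2 where u: "u1 \<in> carrier (F_twist p R T)" "u2 \<in> carrier (F_twist p R L)" "u2 = snd (\<Phi> ?m)"
      and im: "induced_map P' (a, b, c, d) ?m = \<Psi>' (?aF u1 \<oplus>\<^bsub>F_twist p R T'\<^esub> ?bF u2, ?dF u2)"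
      using ind[OF in_sum(2)[OF MoT.M.zero_closed D.l_closed[OF j]]] by blast
    have u2: "u2 = z_map p R P (l j)" unfolding u(3) z_map_def \<Phi>_def ..
    note cl = closedF[OF u(1,2)] and gf = fst_fun[OF k]
    have gz: "?g (v, \<zero>\<^bsub>F_twist p R L'\<^esub>) \<in> carrier W" if "v \<in> carrier (F_twist p R T')" for v
      by (rule add_hom_closed[OF functional_add_hom[OF functional_comp_linear_map[OF incl(1) gf]] that])
    have inF: "(?aF u1, ?dF u2) \<in> carrier (disp_F p R P')" "(?bF u2, \<zero>\<^bsub>F_twist p R L'\<^esub>) \<in> carrier (disp_F p R P')"
      using cl by (simp_all add: disp_F_def direct_sum_simps)
    have "V (\<beta> k j) = ?g (?aF u1 \<oplus>\<^bsub>F_twist p R T'\<^esub> ?bF u2, ?dF u2)"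
      unfolding V\<beta>[OF k j] im[symmetric] ind_L[OF D.l_closed[OF j]] by simp
    also have "(?aF u1 \<oplus>\<^bsub>F_twist p R T'\<^esub> ?bF u2, ?dF u2) = (?aF u1, ?dF u2) \<oplus>\<^bsub>disp_F p R P'\<^esub> (?bF u2, \<zero>\<^bsub>F_twist p R L'\<^esub>)"
      using cl by (simp add: disp_F_def direct_sum_simps)
    also have "?g \<dots> = ?g (?aF u1, ?dF u2) \<oplus>\<^bsub>W\<^esub> ?g (?bF u2, \<zero>\<^bsub>F_twist p R L'\<^esub>)"
      by (rule add_hom_add[OF functional_add_hom[OF gf] inF])
    also have "?g (?bF u2, \<zero>\<^bsub>F_twist p R L'\<^esub>) = (\<Oplus>\<^bsub>W\<^esub>h\<in>{..<nT}. ?\<tau> h (?bF u2) \<otimes>\<^bsub>W\<^esub> X k h)"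
      unfolding X_def by (rule functional_expand[OF mFT' functional_comp_linear_map[OF incl(1) gf] dbFT cl(3)])
    also have "\<dots> = (\<Oplus>\<^bsub>W\<^esub>h\<in>{..<nT}. X k h \<otimes>\<^bsub>W\<^esub> (\<Oplus>\<^bsub>W\<^esub>i\<in>{..<nL}. \<beta> h i \<otimes>\<^bsub>W\<^esub> D.z_matrix i j))"
    proof (rule W.finsum_cong')
      fix h assume "h \<in> {..<nT}"
      then have h: "h < nT" by simp
      have "?\<tau> h (?bF u2) = (\<Oplus>\<^bsub>W\<^esub>i\<in>{..<nL}. \<beta> h i \<otimes>\<^bsub>W\<^esub> D.z_matrix i j)"
        unfolding \<tau>bF[OF h u(2)]
      proof (rule W.finsum_cong')
        fix i assume "i \<in> {..<nL}"
        then have i: "i < nL" by simp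
        show "D.MF.extend_functional (lam i) u2 \<otimes>\<^bsub>W\<^esub> \<beta> h i = \<beta> h i \<otimes>\<^bsub>W\<^esub> D.z_matrix i j"
          unfolding u2 D.z_matrix_def[symmetric] by (rule W.m_comm[OF D.z_matrix_closed[OF i j] \<beta>W[OF h i]])
      qed (use \<beta>W[OF h] D.z_matrix_closed[OF _ j] in auto)
      moreover have "?\<tau> h (?bF u2) \<in> carrier W" by (rule add_hom_closed[OF functional_add_hom[OF \<tau>F_fun[OF h]] cl(3)])
      ultimately show "?\<tau> h (?bF u2) \<otimes>\<^bsub>W\<^esub> X k h = X k h \<otimes>\<^bsub>W\<^esub> (\<Oplus>\<^bsub>W\<^esub>i\<in>{..<nL}. \<beta> h i \<otimes>\<^bsub>W\<^esub> D.z_matrix i j)"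
        using W.m_comm[OF _ XW[OF k h]] by metis
    qed (use XW[OF k] \<beta>W D.z_matrix_closed[OF _ j] in \<open>auto intro!: W.m_closed W.finsum_closed\<close>)
    finally have eq: "V (\<beta> k j) = ?g (?aF u1, ?dF u2) \<oplus>\<^bsub>W\<^esub> (\<Oplus>\<^bsub>W\<^esub>h\<in>{..<nT}. X k h \<otimes>\<^bsub>W\<^esub> (\<Oplus>\<^bsub>W\<^esub>i\<in>{..<nL}. \<beta> h i \<otimes>\<^bsub>W\<^esub> D.z_matrix i j))" .
    have sumW: "(\<Oplus>\<^bsub>W\<^esub>h\<in>{..<nT}. X k h \<otimes>\<^bsub>W\<^esub> (\<Oplus>\<^bsub>W\<^esub>i\<in>{..<nL}. \<beta> h i \<otimes>\<^bsub>W\<^esub> D.z_matrix i j)) \<in> carrier W"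
      using XW[OF k] \<beta>W D.z_matrix_closed[OF _ j] by (intro W.finsum_closed Pi_I W.m_closed) auto
    have gW: "?g (?aF u1, ?dF u2) \<in> carrier W" by (rule add_hom_closed[OF functional_add_hom[OF gf] inF(1)])
    have "?g (?aF u1, ?dF u2) \<in> K"
      by (rule g_K[OF gf cl(1,4) K(1)]) (use aF_K[OF K _ u(1)] dF_K[OF K _ u(2)] in blast)+
    moreover have "V (\<beta> k j) \<ominus>\<^bsub>W\<^esub> (\<Oplus>\<^bsub>W\<^esub>h\<in>{..<nT}. X k h \<otimes>\<^bsub>W\<^esub> (\<Oplus>\<^bsub>W\<^esub>i\<in>{..<nL}. \<beta> h i \<otimes>\<^bsub>W\<^esub> D.z_matrix i j)) = ?g (?aF u1, ?dF u2)"
      unfolding eq using gW sumW by (simp add: a_minus_def W.a_assoc W.r_neg)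
    ultimately show "V (\<beta> k j) \<ominus>\<^bsub>W\<^esub> (\<Oplus>\<^bsub>W\<^esub>h\<in>{..<nT}. X k h \<otimes>\<^bsub>W\<^esub> (\<Oplus>\<^bsub>W\<^esub>i\<in>{..<nL}. \<beta> h i \<otimes>\<^bsub>W\<^esub> D.z_matrix i j)) \<in> K"
      by simp
  next
    fix K assume K: "ideal K W" "\<And>g. g \<in> G \<Longrightarrow> F g \<in> K"
      and \<beta>K: "\<And>h j. h \<in> {..<nT} \<Longrightarrow> j \<in> {..<nL} \<Longrightarrow> \<beta> h j \<in> K"
    have \<beta>K': "\<beta> h j \<in> K" if "h < nT" "j < nL" for h j using \<beta>K that by simp
    show "G \<subseteq> K"
    proof
      fix g assume "g \<in> G"
      then consider k x where "k < nT" "x \<in> carrier T" "g = \<tau> k (a x)" | k y where "k < nL'" "y \<in> carrier L" "g = lam' k (d y)"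
        unfolding G_def by blast
      then show "g \<in> K"
      proof cases
        case 1
        from fst_K[OF 1(1) K \<beta>K' in_sum(1)[OF 1(2) MoL.M.zero_closed]] show ?thesis
          unfolding ind_T[OF 1(2)] 1(3) by simp
      next
        case 2
        from snd_K[OF 2(1) K \<beta>K' in_sum(2)[OF MoT.M.zero_closed 2(2)]] show ?thesis
          unfolding ind_L[OF 2(2)] 2(3) by simp
      qed
    qed
  qed (use XW \<beta>W D.z_matrix_closed s in auto)
  have K0: "ideal {\<zero>\<^bsub>W\<^esub>} W" by (rule W.zeroideal)
  have F0: "F g \<in> {\<zero>\<^bsub>W\<^esub>}" if "g \<in> G" for g
  proof -
    have "g = \<zero>\<^bsub>W\<^esub>" using rigid that by blast
    then show ?thesis using ring_hom_cring.hom_zero[OF ring_hom_F] by simp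
  qed
  have \<beta>0: "\<beta> h j \<in> {\<zero>\<^bsub>W\<^esub>}" if "h < nT" "j < nL" for h j using rigid that by simp
  \<comment> \<open>with \<open>K = 0\<close> the ideal estimates say that all coordinates of \<open>f\<close> vanish, including those of \<open>c\<close>\<close>
  have ind0: "induced_map P' (a, b, c, d) m = (\<zero>\<^bsub>T'\<^esub>, \<zero>\<^bsub>L'\<^esub>)" if m: "m \<in> carrier (disp_sum P)" for m
  proof -
    have mem: "fst (induced_map P' (a, b, c, d) m) \<in> carrier T'" "snd (induced_map P' (a, b, c, d) m) \<in> carrier L'"
      using induced_map_closed[OF ph m] by (simp_all add: disp_sum_def direct_sum_def mem_Times_iff)
    have "fst (induced_map P' (a, b, c, d) m) = \<zero>\<^bsub>T'\<^esub>"
      by (rule dual_basis_eq_zeroI[OF mT' dbT mem(1)]) (use fst_K[OF _ K0 F0 \<beta>0 m] in blast)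
    moreover have "snd (induced_map P' (a, b, c, d) m) = \<zero>\<^bsub>L'\<^esub>"
      by (rule dual_basis_eq_zeroI[OF mL' dbL' mem(2)]) (use snd_K[OF _ K0 F0 \<beta>0 m] in blast)
    ultimately show ?thesis by (metis prod.collapse)
  qed
  show "\<forall>x\<in>carrier T. a x = \<zero>\<^bsub>T'\<^esub> \<and> c x = \<zero>\<^bsub>L'\<^esub>"
  proof
    fix x assume x: "x \<in> carrier T"
    from ind0[OF in_sum(1)[OF x MoL.M.zero_closed]] show "a x = \<zero>\<^bsub>T'\<^esub> \<and> c x = \<zero>\<^bsub>L'\<^esub>"
      unfolding ind_T[OF x] by simp
  qed
  show "\<forall>y\<in>carrier L. b y = \<zero>\<^bsub>IT'\<^esub> \<and> d y = \<zero>\<^bsub>L'\<^esub>"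
  proof
    fix y assume y: "y \<in> carrier L"
    from ind0[OF in_sum(2)[OF MoT.M.zero_closed y]] have "I_incl T' (b y) = \<zero>\<^bsub>T'\<^esub>" "d y = \<zero>\<^bsub>L'\<^esub>"
      unfolding ind_L[OF y] by simp_all
    then show "b y = \<zero>\<^bsub>IT'\<^esub> \<and> d y = \<zero>\<^bsub>L'\<^esub>"
      using T'.I_incl_eq_zeroD[OF dbT bI[OF y]] by simp
  qed
qed

theorem proposition2p15:
  fixes p :: nat
    and R :: "('a, 'm) ring_scheme"
    and P :: "(nat \<Rightarrow> 'a, 't, 'l) display"
    and P' :: "(nat \<Rightarrow> 'a, 't1, 'l1) display"
  assumes "Factorial_Ring.prime p"
    and "cring R" and "p_nilpotent p R"
    and "is_display p R P" and "is_display p R P'"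
    and "nilpotent_display p R P"
  shows "comm_group (Hom_display p R P P') \<and> p_torsionfree p (Hom_display p R P P')"
proof -
  interpret display_pair R p P P'
    using assms by (simp add: display_pair_def display_pair_axioms_def witt_ring_def witt_ring_axioms_def)
  have "p_torsionfree p (Hom_display p R P P')"
    unfolding p_torsionfree_def
  proof (intro ballI impI)
    fix f assume f: "f \<in> carrier (Hom_display p R P P')"
      and pf: "f [^]\<^bsub>Hom_display p R P P'\<^esub> p = \<one>\<^bsub>Hom_display p R P P'\<^esub>"
    obtain a b c d where abcd: "f = (a, b, c, d)" by (cases f)
    have hom: "(a, b, c, d) \<in> display_homs p R P P'" using f by (simp add: abcd Hom_display_simps)
    note ph = display_homs_pair_homs[OF hom]
    from pf have z: "((\<lambda>x\<in>carrier T. [p] \<cdot>\<^bsub>T'\<^esub> a x), (\<lambda>x\<in>carrier L. [p] \<cdot>\<^bsub>IT'\<^esub> b x),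
       (\<lambda>x\<in>carrier T. [p] \<cdot>\<^bsub>L'\<^esub> c x), (\<lambda>x\<in>carrier L. [p] \<cdot>\<^bsub>L'\<^esub> d x)) = pair_zero"
      unfolding abcd pow_Hom_display[OF ph] Hom_display_simps .
    have tors: "[p] \<cdot>\<^bsub>T'\<^esub> a x = \<zero>\<^bsub>T'\<^esub>" "[p] \<cdot>\<^bsub>IT'\<^esub> b y = \<zero>\<^bsub>IT'\<^esub>" "[p] \<cdot>\<^bsub>L'\<^esub> c x = \<zero>\<^bsub>L'\<^esub>" "[p] \<cdot>\<^bsub>L'\<^esub> d y = \<zero>\<^bsub>L'\<^esub>"
      if "x \<in> carrier T" "y \<in> carrier L" for x y
      using z that unfolding pair_zero_def map_zero_def by (auto dest!: fun_cong[of _ _ x] fun_cong[of _ _ y])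
    have zero: "\<zero>\<^bsub>T\<^esub> \<in> carrier T" "\<zero>\<^bsub>L\<^esub> \<in> carrier L"
      using mT mL by (simp_all add: module_def abelian_group_def abelian_monoid.zero_closed)
    note vanish = p_torsion_display_hom_zero[OF assms(6,3) hom tors(1)[OF _ zero(2)] tors(2)[OF zero(1)] tors(3)[OF _ zero(2)] tors(4)[OF zero(1)]]
    have ext: "a \<in> extensional (carrier T)" "b \<in> extensional (carrier L)" "c \<in> extensional (carrier T)" "d \<in> extensional (carrier L)"
      using pair_homsD[OF ph] by (simp_all add: lin_maps_def PiE_def)
    have "a = map_zero T T'" "b = map_zero L IT'" "c = map_zero T L'" "d = map_zero L L'"
      unfolding map_zero_def using vanish ext by (auto intro!: extensionalityI[OF _ restrict_extensional])
    then show "f = \<one>\<^bsub>Hom_display p R P P'\<^esub>"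
      by (simp add: abcd Hom_display_simps pair_zero_def)
  qed
  with comm_group_Hom_display show ?thesis by blast
qed

end
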